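(* Let $(u_h)$ be a bounded sequence in $L^2(\mathbf T^d)$ satisfying the $h$-oscillation property $$\limsup_{h\to0^+}\left\|\mathbf 1_{(-\infty,R)}(h^2\Delta)\,\phi u_h\right\|_{L^2(\mathbf T^d)}\to 0\quad\text{as }R\to-\infty,\ \text{for every }\phi\in C_c^\infty(\mathbf T^d),$$ and such that, for some $\mu_0\in\mathcal M_+(T^*\mathbf T^d)$, $$\lim_{h\to0^+}(\mathrm{op}_h(a)u_h|u_h)=\int_{T^*\mathbf T^d}a(x,\xi)\,\mu_0(dx,d\xi)\quad\text{for every }a\in C_c^\infty(T^*\mathbf T^d).$$ Let $(\alpha_h)$ be a sequence of positive reals with $\alpha_h\to\infty$ as $h\to0^+$, and let $\mu\in L^\infty(\mathbf R_t;\mathcal M_+(T^*\mathbf T^d))$ be such that, along some subsequence, for every $\varphi\in L^1(\mathbf R)$ and $a\in C_c^\infty(T^*\mathbf T^d)$, $$\lim_{h\to0^+}\int_{\mathbf R}\varphi(t)\,(\mathrm{op}_h(a)e^{i\alpha_hht\Delta/2}u_h|e^{i\alpha_hht\Delta/2}u_h)\,dt=\int_{\mathbf R\times T^*\mathbf T^d}\varphi(t)a(x,\xi)\,\mu(t,dx,d\xi)\,dt.$$ If $\mu_0(\mathbf T^d\times\Omega)=0$, where $$\Omega:=\{\xi\in\mathbf R^d: k\cdot\xi=0\text{ for some }k\in\mathbf Z^d\setminus\{0\}\},$$ then, for a.e. $t\in\mathbf R$ and every $a\in C_c^\infty(T^*\mathbf T^d)$, $$\int_{T^*\mathbf T^d}a(x,\xi)\,\mu(t,dx,d\xi)=\int_{T^*\mathbf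 T^d}\langle a\rangle(x,\xi)\,\mu_0(dx,d\xi).$$
   Context: $\mathbf T^d=\mathbf R^d/(2\pi\mathbf Z)^d$ is the flat torus, $T^*\mathbf T^d$ is identified with $\mathbf T^d\times\mathbf R^d$, and $\Delta$ is the (non-positive) Laplacian on $\mathbf T^d$, self-adjoint on $L^2(\mathbf T^d)$ with inner product $(\cdot|\cdot)$; functions of $\Delta$ are defined by the spectral theorem, and $\mathbf 1_A$ is the characteristic function of $A\subset\mathbf R$. $\mathcal M_+(T^*\mathbf T^d)$ is the cone of positive Radon measures. An element $\mu\in L^\infty(\mathbf R;\mathcal M_+(T^*\mathbf T^d))$ is a (weakly measurable, essentially bounded) family $t\mapsto\mu(t,\cdot)$ of positive measures. Sequences such as $(u_h)$, $(\alpha_h)$ are indexed by small parameters $h>0$ with $h\to0^+$. The geodesic flow on $T^*\mathbf T^d$ is $\phi_s(x,\xi)=(x+s\xi,\xi)$, and for $a\in C_c(T^*\mathbf T^d)$ $$\langle a\rangle(x,\xi):=\lim_{T\to\infty}\frac1T\int_0^Ta(\phi_s(x,\xi))\,ds.$$ Quantization. For $a\in C_c^\infty(\mathbf R^d\times\mathbf R^d)$ and $h>0$, the Weyl quantization is $$\mathrm{op}_h(a)u(x)=\int_{\mathbf R^d}\int_{\mathbf R^d}a\left(\tfrac{x+y}{2},h\xi\right)u(y)e^{i(x-y)\cdot\xi}\,dy\,\frac{d\xi}{(2\pi)^d}.$$ On $M=\mathbf T^d$: if $\kappa:U\subset\mathbf R^d\to V\subset M$ is a coordinate patch, $\tilde\kappa:T^*U\to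 T^*V$ the induced canonical diffeomorphism, and $a\in C_c^\infty(T^*M)$ is supported in $T^*M|_V$, then $\mathrm{op}_h(a)$ is defined by $(\mathrm{op}_h(a)u)\circ\kappa=(\theta\circ\kappa)\,\mathrm{op}_h(a\circ\tilde\kappa)\big((\theta u)\circ\kappa\big)$, where $\theta\in C_c^\infty(V)$ equals $1$ on the projection of $\operatorname{supp}a$ to $M$. For general $a\in C_c^\infty(T^*M)$ one decomposes $a$ with a partition of unity; different choices change $\mathrm{op}_h(a)$ by an operator whose $L^2(M)$-norm tends to $0$ as $h\to0^+$. *)

theory Defs
  imports "HOL-Analysis.Analysis"
begin

section \<open>The flat torus\<close>

definition torus_rel :: "real^'n \<Rightarrow> real^'n \<Rightarrow> bool" where
  "torus_rel x y \<longleftrightarrow> (\<exists>k :: int^'n. \<forall>i. x $ i - y $ i = 2 * pi * of_int (k $ i))"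

lemma torus_rel_refl: "torus_rel x x"
  unfolding torus_rel_def by (rule exI[of _ 0]) simp

lemma torus_rel_sym: "torus_rel x y \<Longrightarrow> torus_rel y x"
  unfolding torus_rel_def
  by (elim exE, rule_tac x = "- k" in exI) (simp add: algebra_simps)

lemma torus_rel_add:
  "torus_rel x y \<Longrightarrow> torus_rel x' y' \<Longrightarrow> torus_rel (x + x') (y + y')"
  unfolding torus_rel_def
  by (elim exE, rule_tac x = "k + ka" in exI) (simp add: algebra_simps)

lemma torus_rel_minus: "torus_rel x y \<Longrightarrow> torus_rel (- x) (- y)"
  unfolding torus_rel_def
  by (elim exE, rule_tac x = "- k" in exI) (simp add: algebra_simps)

lemma torus_rel_trans: "torus_rel x y \<Longrightarrow> torus_rel y z \<Longrightarrow> torus_rel x z"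
  unfolding torus_rel_def
  by (elim exE, rule_tac x = "k + ka" in exI) (simp add: algebra_simps)

quotient_type 'n torus = "(real, 'n::finite) vec" / torus_rel
proof (rule equivpI)
  show "reflp torus_rel" by (rule reflpI) (rule torus_rel_refl)
  show "symp torus_rel" by (rule sympI) (rule torus_rel_sym)
  show "transp torus_rel" by (rule transpI) (rule torus_rel_trans)
qed

abbreviation proj :: "real^'n \<Rightarrow> 'n torus" where "proj \<equiv> abs_torus"

instantiation torus :: (finite) ab_group_add
begin

lift_definition zero_torus :: "'a torus" is 0 .
lift_definition plus_torus :: "'a torus \<Rightarrow> 'a torus \<Rightarrow> 'a torus" is "(+)"
  by (rule torus_rel_add)
lift_definition uminus_torus :: "'a torus \<Rightarrow> 'a torus" is uminus
  by (rule torus_rel_minus)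
lift_definition minus_torus :: "'a torus \<Rightarrow> 'a torus \<Rightarrow> 'a torus" is "(-)"
  using torus_rel_add[OF _ torus_rel_minus] by simp

instance
proof
  fix a b c :: "'a torus"
  show "a + b + c = a + (b + c)" by transfer (simp add: add.assoc torus_rel_refl)
  show "a + b = b + a" by transfer (simp add: add.commute torus_rel_refl)
  show "0 + a = a" by transfer (simp add: torus_rel_refl)
  show "- a + a = 0" by transfer (simp add: torus_rel_refl)
  show "a - b = a + - b" by transfer (simp add: torus_rel_refl)
qed

end

text \<open>Quotient topology.\<close>

instantiation torus :: (finite) topological_space
begin

definition open_torus :: "'a torus set \<Rightarrow> bool" where
  "open_torus W \<longleftrightarrow> open (proj -` W)"

instance
  by standard (auto simp: open_torus_def vimage_Union)

end

text \<open>Riemannian volume: the image of Lebesgue measure on a fundamental cube, of total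
  mass \<open>(2 pi)^d\<close>.\<close>

definition torus_measure :: "('n::finite) torus measure" where
  "torus_measure =
     distr (restrict_space lborel {x :: real^'n. \<forall>i. 0 \<le> x $ i \<and> x $ i < 2 * pi}) borel proj"

text \<open>The metric of the flat torus trivialises its cotangent bundle.\<close>

type_synonym 'n cotangent = "'n torus \<times> (real, 'n) vec"


section \<open>Smooth functions\<close>

text \<open>\<open>Ck_on k f S\<close> and \<open>smooth_on S f\<close> are only meant for open sets \<open>S\<close>.\<close>

fun Ck_on :: "nat \<Rightarrow> ('a::euclidean_space \<Rightarrow> 'b::real_normed_vector) \<Rightarrow> 'a set \<Rightarrow> bool" where
  "Ck_on 0 f S \<longleftrightarrow> continuous_on S f"
| "Ck_on (Suc k) f S \<longleftrightarrow>
     (\<forall>x\<in>S. f differentiable (at x)) \<and> (\<forall>v. Ck_on k (\<lambda>x. frechet_derivative f (at x) v) S)"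

definition smooth_on :: "'a::euclidean_space set \<Rightarrow> ('a \<Rightarrow> 'b::real_normed_vector) \<Rightarrow> bool" where
  "smooth_on S f \<longleftrightarrow> (\<forall>k. Ck_on k f S)"

definition supp :: "('a::topological_space \<Rightarrow> 'b::zero) \<Rightarrow> 'a set" where
  "supp f = closure {x. f x \<noteq> 0}"

text \<open>Functions on the torus and on its cotangent bundle are differentiated through their
  periodic lifts.\<close>

definition Cc_inf_torus :: "('n::finite torus \<Rightarrow> 'b::real_normed_vector) set" where
  "Cc_inf_torus = {f. smooth_on UNIV (\<lambda>x. f (proj x)) \<and> compact (supp f)}"

definition Cc_inf_cotangent :: "('n::finite cotangent \<Rightarrow> complex) set" where
  "Cc_inf_cotangent =
     {a. smooth_on UNIV (\<lambda>(x, \<xi>). a (proj x, \<xi>)) \<and> compact (supp a)}"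


section \<open>Square-integrable functions, the Laplacian and its functional calculus\<close>

definition L2_torus :: "('n::finite torus \<Rightarrow> complex) set" where
  "L2_torus = {u \<in> borel_measurable torus_measure.
                 integrable torus_measure (\<lambda>x. (norm (u x))\<^sup>2)}"

definition L2_inner :: "('n::finite torus \<Rightarrow> complex) \<Rightarrow> ('n torus \<Rightarrow> complex) \<Rightarrow> complex" where
  "L2_inner u v = (LINT x|torus_measure. u x * cnj (v x))"

definition L2_norm :: "('n::finite torus \<Rightarrow> complex) \<Rightarrow> real" where
  "L2_norm u = sqrt (LINT x|torus_measure. (norm (u x))\<^sup>2)"

definition partial_deriv :: "'n \<Rightarrow> (real^'n \<Rightarrow> complex) \<Rightarrow> real^'n \<Rightarrow> complex" where
  "partial_deriv i f x = frechet_derivative f (at x) (axis i 1)"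

text \<open>By periodicity the value does not depend on the representative.\<close>

definition laplacian :: "('n::finite torus \<Rightarrow> complex) \<Rightarrow> 'n torus \<Rightarrow> complex" where
  "laplacian f X =
     (\<Sum>i\<in>UNIV. partial_deriv i (partial_deriv i (\<lambda>x. f (proj x))) (rep_torus X))"

definition laplace_eigenfunction :: "real \<Rightarrow> ('n::finite torus \<Rightarrow> complex) \<Rightarrow> bool" where
  "laplace_eigenfunction l f \<longleftrightarrow>
     smooth_on UNIV (\<lambda>x. f (proj x)) \<and> (\<forall>X. laplacian f X = complex_of_real l * f X)"

text \<open>The operator \<open>F(\<Delta>)\<close>.  The Laplacian has pure point spectrum and smooth eigenfunctions,
  so by the spectral theorem \<open>F(\<Delta>) u\<close> is the element of \<open>L\<^sup>2\<close> whose component along each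
  eigenfunction of eigenvalue \<open>l\<close> is \<open>F l\<close> times that of \<open>u\<close>.  As the eigenfunctions are total
  in \<open>L\<^sup>2\<close>, this determines it up to null sets; it exists exactly when \<open>u\<close> is in the domain of
  \<open>F(\<Delta>)\<close>, in particular for all \<open>u\<close> in \<open>L\<^sup>2\<close> when \<open>F\<close> is bounded.\<close>

definition fun_laplacian ::
  "(real \<Rightarrow> complex) \<Rightarrow> ('n::finite torus \<Rightarrow> complex) \<Rightarrow> 'n torus \<Rightarrow> complex" where
  "fun_laplacian F u =
     (SOME w. w \<in> L2_torus \<and>
        (\<forall>l f. laplace_eigenfunction l f \<longrightarrow> L2_inner w f = F l * L2_inner u f))"

text \<open>\<open>schroedinger s\<close> is \<open>exp (i s \<Delta> / 2)\<close>.\<close>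

definition schroedinger :: "real \<Rightarrow> ('n::finite torus \<Rightarrow> complex) \<Rightarrow> 'n torus \<Rightarrow> complex" where
  "schroedinger s = fun_laplacian (\<lambda>l. cis (s * l / 2))"


section \<open>Semiclassical Weyl quantization\<close>

definition weyl ::
  "real \<Rightarrow> ((real^'n) \<times> (real^'n) \<Rightarrow> complex) \<Rightarrow> (real^'n \<Rightarrow> complex) \<Rightarrow> real^'n \<Rightarrow> complex" where
  "weyl h b v x =
     (LINT \<xi>|lborel. LINT y|lborel.
        b ((1/2) *\<^sub>R (x + y), h *\<^sub>R \<xi>) * v y * cis ((x - y) \<bullet> \<xi>)) / of_real ((2 * pi) ^ CARD('n))"

text \<open>The differential of a torus-valued map is that of any local lift near the point.\<close>

definition torus_deriv :: "(real^'n \<Rightarrow> 'n torus) \<Rightarrow> real^'n \<Rightarrow> real^'n \<Rightarrow> real^'n" where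
  "torus_deriv \<kappa> x =
     (THE D. \<exists>g. (g has_derivative D) (at x) \<and> (\<forall>\<^sub>F y in nhds x. \<kappa> y = proj (g y)))"

text \<open>\<open>\<kappa>\<close> is a diffeomorphism of the open set \<open>U\<close> onto the open set \<open>\<kappa> ` U\<close>.  A global
  lift of \<open>\<kappa>\<close> need not exist if \<open>U\<close> is not simply connected.\<close>

definition coordinate_patch :: "(real^'n) set \<Rightarrow> (real^'n \<Rightarrow> 'n torus) \<Rightarrow> bool" where
  "coordinate_patch U \<kappa> \<longleftrightarrow>
     open U \<and> open (\<kappa> ` U) \<and> inj_on \<kappa> U \<and>
     (\<forall>x\<in>U. \<exists>W g. open W \<and> x \<in> W \<and> W \<subseteq> U \<and> smooth_on W g \<and> (\<forall>y\<in>W. \<kappa> y = proj (g y))) \<and>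
     smooth_on (proj -` (\<kappa> ` U)) (\<lambda>z. inv_into U \<kappa> (proj z))"

text \<open>Composition of a symbol with the induced canonical diffeomorphism
  \<open>(x, \<xi>) \<mapsto> (\<kappa> x, (d\<kappa>\<^sub>x\<inverse>)\<^sup>T \<xi>)\<close>, extended by zero off \<open>U\<close>.\<close>

definition pullback_symbol ::
  "(real^'n) set \<Rightarrow> (real^'n \<Rightarrow> 'n torus) \<Rightarrow> ('n cotangent \<Rightarrow> complex) \<Rightarrow>
   (real^'n) \<times> (real^'n) \<Rightarrow> complex" where
  "pullback_symbol U \<kappa> a =
     (\<lambda>(x, \<xi>). if x \<in> U then a (\<kappa> x, adjoint (inv (torus_deriv \<kappa> x)) \<xi>) else 0)"

definition weyl_patch ::
  "(real^'n) set \<Rightarrow> (real^'n \<Rightarrow> 'n torus) \<Rightarrow> ('n torus \<Rightarrow> complex) \<Rightarrow> ('n cotangent \<Rightarrow> complex) \<Rightarrow>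
   real \<Rightarrow> ('n torus \<Rightarrow> complex) \<Rightarrow> 'n torus \<Rightarrow> complex" where
  "weyl_patch U \<kappa> \<theta> a h u X =
     (if X \<in> \<kappa> ` U
      then \<theta> X * weyl h (pullback_symbol U \<kappa> a)
                    (\<lambda>y. if y \<in> U then \<theta> (\<kappa> y) * u (\<kappa> y) else 0) (inv_into U \<kappa> X)
      else 0)"

text \<open>\<open>weyl_quantization a A\<close>: the family \<open>h \<mapsto> A h\<close> is \<open>op\<^sub>h(a)\<close> for some choice of finitely
  many coordinate patches, of a subordinate partition of unity \<open>\<rho>\<close> over the projection of the
  support of \<open>a\<close>, and of cut-offs \<open>\<theta>\<close>.  The choices do not depend on \<open>h\<close>.\<close>

definition weyl_quantization ::
  "('n::finite cotangent \<Rightarrow> complex) \<Rightarrow>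
   (real \<Rightarrow> ('n torus \<Rightarrow> complex) \<Rightarrow> 'n torus \<Rightarrow> complex) \<Rightarrow> bool" where
  "weyl_quantization a A \<longleftrightarrow>
     (\<exists>(N :: nat) (U :: nat \<Rightarrow> (real^'n) set) (\<kappa> :: nat \<Rightarrow> real^'n \<Rightarrow> 'n torus)
        (\<rho> :: nat \<Rightarrow> 'n torus \<Rightarrow> real) (\<theta> :: nat \<Rightarrow> 'n torus \<Rightarrow> complex) b.
        (\<forall>j<N. b j = (\<lambda>(X, \<xi>). complex_of_real (\<rho> j X) * a (X, \<xi>))) \<and>
        (\<forall>j<N. coordinate_patch (U j) (\<kappa> j) \<and>
           \<rho> j \<in> Cc_inf_torus \<and> supp (\<rho> j) \<subseteq> \<kappa> j ` U j \<and> (\<forall>X. 0 \<le> \<rho> j X \<and> \<rho> j X \<le> 1) \<and>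
           \<theta> j \<in> Cc_inf_torus \<and> supp (\<theta> j) \<subseteq> \<kappa> j ` U j \<and> (\<forall>X \<in> fst ` supp (b j). \<theta> j X = 1)) \<and>
        (\<forall>X \<in> fst ` supp a. (\<Sum>j<N. \<rho> j X) = 1) \<and>
        A = (\<lambda>h u X. \<Sum>j<N. weyl_patch (U j) (\<kappa> j) (\<theta> j) (b j) h u X))"


section \<open>Measures on phase space and averages along the geodesic flow\<close>

text \<open>As the cotangent bundle is locally compact and second countable, Borel measures that are
  finite on compact sets are exactly the positive Radon measures.\<close>

definition radon_measure :: "'n::finite cotangent measure \<Rightarrow> bool" where
  "radon_measure \<mu> \<longleftrightarrow> sets \<mu> = sets borel \<and> (\<forall>K. compact K \<longrightarrow> emeasure \<mu> K < \<infinity>)"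

text \<open>Weakly measurable, essentially bounded families.  Boundedness is only asked for on compact
  sets, which is weaker than a bound on the total mass.\<close>

definition Linf_radon :: "(real \<Rightarrow> 'n::finite cotangent measure) \<Rightarrow> bool" where
  "Linf_radon \<mu> \<longleftrightarrow>
     (\<forall>t. radon_measure (\<mu> t)) \<and>
     (\<forall>a :: 'n cotangent \<Rightarrow> complex. continuous_on UNIV a \<and> compact (supp a) \<longrightarrow>
        (\<lambda>t. LINT z|\<mu> t. a z) \<in> borel_measurable lebesgue) \<and>
     (\<forall>K. compact K \<longrightarrow> (\<exists>C. AE t in lebesgue. measure (\<mu> t) K \<le> C))"

definition geodesic_flow :: "real \<Rightarrow> 'n::finite cotangent \<Rightarrow> 'n cotangent" where
  "geodesic_flow s = (\<lambda>(X, \<xi>). (X + proj (s *\<^sub>R \<xi>), \<xi>))"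

definition flow_average :: "('n::finite cotangent \<Rightarrow> complex) \<Rightarrow> 'n cotangent \<Rightarrow> complex" where
  "flow_average a z =
     Lim at_top (\<lambda>T :: real. (1 / T) *\<^sub>R integral {0..T} (\<lambda>s. a (geodesic_flow s z)))"

definition resonant :: "(real^'n) set" where
  "resonant = {\<xi>. \<exists>k :: int^'n. k \<noteq> 0 \<and> (\<chi> i. of_int (k $ i)) \<bullet> \<xi> = 0}"

end

theory Submission
  imports Defs
begin

section \<open>The torus as a compact Hausdorff quotient, its characters, and a Borel section of the
  projection\<close>

section \<open>Topology of the torus\<close>

text \<open>It suffices to understand elementary symbols \<open>tsym k \<eta>\<close>: the character
  of frequency \<open>k\<close> in position times a smooth compactly supported function
  \<open>\<eta>\<close> of momentum. Up to an error that is small relative to the square of the L2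
  norm, the quadratic form of such a symbol is \<open>qform\<close>: it pairs the Fourier
  coefficient of mode \<open>m\<close> with that of mode \<open>m + k\<close>, with weight
  \<open>\<eta>\<close> at \<open>h\<close> times \<open>m\<close>. The Schroedinger flow only turns
  phases, and the pair of modes \<open>m\<close>, \<open>m + k\<close> acquires in the time variable
  the frequency \<alpha> h (k.m + |k|^2 / 2).

  For k = 0 this frequency is zero, so the form is conserved and its limit is read off from the
  initial measure. For k different from 0, integrate over a bounded time interval. Pairs with |k.hm|
  > \<delta> oscillate, for small h, with frequency at least \<alpha> \<delta> / 2 and contribute
  O(1 / (\<alpha> \<delta>)), which disappears because \<alpha> tends to infinity. The remaining
  pairs are controlled, by a weighted arithmetic-geometric inequality, by the form of frequency 0
  whose symbol is \<eta> squared times a bump around the plane k.\<xi> = 0, plus a small multiple of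
  the energy. That form converges to an integral against the initial measure, and this integral is
  small with \<delta> because the plane lies in the resonant set, which is null. Hence the time
  averages vanish in the limit (\<open>qform_time_bound\<close>, \<open>near_symbol_limit\<close>,
  \<open>time_average\<close>), and varying the interval gives the value of the limit for almost
  every time (\<open>AE_eq_of_interval_integrals\<close>). The flow average on the other side
  agrees: it is the symbol restricted to the plane k.\<xi> = 0 (\<open>has_avg_tsym\<close>), hence
  null for the initial measure unless k = 0.

  General symbols follow by density. Trigonometric polynomials with polynomial momentum
  coefficients, times a cut-off, approximate every test symbol uniformly
  (\<open>tpoly_cut_dense\<close>), averaging contracts the uniform norm, and the monomials and
  cut-offs involved are countably many, so one null set of times serves for all
  (\<open>transfer_Cc_inf\<close>).

  The analytic work is the passage from a quantization made with arbitrary patches, partitions and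
  cut-offs to the form on the Fourier lattice. The predicate \<open>semiclassical_kernel\<close>
  isolates what all admissible kernels share: they are bounded and Borel for each h, decay faster
  than every power at scale h, and have a prescribed limit when rescaled about a point. Kernels in
  patches have these properties because integrating out the momentum produces the inverse Fourier
  transform \<open>chk\<close> (\<open>Ker_decay\<close>, \<open>Ker_limit\<close>,
  \<open>quantization_kernel\<close>). The lattice kernel \<open>TK\<close> has them because it is a
  Riemann sum for the same transform, whose decay comes from summation by parts
  (\<open>gint_decay\<close>, \<open>gint_limit\<close>, \<open>semiclassical_TK\<close>). Two such
  kernels are close near the diagonal by compactness and small away from it by decay, so Schur's
  test makes their forms agree in the limit (\<open>semiclassical_forms_close\<close>,
  \<open>quantization_qform\<close>).\<close>

definition ivec :: "int^'n \<Rightarrow> real^'n" where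
  "ivec k = (\<chi> i. of_int (k $ i))"

lemma ivec_nth [simp]: "ivec k $ i = of_int (k $ i)"
  by (simp add: ivec_def)

lemma ivec_0 [simp]: "ivec 0 = 0"
  by (simp add: vec_eq_iff)

lemma ivec_add: "ivec (k + l) = ivec k + ivec l"
  by (simp add: vec_eq_iff)

lemma ivec_uminus: "ivec (- k) = - ivec k"
  by (simp add: vec_eq_iff)

lemma ivec_inject [simp]: "ivec k = ivec l \<longleftrightarrow> k = l"
  by (simp add: vec_eq_iff)

lemma proj_eq_iff: "proj x = proj y \<longleftrightarrow> (\<exists>k. x = y + (2 * pi) *\<^sub>R ivec k)"
proof -
  have "(\<forall>i. x $ i - y $ i = 2 * pi * of_int (k $ i)) \<longleftrightarrow> x = y + (2 * pi) *\<^sub>R ivec k" for k :: "int^'a"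
    by (auto simp: vec_eq_iff algebra_simps)
  then show ?thesis
    by (simp add: torus.abs_eq_iff torus_rel_def)
qed

lemma proj_rep [simp]: "proj (rep_torus X) = X"
  by (rule Quotient3_abs_rep[OF Quotient3_torus])

lemma proj_add: "proj (x + y) = proj x + proj y"
  by (simp add: plus_torus.abs_eq)

lemma proj_diff: "proj (x - y) = proj x - proj y"
  by (simp add: minus_torus.abs_eq)

lemma proj_0: "proj 0 = 0"
  by (simp add: zero_torus_def)

lemma continuous_proj: "continuous_on UNIV proj"
  by (rule iffD2[OF continuous_on_open_vimage]) (auto simp: open_torus_def)

lemma continuous_on_proj [continuous_intros]:
  "continuous_on S f \<Longrightarrow> continuous_on S (\<lambda>x. proj (f x))"
  using continuous_on_compose2[OF continuous_proj] by auto

lemma measurable_proj [measurable]: "proj \<in> borel \<rightarrow>\<^sub>M borel"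
  by (rule borel_measurable_continuous_onI[OF continuous_proj])

text \<open>The full preimage of the image is the union of the lattice translates of the
  set.\<close>

lemma open_proj_image:
  assumes "open S" shows "open (proj ` S)"
proof -
  have "proj -` (proj ` S) = (\<Union>k. (\<lambda>x. (2 * pi) *\<^sub>R ivec k + x) ` S)"
  proof (intro set_eqI iffI)
    fix x assume "x \<in> proj -` (proj ` S)"
    then obtain y k where "y \<in> S" "x = y + (2 * pi) *\<^sub>R ivec k" by (auto simp: proj_eq_iff)
    then show "x \<in> (\<Union>k. (\<lambda>x. (2 * pi) *\<^sub>R ivec k + x) ` S)" by (auto simp: add.commute)
  next
    fix x assume "x \<in> (\<Union>k. (\<lambda>x. (2 * pi) *\<^sub>R ivec k + x) ` S)"
    then obtain y k where y: "y \<in> S" "x = y + (2 * pi) *\<^sub>R ivec k" by (auto simp: add.commute)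
    then have "proj x = proj y" using proj_eq_iff by blast
    with y show "x \<in> proj -` (proj ` S)" by auto
  qed
  then show ?thesis
    using assms by (auto simp: open_torus_def open_translation)
qed

lemma continuous_on_torus_iff:
  "continuous_on UNIV f \<longleftrightarrow> continuous_on UNIV (\<lambda>x. f (proj x))"
proof
  show "continuous_on UNIV f \<Longrightarrow> continuous_on UNIV (\<lambda>x. f (proj x))"
    by (rule continuous_on_compose2[of UNIV f]) (auto intro: continuous_proj)
next
  assume *: "continuous_on UNIV (\<lambda>x. f (proj x))"
  have "open (f -` B)" if "open B" for B
    using * that unfolding open_torus_def
    by (auto simp: continuous_on_open_vimage vimage_def)
  then show "continuous_on UNIV f"
    by (simp add: continuous_on_open_vimage)
qed

text \<open>The product of a quotient map with an identity need not be a quotient map in general.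
  Here openness of \<open>proj\<close> helps: it sends boxes to boxes, so neighbourhoods upstairs
  push down to neighbourhoods.\<close>

lemma continuous_on_cotangent_iff:
  fixes a :: "'n::finite cotangent \<Rightarrow> 'b::topological_space"
  shows "continuous_on UNIV a \<longleftrightarrow> continuous_on UNIV (\<lambda>(x, \<xi>). a (proj x, \<xi>))"
proof
  assume "continuous_on UNIV a"
  then show "continuous_on UNIV (\<lambda>(x, \<xi>). a (proj x, \<xi>))"
    unfolding case_prod_unfold
    by (rule continuous_on_compose2) (auto intro!: continuous_intros continuous_on_compose2[OF continuous_proj])
next
  assume *: "continuous_on UNIV (\<lambda>(x, \<xi>). a (proj x, \<xi>))"
  have "open (a -` B)" if B: "open B" for B
  proof (rule open_prod_intro)
    fix z assume z: "z \<in> a -` B"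
    obtain X \<xi> where zX: "z = (X, \<xi>)" by (cases z)
    define x where "x = rep_torus X"
    have "open ((\<lambda>(x, \<xi>). a (proj x, \<xi>)) -` B)"
      using * B by (simp add: continuous_on_open_vimage)
    moreover have "(x, \<xi>) \<in> (\<lambda>(x, \<xi>). a (proj x, \<xi>)) -` B"
      using z by (simp add: zX x_def)
    ultimately obtain V W where "open V" "open W" "(x, \<xi>) \<in> V \<times> W"
      and VW': "V \<times> W \<subseteq> (\<lambda>(x, \<xi>). a (proj x, \<xi>)) -` B"
      by (rule open_prod_elim)
    then have VW: "open V" "open W" "x \<in> V" "\<xi> \<in> W" by auto
    note VW = VW VW'
    then have "open (proj ` V)" "z \<in> proj ` V \<times> W" "proj ` V \<times> W \<subseteq> a -` B"
      by (auto simp: zX open_proj_image x_def image_iff) (metis proj_rep)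
    with VW show "\<exists>A B'. open A \<and> open B' \<and> z \<in> A \<times> B' \<and> A \<times> B' \<subseteq> a -` B"
      by blast
  qed
  then show "continuous_on UNIV a"
    by (simp add: continuous_on_open_vimage)
qed

text \<open>The characters of the torus.\<close>

definition charc :: "int^'n::finite \<Rightarrow> 'n torus \<Rightarrow> complex" where
  "charc k X = cis (ivec k \<bullet> rep_torus X)"

lemma inner_ivec_ivec: "ivec k \<bullet> ivec l = of_int (\<Sum>i\<in>UNIV. k $ i * l $ i)"
  by (simp add: inner_vec_def)

text \<open>Representatives differ by 2 pi times an integer vector, and the inner product of integer
  vectors is an integer, so the phase is independent of the representative.\<close>

lemma charc_proj: "charc k (proj x) = cis (ivec k \<bullet> x)"
proof -
  obtain l where l: "rep_torus (proj x) = x + (2 * pi) *\<^sub>R ivec l"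
    using proj_eq_iff[of "rep_torus (proj x)" x] by auto
  have "cis (2 * pi * of_int j) = 1" for j :: int
    by (simp add: cis_multiple_2pi)
  then have "cis (ivec k \<bullet> x + 2 * pi * (ivec k \<bullet> ivec l)) = cis (ivec k \<bullet> x)"
    by (simp only: inner_ivec_ivec cis_mult[symmetric] mult_1_right)
  then show ?thesis
    by (simp add: charc_def l inner_add_right)
qed

lemma torus_cases: obtains x where "X = proj x"
  using proj_rep[symmetric] by blast

lemma charc_add: "charc k (X + Y) = charc k X * charc k Y"
  by (cases X rule: torus_cases, cases Y rule: torus_cases)
     (simp add: charc_proj proj_add[symmetric] inner_add_right cis_mult)

lemma charc_add_left: "charc (k + l) X = charc k X * charc l X"
  by (simp add: charc_def ivec_add inner_add_left cis_mult)

lemma charc_0 [simp]: "charc 0 X = 1"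
  by (simp add: charc_def)

lemma charc_zero [simp]: "charc k 0 = 1"
  by (simp add: charc_proj flip: proj_0)

lemma charc_uminus: "charc (- k) X = cnj (charc k X)"
  by (simp add: charc_def ivec_uminus cis_cnj)

lemma charc_diff: "charc k (X - Y) = charc k X * cnj (charc k Y)"
  by (cases X rule: torus_cases, cases Y rule: torus_cases)
     (simp add: charc_proj proj_diff[symmetric] inner_diff_right cis_mult cis_cnj)

lemma norm_charc [simp]: "norm (charc k X) = 1"
  by (simp add: charc_def)

lemma continuous_charc: "continuous_on UNIV (charc k)"
  by (simp add: continuous_on_torus_iff charc_proj continuous_intros)

lemma continuous_on_charc [continuous_intros]:
  "continuous_on S f \<Longrightarrow> continuous_on S (\<lambda>x. charc k (f x))"
  using continuous_on_compose2[OF continuous_charc] by auto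

lemma measurable_charc [measurable]: "charc k \<in> borel_measurable borel"
  by (rule borel_measurable_continuous_onI[OF continuous_charc])

text \<open>\<open>crep\<close> is a Borel choice of the representative with coordinates in \<open>[-pi, pi]\<close>.\<close>

definition crep :: "'n::finite torus \<Rightarrow> real^'n" where
  "crep X = (\<chi> i. let c = charc (axis i 1) X in if 0 \<le> Im c then arccos (Re c) else - arccos (Re c))"

lemma ivec_axis: "ivec (axis i 1) = axis i 1"
  by (simp add: vec_eq_iff axis_def)

lemma abs_crep_le: "\<bar>crep X $ i\<bar> \<le> pi"
proof -
  have "\<bar>Re (charc (axis i 1) X)\<bar> \<le> 1"
    using abs_Re_le_cmod[of "charc (axis i 1) X"] by simp
  then show ?thesis
    using arccos_lbound[of "Re (charc (axis i 1) X)"] arccos_ubound[of "Re (charc (axis i 1) X)"]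
    by (auto simp: crep_def Let_def)
qed

lemma cis_arccos:
  assumes "norm c = 1" 
  shows "cis (if 0 \<le> Im c then arccos (Re c) else - arccos (Re c)) = c"
proof -
  have "\<bar>Re c\<bar> \<le> 1" using abs_Re_le_cmod[of c] assms by simp
  moreover have "(Re c)\<^sup>2 + (Im c)\<^sup>2 = 1" using assms by (simp add: cmod_def)
  then have "sqrt (1 - (Re c)\<^sup>2) = \<bar>Im c\<bar>"
    by (metis add_diff_cancel_left' real_sqrt_abs)
  ultimately show ?thesis
    by (auto simp: complex_eq_iff sin_arccos_abs)
qed

lemma proj_crep [simp]: "proj (crep X) = X"
proof -
  obtain x where X: "X = proj x" by (rule torus_cases)
  have "cis (crep X $ i) = cis (x $ i)" for i
    using cis_arccos[of "charc (axis i 1) X"]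
    by (simp add: crep_def Let_def X charc_proj ivec_axis inner_axis' split: if_splits)
  then have "\<exists>k::int. crep X $ i = x $ i + 2 * pi * of_int k" for i
  proof -
    have "cos (crep X $ i) = cos (x $ i)" "sin (crep X $ i) = sin (x $ i)"
      using \<open>cis (crep X $ i) = cis (x $ i)\<close> by (simp_all add: complex_eq_iff)
    then show ?thesis
      using sin_cos_eq_iff[of "crep X $ i" "x $ i"] by (metis (no_types) mult.assoc mult.commute)
  qed
  then obtain k where k: "\<And>i. crep X $ i = x $ i + 2 * pi * of_int (k i)" by metis
  have "crep X = x + (2 * pi) *\<^sub>R ivec (\<chi> i. k i)"
    by (simp add: vec_eq_iff k)
  then show ?thesis using X proj_eq_iff by blast
qed

lemma measurable_crep [measurable]: "crep \<in> borel \<rightarrow>\<^sub>M borel"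
proof (rule borel_measurable_euclidean_space[THEN iffD2], rule ballI)
  fix b :: "real^'a" assume "b \<in> Basis"
  then obtain i where b: "b = axis i 1" by (auto simp: Basis_vec_def)
  \<comment> \<open>\<open>arccos\<close> is continuous only on \<open>{-1..1}\<close>, where the
    real parts of characters lie, so it is replaced by zero elsewhere.\<close>
  have a: "(\<lambda>x. if x \<in> {-1..1} then arccos x else 0) \<in> borel_measurable borel"
    by (rule borel_measurable_continuous_on_if)
       (auto intro: continuous_on_arccos')
  let ?c = "charc (axis i 1)"
  have *: "(if Re (?c X) \<in> {-1..1} then arccos (Re (?c X)) else 0) = arccos (Re (?c X))" for X
    using abs_Re_le_cmod[of "?c X"] by auto
  have "(\<lambda>X. arccos (Re (?c X))) \<in> borel_measurable borel"
    using measurable_compose[of "\<lambda>X. Re (?c X)", OF _ a] unfolding * by measurable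
  then have "(\<lambda>X. if 0 \<le> Im (?c X) then arccos (Re (?c X)) else - arccos (Re (?c X))) \<in> borel_measurable borel"
    by measurable
  then show "(\<lambda>X. crep X \<bullet> b) \<in> borel_measurable borel"
    by (simp add: b crep_def Let_def inner_axis)
qed

text \<open>The representative \<open>crep\<close> is computed from the characters of the coordinate
  directions alone. This separation gives both the Hausdorff property and the hypothesis of
  Stone-Weierstrass in the position variable.\<close>

lemma charc_separates:
  assumes "X \<noteq> Y" shows "\<exists>i. charc (axis i 1) X \<noteq> charc (axis i 1) Y"
proof (rule ccontr)
  assume "\<not> ?thesis"
  then have "crep X = crep Y" by (simp add: crep_def)
  then show False using assms by (metis proj_crep)
qed

instance torus :: (finite) t2_space
proof
  fix X Y :: "'a torus" assume "X \<noteq> Y"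
  then obtain i where "charc (axis i 1) X \<noteq> charc (axis i 1) Y"
    using charc_separates by blast
  then obtain U V where UV: "open U" "open V" "charc (axis i 1) X \<in> U" "charc (axis i 1) Y \<in> V" "U \<inter> V = {}"
    using hausdorff by metis
  have "open (charc (axis i 1) -` U)" "open (charc (axis i 1) -` V)"
    using UV continuous_charc by (auto simp: continuous_on_open_vimage)
  with UV show "\<exists>U V. open U \<and> open V \<and> X \<in> U \<and> Y \<in> V \<and> U \<inter> V = {}"
    by (intro exI[of _ "charc (axis i 1) -` U"] exI[of _ "charc (axis i 1) -` V"]) auto
qed

text \<open>The closed centred fundamental cube. Its points are shortest representatives of their
  classes, so \<open>norm (crep (X - Y))\<close> serves as the distance on the torus.\<close>

definition pibox :: "(real^'n) set" where "pibox = {x. \<forall>i. \<bar>x $ i\<bar> \<le> pi}"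

lemma pibox_eq_cbox: "pibox = cbox (\<chi> i. - pi) (\<chi> i. pi)"
  by (auto simp: pibox_def mem_box_cart abs_le_iff) (metis minus_le_iff)+

lemma compact_pibox [simp]: "compact pibox"
  by (simp add: pibox_eq_cbox)

lemma crep_pibox [simp]: "crep X \<in> pibox"
  by (simp add: pibox_def abs_crep_le)

lemma compact_UNIV_torus: "compact (UNIV :: 'n::finite torus set)"
proof -
  have "(UNIV :: 'n torus set) = proj ` pibox"
    using proj_crep crep_pibox by (metis (no_types) UNIV_eq_I image_eqI)
  moreover have "compact (proj ` (pibox :: (real^'n) set))"
    by (rule compact_continuous_image[OF continuous_on_subset[OF continuous_proj] compact_pibox]) simp
  ultimately show ?thesis by simp
qed

text \<open>Coordinatewise: adding a nonzero multiple of 2 pi to a number of modulus at most pi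
  cannot decrease the modulus.\<close>

lemma pibox_norm_le:
  assumes "z \<in> pibox" "proj z = proj y" shows "norm z \<le> norm y"
proof (rule norm_le_componentwise_cart)
  fix i
  obtain k where k: "y = z + (2 * pi) *\<^sub>R ivec k" using assms(2) by (metis proj_eq_iff)
  have z: "\<bar>z $ i\<bar> \<le> pi" using assms by (simp add: pibox_def)
  show "norm (z $ i) \<le> norm (y $ i)"
  proof (cases "k $ i = 0")
    case False
    then have "1 \<le> \<bar>real_of_int (k $ i)\<bar>" by linarith
    then have "2 * pi \<le> \<bar>2 * pi * of_int (k $ i)\<bar>" by (simp add: abs_mult)
    then show ?thesis using z k by simp
  qed (simp add: k)
qed

section \<open>Integration over a fundamental cube and invariance under translations\<close>

section \<open>Integration on the torus\<close>

text \<open>Half-open, so that every class has exactly one representative in it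
  (\<open>qcube_cell\<close>).\<close>

definition qcube :: "(real^'n) set" where "qcube = {x. \<forall>i. 0 \<le> x $ i \<and> x $ i < 2 * pi}"

lemma qcube_borel [measurable]: "qcube \<in> sets borel"
  unfolding qcube_def by measurable

lemma qcube_lborel [measurable]: "qcube \<in> sets lborel"
  by simp

lemma torus_measure_eq: "torus_measure = distr (restrict_space lborel qcube) borel proj"
  by (simp add: torus_measure_def qcube_def)

lemma sets_torus_measure [simp, measurable_cong]: "sets torus_measure = sets borel"
  by (simp add: torus_measure_eq)

lemma space_torus_measure [simp]: "space torus_measure = UNIV"
  by (simp add: torus_measure_eq)

lemma measurable_proj_restrict: "proj \<in> restrict_space lborel S \<rightarrow>\<^sub>M borel"
  by (intro measurable_restrict_space1) simp

lemma qcube_cell: "\<exists>!k::int^'n. x - (2 * pi) *\<^sub>R ivec k \<in> qcube" for x :: "real^'n"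
proof -
  have *: "(0 \<le> t - 2 * pi * of_int j \<and> t - 2 * pi * of_int j < 2 * pi) \<longleftrightarrow> j = \<lfloor>t / (2 * pi)\<rfloor>" for t and j :: int
    unfolding eq_commute[of j] floor_eq_iff by (auto simp: field_simps)
  have "x - (2 * pi) *\<^sub>R ivec k \<in> qcube \<longleftrightarrow> k = (\<chi> i. \<lfloor>x $ i / (2 * pi)\<rfloor>)" for k :: "int^'n"
    by (simp only: qcube_def mem_Collect_eq vector_minus_component vector_scaleR_component
        real_scaleR_def ivec_nth mult.assoc[symmetric] * vec_eq_iff vec_lambda_beta)
  then show ?thesis by simp
qed

lemma inj_on_proj_qcube: "inj_on proj qcube"
proof (rule inj_onI)
  fix x y :: "real^'a" assume xy: "x \<in> qcube" "y \<in> qcube" "proj x = proj y"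
  then obtain k where "x = y + (2 * pi) *\<^sub>R ivec k" by (metis proj_eq_iff)
  then have "x - (2 * pi) *\<^sub>R ivec k \<in> qcube" "x - (2 * pi) *\<^sub>R ivec 0 \<in> qcube" using xy by auto
  then have "k = 0" using qcube_cell[of x] by blast
  then show "x = y" using \<open>x = _\<close> by simp
qed

lemma ex_qcube: "\<exists>x\<in>qcube. proj x = X"
proof -
  obtain x where x: "X = proj x" by (rule torus_cases)
  obtain k where "x - (2 * pi) *\<^sub>R ivec k \<in> qcube" using qcube_cell[of x] by blast
  moreover have "proj (x - (2 * pi) *\<^sub>R ivec k) = X"
    unfolding x proj_eq_iff by (rule exI[of _ "- k"]) (simp add: ivec_uminus)
  ultimately show ?thesis by blast
qed

lemma integral_torus:
  fixes F :: "'n::finite torus \<Rightarrow> 'b::{banach, second_countable_topology}"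
  assumes [measurable]: "F \<in> borel_measurable borel"
  shows "(LINT X|torus_measure. F X) = (LINT x|lborel. indicator qcube x *\<^sub>R F (proj x))"
  unfolding torus_measure_eq
  by (subst integral_distr) (auto simp: measurable_proj_restrict integral_restrict_space)

lemma nn_integral_torus:
  assumes [measurable]: "F \<in> borel_measurable borel"
  shows "(\<integral>\<^sup>+X. F X \<partial>torus_measure) = (\<integral>\<^sup>+x. indicator qcube x * F (proj x) \<partial>lborel)"
  unfolding torus_measure_eq
  by (subst nn_integral_distr) 
     (auto simp: measurable_proj_restrict nn_integral_restrict_space mult.commute)

lemma emeasure_torus:
  assumes "A \<in> sets borel"
  shows "emeasure torus_measure A = emeasure lborel (proj -` A \<inter> qcube)"
proof -
  have "(proj -` A \<inter> qcube) \<in> sets borel"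
    using measurable_sets[OF measurable_proj assms] by auto
  then show ?thesis
  unfolding torus_measure_eq using assms
  by (subst emeasure_distr)
     (auto simp: measurable_proj_restrict emeasure_restrict_space space_restrict_space)
qed

text \<open>The half-open cube lies between an open and a closed box of equal volume.\<close>

lemma emeasure_qcube: "emeasure lborel (qcube :: (real^'n) set) = ennreal ((2 * pi) ^ CARD('n))"
proof -
  have "cbox (0::real^'n) (\<chi> i. 2 * pi) \<noteq> {}"
    by (auto simp: interval_eq_empty_cart)
  then have "measure lborel (cbox (0::real^'n) (\<chi> i. 2 * pi)) = (2 * pi) ^ CARD('n)"
    by (subst content_cbox_cart) auto
  then have b: "emeasure lborel (cbox (0::real^'n) (\<chi> i. 2 * pi)) = ennreal ((2 * pi) ^ CARD('n))"
    using emeasure_lborel_cbox_finite[of "0::real^'n" "\<chi> i. 2 * pi"]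
    by (subst emeasure_eq_ennreal_measure) auto
  then have a: "emeasure lborel (box (0::real^'n) (\<chi> i. 2 * pi)) = ennreal ((2 * pi) ^ CARD('n))"
    by (simp add: emeasure_lborel_cbox_eq emeasure_lborel_box_eq)
  have "box 0 (\<chi> i. 2 * pi) \<subseteq> (qcube :: (real^'n) set)" "qcube \<subseteq> cbox (0::real^'n) (\<chi> i. 2 * pi)"
    by (auto simp: qcube_def mem_box_cart less_imp_le)
  then show ?thesis
    using emeasure_mono[of _ _ lborel] a b by (metis antisym qcube_lborel sets_lborel borel_closed closed_cbox)
qed

text \<open>The volume of the torus; the type argument only transports the dimension.\<close>

definition vol :: "'n itself \<Rightarrow> real" where "vol _ = (2 * pi) ^ CARD('n)"

lemma vol_pos [simp]: "vol TYPE('n) > 0" "vol TYPE('n) \<noteq> 0" "vol TYPE('n) \<ge> 0"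
  by (simp_all add: vol_def)

lemma emeasure_torus_UNIV: "emeasure torus_measure (UNIV :: 'n::finite torus set) = ennreal (vol TYPE('n))"
  by (simp add: emeasure_torus emeasure_qcube vol_def)

lemma measure_torus_UNIV: "measure torus_measure (UNIV :: 'n::finite torus set) = vol TYPE('n)"
  by (simp add: measure_def emeasure_torus_UNIV)

lemma finite_measure_torus: "finite_measure torus_measure"
  by (rule finite_measureI) (simp add: emeasure_torus_UNIV)

interpretation torus: finite_measure torus_measure
  by (rule finite_measure_torus)

lemma emeasure_lborel_translate:
  fixes c :: "'a::euclidean_space"
  assumes "A \<in> sets borel"
  shows "emeasure lborel {x. x + c \<in> A} = emeasure lborel A"
proof -
  have "emeasure lborel A = emeasure (distr lborel borel ((+) c)) A"
    by (simp add: lborel_distr_plus)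
  also have "\<dots> = emeasure lborel ((+) c -` A)"
    using assms by (subst emeasure_distr) auto
  finally show ?thesis by (simp add: vimage_def add.commute)
qed

text \<open>Any translate of the fundamental cube is again a fundamental domain.\<close>

lemma emeasure_periodic_translate:
  fixes P :: "(real^'n) set"
  assumes P[measurable]: "P \<in> sets borel" and per: "\<And>x k. x + (2 * pi) *\<^sub>R ivec k \<in> P \<longleftrightarrow> x \<in> P"
  shows "emeasure lborel {x\<in>P. x - y \<in> qcube} = emeasure lborel (P \<inter> qcube)"
proof -
  have [measurable]: "{x. x - c \<in> qcube} \<in> sets borel" for c :: "real^'n"
    using measurable_sets[of "\<lambda>x. x - c" borel borel qcube] by (simp add: vimage_def)
  have m1: "{x\<in>P. x - c \<in> qcube} \<in> sets borel" for c :: "real^'n"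
  proof -
    have "{x\<in>P. x - c \<in> qcube} = P \<inter> {x. x - c \<in> qcube}" by auto
    then show ?thesis by simp
  qed
  have m2: "{x\<in>P. x - c \<in> qcube \<and> x - d \<in> qcube} \<in> sets borel" for c d :: "real^'n"
  proof -
    have "{x\<in>P. x - c \<in> qcube \<and> x - d \<in> qcube} = P \<inter> {x. x - c \<in> qcube} \<inter> {x. x - d \<in> qcube}" by auto
    then show ?thesis by simp
  qed
  let ?c = "\<lambda>k::int^'n. (2 * pi) *\<^sub>R ivec k"
  have ex: "\<exists>k. x - ?c k \<in> qcube" and un: "x - ?c k \<in> qcube \<Longrightarrow> x - ?c l \<in> qcube \<Longrightarrow> k = l" for x k l
    using qcube_cell[of x] by auto
  \<comment> \<open>Cut the part of \<open>P\<close> in the translated cube along the cells of the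
    standard tiling.\<close>
  have "{x\<in>P. x - y \<in> qcube} = (\<Union>k. {x\<in>P. x - y \<in> qcube \<and> x - ?c k \<in> qcube})"
    using ex by auto
  moreover have "disjoint_family (\<lambda>k. {x\<in>P. x - y \<in> qcube \<and> x - ?c k \<in> qcube})"
    unfolding disjoint_family_on_def using un by fast
  ultimately have "emeasure lborel {x\<in>P. x - y \<in> qcube} =
      (\<integral>\<^sup>+k. emeasure lborel {x\<in>P. x - y \<in> qcube \<and> x - ?c k \<in> qcube} \<partial>count_space UNIV)"
    using m2 by (subst (1) \<open>{x\<in>P. x - y \<in> qcube} = _\<close>, intro emeasure_UN_countable) auto
  also have "\<dots> = (\<integral>\<^sup>+k. emeasure lborel {x\<in>P. x - (y - ?c k) \<in> qcube \<and> x \<in> qcube} \<partial>count_space UNIV)"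
  proof (rule nn_integral_cong)
    \<comment> \<open>Shifting the piece in cell \<open>k\<close> by its lattice vector brings it
      into \<open>qcube\<close>, and periodicity keeps it in \<open>P\<close>.\<close>
    fix k :: "int^'n"
    have "{x. x + ?c k \<in> {x\<in>P. x - y \<in> qcube \<and> x - ?c k \<in> qcube}} = {x\<in>P. x - (y - ?c k) \<in> qcube \<and> x \<in> qcube}"
    proof -
      have "x + ?c k - y = x - (y - ?c k)" for x :: "real^'n" by simp
      then show ?thesis by (auto simp only: per mem_Collect_eq add_diff_cancel_right')
    qed
    then show "emeasure lborel {x\<in>P. x - y \<in> qcube \<and> x - ?c k \<in> qcube}
       = emeasure lborel {x\<in>P. x - (y - ?c k) \<in> qcube \<and> x \<in> qcube}"
      using emeasure_lborel_translate[OF m2[of y "?c k"], of "?c k"] by (simp only:)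
  qed
  also have "\<dots> = emeasure lborel (\<Union>k. {x\<in>P. x - (y - ?c k) \<in> qcube \<and> x \<in> qcube})"
  proof (rule emeasure_UN_countable[symmetric])
    show "disjoint_family (\<lambda>k. {x\<in>P. x - (y - ?c k) \<in> qcube \<and> x \<in> qcube})"
    proof (auto simp: disjoint_family_on_def)
      fix k l x assume "k \<noteq> l" "x - (y - ?c k) \<in> qcube" "x - (y - ?c l) \<in> qcube"
      then have "(x - y) - ?c (-k) \<in> qcube" "(x - y) - ?c (-l) \<in> qcube"
        by (simp_all add: ivec_uminus algebra_simps)
      then have "- k = - l" by (rule un)
      with \<open>k \<noteq> l\<close> show False by simp
    qed
    show "{x\<in>P. x - (y - ?c k) \<in> qcube \<and> x \<in> qcube} \<in> sets lborel" for k
      using m2[of "y - ?c k" 0] by simp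
  qed auto
  \<comment> \<open>The translates of the cube by \<open>y\<close> minus lattice vectors also tile
    the space, so the shifted pieces fill \<open>P\<close> inside \<open>qcube\<close>.\<close>
  also have "(\<Union>k. {x\<in>P. x - (y - ?c k) \<in> qcube \<and> x \<in> qcube}) = P \<inter> qcube"
  proof (intro set_eqI iffI)
    fix x assume x: "x \<in> P \<inter> qcube"
    obtain k where "(x - y) - ?c k \<in> qcube" using ex by blast
    then have "x - (y - ?c (- k)) \<in> qcube" by (simp add: ivec_uminus algebra_simps)
    with x show "x \<in> (\<Union>k. {x\<in>P. x - (y - ?c k) \<in> qcube \<and> x \<in> qcube})" by auto
  qed auto
  finally show ?thesis .
qed

lemma measurable_torus_translate [measurable]: "(\<lambda>X. X + Y) \<in> borel \<rightarrow>\<^sub>M (borel :: 'n::finite torus measure)"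
proof (rule borel_measurable_continuous_onI)
  obtain y where y: "Y = proj y" by (rule torus_cases)
  show "continuous_on UNIV (\<lambda>X. X + Y)"
    unfolding continuous_on_torus_iff y proj_add[symmetric] by (intro continuous_intros)
qed

text \<open>The preimage of a Borel set is periodic. Translating the set amounts to measuring this
  periodic set in a translated cube, which \<open>emeasure_periodic_translate\<close> replaces by
  the standard one.\<close>

lemma distr_torus_translate: "distr torus_measure borel (\<lambda>X. X + Y) = (torus_measure :: 'n::finite torus measure)"
proof (rule measure_eqI)
  fix A :: "'n torus set" assume "A \<in> sets (distr torus_measure borel (\<lambda>X. X + Y))"
  then have A: "A \<in> sets borel" by simp
  obtain y where y: "Y = proj y" by (rule torus_cases)
  have m: "(\<lambda>X. X + Y) -` A \<in> sets borel"
    using measurable_sets[OF measurable_torus_translate A] by simp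
  have p: "proj -` A \<in> sets borel"
    using measurable_sets[OF measurable_proj A] by simp
  have "emeasure (distr torus_measure borel (\<lambda>X. X + Y)) A = emeasure torus_measure ((\<lambda>X. X + Y) -` A)"
    using A by (subst emeasure_distr) auto
  also have "\<dots> = emeasure lborel (proj -` (\<lambda>X. X + Y) -` A \<inter> qcube)"
    by (rule emeasure_torus[OF m])
  also have "proj -` (\<lambda>X. X + Y) -` A \<inter> qcube = {x. x + y \<in> {x \<in> proj -` A. x - y \<in> qcube}}"
    by (auto simp: y proj_add)
  also have "emeasure lborel \<dots> = emeasure lborel {x \<in> proj -` A. x - y \<in> qcube}"
  proof (rule emeasure_lborel_translate)
    have "{x \<in> proj -` A. x - y \<in> qcube} = proj -` A \<inter> (\<lambda>x. x - y) -` qcube" by auto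
    moreover have "(\<lambda>x. x - y) -` qcube \<in> sets borel"
      using measurable_sets[of "\<lambda>x. x - y" borel borel qcube] by simp
    ultimately show "{x \<in> proj -` A. x - y \<in> qcube} \<in> sets borel" using p by simp
  qed
  also have "\<dots> = emeasure lborel (proj -` A \<inter> qcube)"
  proof (rule emeasure_periodic_translate[OF p])
    fix x :: "real^'n" and k
    have "proj (x + (2 * pi) *\<^sub>R ivec k) = proj x" by (subst proj_eq_iff) blast
    then show "x + (2 * pi) *\<^sub>R ivec k \<in> proj -` A \<longleftrightarrow> x \<in> proj -` A" by simp
  qed
  also have "\<dots> = emeasure torus_measure A"
    by (rule emeasure_torus[OF A, symmetric])
  finally show "emeasure (distr torus_measure borel (\<lambda>X. X + Y)) A = emeasure torus_measure A" .
qed simp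

lemma integral_torus_translate:
  fixes F :: "'n::finite torus \<Rightarrow> 'b::{banach, second_countable_topology}"
  assumes "F \<in> borel_measurable borel"
  shows "(LINT X|torus_measure. F (X + Y)) = (LINT X|torus_measure. F X)"
  using integral_distr[of "\<lambda>X. X + Y" torus_measure borel F] assms
  by (simp add: distr_torus_translate)

lemma nn_integral_torus_translate:
  fixes F :: "'n::finite torus \<Rightarrow> ennreal"
  assumes "F \<in> borel_measurable borel"
  shows "(\<integral>\<^sup>+X. F (X + Y) \<partial>torus_measure) = (\<integral>\<^sup>+X. F X \<partial>torus_measure)"
  using nn_integral_distr[of "\<lambda>X. X + Y" torus_measure borel F] assms
  by (simp add: distr_torus_translate)

section \<open>Calculus of smooth functions, a flat function for building bumps, and elementary
  symbols\<close>

section \<open>Smooth functions\<close>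

lemma Ck_on_SucI:
  assumes "\<And>x. (f has_derivative f' x) (at x)" "\<And>v. Ck_on k (\<lambda>x. f' x v) UNIV"
  shows "Ck_on (Suc k) f UNIV"
proof -
  have "frechet_derivative f (at x) = f' x" for x
    using frechet_derivative_at[OF assms(1)] by simp
  then show ?thesis using assms by (auto simp: differentiable_def)
qed

lemma Ck_on_SucD:
  assumes "Ck_on (Suc k) f UNIV"
  shows "(f has_derivative frechet_derivative f (at x)) (at x)"
    and "Ck_on k (\<lambda>x. frechet_derivative f (at x) v) UNIV"
  using assms frechet_derivative_works by auto

lemma Ck_on_continuous: "Ck_on k f UNIV \<Longrightarrow> continuous_on UNIV f"
  by (cases k) (auto intro!: differentiable_imp_continuous_on simp: differentiable_on_def)

lemma Ck_on_Suc_imp: "Ck_on (Suc k) f UNIV \<Longrightarrow> Ck_on k f UNIV"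
proof (induction k arbitrary: f)
  case 0
  then show ?case using Ck_on_continuous by (metis Ck_on.simps(1))
next
  case (Suc k)
  then show ?case by (metis Ck_on.simps(2))
qed

lemma Ck_on_const: "Ck_on k (\<lambda>x. c) UNIV"
proof (induction k arbitrary: c)
  case (Suc k)
  show ?case by (rule Ck_on_SucI[where f' = "\<lambda>x v. 0"]) (auto intro: Suc)
qed simp

lemma Ck_on_linear:
  assumes "bounded_linear f" shows "Ck_on k f UNIV"
proof (cases k)
  case 0
  then show ?thesis using assms linear_continuous_on by auto
next
  case (Suc n)
  show ?thesis unfolding Suc
    by (rule Ck_on_SucI[where f' = "\<lambda>x. f"])
       (auto intro: bounded_linear_imp_has_derivative assms Ck_on_const)
qed

lemma Ck_on_add:
  assumes "Ck_on k f UNIV" "Ck_on k g UNIV" shows "Ck_on k (\<lambda>x. f x + g x) UNIV"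
  using assms
proof (induction k arbitrary: f g)
  case 0 then show ?case by (auto intro: continuous_on_add)
next
  case (Suc k)
  show ?case
    by (rule Ck_on_SucI[where f' = "\<lambda>x v. frechet_derivative f (at x) v + frechet_derivative g (at x) v"])
       (intro has_derivative_add Suc.IH Ck_on_SucD[OF Suc.prems(1)] Ck_on_SucD[OF Suc.prems(2)])+
qed

lemma Ck_on_mult:
  fixes f g :: "'a::euclidean_space \<Rightarrow> 'b::real_normed_algebra"
  assumes "Ck_on k f UNIV" "Ck_on k g UNIV" shows "Ck_on k (\<lambda>x. f x * g x) UNIV"
  using assms
proof (induction k arbitrary: f g)
  case 0 then show ?case by (auto intro: continuous_on_mult)
next
  case (Suc k)
  show ?case
    by (rule Ck_on_SucI[where f' = "\<lambda>x v. f x * frechet_derivative g (at x) v + frechet_derivative f (at x) v * g x"])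
       (intro has_derivative_mult Ck_on_add Suc.IH Ck_on_SucD[OF Suc.prems(1)] Ck_on_SucD[OF Suc.prems(2)]
         Ck_on_Suc_imp[OF Suc.prems(1)] Ck_on_Suc_imp[OF Suc.prems(2)])+
qed

lemma Ck_on_prod:
  fixes f :: "'i \<Rightarrow> 'a::euclidean_space \<Rightarrow> 'b::{real_normed_algebra_1, comm_ring_1}"
  assumes "\<And>i. i \<in> I \<Longrightarrow> Ck_on k (f i) UNIV" shows "Ck_on k (\<lambda>x. \<Prod>i\<in>I. f i x) UNIV"
  using assms by (induction I rule: infinite_finite_induct) (auto intro: Ck_on_const Ck_on_mult)

lemma Ck_on_affine:
  assumes "Ck_on k f UNIV" "bounded_linear L" shows "Ck_on k (\<lambda>x. f (L x + c)) UNIV"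
  using assms(1)
proof (induction k arbitrary: f)
  case 0
  have "continuous_on UNIV (\<lambda>x. L x + c)"
    by (intro continuous_intros linear_continuous_on assms)
  then show ?case using 0 continuous_on_compose2[of UNIV f UNIV "\<lambda>x. L x + c"] by simp
next
  case (Suc k)
  show ?case
  proof (rule Ck_on_SucI[where f' = "\<lambda>x v. frechet_derivative f (at (L x + c)) (L v)"])
    fix x
    have "((\<lambda>x. L x + c) has_derivative L) (at x)"
      by (auto intro!: derivative_eq_intros bounded_linear_imp_has_derivative assms)
    from has_derivative_compose[OF this Ck_on_SucD(1)[OF Suc.prems]]
    show "((\<lambda>x. f (L x + c)) has_derivative (\<lambda>v. frechet_derivative f (at (L x + c)) (L v))) (at x)" .
  next
    fix v show "Ck_on k (\<lambda>x. frechet_derivative f (at (L x + c)) (L v)) UNIV"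
      by (rule Suc.IH[OF Ck_on_SucD(2)[OF Suc.prems]])
  qed
qed

lemma Ck_on_of_real:
  assumes "Ck_on k f UNIV" shows "Ck_on k (\<lambda>x. of_real (f x) :: complex) UNIV"
  using assms
proof (induction k arbitrary: f)
  case 0 then show ?case by (auto intro: continuous_on_of_real)
next
  case (Suc k)
  show ?case
    by (rule Ck_on_SucI[where f' = "\<lambda>x v. of_real (frechet_derivative f (at x) v)"])
       (intro has_derivative_of_real Suc.IH Ck_on_SucD[OF Suc.prems])+
qed

lemma Ck_on_cis: "Ck_on k cis UNIV"
proof -
  \<comment> \<open>The constant is kept arbitrary because each differentiation multiplies it by the
    imaginary unit and the increment.\<close>
  have "Ck_on k (\<lambda>t. c * cis t) UNIV" for c
  proof (induction k arbitrary: c)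
    case 0 show ?case by (auto intro!: continuous_intros)
  next
    case (Suc k)
    show ?case
    proof (rule Ck_on_SucI[where f' = "\<lambda>t s. s *\<^sub>R (c * (\<i> * cis t))"])
      fix t show "((\<lambda>t. c * cis t) has_derivative (\<lambda>s. s *\<^sub>R (c * (\<i> * cis t)))) (at t)"
      proof -
        have "(cis has_vector_derivative \<i> * cis t) (at t)"
          unfolding has_vector_derivative_complex_iff by (auto intro!: derivative_eq_intros)
        from has_vector_derivative_mult_right[OF this, of c] show ?thesis
          by (simp add: has_vector_derivative_def)
      qed
    next
      fix s show "Ck_on k (\<lambda>t. s *\<^sub>R (c * (\<i> * cis t))) UNIV"
        using Suc[of "of_real s * c * \<i>"] by (simp add: scaleR_conv_of_real mult.assoc)
    qed
  qed
  from this[of 1] show ?thesis by simp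
qed

text \<open>The functions \<open>t\<^sup>-\<^sup>k exp (- 1 / t)\<close>, extended by \<open>0\<close>, are closed under differentiation up
  to linear combinations, so all of them are smooth.\<close>

definition expinv :: "nat \<Rightarrow> real \<Rightarrow> real" where
  "expinv k t = (if 0 < t then exp (- 1 / t) / t ^ k else 0)"

text \<open>With \<open>inverse t\<close> as variable this is the decay of a power against the
  exponential; on the left the function is zero.\<close>

lemma expinv_tendsto_0: "(expinv k \<longlongrightarrow> 0) (at 0)"
proof -
  have "((\<lambda>t::real. inverse t ^ k / exp (inverse t)) \<longlongrightarrow> 0) (at_right 0)"
    by (rule filterlim_compose[OF tendsto_power_div_exp_0 filterlim_inverse_at_top_right])
  then have "(expinv k \<longlongrightarrow> 0) (at_right 0)"
    by (rule Lim_transform_eventually)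
       (auto simp: eventually_at_filter expinv_def exp_minus field_simps power_inverse inverse_eq_divide)
  moreover have "(expinv k \<longlongrightarrow> 0) (at_left 0)"
    by (rule Lim_transform_eventually[OF tendsto_const]) (auto simp: eventually_at_filter expinv_def)
  ultimately show ?thesis by (simp add: filterlim_split_at)
qed

lemma expinv_deriv:
  "(expinv k has_real_derivative expinv (k + 2) t - k * expinv (k + 1) t) (at t)"
proof (cases t "0::real" rule: linorder_cases)
  case greater
  have "((\<lambda>t. exp (- 1 / t) / t ^ k) has_real_derivative expinv (k + 2) t - k * expinv (k + 1) t) (at t)"
    using greater
    by (auto intro!: derivative_eq_intros simp: expinv_def field_simps power2_eq_square)
       (cases k; simp add: field_simps)
  then show ?thesis
    by (rule has_field_derivative_transform_within_open[where S = "{0<..}"])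
       (use greater in \<open>auto simp: expinv_def\<close>)
next
  case less
  have "((\<lambda>t. 0) has_real_derivative expinv (k + 2) t - k * expinv (k + 1) t) (at t)"
    using less by (simp add: expinv_def)
  then show ?thesis
    by (rule has_field_derivative_transform_within_open[where S = "{..<0}"])
       (use less in \<open>auto simp: expinv_def\<close>)
next
  case equal
  \<comment> \<open>At zero the difference quotient of \<open>expinv k\<close> is
    \<open>expinv (Suc k)\<close>, which tends to zero.\<close>
  have "((\<lambda>h. (expinv k (0 + h) - expinv k 0) / h) \<longlongrightarrow> 0) (at 0)"
    by (rule Lim_transform_eventually[OF expinv_tendsto_0[of "Suc k"]])
       (auto simp: eventually_at_filter expinv_def)
  then show ?thesis by (simp add: equal DERIV_def expinv_def)
qed

lemma Ck_on_expinv: "Ck_on n (expinv k) UNIV"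
proof (induction n arbitrary: k)
  case 0
  show ?case
    using expinv_deriv by (auto intro!: DERIV_continuous_on intro: has_field_derivative_at_within)
next
  case (Suc n)
  show ?case
  proof (rule Ck_on_SucI[where f' = "\<lambda>t s. (expinv (k + 2) t + (- real k) * expinv (k + 1) t) * s"])
    fix t show "(expinv k has_derivative (\<lambda>s. (expinv (k + 2) t + - real k * expinv (k + 1) t) * s)) (at t)"
      using expinv_deriv[of k t] by (simp add: has_field_derivative_def)
  next
    fix s show "Ck_on n (\<lambda>t. (expinv (k + 2) t + - real k * expinv (k + 1) t) * s) UNIV"
      by (intro Ck_on_mult Ck_on_add Ck_on_const Suc)
  qed
qed

text \<open>Smooth functions of the momentum with support in a fixed ball.\<close>

definition testf :: "((real^'n) \<Rightarrow> complex) set" where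
  "testf = {\<eta>. (\<forall>k. Ck_on k \<eta> UNIV) \<and> (\<exists>R. \<forall>\<xi>. R < norm \<xi> \<longrightarrow> \<eta> \<xi> = 0)}"

text \<open>The elementary symbols: the geodesic flow multiplies them by a phase, and their
  quantizations shift Fourier modes by \<open>k\<close> up to small errors.\<close>

definition tsym :: "int^'n::finite \<Rightarrow> ((real^'n) \<Rightarrow> complex) \<Rightarrow> 'n cotangent \<Rightarrow> complex" where
  "tsym k \<eta> = (\<lambda>(X, \<xi>). charc k X * \<eta> \<xi>)"

lemma testf_continuous: "\<eta> \<in> testf \<Longrightarrow> continuous_on UNIV \<eta>"
  using Ck_on_continuous[of 0 \<eta>] by (auto simp: testf_def)

lemma testf_mult: "\<eta> \<in> testf \<Longrightarrow> (\<And>k. Ck_on k \<psi> UNIV) \<Longrightarrow> (\<lambda>\<xi>. \<eta> \<xi> * \<psi> \<xi>) \<in> testf"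
  by (auto simp: testf_def intro!: Ck_on_mult)

lemma testf_support:
  assumes "\<eta> \<in> testf" obtains R where "R > 0" "\<And>\<xi>. R < norm \<xi> \<Longrightarrow> \<eta> \<xi> = 0"
proof -
  obtain R where R: "\<And>\<xi>. R < norm \<xi> \<Longrightarrow> \<eta> \<xi> = 0" using assms by (auto simp: testf_def)
  show thesis by (rule that[of "max R 1"]) (auto intro: R)
qed

lemma compact_support_bounded:
  fixes f :: "'a::euclidean_space \<Rightarrow> 'b::real_normed_vector"
  assumes "continuous_on UNIV f" "\<And>\<xi>. R < norm \<xi> \<Longrightarrow> f \<xi> = 0"
  obtains C where "C \<ge> 0" "\<And>x. norm (f x) \<le> C"
proof -
  have "compact (f ` cball 0 R)"
    by (rule compact_continuous_image[OF continuous_on_subset[OF assms(1)]]) auto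
  then obtain B where B: "\<And>y. y \<in> f ` cball 0 R \<Longrightarrow> norm y \<le> B"
    using compact_imp_bounded bounded_iff by metis
  have "norm (f x) \<le> max B 0" for x
    using B[of "f x"] assms(2)[of x] by (cases "R < norm x") (auto simp: le_max_iff_disj)
  then show thesis by (intro that[of "max B 0"]) auto
qed

lemma tsym_Cc_inf:
  fixes \<eta> :: "real^'n::finite \<Rightarrow> complex"
  assumes "\<eta> \<in> testf" shows "tsym k \<eta> \<in> Cc_inf_cotangent"
proof -
  obtain R where R: "\<And>\<xi>. R < norm \<xi> \<Longrightarrow> \<eta> \<xi> = 0" using assms testf_support by metis
  have "Ck_on n (\<lambda>z::(real^'n) \<times> (real^'n). cis ((ivec k \<bullet> fst z) + 0) * \<eta> (snd z + 0)) UNIV" for n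
    using assms
    by (intro Ck_on_mult Ck_on_affine[OF Ck_on_cis] Ck_on_affine[of n \<eta> snd])
       (auto simp: testf_def intro!: bounded_linear_intros bounded_linear_compose[OF bounded_linear_inner_right bounded_linear_fst])
  then have "smooth_on UNIV (\<lambda>(x, \<xi>). tsym k \<eta> (proj x, \<xi>))"
    by (simp add: smooth_on_def tsym_def charc_proj case_prod_unfold)
  moreover have "compact (supp (tsym k \<eta>))"
  proof -
    have "compact ((UNIV :: 'n torus set) \<times> cball (0 :: real^'n) R)"
      by (intro compact_Times compact_UNIV_torus compact_cball)
    moreover have "supp (tsym k \<eta>) \<subseteq> UNIV \<times> cball 0 R"
      unfolding supp_def
      by (rule closure_minimal) (use R in \<open>force simp: tsym_def not_less[symmetric]\<close>, intro closed_Times closed_UNIV closed_cball)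
    ultimately show ?thesis
      by (metis compact_Int_closed inf.absorb2 supp_def closed_closure)
  qed
  ultimately show ?thesis by (simp add: Cc_inf_cotangent_def)
qed

text \<open>Finite differences are the discrete substitute for derivatives: lattice sums allow
  summation by parts, not integration by parts.\<close>

definition fdiff :: "'a::real_vector \<Rightarrow> ('a \<Rightarrow> 'b::ab_group_add) \<Rightarrow> 'a \<Rightarrow> 'b" where
  "fdiff s f = (\<lambda>x. f (x + s) - f x)"

lemma fdiff_pow_Suc: "(fdiff s ^^ Suc N) f = (\<lambda>x. (fdiff s ^^ N) f (x + s) - (fdiff s ^^ N) f x)"
  by (simp only: funpow.simps o_apply fdiff_def)

lemma fdiff_pow_dirderiv:
  fixes f g :: "'a::real_normed_vector \<Rightarrow> 'b::real_normed_vector"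
  assumes "\<And>x s. ((\<lambda>s. f (x + s *\<^sub>R v)) has_vector_derivative g (x + s *\<^sub>R v)) (at s)"
  shows "((\<lambda>s. (fdiff w ^^ N) f (x + s *\<^sub>R v)) has_vector_derivative (fdiff w ^^ N) g (x + s *\<^sub>R v)) (at s)"
proof (induction N arbitrary: x s)
  case (Suc N)
  have "((\<lambda>s. (fdiff w ^^ N) f ((x + w) + s *\<^sub>R v) - (fdiff w ^^ N) f (x + s *\<^sub>R v)) has_vector_derivative
     (fdiff w ^^ N) g ((x + w) + s *\<^sub>R v) - (fdiff w ^^ N) g (x + s *\<^sub>R v)) (at s)"
    by (intro has_vector_derivative_diff Suc)
  then show ?case
    unfolding fdiff_pow_Suc by (simp only: ac_simps)
qed (use assms in simp)

text \<open>Differences commute with the derivative along \<open>v\<close>, so the mean value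
  inequality can be applied once for each difference and gains a factor \<open>\<bar>t\<bar>\<close>
  each time. The support condition passes to the derivative and keeps all constants finite.\<close>

lemma fdiff_pow_bound:
  fixes f :: "'a::euclidean_space \<Rightarrow> 'b::real_normed_vector"
  assumes "Ck_on N f UNIV" "\<And>\<xi>. R < norm \<xi> \<Longrightarrow> f \<xi> = 0"
  shows "\<exists>C\<ge>0. \<forall>x t. norm ((fdiff (t *\<^sub>R v) ^^ N) f x) \<le> C * \<bar>t\<bar> ^ N"
  using assms
proof (induction N arbitrary: f)
  case 0
  then show ?case using compact_support_bounded[of f R] by auto metis
next
  case (Suc N)
  let ?g = "\<lambda>x. frechet_derivative f (at x) v"
  have "?g \<xi> = 0" if "R < norm \<xi>" for \<xi>
  proof -
    have "(f has_derivative (\<lambda>_. 0)) (at \<xi>)"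
      by (rule has_derivative_transform_within_open[of "\<lambda>_. 0" _ _ _ "{\<xi>. R < norm \<xi>}"])
         (use that Suc.prems(2) in \<open>auto intro!: open_Collect_less continuous_intros\<close>)
    then show ?thesis using frechet_derivative_at by metis
  qed
  then obtain C where C: "C \<ge> 0" "\<And>x t. norm ((fdiff (t *\<^sub>R v) ^^ N) ?g x) \<le> C * \<bar>t\<bar> ^ N"
    using Suc.IH[OF Ck_on_SucD(2)[OF Suc.prems(1)]] by blast
  have d: "((\<lambda>s. f (x + s *\<^sub>R v)) has_vector_derivative ?g (x + s *\<^sub>R v)) (at s)" for x s
  proof -
    have "((\<lambda>s. x + s *\<^sub>R v) has_derivative (\<lambda>s. s *\<^sub>R v)) (at s)"
      by (auto intro!: derivative_eq_intros)
    from has_derivative_compose[OF this Ck_on_SucD(1)[OF Suc.prems(1)]]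
    have "((\<lambda>s. f (x + s *\<^sub>R v)) has_derivative (\<lambda>r. frechet_derivative f (at (x + s *\<^sub>R v)) (r *\<^sub>R v))) (at s)" .
    then show ?thesis
      using linear_scale[OF has_derivative_linear[OF Ck_on_SucD(1)[OF Suc.prems(1), of "x + s *\<^sub>R v"]]]
      by (simp add: has_vector_derivative_def)
  qed
  have "norm ((fdiff (t *\<^sub>R v) ^^ Suc N) f x) \<le> C * \<bar>t\<bar> ^ Suc N" for x t
  proof -
    let ?F = "(fdiff (t *\<^sub>R v) ^^ N) f" and ?G = "(fdiff (t *\<^sub>R v) ^^ N) ?g"
    have "((\<lambda>s. ?F (x + s *\<^sub>R v)) has_derivative (\<lambda>r. r *\<^sub>R ?G (x + s *\<^sub>R v))) (at s within UNIV)" for s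
      using fdiff_pow_dirderiv[OF d, of N "t *\<^sub>R v" x s] by (simp add: has_vector_derivative_def)
    moreover have "onorm (\<lambda>r. r *\<^sub>R ?G (x + s *\<^sub>R v)) \<le> C * \<bar>t\<bar> ^ N" for s
      by (rule onorm_le) (use C(2)[of t "x + s *\<^sub>R v"] in \<open>auto simp: mult.commute intro: mult_left_mono\<close>)
    ultimately have "norm (?F (x + t *\<^sub>R v) - ?F (x + 0 *\<^sub>R v)) \<le> (C * \<bar>t\<bar> ^ N) * norm (t - 0)"
      by (intro differentiable_bound[where S = UNIV and f = "\<lambda>s. ?F (x + s *\<^sub>R v)"]) auto
    then show ?thesis unfolding fdiff_pow_Suc by (simp add: algebra_simps)
  qed
  with C show ?case by blast
qed

section \<open>A dense algebra of symbols, and smooth cut-offs in the momentum\<close>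

section \<open>Trigonometric polynomials with polynomial coefficients in the momentum\<close>

text \<open>The list records a monomial with multiplicities, so products correspond to
  concatenation. There are only countably many pairs \<open>k\<close>, \<open>l\<close>, which later
  allows one null set of times for all monomials.\<close>

definition mon :: "int^'n::finite \<Rightarrow> 'n list \<Rightarrow> 'n cotangent \<Rightarrow> complex" where
  "mon k l = (\<lambda>(X, \<xi>). charc k X * of_real (\<Prod>i\<leftarrow>l. \<xi> $ i))"

inductive_set tpoly :: "('n::finite cotangent \<Rightarrow> complex) set" where
  mon: "mon k l \<in> tpoly"
| add: "f \<in> tpoly \<Longrightarrow> g \<in> tpoly \<Longrightarrow> (\<lambda>z. f z + g z) \<in> tpoly"
| scale: "f \<in> tpoly \<Longrightarrow> (\<lambda>z. c * f z) \<in> tpoly"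

lemma mon_mult: "mon k l z * mon k' l' z = mon (k + k') (l @ l') z"
  by (simp add: mon_def case_prod_unfold charc_add_left)

lemma mon_cnj: "cnj (mon k l z) = mon (- k) l z"
  by (simp add: mon_def case_prod_unfold charc_uminus)

lemma tpoly_mon_mult: "f \<in> tpoly \<Longrightarrow> (\<lambda>z. mon k l z * f z) \<in> tpoly"
  by (induction rule: tpoly.induct)
     (auto simp: mon_mult distrib_left mult.left_commute[of "mon k l _"] intro: tpoly.intros)

lemma tpoly_mult: "f \<in> tpoly \<Longrightarrow> g \<in> tpoly \<Longrightarrow> (\<lambda>z. f z * g z) \<in> tpoly"
  by (induction rule: tpoly.induct)
     (auto simp: distrib_right mult.assoc intro: tpoly.intros tpoly_mon_mult)

lemma tpoly_cnj: "f \<in> tpoly \<Longrightarrow> (\<lambda>z. cnj (f z)) \<in> tpoly"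
  by (induction rule: tpoly.induct) (auto simp: mon_cnj intro: tpoly.intros)

lemma tpoly_const: "(\<lambda>z. c) \<in> tpoly"
  using tpoly.scale[OF tpoly.mon[of 0 "[]"], of c] by (simp add: mon_def case_prod_unfold)

lemma continuous_on_prod_list:
  fixes f :: "'i \<Rightarrow> 'a::topological_space \<Rightarrow> real"
  assumes "\<And>i. continuous_on S (f i)" shows "continuous_on S (\<lambda>x. \<Prod>i\<leftarrow>l. f i x)"
  by (induction l) (auto intro: continuous_on_mult assms)

lemma continuous_mon: "continuous_on UNIV (mon k l)"
  unfolding mon_def case_prod_unfold
  by (intro continuous_intros continuous_on_prod_list)

lemma tpoly_continuous: "f \<in> tpoly \<Longrightarrow> continuous_on UNIV f"
  by (induction rule: tpoly.induct) (auto intro: continuous_intros continuous_mon)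

lemma tpoly_Re_Im:
  assumes "f \<in> tpoly"
  shows "(\<lambda>z. of_real (Re (f z))) \<in> tpoly" "(\<lambda>z. of_real (Im (f z))) \<in> tpoly"
proof -
  have "(\<lambda>z. (1/2) * (f z + cnj (f z))) \<in> tpoly" "(\<lambda>z. (- \<i> / 2) * (f z + (-1) * cnj (f z))) \<in> tpoly"
    using tpoly.scale[OF tpoly.add[OF assms tpoly_cnj[OF assms]]]
      tpoly.scale[OF tpoly.add[OF assms tpoly.scale[OF tpoly_cnj[OF assms]]]] by blast+
  moreover have "(1/2) * (f z + cnj (f z)) = of_real (Re (f z))"
    "(- \<i> / 2) * (f z + (-1) * cnj (f z)) = of_real (Im (f z))" for z
    by (simp_all add: complex_eq_iff)
  ultimately show "(\<lambda>z. of_real (Re (f z))) \<in> tpoly" "(\<lambda>z. of_real (Im (f z))) \<in> tpoly"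
    by simp_all
qed

text \<open>Stone-Weierstrass for the real-valued members: characters separate positions and
  coordinate functions separate momenta. Real and imaginary parts stay in the algebra because it is
  closed under conjugation.\<close>

lemma tpoly_dense_real:
  fixes f :: "'n::finite cotangent \<Rightarrow> real"
  assumes "compact K" "continuous_on K f" "e > 0"
  shows "\<exists>p\<in>tpoly. \<forall>z\<in>K. norm (of_real (f z) - p z) < e"
proof -
  interpret function_ring_on "{g::'n cotangent \<Rightarrow> real. (\<lambda>z. of_real (g z)) \<in> tpoly}" K
  proof
    fix f :: "'n cotangent \<Rightarrow> real" assume "f \<in> {g. (\<lambda>z. of_real (g z)) \<in> tpoly}"
    then have "continuous_on UNIV (\<lambda>z. Re (complex_of_real (f z)))"
      by (intro continuous_on_Re tpoly_continuous) simp
    then show "continuous_on K f" using continuous_on_subset by auto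
  next
    fix z z' :: "'n cotangent" assume "z \<noteq> z'"
    then consider "fst z \<noteq> fst z'" | "snd z \<noteq> snd z'" by (auto simp: prod_eq_iff)
    then show "\<exists>g\<in>{g. (\<lambda>z. of_real (g z)) \<in> tpoly}. g z \<noteq> g z'"
    proof cases
      case 1
      then obtain i where "charc (axis i 1) (fst z) \<noteq> charc (axis i 1) (fst z')"
        using charc_separates by blast
      then have "mon (axis i 1) [] z \<noteq> mon (axis i 1) [] z'"
        by (simp add: mon_def case_prod_unfold)
      then show ?thesis
        using tpoly_Re_Im[OF tpoly.mon[of "axis i 1" "[]"]]
        by (auto simp: complex_eq_iff)
    next
      case 2
      then obtain i where i: "snd z $ i \<noteq> snd z' $ i" by (auto simp: vec_eq_iff)
      have "(\<lambda>z. of_real (snd z $ i)) \<in> tpoly"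
        using tpoly.mon[of 0 "[i]"] by (simp add: mon_def case_prod_unfold)
      with i show ?thesis by (intro bexI[of _ "\<lambda>z. snd z $ i"]) auto
    qed
  qed (use assms in \<open>auto intro: tpoly.intros tpoly_mult tpoly_const\<close>)
  obtain g where g: "(\<lambda>z. of_real (g z)) \<in> tpoly" "\<forall>z\<in>K. \<bar>f z - g z\<bar> < e"
    using Stone_Weierstrass_basic[OF assms(2,3)] by auto
  have "\<forall>z\<in>K. norm (of_real (f z) - of_real (g z) :: complex) < e"
    using g(2) by (simp flip: of_real_diff)
  with g(1) show ?thesis by (intro bexI[of _ "\<lambda>z. of_real (g z)"])
qed

lemma tpoly_dense:
  fixes f :: "'n::finite cotangent \<Rightarrow> complex"
  assumes "compact K" "continuous_on K f" "e > 0"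
  shows "\<exists>p\<in>tpoly. \<forall>z\<in>K. norm (f z - p z) < e"
proof -
  obtain p where p: "p \<in> tpoly" "\<forall>z\<in>K. norm (of_real (Re (f z)) - p z) < e / 2"
    using tpoly_dense_real[of K "\<lambda>z. Re (f z)" "e/2"] assms by (auto intro: continuous_on_Re)
  obtain q where q: "q \<in> tpoly" "\<forall>z\<in>K. norm (of_real (Im (f z)) - q z) < e / 2"
    using tpoly_dense_real[of K "\<lambda>z. Im (f z)" "e/2"] assms by (auto intro: continuous_on_Im)
  have "norm (f z - (p z + \<i> * q z)) < e" if "z \<in> K" for z
  proof -
    have "f z - (p z + \<i> * q z) = (of_real (Re (f z)) - p z) + \<i> * (of_real (Im (f z)) - q z)"
      by (simp add: complex_eq_iff)
    also have "norm \<dots> \<le> norm (of_real (Re (f z)) - p z) + norm (of_real (Im (f z)) - q z)"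
      by (rule order_trans[OF norm_triangle_ineq]) (simp add: norm_mult)
    also have "\<dots> < e / 2 + e / 2" using p(2) q(2) that by (intro add_strict_mono) auto
    finally show ?thesis by simp
  qed
  then show ?thesis
    using tpoly.add[OF p(1) tpoly.scale[OF q(1), of \<i>]] by (intro bexI[of _ "\<lambda>z. p z + \<i> * q z"]) auto
qed

text \<open>A product of one-dimensional smooth bumps, strictly positive exactly on the open cube of
  half-side \<open>N\<close>, so that it can be divided by on compact subsets of this cube.\<close>

definition mcut :: "nat \<Rightarrow> real^'n \<Rightarrow> real" where
  "mcut N \<xi> = (\<Prod>i\<in>UNIV. expinv 0 (N - \<xi> $ i) * expinv 0 (N + \<xi> $ i))"

lemma expinv_0_bounds: "0 \<le> expinv 0 t" "expinv 0 t \<le> 1"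
  by (auto simp: expinv_def)

lemma mcut_nonneg: "0 \<le> mcut N \<xi>"
  unfolding mcut_def by (intro prod_nonneg ballI mult_nonneg_nonneg expinv_0_bounds)

lemma mcut_le_1: "mcut N \<xi> \<le> 1"
  unfolding mcut_def
  by (intro prod_le_1 conjI mult_nonneg_nonneg mult_le_one expinv_0_bounds)

lemma mcut_pos_iff: "0 < mcut N \<xi> \<longleftrightarrow> (\<forall>i. \<bar>\<xi> $ i\<bar> < N)"
proof -
  have "mcut N \<xi> \<noteq> 0 \<longleftrightarrow> (\<forall>i. \<bar>\<xi> $ i\<bar> < N)"
    by (auto simp: mcut_def expinv_def abs_less_iff) (smt (verit))+
  then show ?thesis using mcut_nonneg[of N \<xi>] by (auto simp: order_less_le)
qed

lemma mcut_zero: "real N * CARD('n) < norm \<xi> \<Longrightarrow> mcut N (\<xi>::real^'n) = 0"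
proof (rule ccontr)
  assume n: "real N * CARD('n) < norm \<xi>" and "mcut N \<xi> \<noteq> 0"
  then have "\<forall>i. \<bar>\<xi> $ i\<bar> < N" using mcut_nonneg[of N \<xi>] mcut_pos_iff[of N \<xi>] by (metis less_eq_real_def)
  then have "(\<Sum>i\<in>UNIV. \<bar>\<xi> $ i\<bar>) \<le> (\<Sum>i\<in>(UNIV::'n set). real N)"
    by (intro sum_mono) (simp add: less_imp_le)
  then show False using norm_le_l1_cart[of \<xi>] n by (simp add: mult.commute)
qed

lemma Ck_on_cut: "Ck_on k (\<lambda>\<xi>. of_real (mcut N \<xi>) :: complex) UNIV"
proof -
  have *: "Ck_on k (\<lambda>\<xi>::real^'n. expinv 0 (N - \<xi> $ i)) UNIV" for i
    using Ck_on_affine[OF Ck_on_expinv, of "\<lambda>\<xi>. - (\<xi> $ i)" k 0 "real N"]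
    by (simp add: bounded_linear_minus bounded_linear_vec_nth)
  have **: "Ck_on k (\<lambda>\<xi>::real^'n. expinv 0 (N + \<xi> $ i)) UNIV" for i
    using Ck_on_affine[OF Ck_on_expinv, of "\<lambda>\<xi>. \<xi> $ i" k 0 "real N"]
    by (simp add: bounded_linear_vec_nth add.commute)
  show ?thesis
    unfolding mcut_def by (intro Ck_on_of_real Ck_on_prod Ck_on_mult * **)
qed

lemma mcut_testf: "(\<lambda>\<xi>. of_real (mcut N \<xi>)) \<in> testf"
  unfolding testf_def using Ck_on_cut mcut_zero by (auto intro!: exI[of _ "real N * real CARD('a)"])

lemma mon_cut_testf: "(\<lambda>\<xi>. of_real (\<Prod>i\<leftarrow>l. \<xi> $ i) * of_real (mcut N \<xi>)) \<in> testf"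
proof -
  have "Ck_on k (\<lambda>\<xi>::real^'a. of_real (\<Prod>i\<leftarrow>l. \<xi> $ i) :: complex) UNIV" for k
  proof (intro Ck_on_of_real, induction l)
    case (Cons i l)
    have "Ck_on k (\<lambda>x::real^'a. x $ i) UNIV"
      by (rule Ck_on_linear[OF bounded_linear_vec_nth])
    from Ck_on_mult[OF this Cons] show ?case by simp
  qed (simp add: Ck_on_const)
  from testf_mult[OF mcut_testf this] show ?thesis by (simp add: mult.commute)
qed

lemma tsym_mon_cut:
  "tsym k (\<lambda>\<xi>. of_real (\<Prod>i\<leftarrow>l. \<xi> $ i) * of_real (mcut N \<xi>)) = (\<lambda>z. mon k l z * of_real (mcut N (snd z)))"
  by (auto simp: tsym_def mon_def)

text \<open>no plateau of the cut-off is needed: approximate the quotient by the cut-off.\<close>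

lemma tpoly_cut_dense:
  fixes a :: "'n::finite cotangent \<Rightarrow> complex"
  assumes a: "continuous_on UNIV a" and R: "\<And>X \<xi>. R < norm \<xi> \<Longrightarrow> a (X, \<xi>) = 0"
  shows "\<exists>N. \<forall>e>0. \<exists>p\<in>tpoly. \<forall>z. norm (a z - p z * of_real (mcut N (snd z))) \<le> e * mcut N (snd z)"
proof -
  \<comment> \<open>The margin of 1 makes the cut-off positive slightly beyond the support of
    \<open>a\<close>, so the two open sets \<open>?S\<close> and \<open>?T\<close> below
    overlap.\<close>
  obtain N :: nat where N: "R + 1 < N" using reals_Archimedean2 by blast
  have pos: "0 < mcut N \<xi>" if "norm \<xi> \<le> R + 1" for \<xi> :: "real^'n"
    unfolding mcut_pos_iff using that N component_le_norm_cart[of \<xi>] by (meson order_le_less_trans order_trans)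
  have cc: "continuous_on UNIV (\<lambda>\<xi>::real^'n. of_real (mcut N \<xi>) :: complex)"
    by (rule Ck_on_continuous[OF Ck_on_cut])
  have cs: "continuous_on S (\<lambda>z::'n cotangent. of_real (mcut N (snd z)) :: complex)" for S
    by (rule continuous_on_compose2[OF cc]) (auto intro: continuous_intros)
  \<comment> \<open>The quotient is continuous: on \<open>?S\<close> the denominator is positive,
    and on \<open>?T\<close> the numerator vanishes, so the quotient is zero there even where the
    cut-off is zero.\<close>
  define b where "b = (\<lambda>z. a z / of_real (mcut N (snd z)))"
  let ?S = "{z::'n cotangent. norm (snd z) < R + 1}" and ?T = "{z::'n cotangent. R < norm (snd z)}"
  have "continuous_on (?S \<union> ?T) b"
  proof (rule continuous_on_open_Un)
    show "open ?S" "open ?T"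
      by (auto intro!: open_Collect_less continuous_intros)
    show "continuous_on ?S b"
      unfolding b_def
      by (intro continuous_on_divide continuous_on_subset[OF a] cs) (auto dest!: pos[OF less_imp_le])
    have "continuous_on ?T (\<lambda>z. 0 :: complex)" by simp
    then show "continuous_on ?T b"
      by (rule continuous_on_eq) (auto simp: b_def R)
  qed
  moreover have "?S \<union> ?T = UNIV" by auto
  ultimately have cb: "continuous_on UNIV b" by simp
  let ?K = "(UNIV :: 'n torus set) \<times> cball (0 :: real^'n) (real N * CARD('n))"
  have K: "compact ?K" by (intro compact_Times compact_UNIV_torus compact_cball)
  have "\<exists>p\<in>tpoly. \<forall>z. norm (a z - p z * of_real (mcut N (snd z))) \<le> e * mcut N (snd z)" if e: "e > 0" for e
  proof -
    obtain p where p: "p \<in> tpoly" "\<forall>z\<in>?K. norm (b z - p z) < e"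
      using tpoly_dense[OF K continuous_on_subset[OF cb] e] by auto
    have "norm (a z - p z * of_real (mcut N (snd z))) \<le> e * mcut N (snd z)" for z
    proof (cases "mcut N (snd z) = 0")
      case True
      then have "R < norm (snd z)" using pos[of "snd z"] by force
      then show ?thesis using R[of "snd z" "fst z"] True by simp
    next
      case False
      then have "z \<in> ?K" using mcut_zero[of N "snd z"] by (cases z) (auto simp: not_less[symmetric])
      then have "norm (b z - p z) < e" using p(2) by blast
      then have "norm (b z - p z) \<le> e" by simp
      moreover have "a z - p z * of_real (mcut N (snd z)) = (b z - p z) * of_real (mcut N (snd z))"
        using False by (simp add: b_def field_simps)
      ultimately show ?thesis using mcut_nonneg[of N "snd z"]
        by (simp add: norm_mult mult_right_mono)
    qed
    with p show ?thesis by blast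
  qed
  then show ?thesis by blast
qed

section \<open>Existence and stability of averages along the geodesic flow\<close>

section \<open>Averages along the geodesic flow\<close>

text \<open>A relation rather than a value: it carries the existence of the limit, which the term
  \<open>flow_average a z\<close> alone does not express.\<close>

definition has_avg :: "('n::finite cotangent \<Rightarrow> complex) \<Rightarrow> 'n cotangent \<Rightarrow> complex \<Rightarrow> bool" where
  "has_avg a z L \<longleftrightarrow>
     ((\<lambda>T::real. (1 / T) *\<^sub>R integral {0..T} (\<lambda>s. a (geodesic_flow s z))) \<longlongrightarrow> L) at_top"

lemma flow_average_eq: "has_avg a z L \<Longrightarrow> flow_average a z = L"
  unfolding has_avg_def flow_average_def by (rule tendsto_Lim) auto

lemma continuous_flow: "continuous_on S (\<lambda>s. geodesic_flow s z)"
proof (cases z)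
  case (Pair X \<xi>)
  obtain x where "X = proj x" by (rule torus_cases)
  then have "(\<lambda>s. geodesic_flow s z) = (\<lambda>s. (proj (x + s *\<^sub>R \<xi>), \<xi>))"
    by (auto simp: geodesic_flow_def Pair proj_add)
  then show ?thesis by (simp only:) (intro continuous_intros)
qed

lemma flow_integrable:
  fixes a :: "'n::finite cotangent \<Rightarrow> complex"
  assumes "continuous_on UNIV a" shows "(\<lambda>s. a (geodesic_flow s z)) integrable_on {0..T}"
  by (intro integrable_continuous_real continuous_on_compose2[OF assms continuous_flow]) auto

lemma has_avg_add:
  assumes "continuous_on UNIV a" "continuous_on UNIV b" "has_avg a z L" "has_avg b z M"
  shows "has_avg (\<lambda>z. a z + b z) z (L + M)"
  using tendsto_add[OF assms(3,4)[unfolded has_avg_def]]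
  unfolding has_avg_def
  by (subst integral_add) (auto simp: flow_integrable assms scaleR_add_right)

lemma has_avg_scale:
  assumes "has_avg a z L" shows "has_avg (\<lambda>z. c * a z) z (c * L)"
  using tendsto_mult_left[OF assms[unfolded has_avg_def], of c]
  unfolding has_avg_def by (simp add: mult_scaleR_right)

lemma avg_bound:
  fixes a b :: "'n::finite cotangent \<Rightarrow> complex"
  assumes "continuous_on UNIV a" "continuous_on UNIV b" "\<And>z. norm (a z - b z) \<le> e" "T > 0"
  shows "norm ((1 / T) *\<^sub>R integral {0..T} (\<lambda>s. a (geodesic_flow s z))
     - (1 / T) *\<^sub>R integral {0..T} (\<lambda>s. b (geodesic_flow s z))) \<le> e"
proof -
  have "norm (integral {0..T} (\<lambda>s. a (geodesic_flow s z) - b (geodesic_flow s z))) \<le> e * (T - 0)"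
    by (rule integral_bound)
       (use assms in \<open>auto intro!: continuous_on_diff continuous_on_compose2[OF assms(1) continuous_flow]
          continuous_on_compose2[OF assms(2) continuous_flow]\<close>)
  then have "norm (integral {0..T} (\<lambda>s. a (geodesic_flow s z)) - integral {0..T} (\<lambda>s. b (geodesic_flow s z))) \<le> e * T"
    using integral_diff[OF flow_integrable[OF assms(1)] flow_integrable[OF assms(2)], of T z z] by simp
  then have "(1 / T) * norm (integral {0..T} (\<lambda>s. a (geodesic_flow s z)) - integral {0..T} (\<lambda>s. b (geodesic_flow s z))) \<le> e"
    using assms(4) by (simp add: divide_le_eq)
  then show ?thesis using assms(4)
    by (simp only: scaleR_diff_right[symmetric] norm_scaleR) simp
qed

text \<open>Averaging over a finite time contracts the uniform distance, and the bound survives in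
  the limit.\<close>

lemma has_avg_close:
  fixes a b :: "'n::finite cotangent \<Rightarrow> complex"
  assumes "continuous_on UNIV a" "continuous_on UNIV b" "\<And>z. norm (a z - b z) \<le> e"
    "has_avg a z L" "has_avg b z M"
  shows "norm (L - M) \<le> e"
proof (rule tendsto_upperbound)
  show "((\<lambda>T::real. norm ((1 / T) *\<^sub>R integral {0..T} (\<lambda>s. a (geodesic_flow s z))
     - (1 / T) *\<^sub>R integral {0..T} (\<lambda>s. b (geodesic_flow s z)))) \<longlongrightarrow> norm (L - M)) at_top"
    using assms(4,5) unfolding has_avg_def by (intro tendsto_norm tendsto_diff)
  show "\<forall>\<^sub>F T::real in at_top. norm ((1 / T) *\<^sub>R integral {0..T} (\<lambda>s. a (geodesic_flow s z))
     - (1 / T) *\<^sub>R integral {0..T} (\<lambda>s. b (geodesic_flow s z))) \<le> e"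
    using eventually_gt_at_top[of "0::real"]
    by eventually_elim (rule avg_bound[OF assms(1-3)])
qed simp

text \<open>The average exists everywhere, not only off the resonant set: this is what makes the
  average a Borel function.\<close>

lemma has_avg_limit:
  fixes a :: "'n::finite cotangent \<Rightarrow> complex"
  assumes a: "continuous_on UNIV a" and b: "\<And>j. continuous_on UNIV (b j)"
    and e: "\<And>j z. norm (a z - b j z) \<le> e j" "e \<longlonglongrightarrow> 0"
    and L: "\<And>j. has_avg (b j) z (L j)"
  shows "has_avg a z (lim L)" "L \<longlonglongrightarrow> lim L"
proof -
  \<comment> \<open>The averages of the approximants are Cauchy because the approximants are
    uniformly close to each other.\<close>
  have cl: "norm (L i - L j) \<le> e i + e j" for i j
  proof (rule has_avg_close[OF b b _ L L])
    fix z show "norm (b i z - b j z) \<le> e i + e j"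
      using e(1)[of z i] e(1)[of z j] norm_triangle_ineq4[of "a z - b j z" "a z - b i z"] by simp
  qed
  have "Cauchy L"
  proof (rule metric_CauchyI)
    fix r :: real assume "r > 0"
    then have "\<forall>\<^sub>F j in sequentially. e j < r / 2" using order_tendstoD(2)[OF e(2), of "r/2"] by simp
    then obtain M where M: "\<And>j. j \<ge> M \<Longrightarrow> e j < r / 2" by (auto simp: eventually_sequentially)
    show "\<exists>M. \<forall>m\<ge>M. \<forall>n\<ge>M. dist (L m) (L n) < r"
    proof (intro exI allI impI)
      fix m n assume "m \<ge> M" "n \<ge> M"
      then show "dist (L m) (L n) < r"
        using M[of m] M[of n] cl[of m n] by (simp add: dist_norm)
    qed
  qed
  then show lim: "L \<longlonglongrightarrow> lim L"
    using Cauchy_convergent convergent_LIMSEQ_iff by blast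
  show "has_avg a z (lim L)"
    unfolding has_avg_def
  proof (rule tendstoI)
    fix r :: real assume r: "r > 0"
    have "\<forall>\<^sub>F j in sequentially. e j < r / 3" "\<forall>\<^sub>F j in sequentially. dist (L j) (lim L) < r / 3"
      using order_tendstoD(2)[OF e(2), of "r/3"] tendstoD[OF lim, of "r/3"] r by simp_all
    then have "\<forall>\<^sub>F j in sequentially. e j < r / 3 \<and> dist (L j) (lim L) < r / 3"
      by (rule eventually_conj)
    then obtain j where j: "e j < r / 3" "dist (L j) (lim L) < r / 3"
      by (auto dest!: eventually_happens)
    let ?A = "\<lambda>f T::real. (1 / T) *\<^sub>R integral {0..T} (\<lambda>s. f (geodesic_flow s z))"
    have "\<forall>\<^sub>F T in at_top. dist (?A (b j) T) (L j) < r / 3"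
      using L[of j] r unfolding has_avg_def by (intro tendstoD) auto
    then show "\<forall>\<^sub>F T in at_top. dist (?A a T) (lim L) < r"
      using eventually_gt_at_top[of "0::real"]
    proof eventually_elim
      case (elim T)
      have "dist (?A a T) (?A (b j) T) \<le> e j"
        unfolding dist_norm by (rule avg_bound[OF a b e(1)]) (use elim in auto)
      then show ?case
        using elim j dist_triangle[of "?A a T" "lim L" "?A (b j) T"] dist_triangle[of "?A (b j) T" "lim L" "L j"]
        by linarith
    qed
  qed
qed

text \<open>Along an orbit the symbol is multiplied by \<open>cis (s * c)\<close> with
  \<open>c\<close> the inner product of frequency and momentum. If \<open>c\<close> is zero the
  symbol is constant on the orbit; otherwise its primitive is bounded by a multiple of 2 / |c| and
  the mean decays like 1 / T.\<close>

lemma has_avg_tsym: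
  "has_avg (tsym k \<eta>) z (if ivec k \<bullet> snd z = 0 then tsym k \<eta> z else 0)"
proof (cases z)
  case (Pair X \<xi>)
  let ?c = "ivec k \<bullet> \<xi>"
  have *: "tsym k \<eta> (geodesic_flow s z) = tsym k \<eta> z * cis (?c * s)" for s
    by (simp add: tsym_def Pair geodesic_flow_def charc_add charc_proj mult_ac)
  have "((\<lambda>T::real. (1 / T) *\<^sub>R integral {0..T} (\<lambda>s. tsym k \<eta> z * cis (?c * s)))
      \<longlongrightarrow> (if ?c = 0 then tsym k \<eta> z else 0)) at_top"
  proof (cases "?c = 0")
    case True
    have "\<forall>\<^sub>F T::real in at_top. tsym k \<eta> z = (1 / T) *\<^sub>R integral {0..T} (\<lambda>s. tsym k \<eta> z * cis (?c * s))"
      using eventually_gt_at_top[of "0::real"] by eventually_elim (simp add: True scaleR_conv_of_real)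
    from Lim_transform_eventually[OF tendsto_const this] show ?thesis using True by simp
  next
    case False
    have i: "integral {0..T} (\<lambda>s. tsym k \<eta> z * cis (?c * s)) = tsym k \<eta> z * ((cis (?c * T) - 1) / (\<i> * ?c))"
      if "T > 0" for T
    proof (rule integral_unique)
      have "((\<lambda>s. tsym k \<eta> z * cis (?c * s)) has_integral
         (tsym k \<eta> z * (cis (?c * T) / (\<i> * ?c)) - tsym k \<eta> z * (cis (?c * 0) / (\<i> * ?c)))) {0..T}"
      proof (rule fundamental_theorem_of_calculus)
        fix s assume "s \<in> {0..T}"
        have "((\<lambda>s. cis (?c * s)) has_vector_derivative \<i> * ?c * cis (?c * s)) (at s within {0..T})"
          unfolding has_vector_derivative_def
          by (rule has_derivative_eq_rhs[OF has_derivative_cis[of "\<lambda>s. ?c * s" "\<lambda>s. ?c * s"]])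
             (auto intro!: derivative_eq_intros simp: scaleR_conv_of_real mult_ac)
        from has_vector_derivative_mult_right[OF this, of "tsym k \<eta> z / (\<i> * ?c)"]
        show "((\<lambda>s. tsym k \<eta> z * (cis (?c * s) / (\<i> * ?c))) has_vector_derivative tsym k \<eta> z * cis (?c * s)) (at s within {0..T})"
          using False by simp
      qed (use that in auto)
      then show "((\<lambda>s. tsym k \<eta> z * cis (?c * s)) has_integral tsym k \<eta> z * ((cis (?c * T) - 1) / (\<i> * ?c))) {0..T}"
        by (simp add: algebra_simps diff_divide_distrib)
    qed
    have "((\<lambda>T::real. (1 / T) *\<^sub>R (tsym k \<eta> z * ((cis (?c * T) - 1) / (\<i> * ?c)))) \<longlongrightarrow> 0) at_top"
    proof (rule Lim_null_comparison)
      show "\<forall>\<^sub>F T::real in at_top. norm ((1 / T) *\<^sub>R (tsym k \<eta> z * ((cis (?c * T) - 1) / (\<i> * ?c))))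
         \<le> (1 / T) * (norm (tsym k \<eta> z) * (2 / \<bar>?c\<bar>))"
        using eventually_gt_at_top[of "0::real"]
      proof eventually_elim
        case (elim T)
        have "norm (cis (?c * T) - 1) \<le> 2"
          using norm_triangle_ineq4[of "cis (?c * T)" 1] by simp
        then show ?case using elim
          by (auto simp: norm_mult norm_divide intro!: mult_left_mono divide_right_mono)
      qed
      show "((\<lambda>T::real. (1 / T) * (norm (tsym k \<eta> z) * (2 / \<bar>?c\<bar>))) \<longlongrightarrow> 0) at_top"
        by (intro tendsto_mult_left_zero tendsto_divide_0[OF tendsto_const] filterlim_at_top_imp_at_infinity filterlim_ident)
    qed
    moreover have "\<forall>\<^sub>F T::real in at_top. (1 / T) *\<^sub>R (tsym k \<eta> z * ((cis (?c * T) - 1) / (\<i> * ?c)))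
       = (1 / T) *\<^sub>R integral {0..T} (\<lambda>s. tsym k \<eta> z * cis (?c * s))"
      using eventually_gt_at_top[of "0::real"] by eventually_elim (simp only: i)
    ultimately show ?thesis using False Lim_transform_eventually by fastforce
  qed
  then show ?thesis
    unfolding has_avg_def * by (simp only: Pair snd_conv)
qed

section \<open>The space of square-integrable functions: inequalities and completeness\<close>

section \<open>Square-integrable functions on the torus\<close>

definition N2 :: "('n::finite torus \<Rightarrow> complex) \<Rightarrow> real" where
  "N2 f = (LINT x|torus_measure. (norm (f x))\<^sup>2)"

lemma L2_norm_eq: "L2_norm f = sqrt (N2 f)"
  by (simp add: L2_norm_def N2_def)

lemma N2_nonneg [simp]: "0 \<le> N2 f"
  by (simp add: N2_def)

lemma L2_torus_measurable [measurable_dest]: "f \<in> L2_torus \<Longrightarrow> f \<in> borel_measurable borel"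
  by (simp add: L2_torus_def cong: measurable_cong_sets)

lemma L2_torus_square: "f \<in> L2_torus \<Longrightarrow> integrable torus_measure (\<lambda>x. (norm (f x))\<^sup>2)"
  by (simp add: L2_torus_def)

lemma L2_torusI:
  "f \<in> borel_measurable borel \<Longrightarrow> integrable torus_measure (\<lambda>x. (norm (f x))\<^sup>2) \<Longrightarrow> f \<in> L2_torus"
  by (simp add: L2_torus_def cong: measurable_cong_sets)

lemma L2_bounded:
  fixes f :: "'n::finite torus \<Rightarrow> complex"
  assumes [measurable]: "f \<in> borel_measurable borel" and "\<And>x. norm (f x) \<le> B"
  shows "f \<in> L2_torus"
proof (rule L2_torusI)
  have "norm ((norm (f x))\<^sup>2) \<le> B\<^sup>2" for x using assms(2)[of x] by (simp add: power_mono)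
  then show "integrable torus_measure (\<lambda>x. (norm (f x))\<^sup>2)"
    by (intro torus.integrable_const_bound[of _ "B\<^sup>2"]) auto
qed simp

lemma prod_le_squares: "2 * (a * b) \<le> a\<^sup>2 + (b::real)\<^sup>2"
  using sum_squares_ge_zero[of "a - b" 0] by (simp add: power2_eq_square algebra_simps)

lemma L2_mult_integrable:
  fixes f g :: "'n::finite torus \<Rightarrow> complex"
  assumes f: "f \<in> L2_torus" and g: "g \<in> L2_torus"
  shows "integrable torus_measure (\<lambda>x. f x * g x)"
proof (rule Bochner_Integration.integrable_bound)
  show "integrable torus_measure (\<lambda>x. (norm (f x))\<^sup>2 + (norm (g x))\<^sup>2)"
    using assms by (intro Bochner_Integration.integrable_add L2_torus_square)
  have "norm (f x * g x) \<le> norm ((norm (f x))\<^sup>2 + (norm (g x))\<^sup>2)" for x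
  proof -
    have "0 \<le> norm (f x) * norm (g x)" by simp
    then have "norm (f x) * norm (g x) \<le> (norm (f x))\<^sup>2 + (norm (g x))\<^sup>2"
      using prod_le_squares[of "norm (f x)" "norm (g x)"] by linarith
    then show ?thesis by (simp add: norm_mult)
  qed
  then show "AE x in torus_measure. norm (f x * g x) \<le> norm ((norm (f x))\<^sup>2 + (norm (g x))\<^sup>2)" by simp
qed (use assms in measurable)

lemma L2_one: "(\<lambda>x. c) \<in> L2_torus"
  by (rule L2_bounded[of _ "norm c"]) auto

lemma L2_charc: "charc k \<in> L2_torus"
  by (rule L2_bounded[of _ 1]) auto

lemma measurable_cnj [measurable]: "cnj \<in> borel_measurable borel"
  by (intro borel_measurable_continuous_onI continuous_intros)

lemma L2_cnj: "f \<in> L2_torus \<Longrightarrow> (\<lambda>x. cnj (f x)) \<in> L2_torus"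
  by (rule L2_torusI)
     (auto dest: L2_torus_square intro: measurable_compose[OF L2_torus_measurable measurable_cnj])

lemma L2_integrable:
  fixes f :: "'n::finite torus \<Rightarrow> complex"
  assumes "f \<in> L2_torus" shows "integrable torus_measure f"
  using L2_mult_integrable[OF assms L2_one[of 1]] by simp

lemma L2_inner_integrable: "f \<in> L2_torus \<Longrightarrow> g \<in> L2_torus \<Longrightarrow> integrable torus_measure (\<lambda>x. f x * cnj (g x))"
  by (intro L2_mult_integrable L2_cnj)

lemma norm_add_square_le: "(norm (a + b))\<^sup>2 \<le> 2 * (norm a)\<^sup>2 + 2 * (norm (b::complex))\<^sup>2"
proof -
  have "(norm (a + b))\<^sup>2 \<le> (norm a + norm b)\<^sup>2" by (intro power_mono norm_triangle_ineq) simp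
  also have "\<dots> \<le> 2 * (norm a)\<^sup>2 + 2 * (norm b)\<^sup>2"
    using prod_le_squares[of "norm a" "norm b"] by (simp add: power2_sum)
  finally show ?thesis .
qed

lemma L2_add:
  fixes f g :: "'n::finite torus \<Rightarrow> complex"
  assumes "f \<in> L2_torus" "g \<in> L2_torus" shows "(\<lambda>x. f x + g x) \<in> L2_torus"
proof (rule L2_torusI)
  show "integrable torus_measure (\<lambda>x. (norm (f x + g x))\<^sup>2)"
  proof (rule Bochner_Integration.integrable_bound)
    show "integrable torus_measure (\<lambda>x. 2 * (norm (f x))\<^sup>2 + 2 * (norm (g x))\<^sup>2)"
      using assms by (auto intro!: Bochner_Integration.integrable_add L2_torus_square)
  qed (use assms norm_add_square_le in auto)
qed (use assms in measurable)

lemma L2_scale: "f \<in> L2_torus \<Longrightarrow> (\<lambda>x. c * f x) \<in> L2_torus"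
  by (rule L2_torusI) (auto simp: norm_mult power_mult_distrib dest: L2_torus_square L2_torus_measurable)

lemma L2_diff: "f \<in> L2_torus \<Longrightarrow> g \<in> L2_torus \<Longrightarrow> (\<lambda>x. f x - g x) \<in> L2_torus"
  using L2_add[of f "\<lambda>x. (-1) * g x"] L2_scale[of g "-1"] by simp

lemma L2_sum:
  assumes "\<And>i. i \<in> I \<Longrightarrow> f i \<in> L2_torus" shows "(\<lambda>x. \<Sum>i\<in>I. f i x) \<in> L2_torus"
  using assms by (induction I rule: infinite_finite_induct) (auto intro: L2_one L2_add)

lemma L2_mult_bounded:
  fixes f :: "'n::finite torus \<Rightarrow> complex"
  assumes "f \<in> L2_torus" and [measurable]: "g \<in> borel_measurable borel" and B: "\<And>x. norm (g x) \<le> B"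
  shows "(\<lambda>x. g x * f x) \<in> L2_torus"
proof (rule L2_torusI)
  show "integrable torus_measure (\<lambda>x. (norm (g x * f x))\<^sup>2)"
  proof (rule Bochner_Integration.integrable_bound)
    show "integrable torus_measure (\<lambda>x. B\<^sup>2 * (norm (f x))\<^sup>2)"
      using assms by (auto intro!: L2_torus_square)
    have "norm ((norm (g x * f x))\<^sup>2) \<le> norm (B\<^sup>2 * (norm (f x))\<^sup>2)" for x
      using power_mono[OF B[of x], of 2] by (simp add: norm_mult power_mult_distrib mult_right_mono)
    then show "AE x in torus_measure. norm ((norm (g x * f x))\<^sup>2) \<le> norm (B\<^sup>2 * (norm (f x))\<^sup>2)" by simp
  qed (use assms in measurable)
qed (use assms in measurable)

lemma L2_inner_add_left:
  "f \<in> L2_torus \<Longrightarrow> g \<in> L2_torus \<Longrightarrow> v \<in> L2_torus \<Longrightarrow> L2_inner (\<lambda>x. f x + g x) v = L2_inner f v + L2_inner g v"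
  unfolding L2_inner_def distrib_right
  by (intro Bochner_Integration.integral_add L2_inner_integrable)

lemma L2_inner_scale_left: "L2_inner (\<lambda>x. c * f x) v = c * L2_inner f v"
  by (simp add: L2_inner_def mult.assoc)

lemma L2_inner_cnj: "cnj (L2_inner f g) = L2_inner g f"
  using Bochner_Integration.integral_cnj[of torus_measure "\<lambda>x. f x * cnj (g x)"]
  by (simp add: L2_inner_def mult.commute)

lemma L2_inner_diff_left:
  "f \<in> L2_torus \<Longrightarrow> g \<in> L2_torus \<Longrightarrow> v \<in> L2_torus \<Longrightarrow> L2_inner (\<lambda>x. f x - g x) v = L2_inner f v - L2_inner g v"
  using L2_inner_add_left[of f "\<lambda>x. (-1) * g x" v] L2_scale[of g "-1"] L2_inner_scale_left[of "-1" g v] by simp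

lemma L2_inner_sum_left:
  assumes "\<And>i. i \<in> I \<Longrightarrow> f i \<in> L2_torus" "v \<in> L2_torus"
  shows "L2_inner (\<lambda>x. \<Sum>i\<in>I. f i x) v = (\<Sum>i\<in>I. L2_inner (f i) v)"
  using assms
  by (induction I rule: infinite_finite_induct) (auto simp: L2_inner_add_left L2_sum L2_inner_def[of "\<lambda>x. 0"])

lemma L2_inner_self: "L2_inner f f = of_real (N2 f)"
  by (simp add: L2_inner_def N2_def complex_norm_square[symmetric] del: of_real_power)

lemma N2_scale: "N2 (\<lambda>x. c * f x) = (norm c)\<^sup>2 * N2 f"
  by (simp add: N2_def norm_mult power_mult_distrib)

lemma N2_diff_commute: "N2 (\<lambda>x. f x - g x) = N2 (\<lambda>x. g x - f x)"
  by (simp add: N2_def norm_minus_commute)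

text \<open>A pointwise arithmetic-geometric inequality with free weight \<open>t\<close>;
  completeness uses the weight \<open>(1/2)^j\<close> to turn squared norms \<open>(1/4)^j\<close>
  into summable integrals.\<close>

lemma integral_abs_le:
  fixes f :: "'n::finite torus \<Rightarrow> complex"
  assumes "f \<in> L2_torus" "t > 0"
  shows "2 * (LINT x|torus_measure. norm (f x)) \<le> t * vol TYPE('n) + N2 f / t"
proof -
  have "2 * norm (f x) \<le> t + (norm (f x))\<^sup>2 / t" for x
  proof -
    have "2 * norm (f x) * t \<le> t * t + (norm (f x))\<^sup>2"
      using prod_le_squares[of "norm (f x)" t] by (simp add: power2_eq_square algebra_simps)
    then show ?thesis using assms(2) by (simp add: field_simps)
  qed
  then have "(LINT x|torus_measure. 2 * norm (f x)) \<le> (LINT x|torus_measure. t + (norm (f x))\<^sup>2 / t)"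
    using assms by (intro integral_mono integrable_norm Bochner_Integration.integrable_mult_right
       L2_integrable Bochner_Integration.integrable_add Bochner_Integration.integrable_divide L2_torus_square) auto
  also have "\<dots> = t * vol TYPE('n) + N2 f / t"
    using assms
    by (subst Bochner_Integration.integral_add)
       (auto simp: N2_def measure_torus_UNIV mult.commute intro: L2_torus_square)
  finally show ?thesis by simp
qed

lemma L2_inner_bound:
  fixes f :: "'n::finite torus \<Rightarrow> complex"
  assumes f: "f \<in> L2_torus" and g: "g \<in> L2_torus" and t: "t > 0"
  shows "2 * norm (L2_inner f g) \<le> t * N2 f + N2 g / t"
proof -
  have "2 * norm (f x * cnj (g x)) \<le> t * (norm (f x))\<^sup>2 + (norm (g x))\<^sup>2 / t" for x
  proof -
    have "2 * (t * norm (f x)) * norm (g x) \<le> (t * norm (f x))\<^sup>2 + (norm (g x))\<^sup>2"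
      using prod_le_squares[of "t * norm (f x)" "norm (g x)"] by simp
    then show ?thesis using t by (simp add: norm_mult field_simps power2_eq_square)
  qed
  then have "(LINT x|torus_measure. 2 * norm (f x * cnj (g x))) 
      \<le> (LINT x|torus_measure. t * (norm (f x))\<^sup>2 + (norm (g x))\<^sup>2 / t)"
    using assms by (intro integral_mono integrable_norm Bochner_Integration.integrable_mult_right
       L2_inner_integrable Bochner_Integration.integrable_add Bochner_Integration.integrable_divide L2_torus_square) auto
  also have "\<dots> = t * N2 f + N2 g / t"
    using assms by (subst Bochner_Integration.integral_add) (auto simp: N2_def intro: L2_torus_square)
  finally have "(LINT x|torus_measure. 2 * norm (f x * cnj (g x))) \<le> t * N2 f + N2 g / t" .
  moreover have "norm (L2_inner f g) \<le> (LINT x|torus_measure. norm (f x * cnj (g x)))"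
    unfolding L2_inner_def by (rule integral_norm_bound)
  ultimately show ?thesis by simp
qed

text \<open>The optimal weight in \<open>L2_inner_bound\<close> is the quotient of the two norms;
  shifting both norms by a small \<open>d\<close> avoids division by zero, at a cost of at most
  \<open>e\<close>.\<close>

lemma L2_Cauchy_Schwarz:
  fixes f :: "'n::finite torus \<Rightarrow> complex"
  assumes f: "f \<in> L2_torus" and g: "g \<in> L2_torus"
  shows "norm (L2_inner f g) \<le> sqrt (N2 f) * sqrt (N2 g)"
proof (rule field_le_epsilon)
  fix e :: real assume e: "e > 0"
  define a where "a = sqrt (N2 f)"
  define b where "b = sqrt (N2 g)"
  have ab: "a \<ge> 0" "b \<ge> 0" "N2 f = a\<^sup>2" "N2 g = b\<^sup>2" by (auto simp: a_def b_def)
  define d where "d = e / (a + b + 1)"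
  have d: "d > 0" "d * (a + b) \<le> e" using ab e by (auto simp: d_def field_simps)
  have "2 * norm (L2_inner f g) \<le> ((b + d) / (a + d)) * N2 f + N2 g / ((b + d) / (a + d))"
    using ab d by (intro L2_inner_bound f g) (simp add: add_nonneg_pos)
  also have "\<dots> \<le> (b + d) * a + (a + d) * b"
  proof (rule add_mono)
    have "a * a \<le> a * (a + d)" using ab d by (intro mult_left_mono) auto
    then have "(b + d) * (a * a) \<le> (b + d) * (a * (a + d))" using ab d by (intro mult_left_mono) auto
    then show "((b + d) / (a + d)) * N2 f \<le> (b + d) * a"
      using ab d by (simp add: power2_eq_square divide_le_eq add_nonneg_pos mult_ac)
    have "b * b \<le> b * (b + d)" using ab d by (intro mult_left_mono) auto
    then have "(a + d) * (b * b) \<le> (a + d) * (b * (b + d))" using ab d by (intro mult_left_mono) auto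
    then show "N2 g / ((b + d) / (a + d)) \<le> (a + d) * b"
      using ab d by (simp add: power2_eq_square divide_le_eq add_nonneg_pos mult_ac)
  qed
  also have "\<dots> \<le> 2 * (a * b) + e" using d(2) by (simp add: algebra_simps)
  finally show "norm (L2_inner f g) \<le> sqrt (N2 f) * sqrt (N2 g) + e"
    using e by (simp add: a_def b_def)
qed

text \<open>The increments \<open>f (Suc j) - f j\<close> have summable integrals, so they sum
  absolutely almost everywhere and the sequence converges there. Fatou's lemma transfers the
  quadratic bounds to the limit.\<close>

lemma L2_complete:
  fixes f :: "nat \<Rightarrow> 'n::finite torus \<Rightarrow> complex"
  assumes f: "\<And>j. f j \<in> L2_torus" and d: "\<And>j n. j \<le> n \<Longrightarrow> N2 (\<lambda>x. f n x - f j x) \<le> (1/4)^j"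
  shows "\<exists>w\<in>L2_torus. \<forall>j. N2 (\<lambda>x. w x - f j x) \<le> (1/4)^j"
proof -
  note [measurable] = L2_torus_measurable[OF f]
  have nn: "(\<integral>\<^sup>+x. ennreal ((norm (f n x - f j x))\<^sup>2) \<partial>torus_measure) \<le> ennreal ((1/4)^j)" if "j \<le> n" for j n
    using d[OF that] unfolding N2_def
    by (subst nn_integral_eq_integral[OF L2_torus_square[OF L2_diff[OF f f]]]) (auto intro: ennreal_leI)
  define g where "g j x = norm (f (Suc j) x - f j x)" for j x
  have gi: "(\<integral>\<^sup>+x. ennreal (g j x) \<partial>torus_measure) \<le> ennreal ((1/2)^j * (vol TYPE('n) + 1))" for j
  proof -
    have "2 * (LINT x|torus_measure. g j x) \<le> (1/2)^j * vol TYPE('n) + N2 (\<lambda>x. f (Suc j) x - f j x) / (1/2)^j"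
      unfolding g_def by (intro integral_abs_le L2_diff f) auto
    also have "N2 (\<lambda>x. f (Suc j) x - f j x) / (1/2)^j \<le> (1/4)^j / (1/2)^j"
      by (intro divide_right_mono d) auto
    also have "(1/4)^j / (1/2)^j = (1/2::real)^j"
      by (simp add: power_divide flip: power_mult_distrib) (simp add: field_simps flip: power_mult_distrib)
    finally have "(LINT x|torus_measure. g j x) \<le> (1/2)^j * (vol TYPE('n) + 1)"
      by (simp add: algebra_simps) (smt (verit) vol_pos(3) mult_nonneg_nonneg zero_le_power divide_nonneg_nonneg)
    then show ?thesis
      unfolding g_def
      by (subst nn_integral_eq_integral) (auto intro!: integrable_norm L2_integrable L2_diff f ennreal_leI)
  qed
  have "(\<integral>\<^sup>+x. (\<Sum>j. ennreal (g j x)) \<partial>torus_measure) = (\<Sum>j. \<integral>\<^sup>+x. ennreal (g j x) \<partial>torus_measure)"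
    by (intro nn_integral_suminf) (simp add: g_def)
  also have "\<dots> \<le> (\<Sum>j. ennreal ((1/2)^j * (vol TYPE('n) + 1)))"
    by (intro suminf_le gi) auto
  also have "\<dots> = ennreal (\<Sum>j. (1/2)^j * (vol TYPE('n) + 1))"
    by (intro suminf_ennreal2 summable_mult2 summable_geometric) (auto intro!: mult_nonneg_nonneg add_nonneg_nonneg)
  also have "\<dots> < \<infinity>" by simp
  finally have "AE x in torus_measure. (\<Sum>j. ennreal (g j x)) \<noteq> \<infinity>"
    by (intro nn_integral_PInf_AE) (auto simp: g_def)
  then have conv: "AE x in torus_measure. convergent (\<lambda>j. f j x)"
  proof eventually_elim
    case (elim x)
    have "summable (\<lambda>j. g j x)"
      by (rule summable_suminf_not_top) (use elim in \<open>auto simp: g_def\<close>)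
    then have "summable (\<lambda>j. f (Suc j) x - f j x)"
      unfolding g_def by (rule summable_norm_cancel)
    then have "convergent (\<lambda>n. \<Sum>j<n. f (Suc j) x - f j x)"
      by (simp add: summable_iff_convergent)
    moreover have "(\<Sum>j<n. f (Suc j) x - f j x) = f n x - f 0 x" for n
      by (rule sum_lessThan_telescope)
    ultimately have "convergent (\<lambda>n. (f n x - f 0 x) + f 0 x)"
      by (intro convergent_add convergent_const) simp
    then show ?case by simp
  qed
  define w where "w x = lim (\<lambda>j. f j x)" for x
  have [measurable]: "w \<in> borel_measurable borel"
    unfolding w_def by measurable
  have lim: "AE x in torus_measure. (\<lambda>j. f j x) \<longlonglongrightarrow> w x"
    using conv by eventually_elim (simp add: w_def convergent_LIMSEQ_iff)
  have wn: "(\<integral>\<^sup>+x. ennreal ((norm (w x - f j x))\<^sup>2) \<partial>torus_measure) \<le> ennreal ((1/4)^j)" for j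
  proof -
    \<comment> \<open>Fatou's lemma with \<open>j\<close> fixed, as the other index grows.\<close>
    have "AE x in torus_measure. ennreal ((norm (w x - f j x))\<^sup>2) = liminf (\<lambda>n. ennreal ((norm (f n x - f j x))\<^sup>2))"
      using lim
    proof eventually_elim
      case (elim x)
      have "(\<lambda>n. ennreal ((norm (f n x - f j x))\<^sup>2)) \<longlonglongrightarrow> ennreal ((norm (w x - f j x))\<^sup>2)"
        by (intro tendsto_ennrealI tendsto_intros elim)
      then show ?case by (rule lim_imp_Liminf[OF trivial_limit_sequentially, symmetric])
    qed
    then have "(\<integral>\<^sup>+x. ennreal ((norm (w x - f j x))\<^sup>2) \<partial>torus_measure)
      = (\<integral>\<^sup>+x. liminf (\<lambda>n. ennreal ((norm (f n x - f j x))\<^sup>2)) \<partial>torus_measure)"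
      by (rule nn_integral_cong_AE)
    also have "\<dots> \<le> liminf (\<lambda>n. \<integral>\<^sup>+x. ennreal ((norm (f n x - f j x))\<^sup>2) \<partial>torus_measure)"
      by (rule nn_integral_liminf) auto
    also have "\<dots> \<le> ennreal ((1/4)^j)"
      by (rule Liminf_le) (auto simp: eventually_sequentially intro!: exI[of _ j] nn)
    finally show ?thesis .
  qed
  have wd: "(\<lambda>x. w x - f j x) \<in> L2_torus" for j
  proof (rule L2_torusI)
    show "integrable torus_measure (\<lambda>x. (norm (w x - f j x))\<^sup>2)"
      by (rule integrableI_bounded) (use order_le_less_trans[OF wn[of j]] in auto)
  qed auto
  have "(\<lambda>x. (w x - f 0 x) + f 0 x) \<in> L2_torus"
    by (intro L2_add wd f)
  moreover have "N2 (\<lambda>x. w x - f j x) \<le> (1/4)^j" for j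
    using wn[of j] unfolding N2_def
    by (subst (asm) nn_integral_eq_integral) (auto intro: L2_torus_square wd)
  ultimately show ?thesis by auto
qed

section \<open>Orthogonality and completeness of the characters\<close>

section \<open>Fourier coefficients\<close>

text \<open>For distinct frequencies there is a translation under which the character of the
  difference changes sign. By invariance of the measure its integral is its own negative.\<close>

lemma L2_inner_charc:
  "L2_inner (charc k) (charc l) = (if k = l then of_real (vol TYPE('n::finite)) else 0)" for k l :: "int^'n"
proof (cases "k = l")
  case True
  then show ?thesis by (simp add: L2_inner_self N2_def measure_torus_UNIV)
next
  case False
  let ?m = "k - l"
  obtain i where i: "?m $ i \<noteq> 0" using False by (auto simp: vec_eq_iff)
  define Y where "Y = proj (axis i (pi / of_int (?m $ i)) :: real^'n)"
  have Y: "charc ?m Y = -1"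
    using i by (simp add: Y_def charc_proj inner_axis)
  let ?I = "LINT X|torus_measure. charc ?m X"
  have "?I = (LINT X|torus_measure. charc ?m (X + Y))"
    by (rule integral_torus_translate[symmetric]) simp
  also have "\<dots> = - ?I" by (simp add: charc_add Y)
  finally have "?I = 0" by simp
  moreover have "charc k X * cnj (charc l X) = charc ?m X" for X
    using charc_add_left[of k "- l" X] by (simp add: charc_uminus)
  ultimately show ?thesis using False by (simp add: L2_inner_def)
qed

definition fc :: "('n::finite torus \<Rightarrow> complex) \<Rightarrow> int^'n \<Rightarrow> complex" where
  "fc f k = L2_inner f (charc k)"

text \<open>The characters are orthogonal with squared norm \<open>vol\<close>, so dividing by it
  makes the coefficients of the sum equal to \<open>c\<close> on \<open>F\<close>.\<close>

definition psum :: "(int^'n::finite \<Rightarrow> complex) \<Rightarrow> (int^'n) set \<Rightarrow> 'n torus \<Rightarrow> complex" where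
  "psum c F x = (\<Sum>k\<in>F. c k / of_real (vol TYPE('n)) * charc k x)"

lemma L2_inner_charc_sum:
  assumes "f \<in> L2_torus"
  shows "L2_inner (\<lambda>x. \<Sum>k\<in>F. d k * charc k x) f = (\<Sum>k\<in>F. d k * L2_inner (charc k) f)"
  using L2_inner_sum_left[of F "\<lambda>k x. d k * charc k x" f] assms
  by (simp add: L2_scale L2_charc L2_inner_scale_left)

lemma psum_L2: "psum c F \<in> L2_torus"
  unfolding psum_def[abs_def] by (intro L2_sum L2_scale L2_charc)

lemma fc_psum: "finite F \<Longrightarrow> fc (psum c F) k = (if k \<in> F then c k else 0)" for c :: "int^'n::finite \<Rightarrow> complex"
proof -
  assume F: "finite F"
  have "fc (psum c F) k = (\<Sum>l\<in>F. c l / of_real (vol TYPE('n)) * (if l = k then of_real (vol TYPE('n)) else 0))"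
    unfolding fc_def psum_def[abs_def] L2_inner_charc_sum[OF L2_charc] L2_inner_charc ..
  also have "\<dots> = (\<Sum>l\<in>F. if l = k then c l else 0)"
    by (intro sum.cong) auto
  finally show ?thesis using F by simp
qed

lemma L2_inner_psum_left: "f \<in> L2_torus \<Longrightarrow> L2_inner (psum c F) f = (\<Sum>k\<in>F. c k * cnj (fc f k)) / of_real (vol TYPE('n))"
  for c :: "int^'n::finite \<Rightarrow> complex"
  unfolding psum_def[abs_def] fc_def
  by (simp only: L2_inner_charc_sum) (simp add: L2_inner_cnj sum_divide_distrib)

lemma N2_diff:
  assumes "f \<in> L2_torus" "g \<in> L2_torus"
  shows "N2 (\<lambda>x. f x - g x) = N2 f + N2 g - 2 * Re (L2_inner g f)"
proof -
  have "of_real (N2 (\<lambda>x. f x - g x)) = L2_inner (\<lambda>x. f x - g x) (\<lambda>x. f x - g x)"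
    by (simp add: L2_inner_self)
  also have "\<dots> = L2_inner f (\<lambda>x. f x - g x) - L2_inner g (\<lambda>x. f x - g x)"
    by (intro L2_inner_diff_left L2_diff assms)
  also have "\<dots> = cnj (L2_inner (\<lambda>x. f x - g x) f) - cnj (L2_inner (\<lambda>x. f x - g x) g)"
    by (simp add: L2_inner_cnj)
  also have "\<dots> = of_real (N2 f) - L2_inner f g - L2_inner g f + of_real (N2 g)"
    using assms by (simp add: L2_inner_diff_left L2_inner_self L2_inner_cnj)
  also have "\<dots> = of_real (N2 f) - cnj (L2_inner g f) - L2_inner g f + of_real (N2 g)"
    by (simp add: L2_inner_cnj)
  finally have "Re (of_real (N2 (\<lambda>x. f x - g x))) = Re (of_real (N2 f) - cnj (L2_inner g f) - L2_inner g f + of_real (N2 g))"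
    by simp
  then show ?thesis by simp
qed

lemma N2_psum: "finite F \<Longrightarrow> N2 (psum c F) = (\<Sum>k\<in>F. (norm (c k))\<^sup>2) / vol TYPE('n)" for c :: "int^'n::finite \<Rightarrow> complex"
proof -
  assume F: "finite F"
  have "complex_of_real (N2 (psum c F)) = (\<Sum>k\<in>F. c k * cnj (c k)) / of_real (vol TYPE('n))"
    unfolding L2_inner_self[symmetric] L2_inner_psum_left[OF psum_L2] using F
    by (simp add: fc_psum cong: sum.cong)
  also have "\<dots> = of_real ((\<Sum>k\<in>F. (norm (c k))\<^sup>2) / vol TYPE('n))"
    by (simp add: complex_norm_square[symmetric] del: of_real_power) 
  finally show ?thesis using of_real_eq_iff by blast
qed

lemma N2_psum_diff:
  fixes v :: "'n::finite torus \<Rightarrow> complex"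
  assumes "v \<in> L2_torus" "finite F"
  shows "N2 (\<lambda>x. v x - psum (fc v) F x) = N2 v - (\<Sum>k\<in>F. (norm (fc v k))\<^sup>2) / vol TYPE('n)"
proof -
  have "L2_inner (psum (fc v) F) v = of_real ((\<Sum>k\<in>F. (norm (fc v k))\<^sup>2) / vol TYPE('n))"
    unfolding L2_inner_psum_left[OF assms(1)]
    by (simp add: complex_norm_square[symmetric] del: of_real_power)
  then show ?thesis
    using assms by (simp add: N2_diff psum_L2 N2_psum)
qed

lemma Bessel:
  fixes v :: "'n::finite torus \<Rightarrow> complex"
  assumes "v \<in> L2_torus" "finite F"
  shows "(\<Sum>k\<in>F. (norm (fc v k))\<^sup>2) \<le> vol TYPE('n) * N2 v"
proof -
  have "0 \<le> N2 v - (\<Sum>k\<in>F. (norm (fc v k))\<^sup>2) / vol TYPE('n)"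
    unfolding N2_psum_diff[OF assms, symmetric] by (rule N2_nonneg)
  then show ?thesis by (simp add: divide_le_eq mult.commute)
qed

lemma fc_diff: "f \<in> L2_torus \<Longrightarrow> g \<in> L2_torus \<Longrightarrow> fc (\<lambda>x. f x - g x) k = fc f k - fc g k"
  by (simp add: fc_def L2_inner_diff_left L2_charc)

lemma fc_bound:
  fixes f :: "'n::finite torus \<Rightarrow> complex"
  assumes "f \<in> L2_torus" shows "norm (fc f k) \<le> sqrt (vol TYPE('n)) * sqrt (N2 f)"
proof -
  have "N2 (charc k :: 'n torus \<Rightarrow> complex) = vol TYPE('n)" by (simp add: N2_def measure_torus_UNIV)
  then show ?thesis
    using L2_Cauchy_Schwarz[OF assms L2_charc[of k]] by (simp add: fc_def mult.commute)
qed

text \<open>Along an enumeration of the lattice the sums of squares are bounded and monotone, hence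
  Cauchy. A subsequence with tails at most \<open>(1/4)^j\<close> meets the hypothesis of
  \<open>L2_complete\<close>, and coefficients are continuous in norm.\<close>

lemma Riesz_Fischer:
  fixes c :: "int^'n::finite \<Rightarrow> complex"
  assumes B: "\<And>F. finite F \<Longrightarrow> (\<Sum>k\<in>F. (norm (c k))\<^sup>2) \<le> B"
  shows "\<exists>w\<in>L2_torus. (\<forall>k. fc w k = c k) \<and> (\<forall>j. \<exists>F. finite F \<and> N2 (\<lambda>x. w x - psum c F x) \<le> (1/4)^j)"
proof -
  define G :: "nat \<Rightarrow> (int^'n) set" where "G n = from_nat ` {..<n}" for n
  have G: "finite (G n)" "m \<le> n \<Longrightarrow> G m \<subseteq> G n" for m n by (auto simp: G_def)
  have G_in: "k \<in> G (Suc (to_nat k))" for k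
    unfolding G_def by (rule image_eqI[of _ _ "to_nat k"]) auto
  define s where "s n = (\<Sum>k\<in>G n. (norm (c k))\<^sup>2)" for n
  have "incseq s" unfolding s_def by (intro monoI sum_mono2 G) auto
  moreover have "\<And>n. s n \<le> B" unfolding s_def by (intro B G)
  ultimately have "convergent s" using incseq_convergent by (metis convergent_def)
  then have "Cauchy s" by (rule convergent_Cauchy)
  have "\<exists>N. \<forall>n\<ge>N. \<forall>m\<ge>N. s n - s m \<le> vol TYPE('n) * (1/4)^j" for j :: nat
  proof -
    obtain N where "\<forall>m\<ge>N. \<forall>n\<ge>N. dist (s m) (s n) < vol TYPE('n) * (1/4)^j"
      using metric_CauchyD[OF \<open>Cauchy s\<close>, of "vol TYPE('n) * (1/4)^j"] by auto
    then show ?thesis by (intro exI[of _ N]) (force simp: dist_real_def)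
  qed
  then obtain N where N: "\<And>j n m. n \<ge> N j \<Longrightarrow> m \<ge> N j \<Longrightarrow> s n - s m \<le> vol TYPE('n) * (1/4)^j" by metis
  \<comment> \<open>Summing the thresholds makes \<open>M\<close> monotone, and the extra
    \<open>j\<close> makes the sets \<open>G (M j)\<close> exhaust the lattice.\<close>
  define M where "M j = (\<Sum>i\<le>j. N i) + j" for j
  have M: "N j \<le> M j" "j \<le> M j" "i \<le> j \<Longrightarrow> M i \<le> M j" for i j
  proof -
    show "N j \<le> M j" "j \<le> M j"
      unfolding M_def by (auto intro!: trans_le_add1 member_le_sum)
    show "i \<le> j \<Longrightarrow> M i \<le> M j"
      unfolding M_def by (intro add_mono sum_mono2) auto
  qed
  have tail: "N2 (\<lambda>x. psum c (G (M n)) x - psum c (G (M j)) x) \<le> (1/4)^j" if "j \<le> n" for j n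
  proof -
    have sub: "G (M j) \<subseteq> G (M n)" using M(3)[OF that] G(2) by blast
    have "psum c (G (M n)) x - psum c (G (M j)) x = psum c (G (M n) - G (M j)) x" for x
      unfolding psum_def
      using sum.subset_diff[OF sub G(1), of "\<lambda>k. c k / of_real (vol TYPE('n)) * charc k x"] by simp
    then have "N2 (\<lambda>x. psum c (G (M n)) x - psum c (G (M j)) x) = (\<Sum>k\<in>G (M n) - G (M j). (norm (c k))\<^sup>2) / vol TYPE('n)"
      using G by (simp add: N2_psum)
    also have "\<dots> = (s (M n) - s (M j)) / vol TYPE('n)"
      unfolding s_def using G sub by (simp add: sum_diff)
    also have "\<dots> \<le> (1/4)^j"
      using N[of j "M n" "M j"] M(1)[of j] M(3)[OF that] by (simp add: divide_le_eq mult.commute)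
    finally show ?thesis .
  qed
  obtain w where w: "w \<in> L2_torus" "\<And>j. N2 (\<lambda>x. w x - psum c (G (M j)) x) \<le> (1/4)^j"
    using L2_complete[OF psum_L2 tail] by blast
  have "fc w k = c k" for k
  proof -
    have "\<forall>\<^sub>F j in sequentially. norm (fc w k - c k) \<le> sqrt (vol TYPE('n)) * sqrt ((1/4)^j)"
      using eventually_ge_at_top[of "Suc (to_nat k)"]
    proof eventually_elim
      case (elim j)
      then have "k \<in> G (M j)" using G_in[of k] G(2)[of "Suc (to_nat k)" "M j"] M(2)[of j] by auto
      then have "fc w k - c k = fc (\<lambda>x. w x - psum c (G (M j)) x) k"
        using w G by (simp add: fc_diff psum_L2 fc_psum)
      also have "norm \<dots> \<le> sqrt (vol TYPE('n)) * sqrt (N2 (\<lambda>x. w x - psum c (G (M j)) x))"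
        by (intro fc_bound L2_diff w psum_L2)
      also have "\<dots> \<le> sqrt (vol TYPE('n)) * sqrt ((1/4)^j)"
        by (intro mult_left_mono real_sqrt_le_mono w) auto
      finally show ?case .
    qed
    moreover have "(\<lambda>j. sqrt (vol TYPE('n)) * sqrt ((1/4::real)^j)) \<longlonglongrightarrow> sqrt (vol TYPE('n)) * sqrt 0"
      by (intro tendsto_intros LIMSEQ_power_zero) auto
    ultimately have "norm (fc w k - c k) \<le> sqrt (vol TYPE('n)) * sqrt 0"
      by (intro tendsto_lowerbound[of "\<lambda>j. sqrt (vol TYPE('n)) * sqrt ((1/4::real)^j)" _ sequentially]) auto
    then show ?thesis by simp
  qed
  with w G(1) show ?thesis by (intro bexI[of _ w] conjI allI) blast+
qed

text \<open>The sets over which the integral vanishes form a Dynkin system; it contains an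
  intersection-stable generator and so every measurable set. Vanishing over the whole space gives
  closure under complements.\<close>

lemma AE_zero_of_set_integrals:
  fixes w :: "'a \<Rightarrow> complex"
  assumes M: "sigma_finite_measure M" and w: "integrable M w" and G: "Int_stable G" "G \<subseteq> Pow (space M)"
    and sets: "sets M = sigma_sets (space M) G"
    and z: "\<And>A. A \<in> G \<Longrightarrow> (LINT x|M. w x * indicator A x) = 0" and z1: "(LINT x|M. w x) = 0"
  shows "AE x in M. w x = 0"
proof -
  have wi: "integrable M (\<lambda>x. w x * indicator A x)" if "A \<in> sets M" for A
  proof -
    have "(\<lambda>x. indicat_real A x *\<^sub>R w x) = (\<lambda>x. w x * indicator A x)"
      by (auto simp: indicator_def fun_eq_iff)
    then show ?thesis using integrable_mult_indicator[OF that w] by simp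
  qed
  have "(LINT x|M. w x * indicator A x) = 0" if A: "A \<in> sets M" for A
    using G A unfolding sets
  proof (induction rule: sigma_sets_induct_disjoint)
    case (basic A) then show ?case by (rule z)
  next
    case empty then show ?case by simp
  next
    case (compl A)
    then have A: "A \<in> sets M" by (simp add: sets)
    have "(LINT x|M. w x * indicator (space M - A) x) = (LINT x|M. w x - w x * indicator A x)"
      by (intro Bochner_Integration.integral_cong) (auto simp: indicator_def)
    also have "\<dots> = 0"
      using compl z1 by (subst Bochner_Integration.integral_diff) (auto intro!: wi A w)
    finally show ?case by simp
  next
    case (union A)
    have A[measurable]: "A i \<in> sets M" for i using union by (auto simp: sets)
    have [measurable]: "w \<in> borel_measurable M" using w by simp
    have "(\<lambda>n. LINT x|M. w x * indicator (\<Union>i<n. A i) x) \<longlonglongrightarrow> (LINT x|M. w x * indicator (\<Union>i. A i) x)"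
    proof (rule integral_dominated_convergence)
      show "integrable M (\<lambda>x. norm (w x))" using w by simp
      show "AE x in M. (\<lambda>n. w x * indicator (\<Union>i<n. A i) x) \<longlonglongrightarrow> w x * indicator (\<Union>i. A i) x"
        by (intro AE_I2 tendsto_intros LIMSEQ_indicator_UN)
    qed (auto simp: indicator_def)
    moreover have "(LINT x|M. w x * indicator (\<Union>i<n. A i) x) = 0" for n
    proof (induction n)
      case (Suc n)
      have "w x * indicator (\<Union>i<Suc n. A i) x = w x * indicator (\<Union>i<n. A i) x + w x * indicator (A n) x" for x
      proof -
        have "x \<notin> A n" if "x \<in> A m" "m < n" for m
          using disjoint_family_onD[OF union(1), of m n] that by auto
        then show ?thesis by (auto simp: indicator_def lessThan_Suc)
      qed
      then have "(LINT x|M. w x * indicator (\<Union>i<Suc n. A i) x)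
        = (LINT x|M. w x * indicator (\<Union>i<n. A i) x) + (LINT x|M. w x * indicator (A n) x)"
        by (simp only:) (intro Bochner_Integration.integral_add wi, auto)
      then show ?case using Suc union(3)[of n] by simp
    qed simp
    ultimately show ?case by (simp add: LIMSEQ_const_iff)
  qed
  moreover have "indicat_real A x *\<^sub>R w x = w x * indicator A x" for A x
    by (simp add: indicator_def)
  ultimately show ?thesis
    by (intro sigma_finite_measure.density_zero[OF M w]) (simp add: set_lebesgue_integral_def)
qed

text \<open>The indicator of an open set is the pointwise limit of the continuous functions
  \<open>min 1 (n * d)\<close>, with \<open>d\<close> the distance to the complement, so the
  integrals over open sets vanish; these sets generate the Borel sets.\<close>

lemma zero_if_orthogonal_continuous:
  fixes w :: "'n::finite torus \<Rightarrow> complex"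
  assumes w: "integrable torus_measure w"
    and z: "\<And>g. continuous_on UNIV g \<Longrightarrow> (LINT x|torus_measure. w x * of_real (g x)) = 0"
  shows "AE x in torus_measure. w x = 0"
proof -
  have [measurable]: "w \<in> borel_measurable borel" using borel_measurable_integrable[OF w] by simp
  have op: "(LINT x|torus_measure. w x * indicator U x) = 0" if U: "open U" for U
  proof (cases "U = UNIV")
    case True
    then show ?thesis using z[of "\<lambda>x. 1"] by simp
  next
    case False
    let ?S = "proj -` (- U) :: (real^'n) set"
    have S: "closed ?S" "?S \<noteq> {}"
    proof -
      show "closed ?S" using U by (auto simp: open_torus_def closed_def vimage_Compl)
      obtain X where "X \<notin> U" using False by auto
      then have "rep_torus X \<in> ?S" by simp
      then show "?S \<noteq> {}" by blast
    qed
    define d where "d X = infdist (rep_torus X) ?S" for X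
    \<comment> \<open>The lifted complement is periodic, so the Euclidean distance to it is periodic
      and descends to the torus.\<close>
    have shift: "infdist (x + (2 * pi) *\<^sub>R ivec k) ?S \<le> infdist x ?S" for x k
    proof -
      have "infdist (x + (2 * pi) *\<^sub>R ivec k) ?S \<le> dist x y" if y: "y \<in> ?S" for y
      proof -
        have "proj (y + (2 * pi) *\<^sub>R ivec k) = proj y" by (subst proj_eq_iff) blast
        then have "y + (2 * pi) *\<^sub>R ivec k \<in> ?S" using y by auto
        then show ?thesis using infdist_le[of "y + (2 * pi) *\<^sub>R ivec k" ?S "x + (2 * pi) *\<^sub>R ivec k"] by simp
      qed
      then show ?thesis using S(2) unfolding infdist_notempty[OF S(2), of x] by (intro cINF_greatest) auto
    qed
    have dp: "d (proj x) = infdist x ?S" for x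
    proof -
      obtain k where k: "rep_torus (proj x) = x + (2 * pi) *\<^sub>R ivec k"
        using proj_eq_iff[of "rep_torus (proj x)" x] by auto
      then have "x = rep_torus (proj x) + (2 * pi) *\<^sub>R ivec (- k)" by (simp add: ivec_uminus)
      then show ?thesis unfolding d_def using k shift by (metis order_antisym)
    qed
    have cd: "continuous_on UNIV d"
      unfolding continuous_on_torus_iff dp by (intro continuous_intros)
    have d0: "d X = 0 \<longleftrightarrow> X \<notin> U" for X
    proof -
      obtain x where X: "X = proj x" by (rule torus_cases)
      show ?thesis unfolding X dp using in_closed_iff_infdist_zero[OF S] by auto
    qed
    have dn: "0 \<le> d X" for X by (simp add: d_def infdist_nonneg)
    define g where "g n X = min 1 (real n * d X)" for n X
    have cg: "continuous_on UNIV (g n)" for n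
      unfolding g_def by (intro continuous_intros cd)
    have [measurable]: "g n \<in> borel_measurable borel" for n
      by (rule borel_measurable_continuous_onI[OF cg])
    have lim: "(\<lambda>n. g n X) \<longlonglongrightarrow> indicator U X" for X
    proof (cases "X \<in> U")
      case True
      then have "d X > 0" using d0[of X] dn[of X] by (simp add: order_less_le)
      then obtain N :: nat where "1 / d X < N" using reals_Archimedean2 by blast
      then have "\<forall>n\<ge>N. g n X = 1"
        using \<open>d X > 0\<close> by (auto simp: g_def min_def field_simps) (smt (verit) mult_right_mono of_nat_le_iff)
      then show ?thesis using True
        by (intro tendsto_eventually) (auto simp: eventually_sequentially intro!: exI[of _ N])
    next
      case False
      then show ?thesis using d0[of X] by (simp add: g_def)
    qed
    have "(\<lambda>n. LINT x|torus_measure. w x * of_real (g n x)) \<longlonglongrightarrow> (LINT x|torus_measure. w x * of_real (indicator U x))"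
    proof (rule integral_dominated_convergence)
      show "integrable torus_measure (\<lambda>x. norm (w x))" using w by simp
      show "AE x in torus_measure. (\<lambda>n. w x * of_real (g n x)) \<longlonglongrightarrow> w x * of_real (indicator U x)"
        by (intro AE_I2 tendsto_intros lim)
      have "norm (w x * of_real (g n x)) \<le> norm (w x)" for n x
        using dn[of x] by (auto simp: norm_mult g_def intro!: mult_left_le)
      then show "AE x in torus_measure. norm (w x * of_real (g n x)) \<le> norm (w x)" for n by simp
    next
      have [measurable]: "U \<in> sets borel" using U by simp
      show "(\<lambda>x. w x * complex_of_real (indicator U x)) \<in> borel_measurable torus_measure"
        by measurable
      show "(\<lambda>x. w x * complex_of_real (g n x)) \<in> borel_measurable torus_measure" for n
        by measurable
    qed
    then have "(LINT x|torus_measure. w x * of_real (indicator U x)) = 0"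
      using z[OF cg] by (simp add: LIMSEQ_const_iff)
    moreover have "complex_of_real (indicator U x) = indicator U x" for x
      by (simp add: indicator_def)
    ultimately show ?thesis by simp
  qed
  show ?thesis
  proof (rule AE_zero_of_set_integrals[where G = "{S. open S}"])
    show "sigma_finite_measure torus_measure" by (rule torus.sigma_finite_measure_axioms)
    show "(LINT x|torus_measure. w x) = 0" using op[of UNIV] by simp
  qed (use w op in \<open>auto simp: Int_stable_def borel_def\<close>)
qed

text \<open>Continuous functions are uniform limits of trigonometric polynomials, obtained from
  \<open>tpoly_dense\<close> at zero momentum, and these are orthogonal to \<open>w\<close>.\<close>

lemma fc_unique:
  fixes w :: "'n::finite torus \<Rightarrow> complex"
  assumes w: "w \<in> L2_torus" and z: "\<And>k. fc w k = 0"
  shows "AE x in torus_measure. w x = 0"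
proof (rule zero_if_orthogonal_continuous[OF L2_integrable[OF w]])
  fix g :: "'n torus \<Rightarrow> real" assume g: "continuous_on UNIV g"
  have [measurable]: "g \<in> borel_measurable borel" "w \<in> borel_measurable borel"
    using borel_measurable_continuous_onI[OF g] L2_torus_measurable[OF w] by auto
  have cp: "continuous_on UNIV (\<lambda>X. p (X, 0))" if "p \<in> tpoly" for p :: "'n cotangent \<Rightarrow> complex"
    by (rule continuous_on_compose2[OF tpoly_continuous[OF that]]) (auto intro!: continuous_intros)
  have cL: "f \<in> L2_torus" if f: "continuous_on UNIV f" for f :: "'n torus \<Rightarrow> complex"
  proof -
    have "bounded (range f)"
      using compact_continuous_image[OF f compact_UNIV_torus] compact_imp_bounded by blast
    then obtain B where "\<And>x. norm (f x) \<le> B" by (auto simp: bounded_iff)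
    then show ?thesis by (intro L2_bounded borel_measurable_continuous_onI[OF f])
  qed
  \<comment> \<open>With the momentum frozen at zero each monomial is a multiple of a
    character.\<close>
  have p0: "(LINT x|torus_measure. w x * p (x, 0)) = 0" if "p \<in> tpoly" for p :: "'n cotangent \<Rightarrow> complex"
    using that
  proof (induction rule: tpoly.induct)
    case (mon k l)
    have "(LINT x|torus_measure. w x * mon k l (x, 0)) = fc w (- k) * of_real (\<Prod>i\<leftarrow>l. (0 :: real^'n) $ i)"
      unfolding fc_def L2_inner_def integral_mult_left_zero[symmetric]
      by (simp add: mon_def charc_uminus mult.assoc)
    then show ?case by (simp add: z)
  next
    case (add f g)
    have "(LINT x|torus_measure. w x * f (x, 0) + w x * g (x, 0)) = 0"
      using add by (subst Bochner_Integration.integral_add) (auto intro!: L2_mult_integrable w cL cp)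
    then show ?case by (simp add: distrib_left)
  next
    case (scale f c)
    then show ?case by (simp add: mult.left_commute[of _ c])
  qed
  let ?I = "LINT x|torus_measure. w x * of_real (g x)"
  have gL: "(\<lambda>x. of_real (g x) :: complex) \<in> L2_torus"
    by (rule cL) (intro continuous_intros g)
  have "norm ?I \<le> e * (LINT x|torus_measure. norm (w x))" if e: "e > 0" for e
  proof -
    have "compact ((UNIV :: 'n torus set) \<times> {0 :: real^'n})"
      by (intro compact_Times compact_UNIV_torus compact_sing)
    moreover have "continuous_on (UNIV \<times> {0}) (\<lambda>z::'n cotangent. complex_of_real (g (fst z)))"
      by (intro continuous_on_of_real continuous_on_compose2[OF g]) (auto intro: continuous_intros)
    ultimately obtain p :: "'n cotangent \<Rightarrow> complex" where p: "p \<in> tpoly"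
      "\<forall>z\<in>UNIV \<times> {0}. norm (complex_of_real (g (fst z)) - p z) < e"
      using tpoly_dense e by metis
    have pe: "norm (of_real (g x) - p (x, 0)) \<le> e" for x
      using p(2)[rule_format, of "(x, 0)"] by simp
    have "?I = (LINT x|torus_measure. w x * of_real (g x) - w x * p (x, 0))"
      using p0[OF p(1)]
      by (subst Bochner_Integration.integral_diff) (auto intro!: L2_mult_integrable w gL cL cp p)
    also have "norm \<dots> \<le> (LINT x|torus_measure. norm (w x * of_real (g x) - w x * p (x, 0)))"
      by (rule integral_norm_bound)
    also have "\<dots> \<le> (LINT x|torus_measure. e * norm (w x))"
    proof (rule integral_mono)
      show "integrable torus_measure (\<lambda>x. norm (w x * of_real (g x) - w x * p (x, 0)))"
        by (intro integrable_norm Bochner_Integration.integrable_diff L2_mult_integrable w gL cL cp p)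
      show "integrable torus_measure (\<lambda>x. e * norm (w x))"
        by (intro Bochner_Integration.integrable_mult_right integrable_norm L2_integrable w)
      show "norm (w x * of_real (g x) - w x * p (x, 0)) \<le> e * norm (w x)" for x
        unfolding right_diff_distrib[symmetric] norm_mult
        using mult_left_mono[OF pe[of x], of "norm (w x)"] by (simp add: mult.commute[of e])
    qed
    finally show ?thesis by simp
  qed
  then have *: "norm ?I \<le> e * (LINT x|torus_measure. norm (w x))" if "e > 0" for e using that by blast
  show "?I = 0"
  proof (rule ccontr)
    assume "?I \<noteq> 0"
    let ?J = "LINT x|torus_measure. norm (w x)"
    have J: "?J \<ge> 0" by simp
    have "norm ?I \<le> (norm ?I / (2 * (?J + 1))) * ?J"
      using * \<open>?I \<noteq> 0\<close> J by (intro *) (auto intro!: divide_pos_pos add_nonneg_pos)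
    also have "\<dots> = (norm ?I / 2) * (?J / (?J + 1))" by simp
    also have "\<dots> \<le> (norm ?I / 2) * 1"
      using J by (intro mult_left_mono) (simp_all add: divide_le_eq_1_pos add_nonneg_pos)
    finally show False using \<open>?I \<noteq> 0\<close> by simp
  qed
qed

lemma N2_cong_AE:
  assumes "f \<in> L2_torus" "g \<in> L2_torus" "AE x in torus_measure. f x = g x" shows "N2 f = N2 g"
  unfolding N2_def using assms
  by (intro integral_cong_AE borel_measurable_integrable[OF L2_torus_square]) auto

lemma L2_inner_cong_AE:
  assumes "f \<in> L2_torus" "g \<in> L2_torus" "v \<in> L2_torus" "AE x in torus_measure. f x = g x"
  shows "L2_inner f v = L2_inner g v"
  unfolding L2_inner_def using assms
  by (intro integral_cong_AE borel_measurable_integrable[OF L2_inner_integrable]) auto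

text \<open>\<open>Riesz_Fischer\<close> constructs a function with the coefficients of
  \<open>v\<close> and convergent partial sums; by \<open>fc_unique\<close> it equals
  \<open>v\<close> almost everywhere.\<close>

lemma psum_dense:
  fixes v :: "'n::finite torus \<Rightarrow> complex"
  assumes v: "v \<in> L2_torus" and e: "e > 0"
  shows "\<exists>F. finite F \<and> N2 (\<lambda>x. v x - psum (fc v) F x) < e"
proof -
  obtain w where w: "w \<in> L2_torus" "\<And>k. fc w k = fc v k"
    and F: "\<And>j. \<exists>F. finite F \<and> N2 (\<lambda>x. w x - psum (fc v) F x) \<le> (1/4)^j"
    using Riesz_Fischer[of "fc v", OF Bessel[OF v]] by blast
  have wv: "AE x in torus_measure. w x - v x = 0"
    by (rule fc_unique) (auto simp: fc_diff w v L2_diff)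
  obtain j where j: "(1/4::real)^j < e"
    using real_arch_pow_inv[of e "1/4"] e by auto
  obtain F where F: "finite F" "N2 (\<lambda>x. w x - psum (fc v) F x) \<le> (1/4)^j"
    using F by blast
  have "N2 (\<lambda>x. v x - psum (fc v) F x) = N2 (\<lambda>x. w x - psum (fc v) F x)"
    using wv by (intro N2_cong_AE L2_diff v w psum_L2) auto
  with F j show ?thesis by auto
qed

lemma psum_antimono:
  fixes v :: "'n::finite torus \<Rightarrow> complex"
  assumes "v \<in> L2_torus" "finite F" "G \<subseteq> F"
  shows "N2 (\<lambda>x. v x - psum (fc v) F x) \<le> N2 (\<lambda>x. v x - psum (fc v) G x)"
proof -
  have "(\<Sum>k\<in>G. (norm (fc v k))\<^sup>2) \<le> (\<Sum>k\<in>F. (norm (fc v k))\<^sup>2)"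
    using assms by (intro sum_mono2) auto
  then have "(\<Sum>k\<in>G. (norm (fc v k))\<^sup>2) / vol TYPE('n) \<le> (\<Sum>k\<in>F. (norm (fc v k))\<^sup>2) / vol TYPE('n)"
    by (intro divide_right_mono) auto
  then show ?thesis using assms finite_subset[of G F] by (simp add: N2_psum_diff)
qed

text \<open>A long partial sum carries almost all of the norm of \<open>v\<close>; its size depends
  only on the moduli of the coefficients and is bounded by Bessel's inequality for \<open>w\<close>.
  This half of Parseval, used both ways, gives unitarity of the evolution.\<close>

lemma N2_le_of_fc:
  fixes v w :: "'n::finite torus \<Rightarrow> complex"
  assumes v: "v \<in> L2_torus" and w: "w \<in> L2_torus" and eq: "\<And>k. norm (fc v k) = norm (fc w k)"
  shows "N2 v \<le> N2 w"
proof (rule field_le_epsilon)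
  fix e :: real assume "e > 0"
  then obtain F where F: "finite F" "N2 (\<lambda>x. v x - psum (fc v) F x) < e"
    using psum_dense[OF v] by blast
  then have "N2 v < e + (\<Sum>k\<in>F. (norm (fc w k))\<^sup>2) / vol TYPE('n)"
    by (simp add: N2_psum_diff v eq)
  also have "(\<Sum>k\<in>F. (norm (fc w k))\<^sup>2) / vol TYPE('n) \<le> N2 w"
    using Bessel[OF w F(1)] by (simp add: divide_le_eq mult.commute)
  finally show "N2 v \<le> N2 w + e" by simp
qed

lemma N2_eq_of_fc:
  fixes v w :: "'n::finite torus \<Rightarrow> complex"
  assumes "v \<in> L2_torus" "w \<in> L2_torus" "\<And>k. norm (fc v k) = norm (fc w k)"
  shows "N2 v = N2 w"
  using N2_le_of_fc[of v w] N2_le_of_fc[of w v] assms by (simp add: order_antisym)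

section \<open>Functions of the Laplacian as Fourier multipliers\<close>

section \<open>Functions of the Laplacian\<close>

definition laplev :: "int^'n \<Rightarrow> real" where "laplev k = - (ivec k \<bullet> ivec k)"

lemma frechet_cis_linear:
  "frechet_derivative (\<lambda>x. c * cis (w \<bullet> x)) (at x) v = c * (\<i> * of_real (w \<bullet> v) * cis (w \<bullet> x))"
proof -
  have "((\<lambda>x. c * cis (w \<bullet> x)) has_derivative (\<lambda>v. c * ((w \<bullet> v) *\<^sub>R (\<i> * cis (w \<bullet> x))))) (at x)"
    by (intro has_derivative_mult_right has_derivative_cis bounded_linear_imp_has_derivative bounded_linear_inner_right)
  from frechet_derivative_at[OF this, symmetric] show ?thesis
    by (simp add: scaleR_conv_of_real mult_ac)
qed

lemma Ck_on_cis_inner: "Ck_on k (\<lambda>x. cis (w \<bullet> x)) UNIV"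
  using Ck_on_affine[OF Ck_on_cis bounded_linear_inner_right, of k w 0] by simp

lemma charc_eigenfunction: "laplace_eigenfunction (laplev k) (charc k)"
proof -
  have "partial_deriv i (partial_deriv i (\<lambda>x. charc k (proj x))) x = - (of_int (k $ i))\<^sup>2 * cis (ivec k \<bullet> x)" for i x
  proof -
    have 1: "partial_deriv i (\<lambda>x. charc k (proj x)) = (\<lambda>x. (\<i> * of_int (k $ i)) * cis (ivec k \<bullet> x))"
      using frechet_cis_linear[of 1 "ivec k"] by (auto simp: partial_deriv_def charc_proj inner_axis fun_eq_iff)
    show ?thesis
      unfolding 1 by (simp add: partial_deriv_def frechet_cis_linear inner_axis power2_eq_square)
        (simp add: complex_eq_iff algebra_simps)
  qed
  moreover have "(\<Sum>i\<in>UNIV. - (of_int (k $ i))\<^sup>2 :: complex) = of_real (laplev k)"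
    by (simp add: laplev_def inner_vec_def sum_negf power2_eq_square)
  ultimately have "laplacian (charc k) X = of_real (laplev k) * cis (ivec k \<bullet> rep_torus X)" for X
    by (simp only: laplacian_def sum_distrib_right[symmetric])
  then show ?thesis
    unfolding laplace_eigenfunction_def
    by (simp add: charc_def[symmetric]) (simp add: smooth_on_def charc_proj Ck_on_cis_inner)
qed

text \<open>The derivative is a dominated limit of difference quotients, and each of them integrates
  to zero by translation invariance, so there are no boundary terms. Periodicity of the derivative
  makes it a function on the torus.\<close>

lemma integral_deriv_torus:
  fixes g :: "'n::finite torus \<Rightarrow> complex"
  assumes g: "Ck_on 1 (\<lambda>x. g (proj x)) UNIV"
  shows "continuous_on UNIV (\<lambda>X. partial_deriv i (\<lambda>x. g (proj x)) (rep_torus X))"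
    and "partial_deriv i (\<lambda>x. g (proj x)) (rep_torus (proj y)) = partial_deriv i (\<lambda>x. g (proj x)) y"
    and "(LINT X|torus_measure. partial_deriv i (\<lambda>x. g (proj x)) (rep_torus X)) = 0"
proof -
  let ?G = "\<lambda>x. g (proj x)" and ?v = "axis i 1 :: real^'n"
  let ?D = "\<lambda>X. partial_deriv i ?G (rep_torus X)"
  have der: "(?G has_derivative frechet_derivative ?G (at x)) (at x)" for x
    using Ck_on_SucD(1)[of 0 ?G] g by simp
  have cont: "continuous_on UNIV (partial_deriv i ?G)"
    using Ck_on_SucD(2)[of 0 ?G ?v] g by (simp add: partial_deriv_def[abs_def])
  have per: "partial_deriv i ?G (rep_torus (proj y)) = partial_deriv i ?G y" for y
  proof -
    obtain k where k: "rep_torus (proj y) = y + (2 * pi) *\<^sub>R ivec k"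
      using proj_eq_iff[of "rep_torus (proj y)" y] by auto
    have "((\<lambda>x. x + (2 * pi) *\<^sub>R ivec k) has_derivative (\<lambda>x. x)) (at y)"
      by (auto intro!: derivative_eq_intros)
    from has_derivative_compose[OF this der]
    have "((\<lambda>x. ?G (x + (2 * pi) *\<^sub>R ivec k)) has_derivative frechet_derivative ?G (at (y + (2 * pi) *\<^sub>R ivec k))) (at y)" .
    moreover have "?G (x + (2 * pi) *\<^sub>R ivec k) = ?G x" for x
      using proj_eq_iff by metis
    ultimately have "(?G has_derivative frechet_derivative ?G (at (y + (2 * pi) *\<^sub>R ivec k))) (at y)"
      by simp
    then have "frechet_derivative ?G (at y) = frechet_derivative ?G (at (y + (2 * pi) *\<^sub>R ivec k))"
      by (rule frechet_derivative_at[symmetric])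
    then show ?thesis by (simp add: partial_deriv_def k)
  qed
  then show "partial_deriv i ?G (rep_torus (proj y)) = partial_deriv i ?G y" .
  show cD: "continuous_on UNIV ?D"
    unfolding continuous_on_torus_iff per by (rule cont)
  have "bounded (range ?D)"
    using compact_continuous_image[OF cD compact_UNIV_torus] compact_imp_bounded by blast
  then obtain B where B: "\<And>X. norm (?D X) \<le> B" by (auto simp: bounded_iff)
  have cg: "continuous_on UNIV g"
    unfolding continuous_on_torus_iff using Ck_on_continuous[OF g] .
  have [measurable]: "g \<in> borel_measurable borel" "?D \<in> borel_measurable borel"
    by (auto intro: borel_measurable_continuous_onI cg cD)
  have "bounded (range g)"
    using compact_continuous_image[OF cg compact_UNIV_torus] compact_imp_bounded by blast
  then obtain B' where B': "\<And>X. norm (g X) \<le> B'" by (auto simp: bounded_iff)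
  have gi: "integrable torus_measure g"
    by (rule torus.integrable_const_bound[of _ B']) (use B' in auto)
  \<comment> \<open>The difference quotient in direction \<open>i\<close> with step
    \<open>1 / Suc n\<close>; the mean value inequality bounds it by \<open>B\<close>.\<close>
  define q where "q n X = (g (X + proj ((1 / Suc n) *\<^sub>R ?v)) - g X) * of_real (Suc n)" for n X
  have vd: "((\<lambda>s. ?G (x + s *\<^sub>R ?v)) has_vector_derivative partial_deriv i ?G (x + s *\<^sub>R ?v)) (at s)" for x s
  proof -
    have "((\<lambda>s. x + s *\<^sub>R ?v) has_derivative (\<lambda>s. s *\<^sub>R ?v)) (at s)"
      by (auto intro!: derivative_eq_intros)
    from has_derivative_compose[OF this der]
    show ?thesis
      using linear_scale[OF has_derivative_linear[OF der[of "x + s *\<^sub>R ?v"]]]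
      by (simp add: has_vector_derivative_def partial_deriv_def)
  qed
  have "(\<lambda>n. LINT X|torus_measure. q n X) \<longlonglongrightarrow> (LINT X|torus_measure. ?D X)"
  proof (rule integral_dominated_convergence)
    show "?D \<in> borel_measurable torus_measure" by measurable
    show "q n \<in> borel_measurable torus_measure" for n
      unfolding q_def by measurable
    show "integrable torus_measure (\<lambda>X. B)" by simp
    have "(\<lambda>n. q n X) \<longlonglongrightarrow> ?D X" for X
    proof -
      obtain x where X: "X = proj x" by (rule torus_cases)
      have "((\<lambda>s. ((?G (x + s *\<^sub>R ?v) - ?G (x + 0 *\<^sub>R ?v)) - (s - 0) *\<^sub>R partial_deriv i ?G (x + 0 *\<^sub>R ?v)) /\<^sub>R norm (s - 0)) \<longlongrightarrow> 0) (at 0)"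
        using vd[of x 0] unfolding has_vector_derivative_def has_derivative_at_within by blast
      moreover have "filterlim (\<lambda>n. 1 / real (Suc n)) (at 0) sequentially"
        unfolding filterlim_at using LIMSEQ_inverse_real_of_nat by (auto simp: inverse_eq_divide)
      ultimately have "(\<lambda>n. ((?G (x + (1 / real (Suc n)) *\<^sub>R ?v) - ?G (x + 0 *\<^sub>R ?v)) - (1 / real (Suc n) - 0) *\<^sub>R partial_deriv i ?G (x + 0 *\<^sub>R ?v))
          /\<^sub>R norm (1 / real (Suc n) - 0)) \<longlonglongrightarrow> 0"
        by (rule filterlim_compose)
      then have "(\<lambda>n. (?G (x + (1 / real (Suc n)) *\<^sub>R ?v) - ?G x) /\<^sub>R (1 / real (Suc n)) - partial_deriv i ?G x) \<longlonglongrightarrow> 0"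
        by (simp add: scaleR_diff_right)
      then have "(\<lambda>n. (?G (x + (1 / real (Suc n)) *\<^sub>R ?v) - ?G x) /\<^sub>R (1 / real (Suc n))) \<longlonglongrightarrow> partial_deriv i ?G x"
        by (rule LIM_zero_cancel)
      then show ?thesis
        by (simp add: q_def X per proj_add scaleR_conv_of_real mult.commute)
    qed
    then show "AE X in torus_measure. (\<lambda>n. q n X) \<longlonglongrightarrow> ?D X" by simp
    have "norm (q n X) \<le> B" for n X
    proof -
      obtain x where X: "X = proj x" by (rule torus_cases)
      have "norm (?G (x + (1 / real (Suc n)) *\<^sub>R ?v) - ?G (x + 0 *\<^sub>R ?v)) \<le> B * norm (1 / real (Suc n) - 0)"
      proof (rule differentiable_bound[where S = UNIV and f = "\<lambda>s. ?G (x + s *\<^sub>R ?v)"])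
        show "((\<lambda>s. ?G (x + s *\<^sub>R ?v)) has_derivative (\<lambda>r. r *\<^sub>R partial_deriv i ?G (x + s *\<^sub>R ?v))) (at s within UNIV)" for s
          using vd[of x s] by (simp add: has_vector_derivative_def)
        show "onorm (\<lambda>r. r *\<^sub>R partial_deriv i ?G (x + s *\<^sub>R ?v)) \<le> B" for s
          by (rule onorm_le) (use B[of "proj (x + s *\<^sub>R ?v)"] in \<open>auto simp: per mult.commute[of B] intro!: mult_left_mono\<close>)
      qed auto
      then have "norm (g (proj x + proj ((1 / Suc n) *\<^sub>R ?v)) - g (proj x)) \<le> B / real (Suc n)"
        by (simp add: proj_add del: of_nat_Suc)
      then have "norm (g (proj x + proj ((1 / Suc n) *\<^sub>R ?v)) - g (proj x)) * real (Suc n) \<le> B"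
        by (simp add: le_divide_eq del: of_nat_Suc)
      then show ?thesis
        unfolding q_def X norm_mult norm_of_real by simp
    qed
    then show "AE X in torus_measure. norm (q n X) \<le> B" for n by simp
  qed
  moreover have "(LINT X|torus_measure. q n X) = 0" for n
  proof -
    have i2: "integrable torus_measure (\<lambda>X. g (X + Y))" for Y
      by (rule torus.integrable_const_bound[of _ B']) (use B' in auto)
    have "(LINT X|torus_measure. g (X + Y) - g X) = 0" for Y
      using integral_torus_translate[of g Y] by (simp add: i2 gi)
    then show ?thesis by (simp add: q_def)
  qed
  ultimately show "(LINT X|torus_measure. ?D X) = 0" by (simp add: LIMSEQ_const_iff)
qed

text \<open>Integration by parts: the integral of the derivative of \<open>g\<close> times a
  conjugate character vanishes.\<close>

lemma fc_partial_deriv: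
  fixes g :: "'n::finite torus \<Rightarrow> complex"
  assumes g: "Ck_on 1 (\<lambda>x. g (proj x)) UNIV"
  shows "fc (\<lambda>X. partial_deriv i (\<lambda>x. g (proj x)) (rep_torus X)) k = \<i> * of_int (k $ i) * fc g k"
proof -
  let ?G = "\<lambda>x. g (proj x)" and ?e = "\<lambda>x. charc (- k) (proj x)"
  have e: "Ck_on n ?e UNIV" for n by (simp add: charc_proj Ck_on_cis_inner)
  have ge: "Ck_on 1 (\<lambda>x. ?G x * ?e x) UNIV" by (rule Ck_on_mult[OF g e])
  have dge: "partial_deriv i (\<lambda>x. ?G x * ?e x) x = ?G x * (- \<i> * of_int (k $ i) * ?e x) + partial_deriv i ?G x * ?e x" for x
  proof -
    have "((\<lambda>x. ?G x * ?e x) has_derivative (\<lambda>v. ?G x * frechet_derivative ?e (at x) v + frechet_derivative ?G (at x) v * ?e x)) (at x)"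
      using Ck_on_SucD(1)[of 0 ?G x] g Ck_on_SucD(1)[of 0 ?e x] e[of 1] by (intro has_derivative_mult) simp_all
    from frechet_derivative_at[OF this, symmetric] show ?thesis
      using frechet_cis_linear[of 1 "ivec (- k)" x "axis i 1"]
      by (simp add: partial_deriv_def charc_proj inner_axis)
  qed
  have cg: "continuous_on UNIV g"
    unfolding continuous_on_torus_iff using Ck_on_continuous[OF g] .
  note cD = integral_deriv_torus(1)[OF g, of i]
  have int: "integrable torus_measure f" if f: "continuous_on UNIV f" for f :: "'n torus \<Rightarrow> complex"
  proof -
    have "bounded (range f)"
      using compact_continuous_image[OF f compact_UNIV_torus] compact_imp_bounded by blast
    then obtain B where "\<And>X. norm (f X) \<le> B" by (auto simp: bounded_iff)
    then show ?thesis
      using borel_measurable_continuous_onI[OF f] by (intro torus.integrable_const_bound[of _ B]) auto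
  qed
  have "0 = (LINT X|torus_measure. partial_deriv i (\<lambda>x. ?G x * ?e x) (rep_torus X))"
    using integral_deriv_torus(3)[of "\<lambda>X. g X * charc (- k) X" i] ge by simp
  also have "\<dots> = (LINT X|torus_measure. (- \<i> * of_int (k $ i)) * (g X * charc (- k) X)
       + partial_deriv i ?G (rep_torus X) * charc (- k) X)"
    by (intro Bochner_Integration.integral_cong) (auto simp: dge mult_ac)
  also have "\<dots> = (- \<i> * of_int (k $ i)) * (LINT X|torus_measure. g X * charc (- k) X)
       + (LINT X|torus_measure. partial_deriv i ?G (rep_torus X) * charc (- k) X)"
    by (subst Bochner_Integration.integral_add)
       (auto intro!: int continuous_on_mult cg cD continuous_charc)
  finally show ?thesis
    by (simp add: fc_def L2_inner_def charc_uminus algebra_simps)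
qed

lemma continuous_L2:
  fixes f :: "'n::finite torus \<Rightarrow> complex"
  assumes f: "continuous_on UNIV f" shows "f \<in> L2_torus"
proof -
  have "bounded (range f)"
    using compact_continuous_image[OF f compact_UNIV_torus] compact_imp_bounded by blast
  then obtain B where "\<And>x. norm (f x) \<le> B" by (auto simp: bounded_iff)
  then show ?thesis by (intro L2_bounded borel_measurable_continuous_onI[OF f])
qed

lemma fc_laplacian:
  fixes f :: "'n::finite torus \<Rightarrow> complex"
  assumes f: "smooth_on UNIV (\<lambda>x. f (proj x))"
  shows "fc (laplacian f) k = of_real (laplev k) * fc f k"
proof -
  have C: "Ck_on n (\<lambda>x. f (proj x)) UNIV" for n using f by (simp add: smooth_on_def)
  let ?D = "\<lambda>i X. partial_deriv i (\<lambda>x. f (proj x)) (rep_torus X)"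
  have D: "(\<lambda>x. ?D i (proj x)) = partial_deriv i (\<lambda>x. f (proj x))" for i
    using integral_deriv_torus(2)[OF C] by blast
  have D1: "Ck_on 1 (\<lambda>x. ?D i (proj x)) UNIV" for i
    unfolding D using Ck_on_SucD(2)[OF C[of "Suc 1"], of "axis i 1"] by (simp only: partial_deriv_def[abs_def])
  let ?DD = "\<lambda>i X. partial_deriv i (\<lambda>x. ?D i (proj x)) (rep_torus X)"
  have "laplacian f = (\<lambda>X. \<Sum>i\<in>UNIV. ?DD i X)"
    by (simp add: laplacian_def[abs_def] D)
  then have "fc (laplacian f) k = (\<Sum>i\<in>UNIV. fc (?DD i) k)"
    unfolding fc_def
    by (simp only:) (intro L2_inner_sum_left L2_charc continuous_L2 integral_deriv_torus(1) D1)
  also have "\<dots> = (\<Sum>i\<in>UNIV. \<i> * of_int (k $ i) * (\<i> * of_int (k $ i) * fc f k))"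
    by (intro sum.cong refl) (simp only: fc_partial_deriv[OF D1] fc_partial_deriv[OF C])
  also have "\<dots> = of_real (laplev k) * fc f k"
    by (simp add: laplev_def inner_vec_def sum_negf sum_distrib_right mult_ac)
       (simp add: mult.assoc[symmetric] sum_negf sum_distrib_left)
  finally show ?thesis .
qed

lemma finite_int_vec_bounded: "finite {k::int^'n::finite. norm (ivec k) \<le> B}"
proof -
  let ?S = "PiE (UNIV :: 'n set) (\<lambda>_. {- \<lceil>B\<rceil>..\<lceil>B\<rceil>})"
  have "finite ?S" by (intro finite_PiE) auto
  moreover have "{k::int^'n. norm (ivec k) \<le> B} \<subseteq> (\<lambda>f. \<chi> i. f i) ` ?S"
  proof
    fix k :: "int^'n" assume "k \<in> {k. norm (ivec k) \<le> B}"
    then have "\<bar>real_of_int (k $ i)\<bar> \<le> B" for i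
      using component_le_norm_cart[of "ivec k" i] by simp
    then have "\<bar>k $ i\<bar> \<le> \<lceil>B\<rceil>" for i
      by (metis ceiling_mono ceiling_of_int of_int_abs)
    then have "(\<lambda>i. k $ i) \<in> ?S" by (auto simp: abs_le_iff) (metis minus_le_iff)
    then show "k \<in> (\<lambda>f. \<chi> i. f i) ` ?S" by (intro image_eqI[of _ _ "\<lambda>i. k $ i"]) auto
  qed
  ultimately show ?thesis using finite_surj by blast
qed

text \<open>An eigenfunction of eigenvalue \<open>l\<close> has nonzero coefficients only at
  frequencies of that eigenvalue, so it is a finite combination of characters. Hence a condition on
  all eigenfunctions reduces to one on characters.\<close>

lemma L2_inner_eigenfunction:
  fixes f v :: "'n::finite torus \<Rightarrow> complex"
  assumes ev: "laplace_eigenfunction l f" and v: "v \<in> L2_torus"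
  defines "F \<equiv> {k. laplev k = l}"
  shows "L2_inner v f = (\<Sum>k\<in>F. fc v k * cnj (fc f k)) / of_real (vol TYPE('n))"
proof -
  have sm: "smooth_on UNIV (\<lambda>x. f (proj x))" and lap: "laplacian f = (\<lambda>X. of_real l * f X)"
    using ev by (auto simp: laplace_eigenfunction_def)
  have "Ck_on 0 (\<lambda>x. f (proj x)) UNIV" using sm by (simp only: smooth_on_def)
  then have "continuous_on UNIV f"
    unfolding continuous_on_torus_iff by (rule Ck_on_continuous)
  then have f: "f \<in> L2_torus" by (rule continuous_L2)
  have z: "fc f k = 0" if "k \<notin> F" for k
    using fc_laplacian[OF sm, of k] that unfolding lap by (simp add: fc_def L2_inner_scale_left F_def)
  \<comment> \<open>On the level set the Euclidean norm of the frequency is fixed, so only finitely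
    many lattice points occur.\<close>
  have "F \<subseteq> {k. norm (ivec k) \<le> sqrt (- l)}"
    by (auto simp: F_def laplev_def norm_eq_sqrt_inner)
  then have fin: "finite F" using finite_int_vec_bounded finite_subset by blast
  have "AE x in torus_measure. f x - psum (fc f) F x = 0"
    by (rule fc_unique) (auto simp: L2_diff f psum_L2 fc_diff fc_psum fin z)
  then have "L2_inner f v = L2_inner (psum (fc f) F) v"
    by (intro L2_inner_cong_AE f v psum_L2) auto
  then have "cnj (L2_inner f v) = cnj ((\<Sum>k\<in>F. fc f k * cnj (fc v k)) / of_real (vol TYPE('n)))"
    by (simp add: L2_inner_psum_left v)
  then show ?thesis by (simp add: L2_inner_cnj mult.commute)
qed

text \<open>The multiplied coefficients are square-summable, so some function has them, and it
  satisfies the property that characterises the operator. The choice operator therefore returns such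
  a function, and testing it on characters recovers the coefficients.\<close>

lemma fun_laplacian:
  fixes u :: "'n::finite torus \<Rightarrow> complex"
  assumes u: "u \<in> L2_torus" and F: "\<And>l. norm (F l) \<le> 1"
  shows "fun_laplacian F u \<in> L2_torus" "fc (fun_laplacian F u) k = F (laplev k) * fc u k"
proof -
  let ?P = "\<lambda>w. w \<in> L2_torus \<and> (\<forall>l f. laplace_eigenfunction l f \<longrightarrow> L2_inner w f = F l * L2_inner u f)"
  have "(norm (F (laplev k) * fc u k))\<^sup>2 \<le> (norm (fc u k))\<^sup>2" for k
    using F[of "laplev k"] by (intro power_mono) (auto simp: norm_mult mult_left_le_one_le)
  then have "(\<Sum>k\<in>G. (norm (F (laplev k) * fc u k))\<^sup>2) \<le> vol TYPE('n) * N2 u" if "finite G" for G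
    by (intro order_trans[OF sum_mono Bessel[OF u that]])
  then obtain w where w: "w \<in> L2_torus" "\<And>k. fc w k = F (laplev k) * fc u k"
    using Riesz_Fischer[of "\<lambda>k. F (laplev k) * fc u k"] by blast
  have "?P w"
    using w u by (auto simp: L2_inner_eigenfunction sum_distrib_left mult.assoc intro!: sum.cong)
  then have *: "?P (fun_laplacian F u)"
    unfolding fun_laplacian_def by (rule someI[of ?P])
  then show "fun_laplacian F u \<in> L2_torus" by blast
  show "fc (fun_laplacian F u) k = F (laplev k) * fc u k"
    using * charc_eigenfunction[of k] by (simp add: fc_def)
qed

lemma schroedinger_L2: "u \<in> L2_torus \<Longrightarrow> schroedinger s u \<in> L2_torus"
  unfolding schroedinger_def by (rule fun_laplacian) auto

lemma fc_schroedinger: "u \<in> L2_torus \<Longrightarrow> fc (schroedinger s u) k = cis (s * laplev k / 2) * fc u k"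
  unfolding schroedinger_def by (rule fun_laplacian) auto

lemma N2_schroedinger: "u \<in> L2_torus \<Longrightarrow> N2 (schroedinger s u) = N2 u"
  by (rule N2_eq_of_fc) (auto simp: schroedinger_L2 fc_schroedinger norm_mult)

section \<open>Inverse Fourier transforms and their Riemann sums on a lattice of mesh h\<close>

section \<open>The semiclassical kernel and its lattice approximation\<close>

text \<open>The inverse Fourier transform, with the factor (2 pi)^-d of the quantization built
  in.\<close>

definition chk :: "((real^'n) \<Rightarrow> complex) \<Rightarrow> real^'n \<Rightarrow> complex" where
  "chk \<eta> w = (LINT \<zeta>|lborel. \<eta> \<zeta> * cis (w \<bullet> \<zeta>)) / of_real (vol TYPE('n))"

text \<open>Rounds every coordinate down to a multiple of \<open>h\<close>. Composing with it turns
  sums over the lattice into integrals over the whole space.\<close>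

definition hgrid :: "real \<Rightarrow> real^'n \<Rightarrow> real^'n" where
  "hgrid h \<xi> = h *\<^sub>R ivec (\<chi> i. \<lfloor>\<xi> $ i / h\<rfloor>)"

lemma measurable_hgrid [measurable]: "hgrid h \<in> borel \<rightarrow>\<^sub>M borel"
proof (rule borel_measurable_euclidean_space[THEN iffD2], rule ballI)
  fix b :: "real^'a" assume "b \<in> Basis"
  then obtain i where b: "b = axis i 1" by (auto simp: Basis_vec_def)
  have "(\<lambda>\<xi>::real^'a. h * real_of_int \<lfloor>\<xi> $ i / h\<rfloor>) \<in> borel_measurable borel" by measurable
  then show "(\<lambda>\<xi>. hgrid h \<xi> \<bullet> b) \<in> borel_measurable borel"
    by (simp add: b hgrid_def inner_axis)
qed

lemma hgrid_close:
  fixes \<xi> :: "real^'n"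
  assumes "h > 0" shows "norm (hgrid h \<xi> - \<xi>) \<le> h * CARD('n)"
proof -
  have "\<bar>h * of_int \<lfloor>t / h\<rfloor> - t\<bar> \<le> h" for t
  proof -
    have "h * of_int \<lfloor>t / h\<rfloor> \<le> h * (t / h)" "h * (t / h) < h * (of_int \<lfloor>t / h\<rfloor> + 1)"
      using assms by (intro mult_left_mono mult_strict_left_mono; linarith)+
    then show ?thesis using assms by (simp add: distrib_left)
  qed
  then have "(\<Sum>i\<in>UNIV. \<bar>(hgrid h \<xi> - \<xi>) $ i\<bar>) \<le> (\<Sum>i\<in>(UNIV::'n set). h)"
    by (intro sum_mono) (simp add: hgrid_def)
  then show ?thesis using norm_le_l1_cart[of "hgrid h \<xi> - \<xi>"] by (simp add: mult.commute)
qed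

lemma hgrid_shift:
  assumes "h > 0" shows "hgrid h (\<xi> + h *\<^sub>R axis j 1) = hgrid h \<xi> + h *\<^sub>R axis j 1"
proof -
  have fl: "\<lfloor>(t + (if b then h else 0)) / h\<rfloor> = \<lfloor>t / h\<rfloor> + (if b then 1 else 0)" for t b
    using assms by (simp add: add_divide_distrib)
  show ?thesis
    unfolding vec_eq_iff
  proof
    fix i
    have "(\<xi> + h *\<^sub>R axis j 1) $ i = \<xi> $ i + (if i = j then h else 0)" by (simp add: axis_def)
    then have "hgrid h (\<xi> + h *\<^sub>R axis j 1) $ i = h * of_int \<lfloor>(\<xi> $ i + (if i = j then h else 0)) / h\<rfloor>"
      by (simp add: hgrid_def)
    then show "hgrid h (\<xi> + h *\<^sub>R axis j 1) $ i = (hgrid h \<xi> + h *\<^sub>R axis j 1) $ i"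
      unfolding fl by (simp add: hgrid_def axis_def distrib_left)
  qed
qed

text \<open>A lattice sum with mesh \<open>h\<close> written as an integral of a step function
  (\<open>gint_eq_sum\<close>), so that dominated convergence and translation invariance of Lebesgue
  measure apply to it.\<close>

definition gint :: "((real^'n) \<Rightarrow> complex) \<Rightarrow> real \<Rightarrow> real^'n \<Rightarrow> complex" where
  "gint g h w = (LINT \<zeta>|lborel. g (hgrid h \<zeta>) * cis (w \<bullet> hgrid h \<zeta>))"

lemma integrable_ball_bounded:
  fixes f :: "'a::euclidean_space \<Rightarrow> 'b::{banach, second_countable_topology}"
  assumes [measurable]: "f \<in> borel_measurable borel" and B: "\<And>x. norm (f x) \<le> B" and R: "\<And>x. R < norm x \<Longrightarrow> f x = 0"
  shows "integrable lborel f"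
    and "norm (LINT x|lborel. f x) \<le> B * measure lborel (cball (0::'a) R)"
proof -
  have i: "integrable lborel (\<lambda>x. B * indicator (cball (0::'a) R) x :: real)"
    using emeasure_lborel_cball_finite[of "0::'a" R]
    by (intro Bochner_Integration.integrable_mult_right integrable_real_indicator) auto
  have le: "norm (f x) \<le> B * indicator (cball 0 R) x" for x
    using B[of x] R[of x] by (auto simp: indicator_def)
  show "integrable lborel f"
    by (rule Bochner_Integration.integrable_bound[OF i]) (use le B in \<open>auto intro!: AE_I2 order_trans[OF le]\<close>)
  then have "norm (LINT x|lborel. f x) \<le> (LINT x|lborel. B * indicator (cball (0::'a) R) x)"
    by (intro order_trans[OF integral_norm_bound] integral_mono i integrable_norm le)
  then show "norm (LINT x|lborel. f x) \<le> B * measure lborel (cball (0::'a) R)" by simp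
qed

lemma measurable_cis [measurable]: "cis \<in> borel_measurable borel"
  by (intro borel_measurable_continuous_onI continuous_intros)

lemma lborel_integral_translate:
  fixes f :: "'a::euclidean_space \<Rightarrow> 'b::{banach, second_countable_topology}"
  assumes [measurable]: "f \<in> borel_measurable borel"
  shows "(LINT x|lborel. f (x + c)) = (LINT x|lborel. f x)"
proof -
  have "(LINT x|lborel. f x) = (LINT x|distr lborel borel ((+) c). f x)"
    by (simp add: lborel_distr_plus)
  also have "\<dots> = (LINT x|lborel. f (c + x))"
    by (subst integral_distr) auto
  finally show ?thesis by (simp add: add.commute)
qed

text \<open>On the relevant interval the sine is concave and lies above its chord. This lower bound
  for the chord of the unit circle makes division after summation by parts possible, and forces the
  restriction to one period.\<close>

lemma cis_chord:
  assumes "\<bar>t\<bar> \<le> pi" shows "\<bar>t\<bar> \<le> pi / 2 * norm (cis t - 1)"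
proof -
  have cvx: "convex_on {0..pi} (\<lambda>x. - sin x)"
    by (rule f''_ge0_imp_convex[where f' = "\<lambda>x. - cos x" and f'' = sin])
       (auto intro!: derivative_eq_intros sin_ge_zero)
  have sin: "u \<le> sin (u * (pi / 2))" if "0 \<le> u" "u \<le> 1" for u
    using convex_onD[OF cvx, of u 0 "pi / 2"] that pi_gt_zero by simp
  have "norm (cis t - 1) = 2 * \<bar>sin (t / 2)\<bar>"
  proof -
    have "(norm (cis t - 1))\<^sup>2 = (cos t - 1)\<^sup>2 + (sin t)\<^sup>2"
      by (simp add: cmod_power2)
    also have "\<dots> = 2 - 2 * cos t"
      using sin_cos_squared_add[of t] by (simp add: power2_diff)
    also have "cos t = 1 - 2 * (sin (t / 2))\<^sup>2"
      using cos_double_sin[of "t / 2"] by simp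
    finally have "(norm (cis t - 1))\<^sup>2 = (2 * \<bar>sin (t / 2)\<bar>)\<^sup>2" by (simp add: power_mult_distrib)
    then show ?thesis by (rule power2_eq_imp_eq) auto
  qed
  moreover have "\<bar>t\<bar> / pi \<le> sin (\<bar>t\<bar> / pi * (pi / 2))"
    using assms by (intro sin) auto
  then have "\<bar>t\<bar> / pi \<le> \<bar>sin (t / 2)\<bar>" by (cases "t \<ge> 0") auto
  ultimately show ?thesis by (simp add: field_simps)
qed

lemma testf_bounded:
  assumes "\<eta> \<in> testf" obtains R B where "R > 0" "B \<ge> 0" "\<And>\<xi>. R < norm \<xi> \<Longrightarrow> \<eta> \<xi> = 0" "\<And>\<xi>. norm (\<eta> \<xi>) \<le> B"
proof -
  obtain R where R: "R > 0" "\<And>\<xi>. R < norm \<xi> \<Longrightarrow> \<eta> \<xi> = 0" using testf_support[OF assms] by blast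
  obtain B where "B \<ge> 0" "\<And>\<xi>. norm (\<eta> \<xi>) \<le> B"
    using compact_support_bounded[OF testf_continuous[OF assms], of R] R by blast
  with R that show thesis by blast
qed

lemma grid_support:
  fixes g :: "real^'n \<Rightarrow> complex"
  assumes "\<And>\<xi>. R < norm \<xi> \<Longrightarrow> g \<xi> = 0" "0 < h" "h \<le> 1" "R + CARD('n) < norm \<zeta>"
  shows "g (hgrid h \<zeta>) = 0"
proof (rule assms(1))
  have "norm \<zeta> \<le> norm (hgrid h \<zeta>) + norm (hgrid h \<zeta> - \<zeta>)"
    using norm_triangle_ineq4[of "hgrid h \<zeta>" "hgrid h \<zeta> - \<zeta>"] by simp
  also have "norm (hgrid h \<zeta> - \<zeta>) \<le> h * CARD('n)" by (rule hgrid_close[OF assms(2)])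
  also have "\<dots> \<le> CARD('n)" using assms(2,3) by (simp add: mult_left_le_one_le)
  finally show "R < norm (hgrid h \<zeta>)" using assms(4) by simp
qed

lemma gint_bound:
  fixes g :: "real^'n \<Rightarrow> complex"
  assumes "continuous_on UNIV g" "\<And>\<xi>. R < norm \<xi> \<Longrightarrow> g \<xi> = 0" "\<And>\<xi>. norm (g \<xi>) \<le> B" "0 < h" "h \<le> 1"
  shows "norm (gint g h w) \<le> B * measure lborel (cball (0::real^'n) (R + CARD('n)))"
proof -
  have [measurable]: "g \<in> borel_measurable borel" by (rule borel_measurable_continuous_onI[OF assms(1)])
  show ?thesis
    unfolding gint_def
  proof (rule integrable_ball_bounded(2))
    show "norm (g (hgrid h \<zeta>) * cis (w \<bullet> hgrid h \<zeta>)) \<le> B" for \<zeta>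
      using assms(3) by (simp add: norm_mult)
    show "g (hgrid h \<zeta>) * cis (w \<bullet> hgrid h \<zeta>) = 0" if "R + CARD('n) < norm \<zeta>" for \<zeta>
      using grid_support[where g = g, OF assms(2,4,5) that] by simp
  qed measurable
qed

text \<open>Summation by parts: translating the variable by one mesh width in direction
  \<open>j\<close> moves the shift from \<open>g\<close> to the phase.\<close>

lemma gint_fdiff:
  fixes g :: "real^'n \<Rightarrow> complex"
  assumes g: "continuous_on UNIV g" "\<And>\<xi>. R < norm \<xi> \<Longrightarrow> g \<xi> = 0" "\<And>\<xi>. norm (g \<xi>) \<le> B" and h: "0 < h" "h \<le> 1"
  shows "gint (fdiff (h *\<^sub>R axis j 1) g) h w = (cis (- (h * w $ j)) - 1) * gint g h w"
proof -
  have [measurable]: "g \<in> borel_measurable borel" by (rule borel_measurable_continuous_onI[OF g(1)])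
  let ?e = "h *\<^sub>R axis j 1 :: real^'n"
  let ?f = "\<lambda>\<zeta>. g (hgrid h \<zeta>) * cis (w \<bullet> hgrid h \<zeta>)"
  have i: "integrable lborel ?f"
  proof (rule integrable_ball_bounded(1))
    show "norm (g (hgrid h \<zeta>) * cis (w \<bullet> hgrid h \<zeta>)) \<le> B" for \<zeta>
      using g(3) by (simp add: norm_mult)
    show "g (hgrid h \<zeta>) * cis (w \<bullet> hgrid h \<zeta>) = 0" if "R + CARD('n) < norm \<zeta>" for \<zeta>
      using grid_support[where g = g, OF g(2) h that] by simp
  qed measurable
  have i2: "integrable lborel (\<lambda>\<zeta>. ?f (\<zeta> + ?e))"
    using integrable_distr[of "(+) ?e" lborel borel ?f] i by (simp add: lborel_distr_plus add.commute)
  have eq: "fdiff ?e g (hgrid h \<zeta>) * cis (w \<bullet> hgrid h \<zeta>) = cis (- (h * w $ j)) * ?f (\<zeta> + ?e) - ?f \<zeta>" for \<zeta>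
  proof -
    have "cis (w \<bullet> hgrid h \<zeta>) = cis (- (h * w $ j)) * cis (w \<bullet> (hgrid h \<zeta> + ?e))"
      by (simp add: inner_add_right inner_axis cis_mult)
    then have "g (hgrid h \<zeta> + ?e) * cis (w \<bullet> hgrid h \<zeta>) = cis (- (h * w $ j)) * ?f (\<zeta> + ?e)"
      by (simp only: hgrid_shift[OF h(1)] mult_ac)
    then show ?thesis by (simp add: fdiff_def left_diff_distrib)
  qed
  have "gint (fdiff ?e g) h w = (LINT \<zeta>|lborel. cis (- (h * w $ j)) * ?f (\<zeta> + ?e) - ?f \<zeta>)"
    unfolding gint_def by (simp only: eq)
  also have "\<dots> = cis (- (h * w $ j)) * (LINT \<zeta>|lborel. ?f (\<zeta> + ?e)) - (LINT \<zeta>|lborel. ?f \<zeta>)"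
    by (subst Bochner_Integration.integral_diff) (auto intro!: i i2 Bochner_Integration.integrable_mult_right)
  also have "(LINT \<zeta>|lborel. ?f (\<zeta> + ?e)) = (LINT \<zeta>|lborel. ?f \<zeta>)"
    by (rule lborel_integral_translate) measurable
  finally show ?thesis by (simp add: gint_def left_diff_distrib)
qed

lemma fdiff_pow_continuous: "continuous_on UNIV g \<Longrightarrow> continuous_on UNIV ((fdiff e ^^ N) g)"
  for g :: "'a::real_normed_vector \<Rightarrow> complex"
proof (induction N)
  case (Suc N)
  then show ?case unfolding fdiff_pow_Suc
    by (intro continuous_on_diff continuous_on_compose2[of UNIV "(fdiff e ^^ N) g" UNIV "\<lambda>x. x + e"] continuous_intros) auto
qed simp

lemma fdiff_pow_support:
  assumes "\<And>\<xi>. R < norm \<xi> \<Longrightarrow> g \<xi> = 0" "norm e \<le> 1" "R + real N < norm \<xi>"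
  shows "(fdiff e ^^ N) g \<xi> = 0"
  using assms(3)
proof (induction N arbitrary: \<xi>)
  case (Suc N)
  have "norm \<xi> \<le> norm (\<xi> + e) + norm e" using norm_triangle_ineq4[of "\<xi> + e" e] by simp
  then have "R + real N < norm (\<xi> + e)" using Suc.prems assms(2) by simp
  then show ?case unfolding fdiff_pow_Suc using Suc by simp
qed (use assms(1) in simp)

lemma gint_fdiff_pow:
  fixes g :: "real^'n \<Rightarrow> complex"
  assumes g: "continuous_on UNIV g" "\<And>\<xi>. R < norm \<xi> \<Longrightarrow> g \<xi> = 0" and h: "0 < h" "h \<le> 1"
  shows "gint ((fdiff (h *\<^sub>R axis j 1) ^^ N) g) h w = (cis (- (h * w $ j)) - 1) ^ N * gint g h w"
proof (induction N)
  case (Suc N)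
  let ?g = "(fdiff (h *\<^sub>R axis j 1) ^^ N) g"
  have c: "continuous_on UNIV ?g" by (rule fdiff_pow_continuous[OF g(1)])
  have s: "R + real N < norm \<xi> \<Longrightarrow> ?g \<xi> = 0" for \<xi>
    by (rule fdiff_pow_support[OF g(2)]) (use h in auto)
  obtain B where "\<And>\<xi>. norm (?g \<xi>) \<le> B" using compact_support_bounded[OF c s] by blast
  from gint_fdiff[OF c s this h] Suc show ?case by simp
qed simp

text \<open>All terms are compared with the largest of 1 and the \<open>a i\<close>; this reduces a
  weight in the norm to one coordinate at a time.\<close>

lemma power_one_plus_sum_le:
  fixes a :: "'n::finite \<Rightarrow> real"
  assumes "\<And>i. 0 \<le> a i"
  shows "(1 + (\<Sum>i\<in>UNIV. a i)) ^ N \<le> (1 + CARD('n)) ^ N * (1 + (\<Sum>i\<in>UNIV. a i ^ N))"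
proof -
  obtain j where j: "\<And>i. a i \<le> a j"
  proof -
    have "Max (range a) \<in> range a" by (intro Max_in) auto
    then obtain j where "Max (range a) = a j" by (rule rangeE)
    then show thesis using that Max_ge[of "range a"] by (metis finite finite_imageI rangeI)
  qed
  let ?M = "max 1 (a j)"
  have "(\<Sum>i\<in>UNIV. a i) \<le> CARD('n) * a j"
    using sum_bounded_above[of UNIV a "a j"] j by simp
  also have "\<dots> \<le> CARD('n) * ?M" by (intro mult_left_mono) auto
  finally have "1 + (\<Sum>i\<in>UNIV. a i) \<le> (1 + CARD('n)) * ?M" by (simp add: algebra_simps)
  then have "(1 + (\<Sum>i\<in>UNIV. a i)) ^ N \<le> ((1 + CARD('n)) * ?M) ^ N"
    by (intro power_mono) (auto intro!: add_nonneg_nonneg sum_nonneg assms)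
  also have "\<dots> = (1 + CARD('n)) ^ N * ?M ^ N" by (simp add: power_mult_distrib)
  also have "?M ^ N \<le> 1 + a j ^ N"
    using assms[of j] by (auto simp: max_def)
  also have "a j ^ N \<le> (\<Sum>i\<in>UNIV. a i ^ N)"
    by (intro member_le_sum) (auto intro: assms zero_le_power)
  finally show ?thesis by (auto intro: mult_left_mono)
qed

text \<open>\<open>N\<close> differences in direction \<open>j\<close> gain \<open>h ^ N\<close> by
  smoothness, and \<open>cis_chord\<close> turns the resulting phase factors into
  \<open>\<bar>h * w $ j\<bar> ^ N\<close>, so the powers of \<open>h\<close> cancel and the bound
  is uniform in the mesh.\<close>

lemma gint_decay:
  fixes \<eta> :: "real^'n \<Rightarrow> complex"
  assumes \<eta>: "\<eta> \<in> testf"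
  shows "\<exists>C\<ge>0. \<forall>h w. 0 < h \<and> h \<le> 1 \<and> (\<forall>j. \<bar>h * w $ j\<bar> \<le> pi) \<longrightarrow> norm (gint \<eta> h w) * (1 + norm w) ^ N \<le> C"
proof -
  obtain R B where RB: "R > 0" "B \<ge> 0" "\<And>\<xi>. R < norm \<xi> \<Longrightarrow> \<eta> \<xi> = 0" "\<And>\<xi>. norm (\<eta> \<xi>) \<le> B"
    using testf_bounded[OF \<eta>] by blast
  have c: "continuous_on UNIV \<eta>" by (rule testf_continuous[OF \<eta>])
  have "\<exists>C\<ge>0. \<forall>x t. norm ((fdiff (t *\<^sub>R axis j 1) ^^ N) \<eta> x) \<le> C * \<bar>t\<bar> ^ N" for j
    using fdiff_pow_bound[of N \<eta> R "axis j 1"] \<eta> RB by (auto simp: testf_def)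
  then obtain D where D: "\<And>j. D j \<ge> 0" "\<And>j x t. norm ((fdiff (t *\<^sub>R axis j 1) ^^ N) \<eta> x) \<le> D j * \<bar>t\<bar> ^ N"
    by metis
  define m where "m S = measure lborel (cball (0::real^'n) S)" for S
  have m: "m S \<ge> 0" for S by (simp add: m_def)
  let ?K = "\<lambda>j. (pi / 2) ^ N * (D j * m (R + N + CARD('n)))"
  have dir: "\<bar>w $ j\<bar> ^ N * norm (gint \<eta> h w) \<le> ?K j" if h: "0 < h" "h \<le> 1" "\<bar>h * w $ j\<bar> \<le> pi" for h w j
  proof -
    let ?g = "(fdiff (h *\<^sub>R axis j 1) ^^ N) \<eta>"
    have "norm (gint ?g h w) \<le> (D j * h ^ N) * m (R + N + CARD('n))"
      unfolding m_def
    proof (rule gint_bound)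
      show "R + real N < norm \<xi> \<Longrightarrow> ?g \<xi> = 0" for \<xi>
        by (rule fdiff_pow_support[OF RB(3)]) (use h in auto)
      show "norm (?g \<xi>) \<le> D j * h ^ N" for \<xi> using D(2)[of h j \<xi>] h by simp
    qed (use h fdiff_pow_continuous[OF c] in auto)
    then have 1: "norm (cis (- (h * w $ j)) - 1) ^ N * norm (gint \<eta> h w) \<le> (D j * h ^ N) * m (R + N + CARD('n))"
      using gint_fdiff_pow[OF c RB(3) h(1,2), where j = j and N = N and w = w] by (simp add: norm_mult norm_power)
    \<comment> \<open>The restriction to one period enters here: the phase increment is then
      comparable with \<open>h * w $ j\<close>.\<close>
    have "\<bar>h * w $ j\<bar> ^ N \<le> (pi / 2 * norm (cis (- (h * w $ j)) - 1)) ^ N"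
      using cis_chord[of "- (h * w $ j)"] h(3) by (intro power_mono) auto
    then have "\<bar>h * w $ j\<bar> ^ N * norm (gint \<eta> h w) \<le> (pi / 2 * norm (cis (- (h * w $ j)) - 1)) ^ N * norm (gint \<eta> h w)"
      by (rule mult_right_mono) simp
    also have "\<dots> = (pi / 2) ^ N * (norm (cis (- (h * w $ j)) - 1) ^ N * norm (gint \<eta> h w))"
      by (simp only: power_mult_distrib mult.assoc)
    also have "\<dots> \<le> (pi / 2) ^ N * ((D j * h ^ N) * m (R + N + CARD('n)))"
      by (intro mult_left_mono 1) auto
    finally have "h ^ N * (\<bar>w $ j\<bar> ^ N * norm (gint \<eta> h w)) \<le> h ^ N * ?K j"
      using h by (simp add: abs_mult power_mult_distrib mult_ac)
    then show ?thesis using h by simp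
  qed
  have zero: "norm (gint \<eta> h w) \<le> B * m (R + CARD('n))" if "0 < h" "h \<le> 1" for h w
    unfolding m_def by (rule gint_bound[OF c RB(3,4) that])
  let ?C = "(1 + CARD('n)) ^ N * (B * m (R + CARD('n)) + (\<Sum>j\<in>UNIV. ?K j))"
  have "norm (gint \<eta> h w) * (1 + norm w) ^ N \<le> ?C" if h: "0 < h" "h \<le> 1" "\<forall>j. \<bar>h * w $ j\<bar> \<le> pi" for h w
  proof -
    have "(1 + norm w) ^ N \<le> (1 + (\<Sum>j\<in>UNIV. \<bar>w $ j\<bar>)) ^ N"
      by (intro power_mono) (auto simp: norm_le_l1_cart)
    also have "\<dots> \<le> (1 + CARD('n)) ^ N * (1 + (\<Sum>j\<in>UNIV. \<bar>w $ j\<bar> ^ N))"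
      by (rule power_one_plus_sum_le) simp
    finally have "norm (gint \<eta> h w) * (1 + norm w) ^ N \<le> norm (gint \<eta> h w) * ((1 + CARD('n)) ^ N * (1 + (\<Sum>j\<in>UNIV. \<bar>w $ j\<bar> ^ N)))"
      by (rule mult_left_mono) simp
    also have "\<dots> = (1 + CARD('n)) ^ N * (norm (gint \<eta> h w) + (\<Sum>j\<in>UNIV. \<bar>w $ j\<bar> ^ N * norm (gint \<eta> h w)))"
      by (simp add: algebra_simps sum_distrib_left)
    also have "\<dots> \<le> ?C"
      using h by (intro mult_left_mono add_mono zero sum_mono dir) auto
    finally show ?thesis .
  qed
  moreover have "?C \<ge> 0"
    using D(1) m RB(2) by (intro mult_nonneg_nonneg add_nonneg_nonneg sum_nonneg) auto
  ultimately show ?thesis by blast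
qed

text \<open>Riemann sums converge to the integral. Rounding moves points by at most \<open>h\<close>
  times the dimension, so for \<open>h\<close> at most 1 all integrands live in one ball and are
  dominated there.\<close>

lemma gint_limit:
  fixes \<eta> :: "real^'n \<Rightarrow> complex"
  assumes \<eta>: "\<eta> \<in> testf" and h: "\<And>n. 0 < h n" "\<And>n. h n \<le> 1" "h \<longlonglongrightarrow> 0" and w: "w \<longlonglongrightarrow> w'"
  shows "(\<lambda>n. gint \<eta> (h n) (w n) / of_real (vol TYPE('n))) \<longlonglongrightarrow> chk \<eta> w'"
proof -
  obtain R B where RB: "R > 0" "B \<ge> 0" "\<And>\<xi>. R < norm \<xi> \<Longrightarrow> \<eta> \<xi> = 0" "\<And>\<xi>. norm (\<eta> \<xi>) \<le> B"
    using testf_bounded[OF \<eta>] by blast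
  have c: "continuous_on UNIV \<eta>" by (rule testf_continuous[OF \<eta>])
  then have [measurable]: "\<eta> \<in> borel_measurable borel" by (rule borel_measurable_continuous_onI)
  have g: "(\<lambda>n. hgrid (h n) \<zeta>) \<longlonglongrightarrow> \<zeta>" for \<zeta> :: "real^'n"
  proof (rule LIM_zero_cancel, rule Lim_null_comparison)
    show "\<forall>\<^sub>F n in sequentially. norm (hgrid (h n) \<zeta> - \<zeta>) \<le> h n * CARD('n)"
      using hgrid_close h by (auto intro!: always_eventually)
    show "(\<lambda>n. h n * CARD('n)) \<longlonglongrightarrow> 0" using tendsto_mult_left_zero[OF h(3)] by simp
  qed
  have "(\<lambda>n. LINT \<zeta>|lborel. \<eta> (hgrid (h n) \<zeta>) * cis (w n \<bullet> hgrid (h n) \<zeta>)) \<longlonglongrightarrow> (LINT \<zeta>|lborel. \<eta> \<zeta> * cis (w' \<bullet> \<zeta>))"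
  proof (rule integral_dominated_convergence)
    show "integrable lborel (\<lambda>\<zeta>. B * indicator (cball (0::real^'n) (R + CARD('n))) \<zeta> :: real)"
      using emeasure_lborel_cball_finite[of "0::real^'n" "R + CARD('n)"]
      by (intro Bochner_Integration.integrable_mult_right integrable_real_indicator) auto
    show "AE \<zeta> in lborel. (\<lambda>n. \<eta> (hgrid (h n) \<zeta>) * cis (w n \<bullet> hgrid (h n) \<zeta>)) \<longlonglongrightarrow> \<eta> \<zeta> * cis (w' \<bullet> \<zeta>)"
    proof (intro AE_I2 tendsto_mult)
      fix \<zeta>
      show "(\<lambda>n. \<eta> (hgrid (h n) \<zeta>)) \<longlonglongrightarrow> \<eta> \<zeta>"
        using continuous_on_tendsto_compose[OF c g] by simp
      have "continuous_on UNIV cis" by (intro continuous_intros)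
      from continuous_on_tendsto_compose[OF this tendsto_inner[OF w g]]
      show "(\<lambda>n. cis (w n \<bullet> hgrid (h n) \<zeta>)) \<longlonglongrightarrow> cis (w' \<bullet> \<zeta>)" by simp
    qed
    show "AE \<zeta> in lborel. norm (\<eta> (hgrid (h n) \<zeta>) * cis (w n \<bullet> hgrid (h n) \<zeta>)) \<le> B * indicator (cball 0 (R + CARD('n))) \<zeta>" for n
      using RB(2,4) grid_support[where g = \<eta>, OF RB(3) h(1,2)]
      by (auto intro!: AE_I2 simp: norm_mult indicator_def)
  qed measurable
  then show ?thesis
    unfolding gint_def chk_def by (intro tendsto_divide tendsto_const) auto
qed

lemma chk_continuous:
  fixes \<eta> :: "real^'n \<Rightarrow> complex"
  assumes \<eta>: "\<eta> \<in> testf" shows "continuous_on UNIV (chk \<eta>)"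
proof -
  obtain R B where RB: "R > 0" "B \<ge> 0" "\<And>\<xi>. R < norm \<xi> \<Longrightarrow> \<eta> \<xi> = 0" "\<And>\<xi>. norm (\<eta> \<xi>) \<le> B"
    using testf_bounded[OF \<eta>] by blast
  have [measurable]: "\<eta> \<in> borel_measurable borel"
    by (rule borel_measurable_continuous_onI[OF testf_continuous[OF \<eta>]])
  have "(\<lambda>n. chk \<eta> (w n)) \<longlonglongrightarrow> chk \<eta> w'" if w: "w \<longlonglongrightarrow> w'" for w w'
  proof -
    have "(\<lambda>n. LINT \<zeta>|lborel. \<eta> \<zeta> * cis (w n \<bullet> \<zeta>)) \<longlonglongrightarrow> (LINT \<zeta>|lborel. \<eta> \<zeta> * cis (w' \<bullet> \<zeta>))"
    proof (rule integral_dominated_convergence)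
      show "integrable lborel (\<lambda>\<zeta>. norm (\<eta> \<zeta>))"
        by (intro integrable_norm integrable_ball_bounded(1)[of _ B R]) (use RB in auto)
      show "AE \<zeta> in lborel. (\<lambda>n. \<eta> \<zeta> * cis (w n \<bullet> \<zeta>)) \<longlonglongrightarrow> \<eta> \<zeta> * cis (w' \<bullet> \<zeta>)"
      proof (intro AE_I2 tendsto_mult tendsto_const)
        fix \<zeta> :: "real^'n"
        have "continuous_on UNIV cis" by (intro continuous_intros)
        from continuous_on_tendsto_compose[OF this tendsto_inner[OF w tendsto_const]]
        show "(\<lambda>n. cis (w n \<bullet> \<zeta>)) \<longlonglongrightarrow> cis (w' \<bullet> \<zeta>)" by simp
      qed
    next
      show "(\<lambda>\<zeta>. \<eta> \<zeta> * cis (w' \<bullet> \<zeta>)) \<in> borel_measurable lborel" by measurable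
      show "(\<lambda>\<zeta>. \<eta> \<zeta> * cis (w n \<bullet> \<zeta>)) \<in> borel_measurable lborel" for n by measurable
    qed (auto simp: norm_mult)
    then show ?thesis unfolding chk_def by (intro tendsto_divide tendsto_const) auto
  qed
  then show ?thesis by (simp add: continuous_on_sequentially o_def)
qed

text \<open>Inherited from \<open>gint_decay\<close> as the mesh tends to zero: for fixed
  \<open>w\<close> the restriction to one period holds eventually.\<close>

lemma chk_decay:
  fixes \<eta> :: "real^'n \<Rightarrow> complex"
  assumes \<eta>: "\<eta> \<in> testf"
  shows "\<exists>C\<ge>0. \<forall>w. norm (chk \<eta> w) * (1 + norm w) ^ N \<le> C"
proof -
  obtain C where C: "C \<ge> 0" "\<And>h w. 0 < h \<Longrightarrow> h \<le> 1 \<Longrightarrow> (\<forall>j. \<bar>h * w $ j\<bar> \<le> pi) \<Longrightarrow> norm (gint \<eta> h w) * (1 + norm w) ^ N \<le> C"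
    using gint_decay[OF \<eta>, of N] by auto
  have "norm (chk \<eta> w) * (1 + norm w) ^ N \<le> C / vol TYPE('n)" for w
  proof (rule tendsto_upperbound)
    let ?h = "\<lambda>n. 1 / real (Suc n)"
    have h: "?h \<longlonglongrightarrow> 0" using LIMSEQ_inverse_real_of_nat by (simp add: inverse_eq_divide)
    show "(\<lambda>n. norm (gint \<eta> (?h n) w / of_real (vol TYPE('n))) * (1 + norm w) ^ N) \<longlonglongrightarrow> norm (chk \<eta> w) * (1 + norm w) ^ N"
      by (intro tendsto_mult tendsto_norm tendsto_const gint_limit \<eta> h) auto
    have "\<forall>\<^sub>F n in sequentially. ?h n * norm w < pi"
      using order_tendstoD(2)[OF tendsto_mult_left_zero[OF h, of "norm w"], of pi] by simp
    then show "\<forall>\<^sub>F n in sequentially. norm (gint \<eta> (?h n) w / of_real (vol TYPE('n))) * (1 + norm w) ^ N \<le> C / vol TYPE('n)"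
    proof eventually_elim
      case (elim n)
      have "\<bar>?h n * w $ j\<bar> \<le> pi" for j
      proof -
        have "\<bar>?h n * w $ j\<bar> \<le> ?h n * norm w"
          unfolding abs_mult by (intro mult_mono component_le_norm_cart) auto
        with elim show ?thesis by simp
      qed
      then have "norm (gint \<eta> (?h n) w) * (1 + norm w) ^ N \<le> C" by (intro C) auto
      then show ?case by (simp add: norm_divide divide_right_mono)
    qed
  qed simp
  then show ?thesis using C(1) by (intro exI[of _ "C / vol TYPE('n)"]) auto
qed

lemma emeasure_half_open_cube:
  fixes a :: "real^'n"
  assumes "h > 0"
  shows "{x. \<forall>i. a $ i \<le> x $ i \<and> x $ i < a $ i + h} \<in> sets lborel" (is ?t)
    and "measure lborel {x. \<forall>i. a $ i \<le> x $ i \<and> x $ i < a $ i + h} = h ^ CARD('n)"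
    and "emeasure lborel {x. \<forall>i. a $ i \<le> x $ i \<and> x $ i < a $ i + h} < \<infinity>"
proof -
  let ?S = "{x. \<forall>i. a $ i \<le> x $ i \<and> x $ i < a $ i + h}" and ?b = "a + (\<chi> i. h)"
  have "?S \<in> sets borel" by measurable
  then show S: ?t by simp
  have "cbox a ?b \<noteq> {}" using assms by (auto simp: interval_eq_empty_cart)
  then have "measure lborel (cbox a ?b) = h ^ CARD('n)"
    by (subst content_cbox_cart) auto
  then have b: "emeasure lborel (cbox a ?b) = ennreal (h ^ CARD('n))"
    using emeasure_lborel_cbox_finite[of a ?b] by (subst emeasure_eq_ennreal_measure) auto
  then have c: "emeasure lborel (box a ?b) = ennreal (h ^ CARD('n))"
    by (simp add: emeasure_lborel_cbox_eq emeasure_lborel_box_eq)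
  have sub: "box a ?b \<subseteq> ?S" "?S \<subseteq> cbox a ?b" by (auto simp: mem_box_cart less_imp_le)
  have "emeasure lborel ?S = ennreal (h ^ CARD('n))"
  proof (rule antisym)
    show "emeasure lborel ?S \<le> ennreal (h ^ CARD('n))"
      unfolding b[symmetric] by (rule emeasure_mono[OF sub(2)]) simp
    show "ennreal (h ^ CARD('n)) \<le> emeasure lborel ?S"
      unfolding c[symmetric] by (rule emeasure_mono[OF sub(1) S])
  qed
  then show "measure lborel ?S = h ^ CARD('n)" "emeasure lborel ?S < \<infinity>"
    using assms by (simp_all add: measure_def)
qed

lemma finite_lattice_support:
  assumes "\<eta> \<in> testf" "h > 0" shows "finite {m. \<eta> (h *\<^sub>R ivec m) \<noteq> 0}"
proof -
  obtain R where R: "\<And>\<xi>. R < norm \<xi> \<Longrightarrow> \<eta> \<xi> = 0" using testf_support[OF assms(1)] by blast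
  have "{m. \<eta> (h *\<^sub>R ivec m) \<noteq> 0} \<subseteq> {m. norm (ivec m) \<le> R / h}"
  proof safe
    fix m assume "\<eta> (h *\<^sub>R ivec m) \<noteq> 0"
    then have "norm (h *\<^sub>R ivec m) \<le> R" using R not_less by blast
    then show "norm (ivec m) \<le> R / h" using assms(2) by (simp add: field_simps)
  qed
  then show ?thesis using finite_int_vec_bounded finite_subset by blast
qed

text \<open>The rounding map is constant on half-open cubes of side \<open>h\<close>, and only
  finitely many of them meet the support.\<close>

lemma gint_eq_sum:
  fixes \<eta> :: "real^'n \<Rightarrow> complex"
  assumes \<eta>: "\<eta> \<in> testf" and h: "h > 0"
  shows "gint \<eta> h w = of_real (h ^ CARD('n)) * (\<Sum>m\<in>{m. \<eta> (h *\<^sub>R ivec m) \<noteq> 0}. \<eta> (h *\<^sub>R ivec m) * cis (h * (ivec m \<bullet> w)))"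
proof -
  let ?F = "{m. \<eta> (h *\<^sub>R ivec m) \<noteq> 0}" 
  let ?Q = "\<lambda>m::int^'n. {x. \<forall>i. (h *\<^sub>R ivec m) $ i \<le> x $ i \<and> x $ i < (h *\<^sub>R ivec m) $ i + h}"
  let ?f = "\<lambda>m. \<eta> (h *\<^sub>R ivec m) * cis (h * (ivec m \<bullet> w))"
  have fin: "finite ?F" by (rule finite_lattice_support[OF assms])
  have fl: "\<zeta> \<in> ?Q m \<longleftrightarrow> m = (\<chi> i. \<lfloor>\<zeta> $ i / h\<rfloor>)" for \<zeta> m
  proof -
    have "(h * of_int j \<le> t \<and> t < h * of_int j + h) \<longleftrightarrow> j = \<lfloor>t / h\<rfloor>" for t and j :: int
      unfolding eq_commute[of j] floor_eq_iff using h by (auto simp: field_simps)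
    then show ?thesis by (auto simp: vec_eq_iff)
  qed
  have eq: "\<eta> (hgrid h \<zeta>) * cis (w \<bullet> hgrid h \<zeta>) = (\<Sum>m\<in>?F. indicator (?Q m) \<zeta> *\<^sub>R ?f m)" for \<zeta>
  proof -
    let ?m = "\<chi> i. \<lfloor>\<zeta> $ i / h\<rfloor>"
    have "(\<Sum>m\<in>?F. indicator (?Q m) \<zeta> *\<^sub>R ?f m) = (\<Sum>m\<in>?F. if m = ?m then ?f m else 0)"
      by (intro sum.cong refl) (simp only: indicator_def fl, simp)
    also have "\<dots> = (if ?m \<in> ?F then ?f ?m else 0)" using fin by simp
    also have "\<dots> = \<eta> (hgrid h \<zeta>) * cis (w \<bullet> hgrid h \<zeta>)"
      by (simp add: hgrid_def inner_commute)
    finally show ?thesis ..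
  qed
  note Q = emeasure_half_open_cube[OF h, of "h *\<^sub>R ivec m" for m :: "int^'n"]
  have i: "integrable lborel (indicat_real (?Q m))" for m
    by (intro integrable_real_indicator Q(1) Q(3))
  have "gint \<eta> h w = (\<Sum>m\<in>?F. LINT \<zeta>|lborel. indicator (?Q m) \<zeta> *\<^sub>R ?f m)"
    unfolding gint_def eq
    by (intro Bochner_Integration.integral_sum integrable_scaleR_left i)
  also have "\<dots> = (\<Sum>m\<in>?F. h ^ CARD('n) *\<^sub>R ?f m)"
  proof (intro sum.cong refl)
    fix m
    have "(LINT \<zeta>|lborel. indicator (?Q m) \<zeta> *\<^sub>R ?f m) = (LINT \<zeta>|lborel. indicator (?Q m) \<zeta>) *\<^sub>R ?f m"
      by (intro integral_scaleR_left i)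
    also have "(LINT \<zeta>|lborel. indicator (?Q m) \<zeta>) = measure lborel (?Q m \<inter> space lborel)"
      by (rule Bochner_Integration.integral_indicator)
    also have "\<dots> = h ^ CARD('n)"
      using Q(2)[of m] by (simp only: space_lborel space_borel Int_UNIV_right)
    finally show "(LINT \<zeta>|lborel. indicator (?Q m) \<zeta> *\<^sub>R ?f m) = h ^ CARD('n) *\<^sub>R ?f m" .
  qed
  finally show ?thesis by (simp add: scaleR_conv_of_real sum_distrib_left)
qed

section \<open>Jacobians and the change of variables formula for complex integrands\<close>

section \<open>Change of variables\<close>

text \<open>The change of variables theorem of the library is stated for well-ordered index types, so
  it is transported along a well-ordered copy of the index type.\<close>

typedef 'a wo = "UNIV :: 'a set" ..

lemma bij_Rep_wo: "bij Rep_wo"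
  by (metis Abs_wo_inverse Rep_wo_inverse UNIV_I bijI' surjI)

instance wo :: (finite) finite
  by standard (metis bij_Rep_wo bij_betw_finite finite)

instantiation wo :: (finite) linorder
begin

definition wo_index :: "'a wo \<Rightarrow> nat" where "wo_index = (SOME f. inj f)"

definition less_eq_wo :: "'a wo \<Rightarrow> 'a wo \<Rightarrow> bool" where
  "less_eq_wo x y \<longleftrightarrow> wo_index x \<le> wo_index y"

definition less_wo :: "'a wo \<Rightarrow> 'a wo \<Rightarrow> bool" where
  "less_wo x y \<longleftrightarrow> wo_index x < wo_index y"

instance
proof -
  have "\<exists>f::'a wo \<Rightarrow> nat. inj f"
    using finite_imp_inj_to_nat_seg[of "UNIV :: 'a wo set"] by auto
  then have inj: "inj (wo_index :: 'a wo \<Rightarrow> nat)" unfolding wo_index_def by (rule someI_ex)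
  show "OFCLASS('a wo, linorder_class)"
    by standard (use inj in \<open>auto simp: less_eq_wo_def less_wo_def inj_eq\<close>)
qed

end

instance wo :: (finite) wellorder
proof -
  have "wf {(x :: 'a wo, y). x < y}"
    by (auto simp: trancl_def tranclp_less intro!: finite_acyclic_wf acyclicI)
  then show "OFCLASS('a wo, wellorder_class)"
    by (rule wf_wellorderI) intro_classes
qed

definition reix :: "real^'n \<Rightarrow> real^('n wo)" where "reix x = (\<chi> i. x $ Rep_wo i)"
definition ireix :: "real^('n wo) \<Rightarrow> real^'n" where "ireix y = (\<chi> i. y $ Abs_wo i)"

lemma reix_ireix [simp]: "reix (ireix y) = y" "ireix (reix x) = x"
  by (simp_all add: reix_def ireix_def vec_eq_iff Rep_wo_inverse Abs_wo_inverse)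

lemma linear_reix: "linear reix" "linear ireix"
  by (auto intro!: linearI simp: reix_def ireix_def vec_eq_iff)

lemma bounded_linear_reix: "bounded_linear reix" "bounded_linear ireix"
  using linear_reix by (auto simp: linear_conv_bounded_linear)

lemma continuous_reix: "continuous_on S reix" "continuous_on T ireix"
  using bounded_linear_reix by (auto intro: linear_continuous_on)

lemma measurable_reix [measurable]: "reix \<in> borel \<rightarrow>\<^sub>M borel" "ireix \<in> borel \<rightarrow>\<^sub>M borel"
  by (intro borel_measurable_continuous_onI continuous_reix)+

lemma inj_reix: "inj reix" "inj ireix"
  by (metis injI reix_ireix(2)) (metis injI reix_ireix(1))

lemma prod_Basis_cart: "(\<Prod>b\<in>Basis. x \<bullet> b) = (\<Prod>i\<in>UNIV. (x::real^'n) $ i)"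
proof -
  have "(Basis :: (real^'n) set) = (\<lambda>i. axis i 1) ` UNIV" by (auto simp: Basis_vec_def)
  moreover have "inj (\<lambda>i::'n. axis i (1::real))" by (auto simp: inj_on_def axis_eq_axis)
  ultimately have "(\<Prod>b\<in>Basis. x \<bullet> b) = (\<Prod>i\<in>UNIV. x \<bullet> axis i 1)"
    by (metis prod.reindex_cong)
  then show ?thesis by (simp add: inner_axis)
qed

text \<open>Renaming coordinates maps boxes to boxes with the same side lengths, which determines
  Lebesgue measure.\<close>

lemma distr_ireix: "distr lborel borel ireix = (lborel :: (real^'n) measure)"
proof (rule lborel_eqI[symmetric])
  fix l u :: "real^'n" assume le: "\<And>b. b \<in> Basis \<Longrightarrow> l \<bullet> b \<le> u \<bullet> b"
  have le': "l $ i \<le> u $ i" for i using le[of "axis i 1"] by (simp add: inner_axis)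
  have "emeasure (distr lborel borel ireix) (box l u) = emeasure lborel (ireix -` box l u)"
    by (subst emeasure_distr) auto
  also have "ireix -` box l u = box (reix l) (reix u)"
  proof (rule set_eqI)
    fix y
    have "(\<forall>i. l $ i < y $ Abs_wo i \<and> y $ Abs_wo i < u $ i) \<longleftrightarrow> (\<forall>i. l $ Rep_wo i < y $ i \<and> y $ i < u $ Rep_wo i)"
      by (metis Rep_wo_inverse Abs_wo_inverse UNIV_I)
    then show "y \<in> ireix -` box l u \<longleftrightarrow> y \<in> box (reix l) (reix u)"
      by (simp add: mem_box_cart ireix_def reix_def)
  qed
  also have "emeasure lborel (box (reix l) (reix u)) = ennreal (\<Prod>b\<in>Basis. (reix u - reix l) \<bullet> b)"
  proof (rule emeasure_lborel_box)
    fix b :: "real^('n wo)" assume "b \<in> Basis"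
    then obtain i where "b = axis i 1" by (auto simp: Basis_vec_def)
    then show "reix l \<bullet> b \<le> reix u \<bullet> b" by (simp add: inner_axis reix_def le')
  qed
  also have "(\<Prod>b\<in>Basis. (reix u - reix l) \<bullet> b) = (\<Prod>i\<in>UNIV. (u - l) $ Rep_wo i)"
    unfolding prod_Basis_cart by (simp add: reix_def)
  also have "\<dots> = (\<Prod>i\<in>UNIV. (u - l) $ i)"
    by (rule prod.reindex_bij_betw[OF bij_Rep_wo])
  also have "\<dots> = (\<Prod>b\<in>Basis. (u - l) \<bullet> b)" by (rule prod_Basis_cart[symmetric])
  finally show "emeasure (distr lborel borel ireix) (box l u) = ennreal (\<Prod>b\<in>Basis. (u - l) \<bullet> b)" .
qed simp

text \<open>The absolute value of the determinant, computed in the renamed coordinates in which the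
  change of variables is carried out.\<close>

definition jac :: "(real^'n \<Rightarrow> real^'n) \<Rightarrow> real" where
  "jac A = \<bar>det (matrix (reix \<circ> A \<circ> ireix))\<bar>"

lemma jac_nonneg [simp]: "0 \<le> jac A"
  by (simp add: jac_def)

lemma jac_compose:
  assumes "linear A" "linear B" shows "jac (A \<circ> B) = jac A * jac B"
proof -
  have "reix \<circ> (A \<circ> B) \<circ> ireix = (reix \<circ> A \<circ> ireix) \<circ> (reix \<circ> B \<circ> ireix)"
    by (simp add: fun_eq_iff)
  moreover have "matrix ((reix \<circ> A \<circ> ireix) \<circ> (reix \<circ> B \<circ> ireix)) = matrix (reix \<circ> A \<circ> ireix) ** matrix (reix \<circ> B \<circ> ireix)"
    by (intro matrix_compose linear_compose assms linear_reix)
  ultimately show ?thesis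
    by (simp only: jac_def det_mul abs_mult)
qed

lemma jac_id: "jac (\<lambda>x::real^'n. x) = 1"
proof -
  have "reix \<circ> (\<lambda>x. x) \<circ> ireix = (id :: real^('n wo) \<Rightarrow> _)" by (simp add: fun_eq_iff)
  then show ?thesis unfolding jac_def by (simp only: matrix_id_mat_1 det_I abs_one)
qed

lemma jac_scaleR: "jac ((*\<^sub>R) c :: real^'n \<Rightarrow> real^'n) = \<bar>c\<bar> ^ CARD('n)"
proof -
  have "reix \<circ> (*\<^sub>R) c \<circ> ireix = ((*\<^sub>R) c :: real^'n wo \<Rightarrow> _)"
    by (auto simp: fun_eq_iff reix_def ireix_def vec_eq_iff Rep_wo_inverse)
  moreover have "CARD('n wo) = CARD('n)" using bij_Rep_wo bij_betw_same_card by blast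
  ultimately show ?thesis by (simp add: jac_def det_matrix_scaleR power_abs)
qed

lemma continuous_on_jac:
  fixes A :: "'a::topological_space \<Rightarrow> real^'n \<Rightarrow> real^'n"
  assumes "\<And>v. continuous_on S (\<lambda>m. A m v)" shows "continuous_on S (\<lambda>m. jac (A m))"
proof -
  have "continuous_on S (\<lambda>m. reix (A m (ireix v)))" for v
    by (rule bounded_linear.continuous_on[OF bounded_linear_reix(1) assms])
  note c = this
  have e: "continuous_on S (\<lambda>m. reix (A m (ireix v)) $ i)" for v i
    by (rule bounded_linear.continuous_on[OF bounded_linear_vec_nth c])
  then show ?thesis
    unfolding jac_def det_def matrix_def o_def vec_lambda_beta
    by (intro continuous_intros e)
qed

lemma linear_inverse_jac:
  assumes "linear A" "linear B" "\<And>x. A (B x) = x" shows "jac A * jac B = 1" "jac A > 0"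
proof -
  have "A \<circ> B = (\<lambda>x. x)" using assms(3) by auto
  then show "jac A * jac B = 1"
    unfolding jac_compose[OF assms(1,2), symmetric] by (simp only: jac_id)
  then have "jac A \<noteq> 0" by auto
  then show "jac A > 0" using jac_nonneg[of A] by linarith
qed

lemma CV_wo:
  fixes g :: "real^'m::{finite,wellorder} \<Rightarrow> real^'m::_" and \<Phi> :: "real^'m::_ \<Rightarrow> complex"
  assumes S: "S \<in> sets borel" "g ` S \<in> sets borel"
    and der: "\<And>x. x \<in> S \<Longrightarrow> (g has_derivative g' x) (at x within S)" and inj: "inj_on g S"
    and [measurable]: "\<Phi> \<in> borel_measurable borel"
    and int: "integrable lborel (\<lambda>x. indicator S x *\<^sub>R (\<bar>det (matrix (g' x))\<bar> *\<^sub>R \<Phi> (g x)))"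
  shows "integrable lborel (\<lambda>y. indicator (g ` S) y *\<^sub>R \<Phi> y)"
    and "(LINT y|lborel. indicator (g ` S) y *\<^sub>R \<Phi> y) = (LINT x|lborel. indicator S x *\<^sub>R (\<bar>det (matrix (g' x))\<bar> *\<^sub>R \<Phi> (g x)))"
proof -
  note [measurable] = S
  \<comment> \<open>Complex numbers are encoded in the real plane, since the integrand must take
    values in a real coordinate space.\<close>
  define V :: "complex \<Rightarrow> real^2" where "V c = (\<chi> i. if i = 1 then Re c else Im c)" for c
  define W :: "real^2 \<Rightarrow> complex" where "W v = Complex (v $ 1) (v $ 2)" for v
  have VW: "W (V c) = c" for c by (simp add: V_def W_def complex_eq_iff)
  have "linear V" "linear W"
    by (auto intro!: linearI simp: V_def W_def vec_eq_iff complex_eq_iff)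
  then have bl: "bounded_linear V" "bounded_linear W" by (auto simp: linear_conv_bounded_linear)
  have Vs: "V (r *\<^sub>R c) = r *\<^sub>R V c" for r c using bl(1) by (simp add: linear_simps)
  let ?R = "\<lambda>x. indicator S x *\<^sub>R (\<bar>det (matrix (g' x))\<bar> *\<^sub>R \<Phi> (g x))"
  let ?L = "\<lambda>y. indicator (g ` S) y *\<^sub>R \<Phi> y"
  have R: "integrable lborel (\<lambda>x. V (?R x))" by (rule integrable_bounded_linear[OF bl(1) int])
  have Rm: "(\<lambda>x. V (?R x)) \<in> borel_measurable lborel" using R by (rule borel_measurable_integrable)
  have Rl: "integrable lebesgue (\<lambda>x. V (?R x))" using R integrable_completion[OF Rm] by simp
  have Vm[measurable]: "V \<in> borel_measurable borel"
    by (intro borel_measurable_continuous_onI linear_continuous_on bl)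
  have "(\<lambda>x. \<bar>det (matrix (g' x))\<bar> *\<^sub>R V (\<Phi> (g x))) absolutely_integrable_on S"
    using Rl unfolding set_integrable_def by (simp add: Vs)
  then have L: "(\<lambda>y. V (\<Phi> y)) absolutely_integrable_on (g ` S)"
    and eq: "integral (g ` S) (\<lambda>y. V (\<Phi> y)) = integral S (\<lambda>x. \<bar>det (matrix (g' x))\<bar> *\<^sub>R V (\<Phi> (g x)))"
    using has_absolute_integral_change_of_variables[of S g g' "\<lambda>y. V (\<Phi> y)" "integral S (\<lambda>x. \<bar>det (matrix (g' x))\<bar> *\<^sub>R V (\<Phi> (g x)))"]
      S(1) der inj by auto
  have Lm: "(\<lambda>y. V (?L y)) \<in> borel_measurable lborel" by measurable
  have "integrable lebesgue (\<lambda>y. V (?L y))"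
    using L unfolding set_integrable_def by (simp add: Vs)
  then have LV: "integrable lborel (\<lambda>y. V (?L y))" using integrable_completion[OF Lm] by simp
  then have "integrable lborel (\<lambda>y. W (V (?L y)))" by (rule integrable_bounded_linear[OF bl(2)])
  then show Li: "integrable lborel ?L" by (simp add: VW)
  have "V (LINT y|lborel. ?L y) = (LINT y|lborel. V (?L y))"
    by (rule integral_bounded_linear[OF bl(1) Li, symmetric])
  also have "\<dots> = (LINT y|lebesgue. V (?L y))" by (rule integral_completion[OF Lm, symmetric])
  also have "\<dots> = integral (g ` S) (\<lambda>y. V (\<Phi> y))"
    using set_lebesgue_integral_eq_integral(2)[OF L] by (simp add: set_lebesgue_integral_def Vs)
  also have "\<dots> = (LINT x|lebesgue. V (?R x))"
    using set_lebesgue_integral_eq_integral(2)[OF \<open>(\<lambda>x. \<bar>det (matrix (g' x))\<bar> *\<^sub>R V (\<Phi> (g x))) absolutely_integrable_on S\<close>]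
    by (simp add: set_lebesgue_integral_def Vs eq)
  also have "\<dots> = (LINT x|lborel. V (?R x))" by (rule integral_completion[OF Rm])
  also have "\<dots> = V (LINT x|lborel. ?R x)" by (rule integral_bounded_linear[OF bl(1) int])
  finally have "W (V (LINT y|lborel. ?L y)) = W (V (LINT x|lborel. ?R x))" by simp
  then show "(LINT y|lborel. ?L y) = (LINT x|lborel. ?R x)" by (simp only: VW)
qed

lemma change_of_variables_complex:
  fixes g :: "real^'n \<Rightarrow> real^'n" and \<Phi> :: "real^'n \<Rightarrow> complex"
  assumes S: "S \<in> sets borel" "g ` S \<in> sets borel"
    and der: "\<And>x. x \<in> S \<Longrightarrow> (g has_derivative g' x) (at x within S)" and inj: "inj_on g S"
    and [measurable]: "\<Phi> \<in> borel_measurable borel"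
    and int: "integrable lborel (\<lambda>x. indicator S x *\<^sub>R (jac (g' x) *\<^sub>R \<Phi> (g x)))"
  shows "integrable lborel (\<lambda>y. indicator (g ` S) y *\<^sub>R \<Phi> y)"
    and "(LINT y|lborel. indicator (g ` S) y *\<^sub>R \<Phi> y) = (LINT x|lborel. indicator S x *\<^sub>R (jac (g' x) *\<^sub>R \<Phi> (g x)))"
proof -
  let ?G = "reix \<circ> g \<circ> ireix" and ?T = "ireix -` S" and ?\<Psi> = "\<Phi> \<circ> ireix"
  let ?G' = "\<lambda>y. reix \<circ> g' (ireix y) \<circ> ireix"
  let ?R = "\<lambda>x. indicator S x *\<^sub>R (jac (g' x) *\<^sub>R \<Phi> (g x))"
  let ?L = "\<lambda>y. indicator (g ` S) y *\<^sub>R \<Phi> y"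
  have T: "?T \<in> sets borel" using measurable_sets[OF measurable_reix(2) S(1)] by simp
  have img: "?G ` ?T = ireix -` (g ` S)"
  proof (intro set_eqI iffI)
    fix y assume "y \<in> ?G ` ?T"
    then show "y \<in> ireix -` (g ` S)" by auto
  next
    fix y assume "y \<in> ireix -` (g ` S)"
    then obtain x where x: "ireix y = g x" "x \<in> S" by auto
    then have "?G (reix x) = y" "reix x \<in> ?T" by (simp_all flip: x(1))
    then show "y \<in> ?G ` ?T" by (metis image_eqI)
  qed
  have T2: "?G ` ?T \<in> sets borel"
    unfolding img using measurable_sets[OF measurable_reix(2) S(2)] by simp
  have der': "(?G has_derivative ?G' y) (at y within ?T)" if y: "y \<in> ?T" for y
  proof -
    have 1: "(ireix has_derivative ireix) (at y within ?T)"
      by (rule bounded_linear_imp_has_derivative[OF bounded_linear_reix(2)])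
    have "(g has_derivative g' (ireix y)) (at (ireix y) within ireix ` ?T)"
      by (rule has_derivative_subset[OF der]) (use y in auto)
    from diff_chain_within[OF 1 this]
    have "(g \<circ> ireix has_derivative g' (ireix y) \<circ> ireix) (at y within ?T)" .
    from diff_chain_within[OF this bounded_linear_imp_has_derivative[OF bounded_linear_reix(1)]]
    show ?thesis by (simp add: o_assoc)
  qed
  have inj': "inj_on ?G ?T"
  proof (rule inj_onI)
    fix x y assume "x \<in> ?T" "y \<in> ?T" "?G x = ?G y"
    then have "ireix (reix (g (ireix x))) = ireix (reix (g (ireix y)))" by simp
    then have "g (ireix x) = g (ireix y)" by simp
    then have "ireix x = ireix y" using inj \<open>x \<in> ?T\<close> \<open>y \<in> ?T\<close> by (auto dest: inj_onD)
    then have "reix (ireix x) = reix (ireix y)" by simp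
    then show "x = y" by simp
  qed
  have ind: "indicator ?T x *\<^sub>R (\<bar>det (matrix (?G' x))\<bar> *\<^sub>R ?\<Psi> (?G x)) = ?R (ireix x)" for x
    by (simp add: indicator_def jac_def)
  have Rm: "?R \<in> borel_measurable borel" using int by (auto dest: borel_measurable_integrable)
  have int': "integrable lborel (\<lambda>x. ?R (ireix x))"
    using integrable_distr_eq[of ireix lborel borel ?R] Rm int by (simp add: distr_ireix)
  have Psi: "?\<Psi> \<in> borel_measurable borel" by measurable
  note cv = CV_wo[OF T T2 der' inj' Psi, unfolded ind, OF _ int']
  have ind2: "indicator (?G ` ?T) y *\<^sub>R ?\<Psi> y = ?L (ireix y)" for y
    unfolding img by (simp add: indicator_def)
  have [measurable]: "g ` S \<in> sets borel" by (rule S)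
  have Lm: "?L \<in> borel_measurable borel" by measurable
  have "integrable lborel (\<lambda>y. ?L (ireix y))" using cv(1) unfolding ind2 by blast
  then show "integrable lborel ?L"
    using integrable_distr_eq[of ireix lborel borel ?L] Lm by (simp add: distr_ireix)
  have "(LINT y|lborel. ?L y) = (LINT y|lborel. ?L (ireix y))"
    using integral_distr[of ireix lborel borel ?L] Lm by (simp add: distr_ireix)
  also have "\<dots> = (LINT x|lborel. ?R (ireix x))" using cv(2) unfolding ind2 by blast
  also have "\<dots> = (LINT x|lborel. ?R x)"
    using integral_distr[of ireix lborel borel ?R] Rm by (simp add: distr_ireix)
  finally show "(LINT y|lborel. ?L y) = (LINT x|lborel. ?R x)" .
qed

lemma linear_change_of_variables:
  fixes T :: "real^'n \<Rightarrow> real^'n" and \<Phi> :: "real^'n \<Rightarrow> complex"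
  assumes T: "linear T" "linear T'" "\<And>x. T (T' x) = x" "\<And>x. T' (T x) = x"
    and \<Phi>: "\<Phi> \<in> borel_measurable borel" "integrable lborel (\<lambda>x. \<Phi> (T x))"
  shows "(LINT y|lborel. \<Phi> y) = jac T *\<^sub>R (LINT x|lborel. \<Phi> (T x))"
proof -
  have "surj T" by (metis T(3) surjI)
  have "inj T" by (metis T(4) injI)
  have d: "(T has_derivative T) (at x within UNIV)" for x
    using T(1) by (simp add: linear_conv_bounded_linear bounded_linear_imp_has_derivative)
  show ?thesis
    using change_of_variables_complex(2)[of UNIV T "\<lambda>_. T" \<Phi>] d \<open>inj T\<close> \<open>surj T\<close> \<Phi> by simp
qed

section \<open>Charts of the torus and the integral kernels of Weyl operators in a patch\<close>

section \<open>Coordinate patches\<close>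

lemma inner_reix: "reix x \<bullet> reix y = x \<bullet> y"
proof -
  have "(\<Sum>i\<in>UNIV. x $ Rep_wo i * y $ Rep_wo i) = (\<Sum>i\<in>UNIV. x $ i * y $ i)"
    by (rule sum.reindex_bij_betw[OF bij_Rep_wo])
  then show ?thesis by (simp add: inner_vec_def reix_def)
qed

lemma jac_adjoint:
  fixes A :: "real^'n \<Rightarrow> real^'n"
  assumes "linear A" shows "jac (adjoint A) = jac A"
proof -
  let ?B = "reix \<circ> A \<circ> ireix"
  have B: "linear ?B" by (intro linear_compose assms linear_reix)
  have "adjoint ?B = reix \<circ> adjoint A \<circ> ireix"
  proof (rule adjoint_unique, intro allI)
    fix x y
    have "?B x \<bullet> y = A (ireix x) \<bullet> ireix y"
      using inner_reix[of "A (ireix x)" "ireix y"] by simp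
    also have "\<dots> = ireix x \<bullet> adjoint A (ireix y)" by (simp add: adjoint_works[OF assms])
    also have "\<dots> = x \<bullet> (reix \<circ> adjoint A \<circ> ireix) y"
      using inner_reix[of "ireix x" "adjoint A (ireix y)"] by simp
    finally show "?B x \<bullet> y = x \<bullet> (reix \<circ> adjoint A \<circ> ireix) y" .
  qed
  then have "matrix (reix \<circ> adjoint A \<circ> ireix) = transpose (matrix ?B)"
    using matrix_adjoint[OF B] by simp
  then show ?thesis unfolding jac_def by (simp only: det_transpose)
qed

lemma adjoint_nth: "linear A \<Longrightarrow> adjoint A \<xi> = (\<chi> i. \<xi> \<bullet> A (axis i 1))" for A :: "real^'n \<Rightarrow> real^'n"
proof -
  assume "linear A"
  have "adjoint A \<xi> $ i = \<xi> \<bullet> A (axis i 1)" for i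
    using adjoint_works[OF \<open>linear A\<close>, of "axis i 1" \<xi>] by (simp add: inner_axis' inner_commute)
  then show ?thesis by (simp add: vec_eq_iff)
qed

lemma linear_sum_axis: "linear A \<Longrightarrow> A v = (\<Sum>i\<in>UNIV. v $ i *\<^sub>R A (axis i 1))" for A :: "real^'n \<Rightarrow> real^'n"
proof -
  assume A: "linear A"
  have "A v = A (\<Sum>i\<in>UNIV. v $ i *\<^sub>R axis i 1)"
    using basis_expansion[of v] by (simp add: scalar_mult_eq_scaleR)
  also have "\<dots> = (\<Sum>i\<in>UNIV. v $ i *\<^sub>R A (axis i 1))"
    by (simp add: linear_sum[OF A] linear_scale[OF A])
  finally show ?thesis .
qed

text \<open>A nonzero integer vector has norm at least one. This discreteness makes two nearby lifts
  differ by a constant.\<close>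

lemma ivec_small: "norm ((2 * pi) *\<^sub>R ivec k) < 2 * pi \<Longrightarrow> k = 0"
proof (rule ccontr)
  assume *: "norm ((2 * pi) *\<^sub>R ivec k) < 2 * pi" and "k \<noteq> 0"
  then obtain i where "k $ i \<noteq> 0" by (auto simp: vec_eq_iff)
  then have "1 \<le> \<bar>real_of_int (k $ i)\<bar>" by linarith
  then have "1 \<le> norm (ivec k)" using component_le_norm_cart[of "ivec k" i] by simp
  then show False using * by simp
qed

text \<open>A single patch. The chart map has only local lifts, whereas its inverse becomes one
  smooth function \<open>q\<close> on the whole periodic set \<open>Z\<close> over the patch;
  estimates are therefore stated through \<open>q\<close> and its derivative \<open>dq\<close>
  wherever possible, and \<open>D\<close>, \<open>J\<close> are the differential and Jacobian of the
  chart map itself.\<close>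

locale chart =
  fixes U :: "(real^'n) set" and \<kappa> :: "real^'n \<Rightarrow> 'n torus"
  assumes patch: "coordinate_patch U \<kappa>"
begin

definition Z :: "(real^'n) set" where "Z = proj -` (\<kappa> ` U)"
definition q :: "real^'n \<Rightarrow> real^'n" where "q z = inv_into U \<kappa> (proj z)"
definition dq :: "real^'n \<Rightarrow> real^'n \<Rightarrow> real^'n" where "dq z = frechet_derivative q (at z)"
definition D :: "real^'n \<Rightarrow> real^'n \<Rightarrow> real^'n" where "D x = torus_deriv \<kappa> x"
definition J :: "real^'n \<Rightarrow> real" where "J x = jac (D x)"

lemma open_U: "open U" and open_V: "open (\<kappa> ` U)" and inj: "inj_on \<kappa> U"
  using patch by (auto simp: coordinate_patch_def)

lemma open_Z: "open Z"
  using open_V by (simp add: Z_def open_torus_def)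

lemma q_in: "z \<in> Z \<Longrightarrow> q z \<in> U"
  unfolding Z_def q_def by (metis inv_into_into vimage_eq)

lemma \<kappa>_q: "z \<in> Z \<Longrightarrow> \<kappa> (q z) = proj z"
  unfolding Z_def q_def by (metis f_inv_into_f vimage_eq)

lemma q_\<kappa>: "x \<in> U \<Longrightarrow> proj z = \<kappa> x \<Longrightarrow> q z = x"
  unfolding q_def using inj by simp

lemma \<kappa>_Z: "x \<in> U \<Longrightarrow> proj z = \<kappa> x \<Longrightarrow> z \<in> Z"
  unfolding Z_def by auto

lemma smooth_q: "Ck_on n q Z"
proof -
  have "q = (\<lambda>z. inv_into U \<kappa> (proj z))" by (auto simp: q_def)
  then show ?thesis using patch unfolding coordinate_patch_def smooth_on_def Z_def by simp
qed

lemma q_deriv: "z \<in> Z \<Longrightarrow> (q has_derivative dq z) (at z)"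
  using smooth_q[of 1] unfolding dq_def by (auto simp: frechet_derivative_works)

lemma dq_continuous: "continuous_on Z (\<lambda>z. dq z v)"
  using smooth_q[of 1] unfolding dq_def by auto

lemma linear_dq: "z \<in> Z \<Longrightarrow> linear (dq z)"
  using q_deriv has_derivative_linear by blast

lemma q_continuous: "continuous_on Z q"
  using smooth_q[of 0] by simp

text \<open>Adding a period to a local lift prescribes its value at one point without changing its
  derivative.\<close>

lemma lift:
  assumes "x \<in> U" "proj z = \<kappa> x"
  obtains W g g' where "open W" "x \<in> W" "W \<subseteq> U" "g x = z" "\<And>y. y \<in> W \<Longrightarrow> \<kappa> y = proj (g y)"
    "\<And>y. y \<in> W \<Longrightarrow> (g has_derivative g' y) (at y)" "\<And>v. continuous_on W (\<lambda>y. g' y v)"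
proof -
  obtain W g where W: "open W" "x \<in> W" "W \<subseteq> U" "smooth_on W g" "\<And>y. y \<in> W \<Longrightarrow> \<kappa> y = proj (g y)"
    using patch assms(1) unfolding coordinate_patch_def by blast
  have C: "Ck_on 1 g W" using W(4) by (simp only: smooth_on_def)
  have "proj z = proj (g x)" using assms(2) W by simp
  then obtain k where k: "z = g x + (2 * pi) *\<^sub>R ivec k" unfolding proj_eq_iff by blast
  show thesis
  proof (rule that[of W "\<lambda>y. g y + (2 * pi) *\<^sub>R ivec k" "\<lambda>y. frechet_derivative g (at y)"])
    show "\<kappa> y = proj (g y + (2 * pi) *\<^sub>R ivec k)" if "y \<in> W" for y
    proof -
      have "proj (g y + (2 * pi) *\<^sub>R ivec k) = proj (g y)" by (subst proj_eq_iff) blast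
      then show ?thesis using W(5)[OF that] by simp
    qed
    show "((\<lambda>y. g y + (2 * pi) *\<^sub>R ivec k) has_derivative frechet_derivative g (at y)) (at y)" if "y \<in> W" for y
    proof -
      have "(g has_derivative frechet_derivative g (at y)) (at y)"
        using C that by (auto simp: frechet_derivative_works)
      then show ?thesis by (auto intro!: derivative_eq_intros)
    qed
    show "continuous_on W (\<lambda>y. frechet_derivative g (at y) v)" for v
      using C by auto
  qed (use W k in auto)
qed

text \<open>Two lifts differ by a continuous function with values in the period lattice, hence by a
  constant near the point. Thus the definite description in \<open>torus_deriv\<close> has exactly
  one solution.\<close>

lemma torus_deriv_lift:
  assumes "open W" "y \<in> W" "\<And>y. y \<in> W \<Longrightarrow> \<kappa> y = proj (g y)" "(g has_derivative g') (at y)"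
  shows "D y = g'"
  unfolding D_def torus_deriv_def
proof (rule the_equality)
  have "\<forall>\<^sub>F w in nhds y. w \<in> W" by (rule eventually_nhds_in_open[OF assms(1,2)])
  then have "\<forall>\<^sub>F w in nhds y. \<kappa> w = proj (g w)" by eventually_elim (rule assms(3))
  then show ex: "\<exists>g. (g has_derivative g') (at y) \<and> (\<forall>\<^sub>F w in nhds y. \<kappa> w = proj (g w))"
    using assms(4) by blast
  fix D' assume "\<exists>g. (g has_derivative D') (at y) \<and> (\<forall>\<^sub>F w in nhds y. \<kappa> w = proj (g w))"
  then obtain f where f: "(f has_derivative D') (at y)" "\<forall>\<^sub>F w in nhds y. \<kappa> w = proj (f w)" by blast
  let ?e = "\<lambda>w. g w - f w"
  have "isCont ?e y" using assms(4) f(1) by (intro continuous_intros has_derivative_continuous)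
  then have "(?e \<longlongrightarrow> ?e y) (nhds y)"
    using tendsto_at_iff_tendsto_nhds[of ?e y] by (simp add: isCont_def)
  then have "\<forall>\<^sub>F w in nhds y. dist (?e w) (?e y) < 2 * pi" by (rule tendstoD) simp
  with \<open>\<forall>\<^sub>F w in nhds y. \<kappa> w = proj (g w)\<close> f(2) have ev: "\<forall>\<^sub>F w in nhds y. g w = f w + ?e y"
  proof eventually_elim
    case (elim w)
    obtain k where k: "g w = f w + (2 * pi) *\<^sub>R ivec k" using elim by (metis proj_eq_iff)
    have "\<kappa> y = proj (g y)" "\<kappa> y = proj (f y)"
      using assms(2,3) eventually_nhds_x_imp_x[OF f(2)] by auto
    then obtain l where l: "g y = f y + (2 * pi) *\<^sub>R ivec l" by (metis proj_eq_iff)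
    have "?e w - ?e y = (2 * pi) *\<^sub>R ivec (k - l)"
      using ivec_add[of k "- l"] by (simp add: k l ivec_uminus scaleR_diff_right)
    then have "k - l = 0" using elim by (intro ivec_small) (simp add: dist_norm)
    then show ?case using k l by simp
  qed
  have "(g has_derivative D') (at y)"
  proof (rule has_derivative_transform_eventually)
    show "((\<lambda>w. f w + ?e y) has_derivative D') (at y)"
      using f(1) by (auto intro!: derivative_eq_intros)
    show "\<forall>\<^sub>F w in at y. f w + ?e y = g w"
      using ev unfolding eventually_at_filter by eventually_elim simp
  qed auto
  then show "D' = g'" using assms(4) has_derivative_unique by blast
qed

lemma D_lift:
  assumes "x \<in> U" "proj z = \<kappa> x"
  obtains W g where "open W" "x \<in> W" "W \<subseteq> U" "g x = z" "\<And>y. y \<in> W \<Longrightarrow> \<kappa> y = proj (g y)"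
    "\<And>y. y \<in> W \<Longrightarrow> (g has_derivative D y) (at y)" "\<And>v. continuous_on W (\<lambda>y. D y v)"
proof -
  obtain W g g' where W: "open W" "x \<in> W" "W \<subseteq> U" "g x = z" "\<And>y. y \<in> W \<Longrightarrow> \<kappa> y = proj (g y)"
    "\<And>y. y \<in> W \<Longrightarrow> (g has_derivative g' y) (at y)" "\<And>v. continuous_on W (\<lambda>y. g' y v)"
    using lift[OF assms] by metis
  have D: "D y = g' y" if "y \<in> W" for y
    by (rule torus_deriv_lift[OF W(1) that W(5,6)]) (use that in auto)
  show thesis
  proof (rule that[of W g])
    show "continuous_on W (\<lambda>y. D y v)" for v
      using W(7)[of v] by (rule continuous_on_eq) (simp add: D)
  qed (use W D in auto)
qed

lemma linear_D: assumes "x \<in> U" shows "linear (D x)"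
proof -
  obtain z where z: "\<kappa> x = proj z" by (rule torus_cases)
  obtain W g where "x \<in> W" "\<And>y. y \<in> W \<Longrightarrow> (g has_derivative D y) (at y)"
    using D_lift[OF assms z[symmetric]] by metis
  then show ?thesis using has_derivative_linear by blast
qed

text \<open>The chain rule applied to \<open>q\<close> after a local lift, which is the identity
  near \<open>x\<close>; in finite dimension a left inverse is also a right inverse.\<close>

lemma dq_D:
  assumes x: "x \<in> U" and z: "proj z = \<kappa> x"
  shows "dq z (D x v) = v" "D x (dq z v) = v"
proof -
  obtain W g where W: "open W" "x \<in> W" "W \<subseteq> U" "g x = z" "\<And>y. y \<in> W \<Longrightarrow> \<kappa> y = proj (g y)"
    "\<And>y. y \<in> W \<Longrightarrow> (g has_derivative D y) (at y)" using D_lift[OF x z] by metis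
  have zZ: "z \<in> Z" using \<kappa>_Z[OF x z] .
  have "(q \<circ> g has_derivative dq z \<circ> D x) (at x)"
    using diff_chain_at[OF W(6)[OF W(2)]] q_deriv[OF zZ] W(4) by simp
  then have "((\<lambda>y. y) has_derivative dq z \<circ> D x) (at x)"
    by (rule has_derivative_transform_within_open[OF _ W(1,2)]) (use W q_\<kappa> in auto)
  then have "dq z \<circ> D x = id"
    using has_derivative_unique[OF _ has_derivative_ident] by (auto simp: id_def)
  moreover then have "D x \<circ> dq z = id"
    using linear_inverse_left[OF linear_dq[OF zZ] linear_D[OF x]] by simp
  ultimately show "dq z (D x v) = v" "D x (dq z v) = v" by (auto simp: fun_eq_iff)
qed

lemma inv_D: "x \<in> U \<Longrightarrow> proj z = \<kappa> x \<Longrightarrow> inv (D x) = dq z"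
  using dq_D by (intro inv_equality) auto

lemma D_continuous: "continuous_on U (\<lambda>x. D x v)"
proof (rule continuous_at_imp_continuous_on, rule ballI)
  fix x assume x: "x \<in> U"
  obtain z where z: "\<kappa> x = proj z" by (rule torus_cases)
  obtain W where "open W" "x \<in> W" "\<And>v. continuous_on W (\<lambda>y. D y v)"
    using D_lift[OF x z[symmetric]] by metis
  then show "isCont (\<lambda>x. D x v) x" by (simp add: continuous_on_eq_continuous_at)
qed

lemma inv_D_continuous: "continuous_on U (\<lambda>x. inv (D x) v)"
proof (rule continuous_at_imp_continuous_on, rule ballI)
  fix x assume x: "x \<in> U"
  obtain z where z: "\<kappa> x = proj z" by (rule torus_cases)
  obtain W g where W: "open W" "x \<in> W" "W \<subseteq> U" "\<And>y. y \<in> W \<Longrightarrow> \<kappa> y = proj (g y)"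
    "\<And>y. y \<in> W \<Longrightarrow> (g has_derivative D y) (at y)"
    using D_lift[OF x z[symmetric]] by metis
  have "continuous_on W g"
    using W(5) by (intro has_derivative_continuous_on) (auto intro: has_derivative_at_withinI)
  moreover have "g ` W \<subseteq> Z"
  proof (rule image_subsetI)
    fix y assume "y \<in> W"
    then show "g y \<in> Z" using W(3,4) by (intro \<kappa>_Z[of y]) auto
  qed
  ultimately have c: "continuous_on W (\<lambda>y. dq (g y) v)"
    by (rule continuous_on_compose2[OF dq_continuous])
  have "dq (g y) v = inv (D y) v" if "y \<in> W" for y
    using inv_D[of y "g y"] W(3,4) that by (simp add: subset_iff)
  with c have "continuous_on W (\<lambda>y. inv (D y) v)" by (rule continuous_on_eq)
  then show "isCont (\<lambda>x. inv (D x) v) x" using W(1,2) by (simp add: continuous_on_eq_continuous_at)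
qed

lemma \<kappa>_continuous: "continuous_on U \<kappa>"
proof (rule continuous_at_imp_continuous_on, rule ballI)
  fix x assume x: "x \<in> U"
  obtain z where z: "\<kappa> x = proj z" by (rule torus_cases)
  obtain W g where W: "open W" "x \<in> W" "W \<subseteq> U" "\<And>y. y \<in> W \<Longrightarrow> \<kappa> y = proj (g y)"
    "\<And>y. y \<in> W \<Longrightarrow> (g has_derivative D y) (at y)"
    using D_lift[OF x z[symmetric]] by metis
  have "continuous_on W g"
    using W(5) by (intro has_derivative_continuous_on) (auto intro: has_derivative_at_withinI)
  then have "continuous_on W (\<lambda>y. proj (g y))" by (intro continuous_intros)
  then have "continuous_on W \<kappa>" by (rule continuous_on_eq) (simp add: W)
  then show "isCont \<kappa> x" using W(1,2) by (simp add: continuous_on_eq_continuous_at)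
qed

lemma J_continuous: "continuous_on U J"
  unfolding J_def[abs_def] by (intro continuous_on_jac D_continuous)

lemma J_dq: assumes "x \<in> U" "proj z = \<kappa> x" shows "jac (dq z) * J x = 1" "J x > 0" "jac (dq z) = 1 / J x"
proof -
  have l: "linear (dq z)" "linear (D x)" using assms linear_D linear_dq \<kappa>_Z by auto
  show 1: "jac (dq z) * J x = 1"
    unfolding J_def by (rule linear_inverse_jac(1)[OF l dq_D(1)[OF assms]])
  show "J x > 0" unfolding J_def by (rule linear_inverse_jac(2)[OF l(2,1) dq_D(2)[OF assms]])
  then show "jac (dq z) = 1 / J x" using 1 by (simp add: field_simps)
qed

lemma J_pos: "x \<in> U \<Longrightarrow> J x > 0"
  using J_dq(2) torus_cases by metis

text \<open>Linearity in the second variable reduces joint continuity to that of finitely many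
  columns.\<close>

lemma D_joint_continuous: "continuous_on (U \<times> UNIV) (\<lambda>(m, v). D m v)"
proof -
  have "continuous_on (U \<times> UNIV) (\<lambda>p. \<Sum>i\<in>UNIV. snd p $ i *\<^sub>R D (fst p) (axis i 1))"
    by (intro continuous_intros continuous_on_compose2[OF D_continuous]) auto
  then show ?thesis
    by (rule continuous_on_eq) (auto simp: linear_sum_axis[OF linear_D, symmetric])
qed

lemma inv_D_linear: "x \<in> U \<Longrightarrow> linear (inv (D x))"
  using inv_D linear_dq \<kappa>_Z torus_cases by metis

lemma adjoint_joint_continuous: "continuous_on (U \<times> UNIV) (\<lambda>(m, \<xi>). adjoint (inv (D m)) \<xi>)"
proof -
  have "continuous_on (U \<times> UNIV) (\<lambda>p. \<chi> i. snd p \<bullet> inv (D (fst p)) (axis i 1))"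
    by (intro continuous_intros continuous_on_compose2[OF inv_D_continuous]) auto
  then show ?thesis
    by (rule continuous_on_eq) (auto simp: adjoint_nth[OF inv_D_linear])
qed

definition pre :: "'n torus set \<Rightarrow> (real^'n) set" where "pre K = {x\<in>U. \<kappa> x \<in> K}"

text \<open>The part of the lifted set inside \<open>pibox\<close> is compact and meets every class,
  and \<open>q\<close> maps it continuously onto the set in question.\<close>

lemma compact_pre:
  assumes "closed K" "K \<subseteq> \<kappa> ` U" shows "compact (pre K)"
proof -
  have "closed (proj -` K)"
    using continuous_closed_preimage[OF continuous_proj closed_UNIV assms(1)] by simp
  then have "compact (proj -` K \<inter> pibox)" by (simp add: closed_Int_compact)
  moreover have sub: "proj -` K \<inter> pibox \<subseteq> Z" using assms(2) by (auto simp: Z_def)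
  ultimately have "compact (q ` (proj -` K \<inter> pibox))"
    by (intro compact_continuous_image continuous_on_subset[OF q_continuous])
  moreover have "q ` (proj -` K \<inter> pibox) = pre K"
  proof (intro set_eqI iffI)
    fix x assume "x \<in> q ` (proj -` K \<inter> pibox)"
    then obtain z where "x = q z" "proj z \<in> K" "z \<in> Z" using sub by auto
    then show "x \<in> pre K" using q_in \<kappa>_q by (simp add: pre_def)
  next
    fix x assume x: "x \<in> pre K"
    then have "q (crep (\<kappa> x)) = x" by (intro q_\<kappa>) (auto simp: pre_def)
    moreover have "crep (\<kappa> x) \<in> proj -` K \<inter> pibox" using x by (simp add: pre_def)
    ultimately show "x \<in> q ` (proj -` K \<inter> pibox)" by (metis image_eqI)
  qed
  ultimately show ?thesis by simp
qed

text \<open>Strict differentiability: for a continuously differentiable map the difference quotients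
  converge even when the base point moves. It follows from the mean value inequality for
  \<open>q\<close> minus its linearisation at the limit point.\<close>

lemma strict_deriv_q:
  assumes z: "z \<longlonglongrightarrow> z'" "z' \<in> Z" and w: "w \<longlonglongrightarrow> w'" and h: "\<And>n. 0 < h n" "h \<longlonglongrightarrow> 0"
  shows "(\<lambda>n. (1 / h n) *\<^sub>R (q (z n) - q (z n - h n *\<^sub>R w n))) \<longlonglongrightarrow> dq z' w'"
proof -
  obtain r where r: "r > 0" "ball z' r \<subseteq> Z" using open_Z z(2) openE by blast
  have dqs: "dq y v = (\<Sum>i\<in>UNIV. v $ i *\<^sub>R dq y (axis i 1))" if "y \<in> Z" for y v
    by (rule linear_sum_axis[OF linear_dq[OF that]])
  have "(\<lambda>n. (1 / h n) *\<^sub>R (q (z n) - q (z n - h n *\<^sub>R w n)) - dq z' (w n)) \<longlonglongrightarrow> 0"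
  proof (rule tendstoI)
    fix e :: real assume e: "e > 0"
    have "Bseq w" using w convergentI convergent_imp_Bseq by blast
    then obtain B where B: "B > 0" "\<And>n. norm (w n) \<le> B" by (auto elim: BseqE)
    \<comment> \<open>Chosen so that the column errors, summed over all directions and multiplied by
      the bound \<open>B\<close> on \<open>w\<close>, give \<open>e / 2\<close>.\<close>
    define e' where "e' = e / (2 * B * CARD('n))"
    have e': "e' > 0" using e B by (simp add: e'_def)
    have "\<forall>\<^sub>F y in nhds z'. \<forall>i. dist (dq y (axis i 1)) (dq z' (axis i 1)) < e'"
    proof (rule eventually_all_finite)
      fix i
      have "isCont (\<lambda>y. dq y (axis i 1)) z'"
        using dq_continuous open_Z z(2) by (simp add: continuous_on_eq_continuous_at)
      then have "((\<lambda>y. dq y (axis i 1)) \<longlongrightarrow> dq z' (axis i 1)) (nhds z')"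
        using tendsto_at_iff_tendsto_nhds[of "\<lambda>y. dq y (axis i 1)" z'] by (simp add: isCont_def)
      then show "\<forall>\<^sub>F y in nhds z'. dist (dq y (axis i 1)) (dq z' (axis i 1)) < e'"
        using e' by (rule tendstoD)
    qed
    then obtain s where s: "s > 0" "\<And>y i. dist y z' < s \<Longrightarrow> dist (dq y (axis i 1)) (dq z' (axis i 1)) < e'"
      unfolding eventually_nhds_metric by blast
    define t where "t = min r s"
    have t: "t > 0" "ball z' t \<subseteq> Z" using r s by (auto simp: t_def)
    have close: "norm (dq y v - dq z' v) \<le> e' * CARD('n) * norm v" if y: "y \<in> ball z' t" for y v
    proof -
      have "dq y v - dq z' v = (\<Sum>i\<in>UNIV. v $ i *\<^sub>R (dq y (axis i 1) - dq z' (axis i 1)))"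
        using y t by (subst dqs[of y], blast, subst dqs[OF z(2)]) (simp add: sum_subtractf scaleR_diff_right)
      also have "norm \<dots> \<le> (\<Sum>i\<in>(UNIV::'n set). norm v * e')"
      proof (rule sum_norm_le)
        fix i
        have "dist (dq y (axis i 1)) (dq z' (axis i 1)) < e'"
          by (rule s(2)) (use y in \<open>auto simp: t_def dist_commute\<close>)
        then show "norm (v $ i *\<^sub>R (dq y (axis i 1) - dq z' (axis i 1))) \<le> norm v * e'"
          using component_le_norm_cart[of v i] by (auto simp: dist_norm intro!: mult_mono)
      qed
      finally show ?thesis by (simp add: mult_ac)
    qed
    have hw: "(\<lambda>n. h n *\<^sub>R w n) \<longlonglongrightarrow> 0" using tendsto_scaleR[OF h(2) w] by simp
    have zw: "(\<lambda>n. z n - h n *\<^sub>R w n) \<longlonglongrightarrow> z'" using tendsto_diff[OF z(1) hw] by simp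
    have "\<forall>\<^sub>F n in sequentially. dist (z n) z' < t" "\<forall>\<^sub>F n in sequentially. dist (z n - h n *\<^sub>R w n) z' < t"
      using tendstoD[OF z(1) t(1)] tendstoD[OF zw t(1)] by auto
    then show "\<forall>\<^sub>F n in sequentially. dist ((1 / h n) *\<^sub>R (q (z n) - q (z n - h n *\<^sub>R w n)) - dq z' (w n)) 0 < e"
    proof eventually_elim
      case (elim n)
      let ?F = "\<lambda>y. q y - dq z' y"
      have bl: "bounded_linear (dq z')" by (rule has_derivative_bounded_linear[OF q_deriv[OF z(2)]])
      have F: "(?F has_derivative (\<lambda>v. dq y v - dq z' v)) (at y within ball z' t)" if "y \<in> ball z' t" for y
      proof -
        have "y \<in> Z" using that t(2) by blast
        then show ?thesis
          by (intro has_derivative_diff bounded_linear_imp_has_derivative[OF bl] has_derivative_at_withinI[OF q_deriv])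
      qed
      have on: "onorm (\<lambda>v. dq y v - dq z' v) \<le> e' * CARD('n)" if "y \<in> ball z' t" for y
        by (rule onorm_le) (rule close[OF that])
      have in1: "z n \<in> ball z' t" and in2: "z n - h n *\<^sub>R w n \<in> ball z' t"
        using elim by (simp_all add: dist_commute)
      have "norm (?F (z n) - ?F (z n - h n *\<^sub>R w n)) \<le> (e' * CARD('n)) * norm (z n - (z n - h n *\<^sub>R w n))"
        by (rule differentiable_bound[where f = ?F, OF convex_ball F on in1 in2])
      also have "?F (z n) - ?F (z n - h n *\<^sub>R w n) = (q (z n) - q (z n - h n *\<^sub>R w n)) - h n *\<^sub>R dq z' (w n)"
        using linear_diff[OF bounded_linear.linear[OF bl]] linear_scale[OF bounded_linear.linear[OF bl]] by simp
      finally have 1: "norm ((q (z n) - q (z n - h n *\<^sub>R w n)) - h n *\<^sub>R dq z' (w n)) \<le> e' * CARD('n) * (h n * norm (w n))"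
        using h(1)[of n] by simp
      have "(1 / h n) *\<^sub>R (q (z n) - q (z n - h n *\<^sub>R w n)) - dq z' (w n) = (1 / h n) *\<^sub>R ((q (z n) - q (z n - h n *\<^sub>R w n)) - h n *\<^sub>R dq z' (w n))"
        using h(1)[of n] by (simp add: scaleR_diff_right)
      then have "norm ((1 / h n) *\<^sub>R (q (z n) - q (z n - h n *\<^sub>R w n)) - dq z' (w n)) = (1 / h n) * norm ((q (z n) - q (z n - h n *\<^sub>R w n)) - h n *\<^sub>R dq z' (w n))"
        using h(1)[of n] by simp
      also have "\<dots> \<le> (1 / h n) * (e' * CARD('n) * (h n * norm (w n)))"
        using 1 h(1)[of n] by (intro mult_left_mono) auto
      also have "\<dots> = e' * CARD('n) * norm (w n)" using h(1)[of n] by simp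
      also have "\<dots> \<le> e' * CARD('n) * B" using B e' by (intro mult_left_mono) auto
      also have "\<dots> = e / 2" using B by (simp add: e'_def)
      finally show ?case using e by (simp add: dist_norm)
    qed
  qed
  moreover have "(\<lambda>n. dq z' (w n)) \<longlonglongrightarrow> dq z' w'"
    by (rule bounded_linear.tendsto[OF has_derivative_bounded_linear[OF q_deriv[OF z(2)]] w])
  ultimately show ?thesis by (rule Lim_transform[rotated])
qed

end

lemma integrable_torus_iff:
  fixes F :: "'n::finite torus \<Rightarrow> 'b::{banach, second_countable_topology}"
  assumes [measurable]: "F \<in> borel_measurable borel"
  shows "integrable torus_measure F \<longleftrightarrow> integrable lborel (\<lambda>x. indicator qcube x *\<^sub>R F (proj x))"
  unfolding torus_measure_eq
  by (subst integrable_distr_eq) (auto simp: measurable_proj_restrict integrable_restrict_space)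

lemma Cc_inf_torus_continuous: "f \<in> Cc_inf_torus \<Longrightarrow> continuous_on UNIV f"
  unfolding Cc_inf_torus_def continuous_on_torus_iff smooth_on_def
  by (auto intro: Ck_on_continuous)

lemma continuous_torus_bounded:
  fixes f :: "'n::finite torus \<Rightarrow> 'b::real_normed_vector"
  assumes "continuous_on UNIV f" obtains B where "B \<ge> 0" "\<And>X. norm (f X) \<le> B"
proof -
  have "bounded (range f)"
    using compact_continuous_image[OF assms compact_UNIV_torus] compact_imp_bounded by blast
  then obtain B where B: "\<And>x. norm (f x) \<le> B" by (auto simp: bounded_iff)
  have "norm (f x) \<le> max B 0" for x using B[of x] by (simp add: le_max_iff_disj)
  then show thesis by (intro that[of "max B 0"]) auto
qed

lemma compact_bounded_on:
  fixes f :: "'a::topological_space \<Rightarrow> 'b::real_normed_vector"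
  assumes "compact K" "continuous_on K f" obtains B where "B \<ge> 0" "\<And>x. x \<in> K \<Longrightarrow> norm (f x) \<le> B"
proof -
  have "bounded (f ` K)"
    using compact_continuous_image[OF assms(2,1)] compact_imp_bounded by blast
  then obtain B where B: "\<And>x. x \<in> K \<Longrightarrow> norm (f x) \<le> B" by (auto simp: bounded_iff)
  have "norm (f x) \<le> max B 0" if "x \<in> K" for x using B[OF that] by (simp add: le_max_iff_disj)
  then show thesis by (intro that[of "max B 0"]) auto
qed

context chart
begin

lemma V_borel: "\<kappa> ` U \<in> sets borel" and U_borel: "U \<in> sets borel" and Z_borel: "Z \<in> sets borel"
  using open_V open_U open_Z by auto

lemma q_image: "q ` (qcube \<inter> Z) = U"
proof (intro set_eqI iffI)
  fix x assume x: "x \<in> U"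
  obtain z where z: "z \<in> qcube" "proj z = \<kappa> x" using ex_qcube by blast
  then have "q z = x" "z \<in> Z" using q_\<kappa>[OF x] \<kappa>_Z[OF x] by auto
  then show "x \<in> q ` (qcube \<inter> Z)" using z by blast
qed (use q_in in blast)

lemma q_inj: "inj_on q (qcube \<inter> Z)"
proof (rule inj_onI)
  fix z z' assume "z \<in> qcube \<inter> Z" "z' \<in> qcube \<inter> Z" "q z = q z'"
  then have "proj z = proj z'" using \<kappa>_q by (metis IntE)
  then show "z = z'" using inj_on_proj_qcube \<open>z \<in> qcube \<inter> Z\<close> \<open>z' \<in> qcube \<inter> Z\<close> by (auto dest: inj_onD)
qed

text \<open>Change of variables along \<open>q\<close>, which maps the part of the fundamental cube
  over the patch bijectively onto \<open>U\<close> with Jacobian \<open>1 / J\<close>.\<close>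

lemma chart_integral:
  fixes \<Phi> :: "real^'n \<Rightarrow> complex" and F :: "'n torus \<Rightarrow> complex"
  assumes \<Phi>: "\<Phi> \<in> borel_measurable borel" and F: "integrable torus_measure F"
    and off: "\<And>Y. Y \<notin> \<kappa> ` U \<Longrightarrow> F Y = 0"
    and on: "\<And>z. z \<in> Z \<Longrightarrow> F (proj z) = (1 / J (q z)) *\<^sub>R \<Phi> (q z)"
  shows "integrable lborel (\<lambda>y. indicator U y *\<^sub>R \<Phi> y)"
    and "(LINT y|lborel. indicator U y *\<^sub>R \<Phi> y) = (LINT Y|torus_measure. F Y)"
proof -
  have [measurable]: "F \<in> borel_measurable borel" using borel_measurable_integrable[OF F] by simp
  have eq: "indicator (qcube \<inter> Z) z *\<^sub>R (jac (dq z) *\<^sub>R \<Phi> (q z)) = indicator qcube z *\<^sub>R F (proj z)" for z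
  proof (cases "z \<in> Z")
    case True
    then have "jac (dq z) = 1 / J (q z)" using J_dq(3)[OF q_in \<kappa>_q[symmetric]] by blast
    then show ?thesis using True on[OF True] by (simp add: indicator_def)
  next
    case False
    then show ?thesis using off[of "proj z"] by (simp add: Z_def)
  qed
  have i: "integrable lborel (\<lambda>z. indicator (qcube \<inter> Z) z *\<^sub>R (jac (dq z) *\<^sub>R \<Phi> (q z)))"
    unfolding eq using F integrable_torus_iff[of F] by simp
  have S: "qcube \<inter> Z \<in> sets borel" using qcube_borel Z_borel by auto
  have d: "(q has_derivative dq z) (at z within (qcube \<inter> Z))" if "z \<in> qcube \<inter> Z" for z
    by (rule has_derivative_at_withinI[OF q_deriv]) (use that in simp)
  note cv = change_of_variables_complex[where S = "qcube \<inter> Z" and g = q and g' = dq and \<Phi> = \<Phi>,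
      unfolded q_image, OF S U_borel d q_inj \<Phi> i]
  show "integrable lborel (\<lambda>y. indicator U y *\<^sub>R \<Phi> y)" by (rule cv(1))
  show "(LINT y|lborel. indicator U y *\<^sub>R \<Phi> y) = (LINT Y|torus_measure. F Y)"
    using cv(2) integral_torus[of F] by (simp only: eq \<open>F \<in> borel_measurable borel\<close>)
qed

lemma measurable_q [measurable]: "(\<lambda>z. if z \<in> Z then q z else 0) \<in> borel \<rightarrow>\<^sub>M borel"
  by (rule borel_measurable_continuous_on_if[OF Z_borel q_continuous]) auto

lemma measurable_\<kappa> [measurable]: "(\<lambda>x. if x \<in> U then \<kappa> x else 0) \<in> borel \<rightarrow>\<^sub>M borel"
  by (rule borel_measurable_continuous_on_if[OF U_borel \<kappa>_continuous]) auto

lemma measurable_invJ [measurable]: "(\<lambda>x. if x \<in> U then 1 / J x else 0) \<in> borel_measurable borel"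
proof (rule borel_measurable_continuous_on_if[OF U_borel])
  show "continuous_on U (\<lambda>x. 1 / J x)"
    by (intro continuous_intros J_continuous) (use J_pos in force)
qed auto

lemma measurable_J [measurable]: "(\<lambda>x. if x \<in> U then J x else 0) \<in> borel_measurable borel"
  by (rule borel_measurable_continuous_on_if[OF U_borel J_continuous]) auto

lemma UxUNIV: "U \<times> UNIV \<in> sets (borel :: ((real^'n) \<times> (real^'n)) measure)"
  by (intro borel_open open_Times open_U open_UNIV)

lemma measurable_D [measurable]: "(\<lambda>(m, v). if m \<in> U then D m v else 0) \<in> borel \<Otimes>\<^sub>M borel \<rightarrow>\<^sub>M borel"
proof -
  have "(\<lambda>p. if p \<in> U \<times> UNIV then (case p of (m, v) \<Rightarrow> D m v) else 0) \<in> borel \<rightarrow>\<^sub>M borel"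
    by (rule borel_measurable_continuous_on_if[OF UxUNIV D_joint_continuous]) auto
  moreover have "(\<lambda>p. if p \<in> U \<times> UNIV then (case p of (m, v) \<Rightarrow> D m v) else 0) = (\<lambda>(m, v). if m \<in> U then D m v else 0)"
    by auto
  ultimately show ?thesis unfolding borel_prod by simp
qed

lemma measurable_adjoint [measurable]:
  "(\<lambda>(m, \<xi>). if m \<in> U then adjoint (inv (D m)) \<xi> else 0) \<in> borel \<Otimes>\<^sub>M borel \<rightarrow>\<^sub>M borel"
proof -
  have "(\<lambda>p. if p \<in> U \<times> UNIV then (case p of (m, v) \<Rightarrow> adjoint (inv (D m)) v) else 0) \<in> borel \<rightarrow>\<^sub>M borel"
    by (rule borel_measurable_continuous_on_if[OF UxUNIV adjoint_joint_continuous]) auto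
  moreover have "(\<lambda>p. if p \<in> U \<times> UNIV then (case p of (m, v) \<Rightarrow> adjoint (inv (D m)) v) else 0)
    = (\<lambda>(m, \<xi>). if m \<in> U then adjoint (inv (D m)) \<xi> else 0)"
    by auto
  ultimately show ?thesis unfolding borel_prod by simp
qed

end

text \<open>One summand of a quantization of \<open>tsym k \<eta>\<close>: a patch, a member of the
  partition supported in it, and a cut-off that is 1 wherever this member is nonzero.\<close>

locale weyl_chart = chart U \<kappa>
  for U :: "(real^'n) set" and \<kappa> :: "real^'n \<Rightarrow> 'n torus" +
  fixes \<rho> :: "'n torus \<Rightarrow> real" and \<theta> :: "'n torus \<Rightarrow> complex" and k :: "int^'n" and \<eta> :: "(real^'n) \<Rightarrow> complex"
  assumes \<rho>: "\<rho> \<in> Cc_inf_torus" "supp \<rho> \<subseteq> \<kappa> ` U"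
    and \<theta>: "\<theta> \<in> Cc_inf_torus" "supp \<theta> \<subseteq> \<kappa> ` U" "\<And>X. \<rho> X \<noteq> 0 \<Longrightarrow> \<theta> X = 1"
    and \<eta>: "\<eta> \<in> testf"
begin

text \<open>The position factor of the local kernel, to be taken at the midpoint of the two
  arguments as in Weyl quantization; the Jacobian comes from substituting in the momentum
  integral.\<close>

definition amp :: "real^'n \<Rightarrow> complex" where
  "amp m = (if m \<in> U then of_real (\<rho> (\<kappa> m)) * charc k (\<kappa> m) * of_real (J m) else 0)"

definition kap :: "real \<Rightarrow> real^'n \<Rightarrow> real^'n \<Rightarrow> complex" where
  "kap h x y = amp ((1/2) *\<^sub>R (x + y)) * chk \<eta> ((1 / h) *\<^sub>R D ((1/2) *\<^sub>R (x + y)) (x - y)) / of_real (h ^ CARD('n))"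

text \<open>The local kernel lifted to periodic coordinates. The factor \<open>1 / J\<close> at the
  second point converts Lebesgue measure in the chart into the measure of the torus.\<close>

definition Kz :: "real \<Rightarrow> real^'n \<Rightarrow> real^'n \<Rightarrow> complex" where
  "Kz h z z' = (if z \<in> Z \<and> z' \<in> Z then \<theta> (proj z) * \<theta> (proj z') * kap h (q z) (q z') * of_real (1 / J (q z')) else 0)"

definition Ker :: "real \<Rightarrow> 'n torus \<Rightarrow> 'n torus \<Rightarrow> complex" where
  "Ker h X Y = Kz h (crep X) (crep Y)"

lemma Kz_proj: "Ker h (proj z) (proj z') = Kz h z z'"
  unfolding Ker_def Kz_def by (simp add: Z_def q_def)

lemma cont_\<rho>: "continuous_on UNIV \<rho>" and cont_\<theta>: "continuous_on UNIV \<theta>" and cont_\<eta>: "continuous_on UNIV \<eta>"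
  using \<rho>(1) \<theta>(1) \<eta> by (auto intro: Cc_inf_torus_continuous testf_continuous)

lemma meas_\<rho> [measurable]: "\<rho> \<in> borel_measurable borel" and meas_\<theta> [measurable]: "\<theta> \<in> borel_measurable borel"
  and meas_\<eta> [measurable]: "\<eta> \<in> borel_measurable borel" and meas_chk [measurable]: "chk \<eta> \<in> borel_measurable borel"
  by (auto intro: borel_measurable_continuous_onI cont_\<rho> cont_\<theta> cont_\<eta> chk_continuous \<eta>)

lemma \<rho>_supp: "\<rho> X \<noteq> 0 \<Longrightarrow> X \<in> supp \<rho>" and \<theta>_supp: "\<theta> X \<noteq> 0 \<Longrightarrow> X \<in> supp \<theta>"
  by (auto simp: supp_def intro: subsetD[OF closure_subset])

lemma compact_pre\<rho>: "compact (pre (supp \<rho>))" and compact_pre\<theta>: "compact (pre (supp \<theta>))"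
  by (rule compact_pre[OF _ \<rho>(2)], simp add: supp_def, rule compact_pre[OF _ \<theta>(2)], simp add: supp_def)

lemma pre_sub: "pre K \<subseteq> U"
  by (auto simp: pre_def)

lemma amp_eq: "amp m = of_real (\<rho> (if m \<in> U then \<kappa> m else 0)) * charc k (if m \<in> U then \<kappa> m else 0) * of_real (if m \<in> U then J m else 0)"
  by (simp add: amp_def)

lemma meas_amp [measurable]: "amp \<in> borel_measurable borel"
  unfolding amp_eq[abs_def] by measurable

lemma amp_nonzero: "amp m \<noteq> 0 \<Longrightarrow> m \<in> pre (supp \<rho>)"
  using \<rho>_supp[of "\<kappa> m"] by (auto simp: amp_def pre_def split: if_splits)

lemma amp_bounded: obtains B where "B \<ge> 0" "\<And>m. norm (amp m) \<le> B"
proof -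
  obtain B1 where B1: "B1 \<ge> 0" "\<And>m. m \<in> pre (supp \<rho>) \<Longrightarrow> norm (J m) \<le> B1"
    using compact_bounded_on[OF compact_pre\<rho> continuous_on_subset[OF J_continuous pre_sub]] by blast
  obtain B2 where B2: "B2 \<ge> 0" "\<And>X. norm (\<rho> X) \<le> B2"
    using continuous_torus_bounded[OF cont_\<rho>] by blast
  have "norm (amp m) \<le> B2 * B1" for m
  proof (cases "amp m = 0")
    case False
    then have "m \<in> pre (supp \<rho>)" by (rule amp_nonzero)
    then show ?thesis using B1(2)[of m] B2(2)[of "\<kappa> m"] B1(1) B2(1)
      by (auto simp: amp_def norm_mult intro!: mult_mono)
  qed (use B1 B2 in simp)
  then show thesis using B1 B2 by (intro that[of "B2 * B1"]) auto
qed

lemma chk_bounded: obtains B where "B \<ge> 0" "\<And>w. norm (chk \<eta> w) \<le> B"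
  using chk_decay[OF \<eta>, of 0] by auto

lemma kap_bounded:
  assumes "h > 0" obtains B where "B \<ge> 0" "\<And>x y. norm (kap h x y) \<le> B"
proof -
  obtain B1 where B1: "B1 \<ge> 0" "\<And>m. norm (amp m) \<le> B1" using amp_bounded by blast
  obtain B2 where B2: "B2 \<ge> 0" "\<And>w. norm (chk \<eta> w) \<le> B2" using chk_bounded by blast
  have "norm (kap h x y) \<le> B1 * B2 / h ^ CARD('n)" for x y
    unfolding kap_def norm_divide norm_mult
    using assms B1 B2 by (auto simp: norm_power intro!: divide_right_mono mult_mono)
  then show thesis using assms B1 B2 by (intro that[of "B1 * B2 / h ^ CARD('n)"]) auto
qed

text \<open>\<open>J\<close> may tend to zero at the edge of \<open>U\<close>; the support of the
  cut-off is compact in the patch and stays away from that edge.\<close>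

lemma \<theta>J_bounded: obtains B where "B \<ge> 0" "\<And>z. z \<in> Z \<Longrightarrow> norm (\<theta> (proj z) * of_real (1 / J (q z))) \<le> B"
proof -
  have "continuous_on (pre (supp \<theta>)) (\<lambda>x. 1 / J x)"
    by (intro continuous_intros continuous_on_subset[OF J_continuous pre_sub]) (use J_pos pre_sub in force)
  then obtain B1 where B1: "B1 \<ge> 0" "\<And>m. m \<in> pre (supp \<theta>) \<Longrightarrow> norm (1 / J m) \<le> B1"
    using compact_bounded_on[OF compact_pre\<theta>] by metis
  obtain B2 where B2: "B2 \<ge> 0" "\<And>X. norm (\<theta> X) \<le> B2"
    using continuous_torus_bounded[OF cont_\<theta>] by blast
  have "norm (\<theta> (proj z) * of_real (1 / J (q z))) \<le> B2 * B1" if z: "z \<in> Z" for z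
  proof (cases "\<theta> (proj z) = 0")
    case False
    then have "q z \<in> pre (supp \<theta>)" using \<theta>_supp q_in[OF z] \<kappa>_q[OF z] by (simp add: pre_def)
    then show ?thesis using B1(2)[of "q z"] B2(2)[of "proj z"] B1(1) B2(1)
      unfolding norm_mult by (intro mult_mono) (auto simp: norm_divide)
  qed (use B1 B2 in simp)
  then show thesis using B1 B2 by (intro that[of "B2 * B1"]) auto
qed

lemma meas_kap [measurable]: "(\<lambda>(x, y). kap h x y) \<in> borel_measurable (borel \<Otimes>\<^sub>M borel)"
proof -
  have [measurable]: "(\<lambda>p. if fst p \<in> U then D (fst p) (snd p) else 0) \<in> borel \<Otimes>\<^sub>M borel \<rightarrow>\<^sub>M borel"
    using measurable_D by (simp add: case_prod_unfold)
  let ?m = "\<lambda>p::(real^'n) \<times> (real^'n). (1/2) *\<^sub>R (fst p + snd p)"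
  have "(\<lambda>p. (\<lambda>p. if fst p \<in> U then D (fst p) (snd p) else 0) (?m p, fst p - snd p)) \<in> borel \<Otimes>\<^sub>M borel \<rightarrow>\<^sub>M borel"
    by (rule measurable_compose[of _ _ "borel \<Otimes>\<^sub>M borel"]) measurable
  then have [measurable]: "(\<lambda>p. if ?m p \<in> U then D (?m p) (fst p - snd p) else 0) \<in> borel \<Otimes>\<^sub>M borel \<rightarrow>\<^sub>M borel"
    by simp
  have eq: "kap h (fst p) (snd p) = amp (?m p) * chk \<eta> ((1 / h) *\<^sub>R (if ?m p \<in> U then D (?m p) (fst p - snd p) else 0)) / of_real (h ^ CARD('n))" for p
    by (simp add: kap_def amp_def)
  show ?thesis unfolding case_prod_unfold eq by measurable
qed

lemma meas_Kz [measurable]: "(\<lambda>(z, z'). Kz h z z') \<in> borel_measurable (borel \<Otimes>\<^sub>M borel)"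
proof -
  let ?q = "\<lambda>z. if z \<in> Z then q z else 0"
  note [measurable] = Z_borel
  have 1: "(\<lambda>p. (\<lambda>(x, y). kap h x y) (?q (fst p), ?q (snd p))) \<in> borel_measurable (borel \<Otimes>\<^sub>M borel)"
    by (rule measurable_compose[OF _ meas_kap]) measurable
  have 2: "(\<lambda>p. (\<lambda>x. if x \<in> U then 1 / J x else 0) (?q (snd p))) \<in> borel_measurable (borel \<Otimes>\<^sub>M borel)"
    by (rule measurable_compose[OF _ measurable_invJ]) measurable
  note [measurable] = 1 2
  have eq: "Kz h (fst p) (snd p) = (if fst p \<in> Z \<and> snd p \<in> Z then \<theta> (proj (fst p)) * \<theta> (proj (snd p)) * (\<lambda>(x, y). kap h x y) (?q (fst p), ?q (snd p))
     * of_real ((\<lambda>x. if x \<in> U then 1 / J x else 0) (?q (snd p))) else 0)" for p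
    using q_in by (simp add: Kz_def)
  show ?thesis unfolding case_prod_unfold eq by measurable
qed

lemma meas_Ker [measurable]: "(\<lambda>(X, Y). Ker h X Y) \<in> borel_measurable (borel \<Otimes>\<^sub>M borel)"
proof -
  have "(\<lambda>p. (\<lambda>(z, z'). Kz h z z') (crep (fst p), crep (snd p))) \<in> borel_measurable (borel \<Otimes>\<^sub>M borel)"
    by (rule measurable_compose[OF _ meas_Kz]) measurable
  then show ?thesis by (simp add: Ker_def case_prod_unfold)
qed

lemma Ker_bounded:
  assumes "h > 0" obtains B where "B \<ge> 0" "\<And>X Y. norm (Ker h X Y) \<le> B"
proof -
  obtain B1 where B1: "B1 \<ge> 0" "\<And>X. norm (\<theta> X) \<le> B1" using continuous_torus_bounded[OF cont_\<theta>] by blast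
  obtain B2 where B2: "B2 \<ge> 0" "\<And>x y. norm (kap h x y) \<le> B2" using kap_bounded[OF assms] by blast
  obtain B3 where B3: "B3 \<ge> 0" "\<And>z. z \<in> Z \<Longrightarrow> norm (\<theta> (proj z) * of_real (1 / J (q z))) \<le> B3" using \<theta>J_bounded by blast
  have "norm (Kz h z z') \<le> B1 * B2 * B3" for z z'
  proof (cases "z \<in> Z \<and> z' \<in> Z")
    case True
    then have "Kz h z z' = \<theta> (proj z) * kap h (q z) (q z') * (\<theta> (proj z') * of_real (1 / J (q z')))"
      by (simp add: Kz_def)
    then show ?thesis using B1 B2 B3 True
      by (simp only: norm_mult[of _ "\<theta> (proj z') * of_real (1 / J (q z'))"]) (auto simp: norm_mult intro!: mult_mono)
  next
    case False
    then have "Kz h z z' = 0" by (auto simp: Kz_def)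
    then show ?thesis using B1 B2 B3 by simp
  qed
  then show thesis using B1 B2 B3 by (intro that[of "B1 * B2 * B3"]) (auto simp: Ker_def)
qed

text \<open>The substitution by the transposed inverse differential composed with multiplication by
  \<open>h\<close> has Jacobian \<open>h ^ CARD('n) / J m\<close>, and moves the differential onto
  the displacement \<open>w\<close> in the phase.\<close>

lemma symbol_integral:
  assumes m: "m \<in> U" and h: "h > 0"
  shows "(LINT \<xi>|lborel. \<eta> (adjoint (inv (D m)) (h *\<^sub>R \<xi>)) * cis (w \<bullet> \<xi>))
    = of_real (vol TYPE('n) * J m / h ^ CARD('n)) * chk \<eta> ((1 / h) *\<^sub>R D m w)"
proof -
  obtain z where z: "proj z = \<kappa> m" by (metis torus_cases)
  let ?A = "inv (D m)"
  have A: "?A = dq z" by (rule inv_D[OF m z])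
  have lA: "linear ?A" and lD: "linear (D m)" by (rule inv_D_linear[OF m], rule linear_D[OF m])
  have DA: "D m (?A v) = v" "?A (D m v) = v" for v unfolding A by (rule dq_D[OF m z])+
  define T where "T = adjoint ?A \<circ> ((*\<^sub>R) h)"
  define T' where "T' = (\<lambda>\<zeta>. (1 / h) *\<^sub>R adjoint (D m) \<zeta>)"
  have lT: "linear T" "linear T'"
    unfolding T_def T'_def
    by (intro linear_compose adjoint_linear[OF lA] linear_compose_scale_right adjoint_linear[OF lD] linear_scaleR)+
  have adj: "adjoint ?A (adjoint (D m) v) = v" "adjoint (D m) (adjoint ?A v) = v" for v
  proof -
    have "adjoint ?A (adjoint (D m) v) \<bullet> u = v \<bullet> u" "adjoint (D m) (adjoint ?A v) \<bullet> u = v \<bullet> u" for u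
      by (simp_all add: inner_commute[of _ u] adjoint_works[OF lA] adjoint_works[OF lD] DA)
    then show "adjoint ?A (adjoint (D m) v) = v" "adjoint (D m) (adjoint ?A v) = v"
      by (metis vector_eq_rdot)+
  qed
  have TT: "T (T' v) = v" "T' (T v) = v" for v
    using h by (simp_all add: T_def T'_def linear_scale[OF adjoint_linear[OF lA]] linear_scale[OF adjoint_linear[OF lD]] adj)
  define \<Phi> where "\<Phi> \<zeta> = \<eta> \<zeta> * cis (w \<bullet> T' \<zeta>)" for \<zeta>
  have T'w: "w \<bullet> T' \<zeta> = ((1 / h) *\<^sub>R D m w) \<bullet> \<zeta>" for \<zeta>
    by (simp add: T'_def adjoint_works[OF lD])
  have \<Phi>T: "\<Phi> (T \<xi>) = \<eta> (adjoint ?A (h *\<^sub>R \<xi>)) * cis (w \<bullet> \<xi>)" for \<xi>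
    unfolding \<Phi>_def TT(2) by (simp add: T_def)
  obtain R B where RB: "R > 0" "B \<ge> 0" "\<And>\<xi>. R < norm \<xi> \<Longrightarrow> \<eta> \<xi> = 0" "\<And>\<xi>. norm (\<eta> \<xi>) \<le> B"
    using testf_bounded[OF \<eta>] by blast
  have [measurable]: "T \<in> borel \<rightarrow>\<^sub>M borel" "T' \<in> borel \<rightarrow>\<^sub>M borel"
    using lT by (auto intro!: borel_measurable_continuous_onI linear_continuous_on simp: linear_conv_bounded_linear)
  have m\<Phi>: "\<Phi> \<in> borel_measurable borel" unfolding \<Phi>_def[abs_def] by measurable
  obtain C where C: "C > 0" "\<And>v. norm (T' v) \<le> C * norm v"
    using linear_bounded_pos[OF lT(2)] by blast
  have i: "integrable lborel (\<lambda>\<xi>. \<Phi> (T \<xi>))"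
  proof (rule integrable_ball_bounded(1))
    show "(\<lambda>\<xi>. \<Phi> (T \<xi>)) \<in> borel_measurable borel" using m\<Phi> by measurable
    show "norm (\<Phi> (T \<xi>)) \<le> B" for \<xi> using RB by (simp add: \<Phi>_def norm_mult)
    show "\<Phi> (T \<xi>) = 0" if "C * R < norm \<xi>" for \<xi>
    proof -
      have "norm \<xi> \<le> C * norm (T \<xi>)" using C(2)[of "T \<xi>"] by (simp add: TT)
      with that have "C * R < C * norm (T \<xi>)" by simp
      then have "R < norm (T \<xi>)" using C(1) by simp
      then show ?thesis using RB by (simp add: \<Phi>_def)
    qed
  qed
  have "(LINT \<zeta>|lborel. \<Phi> \<zeta>) = jac T *\<^sub>R (LINT \<xi>|lborel. \<Phi> (T \<xi>))"
    by (rule linear_change_of_variables[OF lT TT m\<Phi> i])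
  moreover have "jac T = h ^ CARD('n) / J m"
  proof -
    have "jac T = jac (adjoint ?A) * jac ((*\<^sub>R) h :: real^'n \<Rightarrow> real^'n)"
      unfolding T_def by (rule jac_compose[OF adjoint_linear[OF lA] linear_scaleR])
    also have "jac (adjoint ?A) = 1 / J m"
      using jac_adjoint[OF lA] J_dq(3)[OF m z] by (simp add: A)
    finally show ?thesis using h by (simp add: jac_scaleR)
  qed
  moreover have "(LINT \<zeta>|lborel. \<Phi> \<zeta>) = of_real (vol TYPE('n)) * chk \<eta> ((1 / h) *\<^sub>R D m w)"
    unfolding \<Phi>_def T'w chk_def by simp
  ultimately have "of_real (vol TYPE('n)) * chk \<eta> ((1 / h) *\<^sub>R D m w) = of_real (h ^ CARD('n) / J m) * (LINT \<xi>|lborel. \<Phi> (T \<xi>))"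
    by (simp add: scaleR_conv_of_real)
  then show ?thesis
    unfolding \<Phi>T using h J_pos[OF m] by (simp add: field_simps)
qed

end

lemma (in pair_sigma_finite) integrable_mult_pair:
  fixes a b :: "_ \<Rightarrow> real"
  assumes a: "integrable M1 a" and b: "integrable M2 b"
  shows "integrable (M1 \<Otimes>\<^sub>M M2) (\<lambda>(x, y). a x * b y)"
proof (rule Fubini_integrable)
  have [measurable]: "a \<in> borel_measurable M1" "b \<in> borel_measurable M2" using a b by auto
  show "(\<lambda>(x, y). a x * b y) \<in> borel_measurable (M1 \<Otimes>\<^sub>M M2)" by measurable
  have "integrable M1 (\<lambda>x. norm (a x) * (\<integral>y. norm (b y) \<partial>M2))"
    by (intro Bochner_Integration.integrable_mult_left integrable_norm a)
  then show "integrable M1 (\<lambda>x. \<integral>y. norm (case (x, y) of (x, y) \<Rightarrow> a x * b y) \<partial>M2)"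
    by (simp add: abs_mult)
  show "AE x in M1. integrable M2 (\<lambda>y. case (x, y) of (x, y) \<Rightarrow> a x * b y)"
    using b by simp
qed

context weyl_chart
begin

lemma adjoint_inv:
  assumes m: "m \<in> U" shows "adjoint (D m) (adjoint (inv (D m)) v) = v"
proof -
  obtain z where z: "proj z = \<kappa> m" by (metis torus_cases)
  have A: "inv (D m) = dq z" by (rule inv_D[OF m z])
  have "adjoint (D m) (adjoint (inv (D m)) v) \<bullet> u = v \<bullet> u" for u
    using adjoint_works[OF linear_D[OF m], of u "adjoint (inv (D m)) v"]
      adjoint_works[OF inv_D_linear[OF m], of "D m u" v] dq_D(1)[OF m z]
    by (simp add: inner_commute A)
  then show ?thesis by (metis vector_eq_rdot)
qed

lemma adjoint_D_bounded: obtains C where "C > 0" "\<And>m v. m \<in> pre (supp \<rho>) \<Longrightarrow> norm (adjoint (D m) v) \<le> C * norm v"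
proof -
  have "\<exists>B\<ge>0. \<forall>m\<in>pre (supp \<rho>). norm (D m (axis i 1)) \<le> B" for i
    using compact_bounded_on[OF compact_pre\<rho> continuous_on_subset[OF D_continuous pre_sub]] by metis
  then obtain B where B: "\<And>i. B i \<ge> 0" "\<And>i m. m \<in> pre (supp \<rho>) \<Longrightarrow> norm (D m (axis i 1)) \<le> B i" by metis
  let ?C = "(\<Sum>i\<in>UNIV. B i) + 1"
  have "norm (adjoint (D m) v) \<le> ?C * norm v" if m: "m \<in> pre (supp \<rho>)" for m v
  proof -
    have mU: "m \<in> U" using m pre_sub by blast
    have "norm (adjoint (D m) v) \<le> (\<Sum>i\<in>UNIV. \<bar>adjoint (D m) v $ i\<bar>)" by (rule norm_le_l1_cart)
    also have "\<dots> \<le> (\<Sum>i\<in>UNIV. norm v * B i)"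
    proof (rule sum_mono)
      fix i
      have "\<bar>adjoint (D m) v $ i\<bar> \<le> norm v * norm (D m (axis i 1))"
        unfolding adjoint_nth[OF linear_D[OF mU]] using Cauchy_Schwarz_ineq2 by simp
      also have "\<dots> \<le> norm v * B i" by (intro mult_left_mono B m) simp
      finally show "\<bar>adjoint (D m) v $ i\<bar> \<le> norm v * B i" .
    qed
    also have "\<dots> = (\<Sum>i\<in>UNIV. B i) * norm v" by (simp add: sum_distrib_left mult.commute)
    also have "\<dots> \<le> ?C * norm v" by (intro mult_right_mono) auto
    finally show ?thesis .
  qed
  moreover have "?C > 0" using B(1) by (intro add_nonneg_pos sum_nonneg) auto
  ultimately show thesis by (rule that[rotated])
qed

definition fv :: "('n torus \<Rightarrow> complex) \<Rightarrow> real^'n \<Rightarrow> complex" where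
  "fv v y = (if y \<in> U then \<theta> (\<kappa> y) * v (\<kappa> y) else 0)"

lemma meas_fv: "v \<in> borel_measurable borel \<Longrightarrow> fv v \<in> borel_measurable borel"
proof -
  assume [measurable]: "v \<in> borel_measurable borel"
  note [measurable] = U_borel
  have "fv v = (\<lambda>y. if y \<in> U then \<theta> (if y \<in> U then \<kappa> y else 0) * v (if y \<in> U then \<kappa> y else 0) else 0)"
    by (auto simp: fv_def)
  then show ?thesis by simp
qed

lemma meas_on_chart:
  assumes [measurable]: "G \<in> borel_measurable borel"
  shows "(\<lambda>Y. if Y \<in> \<kappa> ` U then (G (q (crep Y)) :: complex) * of_real (1 / J (q (crep Y))) else 0) \<in> borel_measurable borel"
proof -
  note [measurable] = V_borel
  let ?q = "\<lambda>z. if z \<in> Z then q z else 0" and ?j = "\<lambda>x. if x \<in> U then 1 / J x else 0"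
  have [measurable]: "(\<lambda>Y. ?j (?q (crep Y))) \<in> borel_measurable borel"
    by (rule measurable_compose[OF _ measurable_invJ]) measurable
  have "(\<lambda>Y. if Y \<in> \<kappa> ` U then G (?q (crep Y)) * of_real (?j (?q (crep Y))) else 0) \<in> borel_measurable borel"
    by measurable
  moreover have "(\<lambda>Y. if Y \<in> \<kappa> ` U then G (?q (crep Y)) * of_real (?j (?q (crep Y))) else 0)
    = (\<lambda>Y. if Y \<in> \<kappa> ` U then G (q (crep Y)) * of_real (1 / J (q (crep Y))) else 0)"
  proof (rule ext)
    fix Y
    have "crep Y \<in> Z" "q (crep Y) \<in> U" if "Y \<in> \<kappa> ` U"
      using that q_in[of "crep Y"] by (auto simp: Z_def)
    then show "(if Y \<in> \<kappa> ` U then G (?q (crep Y)) * of_real (?j (?q (crep Y))) else 0)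
      = (if Y \<in> \<kappa> ` U then G (q (crep Y)) * of_real (1 / J (q (crep Y))) else 0)" by auto
  qed
  ultimately show ?thesis by simp
qed

text \<open>\<open>chart_integral\<close> for functions localised by the cut-off; integrability on
  the torus rests on \<open>\<theta>J_bounded\<close>.\<close>

lemma fv_integral:
  assumes v: "v \<in> L2_torus" and G: "G \<in> borel_measurable borel" "\<And>y. norm (G y) \<le> B"
  shows "integrable lborel (\<lambda>y. G y * fv v y)"
    and "(LINT y|lborel. G y * fv v y)
      = (LINT Y|torus_measure. (if Y \<in> \<kappa> ` U then G (q (crep Y)) * of_real (1 / J (q (crep Y))) else 0) * (\<theta> Y * v Y))"
    and "integrable torus_measure (\<lambda>Y. (if Y \<in> \<kappa> ` U then G (q (crep Y)) * of_real (1 / J (q (crep Y))) else 0) * (\<theta> Y * v Y))"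
proof -
  note vm = L2_torus_measurable[OF v]
  let ?w = "\<lambda>Y. if Y \<in> \<kappa> ` U then G (q (crep Y)) * of_real (1 / J (q (crep Y))) else 0"
  let ?F = "\<lambda>Y. ?w Y * (\<theta> Y * v Y)"
  obtain B3 where B3: "B3 \<ge> 0" "\<And>z. z \<in> Z \<Longrightarrow> norm (\<theta> (proj z) * of_real (1 / J (q z))) \<le> B3" using \<theta>J_bounded by blast
  have B0: "B \<ge> 0" using order_trans[OF norm_ge_zero G(2)] .
  have wm [measurable]: "?w \<in> borel_measurable borel" by (rule meas_on_chart[OF G(1)])
  have wb: "norm (?w Y * \<theta> Y) \<le> B * B3" for Y
  proof (cases "Y \<in> \<kappa> ` U")
    case True
    then have "crep Y \<in> Z" by (simp add: Z_def)
    then have b: "norm (\<theta> Y * of_real (1 / J (q (crep Y)))) \<le> B3" using B3(2)[of "crep Y"] by simp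
    have "?w Y * \<theta> Y = G (q (crep Y)) * (\<theta> Y * of_real (1 / J (q (crep Y))))" using True by simp
    also have "norm \<dots> \<le> B * B3"
      unfolding norm_mult[of "G (q (crep Y))"] by (rule mult_mono[OF G(2) b B0]) simp
    finally show ?thesis .
  qed (use B0 B3 in simp)
  have "(\<lambda>Y. (?w Y * \<theta> Y) * v Y) \<in> L2_torus"
    by (rule L2_mult_bounded[OF v _ wb]) measurable
  then show i: "integrable torus_measure ?F" using L2_integrable by (simp add: mult.assoc)
  have \<Phi>: "(\<lambda>y. G y * fv v y) \<in> borel_measurable borel"
    using G(1) meas_fv[OF vm] by measurable
  have on: "?F (proj z) = (1 / J (q z)) *\<^sub>R (G (q z) * fv v (q z))" if z: "z \<in> Z" for z
  proof -
    have "q (crep (proj z)) = q z" by (simp add: q_def)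
    moreover have "proj z \<in> \<kappa> ` U" using z by (simp add: Z_def)
    ultimately show ?thesis
      using q_in[OF z] \<kappa>_q[OF z] by (simp add: fv_def scaleR_conv_of_real mult_ac)
  qed
  have ind: "indicator U y *\<^sub>R (G y * fv v y) = G y * fv v y" for y
    by (simp add: fv_def indicator_def)
  note ci = chart_integral[OF \<Phi> i _ on, unfolded ind]
  show "integrable lborel (\<lambda>y. G y * fv v y)" by (rule ci(1)) simp
  show "(LINT y|lborel. G y * fv v y) = (LINT Y|torus_measure. ?F Y)" by (rule ci(2)) simp
qed

abbreviation symb :: "'n cotangent \<Rightarrow> complex" where
  "symb \<equiv> \<lambda>(X, \<xi>). of_real (\<rho> X) * tsym k \<eta> (X, \<xi>)"

lemma pullback_symb:
  "pullback_symbol U \<kappa> symb (m, \<zeta>) = (if m \<in> U then of_real (\<rho> (\<kappa> m)) * (charc k (\<kappa> m) * \<eta> (adjoint (inv (D m)) \<zeta>)) else 0)"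
  by (simp add: pullback_symbol_def tsym_def D_def)

text \<open>For fixed \<open>x\<close> and \<open>h\<close> the momentum in the iterated integral
  stays in a ball independent of \<open>y\<close>, so the double integral converges absolutely.
  Fubini's theorem lets the momentum be integrated out at once, which is
  \<open>symbol_integral\<close>.\<close>

lemma weyl_kernel:
  assumes h: "h > 0" and v: "v \<in> L2_torus"
  shows "weyl h (pullback_symbol U \<kappa> symb) (fv v) x = (LINT y|lborel. kap h x y * fv v y)"
proof -
  let ?b = "pullback_symbol U \<kappa> symb"
  let ?m = "\<lambda>y. (1/2) *\<^sub>R (x + y)"
  define P where "P \<xi> y = ?b (?m y, h *\<^sub>R \<xi>) * fv v y * cis ((x - y) \<bullet> \<xi>)" for \<xi> y
  obtain R B where RB: "R > 0" "B \<ge> 0" "\<And>\<xi>. R < norm \<xi> \<Longrightarrow> \<eta> \<xi> = 0" "\<And>\<xi>. norm (\<eta> \<xi>) \<le> B"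
    using testf_bounded[OF \<eta>] by blast
  obtain B2 where B2: "B2 \<ge> 0" "\<And>X. norm (\<rho> X) \<le> B2"
    using continuous_torus_bounded[OF cont_\<rho>] by blast
  obtain C where C: "C > 0" "\<And>m v. m \<in> pre (supp \<rho>) \<Longrightarrow> norm (adjoint (D m) v) \<le> C * norm v"
    using adjoint_D_bounded by blast
  note vm = L2_torus_measurable[OF v]
  have fi: "integrable lborel (fv v)" using fv_integral(1)[OF v, of "\<lambda>_. 1" 1] by simp
  have fm [measurable]: "fv v \<in> borel_measurable borel" by (rule meas_fv[OF vm])
  have beq: "?b (m, \<zeta>) = of_real (\<rho> (if m \<in> U then \<kappa> m else 0)) * (charc k (if m \<in> U then \<kappa> m else 0) * 
      \<eta> (if m \<in> U then adjoint (inv (D m)) \<zeta> else 0)) * indicator U m" for m \<zeta>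
    by (simp add: pullback_symb)
  have [measurable]: "(\<lambda>p. if fst p \<in> U then adjoint (inv (D (fst p))) (snd p) else 0) \<in> borel \<Otimes>\<^sub>M borel \<rightarrow>\<^sub>M borel"
    using measurable_adjoint by (simp add: case_prod_unfold)
  note [measurable] = U_borel
  have "(\<lambda>p. ?b (fst p, snd p)) \<in> borel_measurable (borel \<Otimes>\<^sub>M borel)"
    unfolding beq by measurable
  then have bm: "(\<lambda>p. ?b p) \<in> borel_measurable (borel \<Otimes>\<^sub>M borel)" by simp
  have "(\<lambda>p. ?b (?m (snd p), h *\<^sub>R fst p)) \<in> borel_measurable (borel \<Otimes>\<^sub>M borel)"
    by (rule measurable_compose[OF _ bm]) measurable
  then have Pm: "(\<lambda>(\<xi>, y). P \<xi> y) \<in> borel_measurable (lborel \<Otimes>\<^sub>M lborel)"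
    unfolding P_def case_prod_unfold by measurable
  have Pb: "norm (P \<xi> y) \<le> (B2 * B * indicator (cball 0 (C * R / h)) \<xi>) * norm (fv v y)" for \<xi> y
  proof (cases "P \<xi> y = 0")
    case False
    then have m: "?m y \<in> U" "\<rho> (\<kappa> (?m y)) \<noteq> 0" "\<eta> (adjoint (inv (D (?m y))) (h *\<^sub>R \<xi>)) \<noteq> 0"
      by (auto simp: P_def pullback_symb split: if_splits)
    then have mp: "?m y \<in> pre (supp \<rho>)" using \<rho>_supp by (simp add: pre_def)
    have "norm (adjoint (inv (D (?m y))) (h *\<^sub>R \<xi>)) \<le> R" using m(3) RB(3) not_less by blast
    \<comment> \<open>The symbol restricts the transformed momentum; the transposed differential
      undoes the transformation and is bounded over the compact support of
      \<open>\<rho>\<close>.\<close>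
    then have "norm (h *\<^sub>R \<xi>) \<le> C * R"
      using C(2)[OF mp, of "adjoint (inv (D (?m y))) (h *\<^sub>R \<xi>)"] C(1)
      unfolding adjoint_inv[OF m(1)] by (meson mult_left_mono order_trans less_imp_le)
    then have "norm \<xi> \<le> C * R / h" using h by (simp add: field_simps)
    moreover have "norm (?b (?m y, h *\<^sub>R \<xi>)) \<le> B2 * B"
      using m(1) B2(2)[of "\<kappa> (?m y)"] RB B2 by (auto simp: pullback_symb norm_mult intro!: mult_mono)
    ultimately show ?thesis by (simp add: P_def norm_mult mult_right_mono)
  qed (use B2 RB in simp)
  have bi: "integrable lborel (\<lambda>\<xi>. B2 * B * indicator (cball (0::real^'n) (C * R / h)) \<xi> :: real)"
    using emeasure_lborel_cball_finite[of "0::real^'n" "C * R / h"]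
    by (intro Bochner_Integration.integrable_mult_right integrable_real_indicator) auto
  have Pi: "integrable (lborel \<Otimes>\<^sub>M lborel) (\<lambda>(\<xi>, y). P \<xi> y)"
  proof (rule Bochner_Integration.integrable_bound[OF lborel_pair.integrable_mult_pair[OF bi integrable_norm[OF fi]] Pm])
    show "AE p in lborel \<Otimes>\<^sub>M lborel. norm (case p of (\<xi>, y) \<Rightarrow> P \<xi> y)
       \<le> norm (case p of (\<xi>, y) \<Rightarrow> B2 * B * indicator (cball 0 (C * R / h)) \<xi> * norm (fv v y))"
      using Pb by (auto intro!: AE_I2 order_trans[OF Pb])
  qed
  have inner: "(LINT \<xi>|lborel. P \<xi> y) = of_real (vol TYPE('n)) * (kap h x y * fv v y)" for y
  proof (cases "?m y \<in> U")
    case True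
    have "(LINT \<xi>|lborel. P \<xi> y) = (LINT \<xi>|lborel. (of_real (\<rho> (\<kappa> (?m y))) * charc k (\<kappa> (?m y)) * fv v y) *
        (\<eta> (adjoint (inv (D (?m y))) (h *\<^sub>R \<xi>)) * cis ((x - y) \<bullet> \<xi>)))"
      using True by (intro Bochner_Integration.integral_cong) (auto simp: P_def pullback_symb mult_ac)
    also have "\<dots> = (of_real (\<rho> (\<kappa> (?m y))) * charc k (\<kappa> (?m y)) * fv v y) *
       (of_real (vol TYPE('n) * J (?m y) / h ^ CARD('n)) * chk \<eta> ((1 / h) *\<^sub>R D (?m y) (x - y)))"
      using symbol_integral[OF True h, of "x - y"] by simp
    also have "\<dots> = of_real (vol TYPE('n)) * (kap h x y * fv v y)"
      using True by (simp add: kap_def amp_def mult_ac)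
    finally show ?thesis .
  next
    case False
    then show ?thesis by (simp add: P_def pullback_symb kap_def amp_def)
  qed
  have "weyl h ?b (fv v) x = (LINT \<xi>|lborel. LINT y|lborel. P \<xi> y) / of_real (vol TYPE('n))"
    by (simp add: weyl_def P_def vol_def)
  also have "(LINT \<xi>|lborel. LINT y|lborel. P \<xi> y) = (LINT y|lborel. LINT \<xi>|lborel. P \<xi> y)"
    by (rule lborel_pair.Fubini_integral[OF Pi, symmetric])
  also have "\<dots> = of_real (vol TYPE('n)) * (LINT y|lborel. kap h x y * fv v y)"
    unfolding inner by simp
  finally show ?thesis by simp
qed

lemma patch_kernel:
  assumes h: "h > 0" and v: "v \<in> L2_torus"
  shows "weyl_patch U \<kappa> \<theta> symb h v X = (LINT Y|torus_measure. Ker h X Y * v Y)"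
proof (cases "X \<in> \<kappa> ` U")
  case True
  define x where "x = q (crep X)"
  have x: "inv_into U \<kappa> X = x" by (simp add: x_def q_def)
  have cZ: "crep X \<in> Z" using True by (simp add: Z_def)
  have f: "(\<lambda>y. if y \<in> U then \<theta> (\<kappa> y) * v (\<kappa> y) else 0) = fv v" by (auto simp: fv_def)
  obtain B where B: "\<And>x y. norm (kap h x y) \<le> B" using kap_bounded[OF h] by blast
  have "(\<lambda>y. (\<lambda>(x, y). kap h x y) (x, y)) \<in> borel_measurable borel"
    by (rule measurable_compose[OF _ meas_kap]) measurable
  then have m: "kap h x \<in> borel_measurable borel" by simp
  have "weyl_patch U \<kappa> \<theta> symb h v X = \<theta> X * (LINT y|lborel. kap h x y * fv v y)"
    using True weyl_kernel[OF h v] by (simp add: weyl_patch_def x f)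
  also have "\<dots> = (LINT Y|torus_measure. \<theta> X * ((if Y \<in> \<kappa> ` U then kap h x (q (crep Y)) * of_real (1 / J (q (crep Y))) else 0) * (\<theta> Y * v Y)))"
    unfolding fv_integral(2)[OF v m B] by simp
  also have "\<dots> = (LINT Y|torus_measure. Ker h X Y * v Y)"
  proof (intro Bochner_Integration.integral_cong refl)
    fix Y
    have "crep Y \<in> Z \<longleftrightarrow> Y \<in> \<kappa> ` U" by (simp add: Z_def)
    then show "\<theta> X * ((if Y \<in> \<kappa> ` U then kap h x (q (crep Y)) * of_real (1 / J (q (crep Y))) else 0) * (\<theta> Y * v Y)) = Ker h X Y * v Y"
      using cZ by (simp add: Ker_def Kz_def x_def)
  qed
  finally show ?thesis .
next
  case False
  then have "crep X \<notin> Z" by (simp add: Z_def)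
  then show ?thesis using False by (simp add: weyl_patch_def Ker_def Kz_def)
qed

end

section \<open>Off-diagonal decay and rescaled limit of the kernel in a patch\<close>

section \<open>Estimates for the kernel in a patch\<close>

context weyl_chart
begin

lemma inv_D_bounded: obtains C where "C > 0" "\<And>m v. m \<in> pre (supp \<rho>) \<Longrightarrow> norm v \<le> C * norm (D m v)"
proof -
  have "\<exists>B\<ge>0. \<forall>m\<in>pre (supp \<rho>). norm (inv (D m) (axis i 1)) \<le> B" for i
    using compact_bounded_on[OF compact_pre\<rho> continuous_on_subset[OF inv_D_continuous pre_sub]] by metis
  then obtain B where B: "\<And>i. B i \<ge> 0" "\<And>i m. m \<in> pre (supp \<rho>) \<Longrightarrow> norm (inv (D m) (axis i 1)) \<le> B i" by metis
  let ?C = "(\<Sum>i\<in>UNIV. B i) + 1"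
  have "norm v \<le> ?C * norm (D m v)" if m: "m \<in> pre (supp \<rho>)" for m v
  proof -
    have mU: "m \<in> U" using m pre_sub by blast
    obtain z where z: "proj z = \<kappa> m" by (metis torus_cases)
    let ?u = "D m v"
    have "v = inv (D m) ?u" using dq_D(1)[OF mU z] inv_D[OF mU z] by simp
    also have "\<dots> = (\<Sum>i\<in>UNIV. ?u $ i *\<^sub>R inv (D m) (axis i 1))" by (rule linear_sum_axis[OF inv_D_linear[OF mU]])
    finally have "norm v = norm (\<Sum>i\<in>UNIV. ?u $ i *\<^sub>R inv (D m) (axis i 1))" by simp
    also have "\<dots> \<le> (\<Sum>i\<in>UNIV. norm ?u * B i)"
      by (rule sum_norm_le) (use B m component_le_norm_cart[of ?u] in \<open>auto intro!: mult_mono\<close>)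
    also have "\<dots> = (\<Sum>i\<in>UNIV. B i) * norm ?u" by (simp add: sum_distrib_right mult.commute)
    also have "\<dots> \<le> ?C * norm ?u" by (intro mult_right_mono) auto
    finally show ?thesis .
  qed
  moreover have "?C > 0" using B(1) by (intro add_nonneg_pos sum_nonneg) auto
  ultimately show thesis by (rule that[rotated])
qed

text \<open>\<open>\<kappa>\<close> is Lipschitz on compact sets for the distance of the torus: otherwise the failure
  would concentrate at one point, near which \<open>\<kappa>\<close> has a differentiable lift.\<close>

lemma \<kappa>_Lipschitz:
  assumes L: "compact L" "L \<subseteq> U"
  obtains c where "c > 0" "\<And>x y z. x \<in> L \<Longrightarrow> y \<in> L \<Longrightarrow> z \<in> pibox \<Longrightarrow> \<kappa> x - \<kappa> y = proj z \<Longrightarrow> norm z \<le> c * norm (x - y)"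
proof -
  have "\<exists>c>0. \<forall>x\<in>L. \<forall>y\<in>L. \<forall>z\<in>pibox. \<kappa> x - \<kappa> y = proj z \<longrightarrow> norm z \<le> c * norm (x - y)"
  proof (rule ccontr)
    assume neg: "\<not> ?thesis"
    have "\<exists>x y z. x \<in> L \<and> y \<in> L \<and> z \<in> pibox \<and> \<kappa> x - \<kappa> y = proj z \<and> real (Suc n) * norm (x - y) < norm z" for n
    proof -
      have "real (Suc n) > 0" by simp
      with neg show ?thesis by (meson not_less)
    qed
    then obtain x y z where s: "\<And>n. x n \<in> L" "\<And>n. y n \<in> L" "\<And>n. z n \<in> pibox"
      "\<And>n. \<kappa> (x n) - \<kappa> (y n) = proj (z n)" "\<And>n. real (Suc n) * norm (x n - y n) < norm (z n)" by metis
    obtain B where B: "\<And>z::real^'n. z \<in> pibox \<Longrightarrow> norm z \<le> B"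
      using compact_imp_bounded[OF compact_pibox] bounded_iff by metis
    obtain p r where p: "p \<in> L" "strict_mono r" "(x \<circ> r) \<longlonglongrightarrow> p"
      using L(1) s(1) unfolding compact_def by metis
    have "(\<lambda>n. x n - y n) \<longlonglongrightarrow> 0"
    proof (rule Lim_null_comparison)
      have "norm (x n - y n) \<le> B * inverse (real (Suc n))" for n
        using s(5)[of n] B[OF s(3)[of n]] by (simp add: field_simps)
      then show "\<forall>\<^sub>F n in sequentially. norm (x n - y n) \<le> B * inverse (real (Suc n))" by simp
      show "(\<lambda>n. B * inverse (real (Suc n))) \<longlonglongrightarrow> 0"
        using tendsto_mult_right_zero[OF LIMSEQ_inverse_real_of_nat] by simp
    qed
    from LIMSEQ_subseq_LIMSEQ[OF this p(2)] have "(\<lambda>n. x (r n) - y (r n)) \<longlonglongrightarrow> 0" by (simp add: o_def)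
    from tendsto_diff[OF p(3) this] have yr: "(\<lambda>n. y (r n)) \<longlonglongrightarrow> p" by (simp add: o_def)
    have xr: "(\<lambda>n. x (r n)) \<longlonglongrightarrow> p" using p(3) by (simp add: o_def)
    have pU: "p \<in> U" using p L by blast
    obtain z0 where z0: "proj z0 = \<kappa> p" by (metis torus_cases)
    obtain W g where W: "open W" "p \<in> W" "W \<subseteq> U" "\<And>y. y \<in> W \<Longrightarrow> \<kappa> y = proj (g y)"
      "\<And>y. y \<in> W \<Longrightarrow> (g has_derivative D y) (at y)" using D_lift[OF pU z0] by metis
    obtain e where e: "e > 0" "cball p e \<subseteq> W" using W(1,2) open_contains_cball by blast
    have "\<exists>B\<ge>0. \<forall>m\<in>cball p e. norm (D m (axis i 1)) \<le> B" for i
    proof -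
      have sub: "cball p e \<subseteq> U" using e(2) W(3) by (rule subset_trans)
      show ?thesis
        by (rule compact_bounded_on[OF compact_cball continuous_on_subset[OF D_continuous[of "axis i 1"] sub]]) blast
    qed
    then obtain C where C: "\<And>i. C i \<ge> 0" "\<And>i m. m \<in> cball p e \<Longrightarrow> norm (D m (axis i 1)) \<le> C i" by metis
    define S where "S = (\<Sum>i\<in>UNIV. C i)"
    have on: "onorm (D m) \<le> S" if m: "m \<in> cball p e" for m
    proof (rule onorm_le)
      fix v
      have mU: "m \<in> U" using m e W by blast
      have "norm (D m v) \<le> (\<Sum>i\<in>UNIV. norm v * C i)"
        unfolding linear_sum_axis[OF linear_D[OF mU], of v]
        by (rule sum_norm_le) (use C m component_le_norm_cart[of v] in \<open>auto intro!: mult_mono\<close>)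
      then show "norm (D m v) \<le> S * norm v" unfolding S_def sum_distrib_right by (simp only: mult.commute)
    qed
    have gl: "norm (g a - g b) \<le> S * norm (a - b)" if "a \<in> cball p e" "b \<in> cball p e" for a b
    proof (rule differentiable_bound[OF convex_cball _ on that])
      fix m assume "m \<in> cball p e"
      then have "m \<in> W" using e by blast
      then show "(g has_derivative D m) (at m within cball p e)"
        by (rule has_derivative_at_withinI[OF W(5)])
    qed
    \<comment> \<open>\<open>S\<close> bounds the slope of the lift near \<open>p\<close>, so the
      failing constants \<open>Suc (r n)\<close> cannot exceed it.\<close>
    obtain M :: nat where M: "S < M" using reals_Archimedean2 by blast
    have "\<forall>\<^sub>F n in sequentially. dist (x (r n)) p < e" "\<forall>\<^sub>F n in sequentially. dist (y (r n)) p < e"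
      using tendstoD[OF xr e(1)] tendstoD[OF yr e(1)] by auto
    then have "\<forall>\<^sub>F n in sequentially. False"
      using eventually_ge_at_top[of M]
    proof eventually_elim
      case (elim n)
      have in1: "x (r n) \<in> cball p e" "y (r n) \<in> cball p e" using elim by (auto simp: dist_commute)
      then have in2: "x (r n) \<in> W" "y (r n) \<in> W" using e by auto
      have "proj (z (r n)) = proj (g (x (r n)) - g (y (r n)))"
        using s(4)[of "r n"] W(4)[OF in2(1)] W(4)[OF in2(2)] by (simp add: proj_diff)
      then have "norm (z (r n)) \<le> norm (g (x (r n)) - g (y (r n)))"
        by (rule pibox_norm_le[OF s(3)])
      also have "\<dots> \<le> S * norm (x (r n) - y (r n))" by (rule gl[OF in1])
      finally have 1: "real (Suc (r n)) * norm (x (r n) - y (r n)) < S * norm (x (r n) - y (r n))"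
        using s(5)[of "r n"] by linarith
      have "S \<le> real (Suc (r n))" using M elim(3) seq_suble[OF p(2), of n] by linarith
      then have "S * norm (x (r n) - y (r n)) \<le> real (Suc (r n)) * norm (x (r n) - y (r n))"
        by (rule mult_right_mono) simp
      with 1 show False by linarith
    qed
    then show False by simp
  qed
  then show thesis using that by blast
qed

text \<open>On the supports the distance on the torus is at most a constant times the distance in
  the chart, and this in turn is at most a constant times the length of the displacement seen by
  \<open>chk\<close>. The decay of \<open>chk\<close> thus passes to the torus, uniformly in
  \<open>h\<close>.\<close>

lemma Ker_decay:
  "\<exists>C\<ge>0. \<forall>h X Y z. 0 < h \<longrightarrow> z \<in> pibox \<longrightarrow> X - Y = proj z \<longrightarrow>
     h ^ CARD('n) * norm (Ker h X Y) * (1 + norm z / h) ^ N \<le> C"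
proof -
  obtain c where c: "c > 0" "\<And>x y z. x \<in> pre (supp \<theta>) \<Longrightarrow> y \<in> pre (supp \<theta>) \<Longrightarrow> z \<in> pibox \<Longrightarrow> \<kappa> x - \<kappa> y = proj z \<Longrightarrow> norm z \<le> c * norm (x - y)"
    using \<kappa>_Lipschitz[OF compact_pre\<theta> pre_sub] by blast
  obtain c' where c': "c' > 0" "\<And>m v. m \<in> pre (supp \<rho>) \<Longrightarrow> norm v \<le> c' * norm (D m v)"
    using inv_D_bounded by blast
  obtain C where C: "C \<ge> 0" "\<And>w. norm (chk \<eta> w) * (1 + norm w) ^ N \<le> C" using chk_decay[OF \<eta>] by blast
  obtain B1 where B1: "B1 \<ge> 0" "\<And>X. norm (\<theta> X) \<le> B1" using continuous_torus_bounded[OF cont_\<theta>] by blast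
  obtain B2 where B2: "B2 \<ge> 0" "\<And>m. norm (amp m) \<le> B2" using amp_bounded by blast
  obtain B3 where B3: "B3 \<ge> 0" "\<And>z. z \<in> Z \<Longrightarrow> norm (\<theta> (proj z) * of_real (1 / J (q z))) \<le> B3" using \<theta>J_bounded by blast
  define a where "a = max 1 (c * c')"
  have a: "a \<ge> 1" "c * c' \<le> a" by (auto simp: a_def)
  let ?B = "B1 * B2 * B3 * (a ^ N * C)"
  have "h ^ CARD('n) * norm (Ker h X Y) * (1 + norm z / h) ^ N \<le> ?B"
    if h: "0 < h" and z: "z \<in> pibox" "X - Y = proj z" for h X Y z
  proof (cases "Ker h X Y = 0")
    case True
    then show ?thesis using B1 B2 B3 C a by simp
  next
    case False
    let ?X = "crep X" and ?Y = "crep Y"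
    have Zs: "?X \<in> Z" "?Y \<in> Z" and nz: "\<theta> X \<noteq> 0" "\<theta> Y \<noteq> 0" "kap h (q ?X) (q ?Y) \<noteq> 0"
      using False by (auto simp: Ker_def Kz_def split: if_splits)
    let ?x = "q ?X" and ?y = "q ?Y"
    let ?m = "(1/2) *\<^sub>R (?x + ?y)"
    let ?w = "(1 / h) *\<^sub>R D ?m (?x - ?y)"
    have m: "?m \<in> pre (supp \<rho>)" using nz(3) by (intro amp_nonzero) (auto simp: kap_def)
    have x: "?x \<in> pre (supp \<theta>)" "?y \<in> pre (supp \<theta>)"
      using nz \<theta>_supp q_in[OF Zs(1)] q_in[OF Zs(2)] \<kappa>_q[OF Zs(1)] \<kappa>_q[OF Zs(2)] by (auto simp: pre_def)
    have "\<kappa> ?x - \<kappa> ?y = proj z" using \<kappa>_q[OF Zs(1)] \<kappa>_q[OF Zs(2)] z(2) by simp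
    then have "norm z \<le> c * norm (?x - ?y)" by (rule c(2)[OF x z(1)])
    also have "\<dots> \<le> c * (c' * norm (D ?m (?x - ?y)))"
      using c(1) by (intro mult_left_mono c'(2)[OF m]) auto
    also have "\<dots> \<le> a * norm (D ?m (?x - ?y))"
      using a(2) by (simp add: mult.assoc[symmetric] mult_right_mono)
    finally have "norm z / h \<le> a * norm ?w" using h by (simp add: divide_right_mono field_simps)
    then have "1 + norm z / h \<le> a * (1 + norm ?w)" using a(1) by (simp add: algebra_simps)
    then have p: "(1 + norm z / h) ^ N \<le> a ^ N * (1 + norm ?w) ^ N"
      unfolding power_mult_distrib[symmetric] using h by (intro power_mono) auto
    have "Ker h X Y = \<theta> X * amp ?m * chk \<eta> ?w * (\<theta> (proj ?Y) * of_real (1 / J ?y)) / of_real (h ^ CARD('n))"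
      using Zs by (simp add: Ker_def Kz_def kap_def mult_ac)
    then have "h ^ CARD('n) * norm (Ker h X Y) = norm (\<theta> X) * norm (amp ?m) * norm (chk \<eta> ?w) * norm (\<theta> (proj ?Y) * of_real (1 / J ?y))"
      using h by (simp only: norm_mult norm_divide norm_of_real) (simp add: norm_power)
    also have "\<dots> \<le> B1 * B2 * norm (chk \<eta> ?w) * B3"
      using B1 B2 B3(1) B3(2)[OF Zs(2)] by (intro mult_mono) auto
    finally have L: "h ^ CARD('n) * norm (Ker h X Y) \<le> B1 * B2 * norm (chk \<eta> ?w) * B3" .
    have "h ^ CARD('n) * norm (Ker h X Y) * (1 + norm z / h) ^ N
       \<le> (B1 * B2 * norm (chk \<eta> ?w) * B3) * (a ^ N * (1 + norm ?w) ^ N)"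
      by (rule mult_mono[OF L p]) (use h B1(1) B2(1) B3(1) in auto)
    also have "\<dots> = B1 * B2 * B3 * (a ^ N * (norm (chk \<eta> ?w) * (1 + norm ?w) ^ N))" by (simp add: mult_ac)
    also have "\<dots> \<le> ?B"
    proof (intro mult_left_mono C(2))
      show "0 \<le> a ^ N" using a by simp
      show "0 \<le> B1 * B2 * B3" using B1 B2 B3 by simp
    qed
    finally show ?thesis .
  qed
  moreover have "?B \<ge> 0" using B1 B2 B3 C a by simp
  ultimately show ?thesis by blast
qed

text \<open>The midpoint tends to \<open>q z'\<close> and the rescaled chart displacement to
  \<open>dq z' w'\<close>, which \<open>D\<close> maps back to \<open>w'\<close>; the two Jacobian
  factors cancel and the cut-offs are 1 where \<open>\<rho>\<close> is nonzero. No trace of the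
  chart remains apart from the weight \<open>\<rho>\<close>.\<close>

lemma Ker_limit:
  assumes h: "\<And>n. 0 < h n" "h \<longlonglongrightarrow> 0" and z: "z \<longlonglongrightarrow> z'" and w: "w \<longlonglongrightarrow> w'"
  shows "(\<lambda>n. of_real (h n ^ CARD('n)) * Ker (h n) (proj (z n)) (proj (z n - h n *\<^sub>R w n)))
    \<longlonglongrightarrow> of_real (\<rho> (proj z')) * charc k (proj z') * chk \<eta> w'"
proof -
  have hw: "(\<lambda>n. h n *\<^sub>R w n) \<longlonglongrightarrow> 0" using tendsto_scaleR[OF h(2) w] by simp
  have zw: "(\<lambda>n. z n - h n *\<^sub>R w n) \<longlonglongrightarrow> z'" using tendsto_diff[OF z hw] by simp
  have pz: "(\<lambda>n. proj (z n)) \<longlonglongrightarrow> proj z'" "(\<lambda>n. proj (z n - h n *\<^sub>R w n)) \<longlonglongrightarrow> proj z'"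
    using continuous_on_tendsto_compose[OF continuous_proj z] continuous_on_tendsto_compose[OF continuous_proj zw] by auto
  show ?thesis
  proof (cases "z' \<in> Z")
    \<comment> \<open>Off the patch both sides vanish: the support of the cut-off is closed and
      misses the limit point, so the kernel is eventually zero, and \<open>\<rho>\<close> is zero
      there.\<close>
    case False
    then have "proj z' \<notin> supp \<theta>" using \<theta>(2) by (auto simp: Z_def)
    moreover have op: "open (- supp \<theta>)" by (simp add: supp_def open_Compl)
    ultimately have "\<forall>\<^sub>F n in sequentially. proj (z n) \<in> - supp \<theta>"
      by (intro topological_tendstoD[OF pz(1) op]) simp
    then have ev: "\<forall>\<^sub>F n in sequentially. 0 = of_real (h n ^ CARD('n)) * Ker (h n) (proj (z n)) (proj (z n - h n *\<^sub>R w n))"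
    proof eventually_elim
      case (elim n)
      then have "\<theta> (proj (z n)) = 0" using \<theta>_supp by blast
      then show ?case unfolding Kz_proj by (simp add: Kz_def)
    qed
    moreover have "\<rho> (proj z') = 0"
      using False \<rho>(2) \<rho>_supp[of "proj z'"] by (auto simp: Z_def)
    ultimately show ?thesis using Lim_transform_eventually[OF tendsto_const ev] by simp
  next
    case True
    have evZ: "\<forall>\<^sub>F n in sequentially. z n \<in> Z" "\<forall>\<^sub>F n in sequentially. z n - h n *\<^sub>R w n \<in> Z"
      using topological_tendstoD[OF z open_Z True] topological_tendstoD[OF zw open_Z True] by auto
    have iq: "isCont q z'" using q_continuous open_Z True by (simp add: continuous_on_eq_continuous_at)
    let ?x = "\<lambda>n. q (z n)" and ?y = "\<lambda>n. q (z n - h n *\<^sub>R w n)"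
    have x: "?x \<longlonglongrightarrow> q z'" and y: "?y \<longlonglongrightarrow> q z'"
      using isCont_tendsto_compose[OF iq z] isCont_tendsto_compose[OF iq zw] by auto
    let ?m = "\<lambda>n. (1/2) *\<^sub>R (?x n + ?y n)"
    have m: "?m \<longlonglongrightarrow> q z'"
      using tendsto_scaleR[OF tendsto_const[of "1/2"] tendsto_add[OF x y]] by (simp flip: scaleR_2)
    have qU: "q z' \<in> U" by (rule q_in[OF True])
    have evm: "\<forall>\<^sub>F n in sequentially. ?m n \<in> U" by (rule topological_tendstoD[OF m open_U qU])
    let ?v = "\<lambda>n. (1 / h n) *\<^sub>R (?x n - ?y n)"
    have v: "?v \<longlonglongrightarrow> dq z' w'" by (rule strict_deriv_q[OF z True w h])
    have iD: "isCont (\<lambda>(m, v). D m v) (q z', dq z' w')"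
    proof -
      have "open (U \<times> (UNIV :: (real^'n) set))" by (intro open_Times open_U open_UNIV)
      then show ?thesis using D_joint_continuous qU by (simp add: continuous_on_eq_continuous_at)
    qed
    have Dv: "(\<lambda>n. D (?m n) (?v n)) \<longlonglongrightarrow> w'"
      using isCont_tendsto_compose[OF iD tendsto_Pair[OF m v]] dq_D(2)[OF qU \<kappa>_q[OF True, symmetric]] by simp
    have chk: "(\<lambda>n. chk \<eta> (D (?m n) (?v n))) \<longlonglongrightarrow> chk \<eta> w'"
      using continuous_on_tendsto_compose[OF chk_continuous[OF \<eta>] Dv] by simp
    have amp: "(\<lambda>n. amp (?m n)) \<longlonglongrightarrow> amp (q z')"
    proof -
      have "continuous_on U (\<lambda>m. of_real (\<rho> (\<kappa> m)) * charc k (\<kappa> m) * of_real (J m) :: complex)"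
        by (intro continuous_intros continuous_on_compose2[OF cont_\<rho> \<kappa>_continuous] \<kappa>_continuous J_continuous) auto
      then have "continuous_on U amp" by (rule continuous_on_eq) (simp add: amp_def)
      then have "isCont amp (q z')" using open_U qU by (simp add: continuous_on_eq_continuous_at)
      then show ?thesis by (rule isCont_tendsto_compose[OF _ m])
    qed
    have iJ: "isCont J (q z')" using J_continuous open_U qU by (simp add: continuous_on_eq_continuous_at)
    have Jy: "(\<lambda>n. complex_of_real (1 / J (?y n))) \<longlonglongrightarrow> of_real (1 / J (q z'))"
      using J_pos[OF qU] by (intro tendsto_of_real tendsto_divide tendsto_const isCont_tendsto_compose[OF iJ y]) simp
    have th: "(\<lambda>n. \<theta> (proj (z n))) \<longlonglongrightarrow> \<theta> (proj z')" "(\<lambda>n. \<theta> (proj (z n - h n *\<^sub>R w n))) \<longlonglongrightarrow> \<theta> (proj z')"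
      using continuous_on_tendsto_compose[OF cont_\<theta> pz(1)] continuous_on_tendsto_compose[OF cont_\<theta> pz(2)] by auto
    have "(\<lambda>n. \<theta> (proj (z n)) * \<theta> (proj (z n - h n *\<^sub>R w n)) * (amp (?m n) * chk \<eta> (D (?m n) (?v n))) * of_real (1 / J (?y n)))
      \<longlonglongrightarrow> \<theta> (proj z') * \<theta> (proj z') * (amp (q z') * chk \<eta> w') * of_real (1 / J (q z'))"
      by (intro tendsto_mult th amp chk Jy)
    moreover have "\<theta> (proj z') * \<theta> (proj z') * (amp (q z') * chk \<eta> w') * of_real (1 / J (q z'))
        = of_real (\<rho> (proj z')) * charc k (proj z') * chk \<eta> w'"
      using qU J_pos[OF qU] \<kappa>_q[OF True] \<theta>(3)[of "proj z'"] by (cases "\<rho> (proj z') = 0") (auto simp: amp_def)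
    moreover have "\<forall>\<^sub>F n in sequentially. \<theta> (proj (z n)) * \<theta> (proj (z n - h n *\<^sub>R w n)) * (amp (?m n) * chk \<eta> (D (?m n) (?v n))) * of_real (1 / J (?y n))
        = of_real (h n ^ CARD('n)) * Ker (h n) (proj (z n)) (proj (z n - h n *\<^sub>R w n))"
      using evZ evm
    proof eventually_elim
      case (elim n)
      have "D (?m n) (?v n) = (1 / h n) *\<^sub>R D (?m n) (?x n - ?y n)"
        by (rule linear_scale[OF linear_D[OF elim(3)]])
      then show ?case unfolding Kz_proj using elim h(1)[of n] by (simp add: Kz_def kap_def)
    qed
    ultimately show ?thesis by (simp only: Lim_transform_eventually)
  qed
qed

end

section \<open>Properties of quantization kernels that are independent of all choices\<close>

section \<open>The kernel of a quantization\<close>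

text \<open>The properties of the kernel of \<open>op\<^sub>h\<close> of the symbol \<open>tsym k \<eta>\<close> that do not depend on the
  choice of patches and cut-offs.\<close>

definition semiclassical_kernel ::
  "int^'n::finite \<Rightarrow> ((real^'n) \<Rightarrow> complex) \<Rightarrow> (real \<Rightarrow> 'n torus \<Rightarrow> 'n torus \<Rightarrow> complex) \<Rightarrow> bool" where
  "semiclassical_kernel k \<eta> K \<longleftrightarrow>
     (\<forall>h>0. (\<lambda>(X, Y). K h X Y) \<in> borel_measurable (borel \<Otimes>\<^sub>M borel) \<and> (\<exists>B. \<forall>X Y. norm (K h X Y) \<le> B)) \<and>
     (\<forall>N. \<exists>C\<ge>0. \<forall>h X Y z. 0 < h \<longrightarrow> h \<le> 1 \<longrightarrow> z \<in> pibox \<longrightarrow> X - Y = proj z \<longrightarrow>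
        h ^ CARD('n) * norm (K h X Y) * (1 + norm z / h) ^ N \<le> C) \<and>
     (\<forall>h z z' w w'. (\<forall>n. 0 < h n \<and> h n \<le> 1) \<longrightarrow> h \<longlonglongrightarrow> 0 \<longrightarrow> z \<longlonglongrightarrow> z' \<longrightarrow> w \<longlonglongrightarrow> w' \<longrightarrow>
        (\<lambda>n. of_real (h n ^ CARD('n)) * K (h n) (proj (z n)) (proj (z n - h n *\<^sub>R w n)))
          \<longlonglongrightarrow> charc k (proj z') * chk \<eta> w')"

text \<open>Summing the kernels of the patches adds the weights of the partition, whose total is 1,
  so the rescaled limit no longer depends on the partition.\<close>

lemma quantization_kernel:
  fixes \<eta> :: "(real^'n::finite) \<Rightarrow> complex"
  assumes \<eta>: "\<eta> \<in> testf" and A: "weyl_quantization (tsym k \<eta>) A"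
  shows "\<exists>K. semiclassical_kernel k \<eta> K \<and>
    (\<forall>h>0. \<forall>v\<in>L2_torus. \<forall>X. A h v X = (LINT Y|torus_measure. K h X Y * v Y))"
proof -
  obtain N :: nat and U \<kappa> \<rho> \<theta> b where *:
    "(\<forall>j<N. b j = (\<lambda>(X, \<xi>). complex_of_real (\<rho> j X) * tsym k \<eta> (X, \<xi>))) \<and>
     (\<forall>j<N. coordinate_patch (U j) (\<kappa> j) \<and>
       \<rho> j \<in> Cc_inf_torus \<and> supp (\<rho> j) \<subseteq> \<kappa> j ` U j \<and> (\<forall>X. 0 \<le> \<rho> j X \<and> \<rho> j X \<le> 1) \<and>
       \<theta> j \<in> Cc_inf_torus \<and> supp (\<theta> j) \<subseteq> \<kappa> j ` U j \<and> (\<forall>X \<in> fst ` supp (b j). \<theta> j X = 1)) \<and>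
     (\<forall>X \<in> fst ` supp (tsym k \<eta>). (\<Sum>j<N. \<rho> j X) = 1) \<and>
     A = (\<lambda>h u X. \<Sum>j<N. weyl_patch (U j) (\<kappa> j) (\<theta> j) (b j) h u X)"
    using A unfolding weyl_quantization_def by (elim exE) (erule that)
  then have
    b: "\<And>j. j < N \<Longrightarrow> b j = (\<lambda>(X, \<xi>). complex_of_real (\<rho> j X) * tsym k \<eta> (X, \<xi>))"
    and ch: "\<And>j. j < N \<Longrightarrow> coordinate_patch (U j) (\<kappa> j)"
    and \<rho>: "\<And>j. j < N \<Longrightarrow> \<rho> j \<in> Cc_inf_torus" "\<And>j. j < N \<Longrightarrow> supp (\<rho> j) \<subseteq> \<kappa> j ` U j"
    and \<theta>: "\<And>j. j < N \<Longrightarrow> \<theta> j \<in> Cc_inf_torus" "\<And>j. j < N \<Longrightarrow> supp (\<theta> j) \<subseteq> \<kappa> j ` U j"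
      "\<And>j. j < N \<Longrightarrow> \<forall>X\<in>fst ` supp (b j). \<theta> j X = 1"
    and sum: "\<forall>X\<in>fst ` supp (tsym k \<eta>). (\<Sum>j<N. \<rho> j X) = 1"
    and A: "A = (\<lambda>h u X. \<Sum>j<N. weyl_patch (U j) (\<kappa> j) (\<theta> j) (b j) h u X)"
    by blast+
  show ?thesis
  proof (cases "\<exists>\<xi>0. \<eta> \<xi>0 \<noteq> 0")
    \<comment> \<open>The zero symbol has empty support, so the conditions on the partition and the
      cut-offs say nothing; the quantization is zero and has the zero kernel.\<close>
    case False
    then have e: "\<eta> = (\<lambda>_. 0)" by auto
    have "pullback_symbol (U j) (\<kappa> j) (b j) = (\<lambda>_. 0)" if "j < N" for j
      by (auto simp: b[OF that] pullback_symbol_def tsym_def e)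
    then have "A h v X = 0" for h v X
      unfolding A by (intro sum.neutral) (auto simp: weyl_patch_def weyl_def)
    moreover have "chk \<eta> w = 0" for w by (simp add: chk_def e)
    then have "semiclassical_kernel k \<eta> (\<lambda>_ _ _. 0)"
      unfolding semiclassical_kernel_def by auto
    ultimately show ?thesis by (intro exI[of _ "\<lambda>_ _ _. 0"]) auto
  next
    case True
    then obtain \<xi>0 where \<xi>0: "\<eta> \<xi>0 \<noteq> 0" by blast
    have cn: "charc k X \<noteq> 0" for X :: "'n torus" using norm_charc[of k X] by (metis norm_zero zero_neq_one)
    have t1: "\<theta> j X = 1" if "j < N" "\<rho> j X \<noteq> 0" for j X
    proof -
      have "b j (X, \<xi>0) \<noteq> 0" using that \<xi>0 cn by (simp add: b tsym_def)
      then have "(X, \<xi>0) \<in> supp (b j)" unfolding supp_def by (intro subsetD[OF closure_subset]) simp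
      then have "X \<in> fst ` supp (b j)" by (metis fst_conv image_eqI)
      then show ?thesis using \<theta>(3)[OF that(1)] by blast
    qed
    \<comment> \<open>A character never vanishes, so the support of a nonzero elementary symbol
      projects onto the whole torus and the partition sums to 1 at every point.\<close>
    have one: "(\<Sum>j<N. \<rho> j X) = 1" for X
    proof -
      have "tsym k \<eta> (X, \<xi>0) \<noteq> 0" using \<xi>0 cn by (simp add: tsym_def)
      then have "(X, \<xi>0) \<in> supp (tsym k \<eta>)" unfolding supp_def by (intro subsetD[OF closure_subset]) simp
      then have "X \<in> fst ` supp (tsym k \<eta>)" by (metis fst_conv image_eqI)
      then show ?thesis using sum by blast
    qed
    have wc: "weyl_chart (U j) (\<kappa> j) (\<rho> j) (\<theta> j) \<eta>" if "j < N" for j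
      by unfold_locales (use that ch \<rho> \<theta> t1 \<eta> in auto)
    define K where "K h X Y = (\<Sum>j<N. weyl_chart.Ker (U j) (\<kappa> j) (\<rho> j) (\<theta> j) k \<eta> h X Y)" for h X Y
    have "semiclassical_kernel k \<eta> K"
      unfolding semiclassical_kernel_def
    proof (intro conjI allI impI)
      fix h :: real assume h: "h > 0"
      have "(\<lambda>p. weyl_chart.Ker (U j) (\<kappa> j) (\<rho> j) (\<theta> j) k \<eta> h (fst p) (snd p)) \<in> borel_measurable (borel \<Otimes>\<^sub>M borel)" if "j < N" for j
        using weyl_chart.meas_Ker[OF wc[OF that], of k h] by (simp add: case_prod_unfold)
      then show "(\<lambda>(X, Y). K h X Y) \<in> borel_measurable (borel \<Otimes>\<^sub>M borel)"
        unfolding K_def case_prod_unfold by (intro borel_measurable_sum) auto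
      have "\<exists>B. \<forall>X Y. norm (weyl_chart.Ker (U j) (\<kappa> j) (\<rho> j) (\<theta> j) k \<eta> h X Y) \<le> B" if "j < N" for j
        using weyl_chart.Ker_bounded[OF wc[OF that] h, of k] by metis
      then obtain B where B: "\<And>j X Y. j < N \<Longrightarrow> norm (weyl_chart.Ker (U j) (\<kappa> j) (\<rho> j) (\<theta> j) k \<eta> h X Y) \<le> B j"
        by metis
      have "norm (K h X Y) \<le> (\<Sum>j<N. B j)" for X Y
        unfolding K_def by (rule sum_norm_le) (use B in auto)
      then show "\<exists>B. \<forall>X Y. norm (K h X Y) \<le> B" by blast
    next
      fix M :: nat
      have "\<exists>C\<ge>0. \<forall>h X Y z. 0 < h \<longrightarrow> z \<in> pibox \<longrightarrow> X - Y = proj z \<longrightarrow>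
         h ^ CARD('n) * norm (weyl_chart.Ker (U j) (\<kappa> j) (\<rho> j) (\<theta> j) k \<eta> h X Y) * (1 + norm z / h) ^ M \<le> C" if "j < N" for j
        by (rule weyl_chart.Ker_decay[OF wc[OF that]])
      then obtain C where C: "\<And>j. j < N \<Longrightarrow> C j \<ge> 0"
        "\<And>j h X Y z. j < N \<Longrightarrow> 0 < h \<Longrightarrow> z \<in> pibox \<Longrightarrow> X - Y = proj z \<Longrightarrow>
         h ^ CARD('n) * norm (weyl_chart.Ker (U j) (\<kappa> j) (\<rho> j) (\<theta> j) k \<eta> h X Y) * (1 + norm z / h) ^ M \<le> C j"
        by metis
      have "h ^ CARD('n) * norm (K h X Y) * (1 + norm z / h) ^ M \<le> (\<Sum>j<N. C j)"
        if h: "0 < h" and z: "z \<in> pibox" "X - Y = proj z" for h X Y z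
      proof -
        have "norm (K h X Y) \<le> (\<Sum>j<N. norm (weyl_chart.Ker (U j) (\<kappa> j) (\<rho> j) (\<theta> j) k \<eta> h X Y))"
          unfolding K_def by (rule norm_sum)
        then have "h ^ CARD('n) * norm (K h X Y) * (1 + norm z / h) ^ M
          \<le> h ^ CARD('n) * (\<Sum>j<N. norm (weyl_chart.Ker (U j) (\<kappa> j) (\<rho> j) (\<theta> j) k \<eta> h X Y)) * (1 + norm z / h) ^ M"
          using h by (intro mult_right_mono mult_left_mono) auto
        also have "\<dots> = (\<Sum>j<N. h ^ CARD('n) * norm (weyl_chart.Ker (U j) (\<kappa> j) (\<rho> j) (\<theta> j) k \<eta> h X Y) * (1 + norm z / h) ^ M)"
          by (simp add: sum_distrib_left sum_distrib_right)
        also have "\<dots> \<le> (\<Sum>j<N. C j)" by (intro sum_mono C h z) auto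
        finally show ?thesis .
      qed
      moreover have "(\<Sum>j<N. C j) \<ge> 0" by (intro sum_nonneg C) auto
      ultimately show "\<exists>C\<ge>0. \<forall>h X Y z. 0 < h \<longrightarrow> h \<le> 1 \<longrightarrow> z \<in> pibox \<longrightarrow> X - Y = proj z \<longrightarrow>
          h ^ CARD('n) * norm (K h X Y) * (1 + norm z / h) ^ M \<le> C" by blast
    next
      fix h :: "nat \<Rightarrow> real" and z w :: "nat \<Rightarrow> real^'n" and z' w'
      assume h: "\<forall>n. 0 < h n \<and> h n \<le> 1" "h \<longlonglongrightarrow> 0" and z: "z \<longlonglongrightarrow> z'" and w: "w \<longlonglongrightarrow> w'"
      have "(\<lambda>n. \<Sum>j<N. of_real (h n ^ CARD('n)) * weyl_chart.Ker (U j) (\<kappa> j) (\<rho> j) (\<theta> j) k \<eta> (h n) (proj (z n)) (proj (z n - h n *\<^sub>R w n)))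
        \<longlonglongrightarrow> (\<Sum>j<N. of_real (\<rho> j (proj z')) * charc k (proj z') * chk \<eta> w')"
        by (intro tendsto_sum weyl_chart.Ker_limit wc) (use h z w in auto)
      also have "(\<Sum>j<N. of_real (\<rho> j (proj z')) * charc k (proj z') * chk \<eta> w') = of_real (\<Sum>j<N. \<rho> j (proj z')) * (charc k (proj z') * chk \<eta> w')"
        by (simp add: sum_distrib_right mult.assoc)
      finally show "(\<lambda>n. of_real (h n ^ CARD('n)) * K (h n) (proj (z n)) (proj (z n - h n *\<^sub>R w n))) \<longlonglongrightarrow> charc k (proj z') * chk \<eta> w'"
        by (simp add: one K_def sum_distrib_left)
    qed
    moreover have "A h v X = (LINT Y|torus_measure. K h X Y * v Y)" if h: "h > 0" and v: "v \<in> L2_torus" for h v X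
    proof -
      have i: "integrable torus_measure (\<lambda>Y. weyl_chart.Ker (U j) (\<kappa> j) (\<rho> j) (\<theta> j) k \<eta> h X Y * v Y)" if jN: "j < N" for j
      proof -
        obtain B where B: "\<And>X Y. norm (weyl_chart.Ker (U j) (\<kappa> j) (\<rho> j) (\<theta> j) k \<eta> h X Y) \<le> B"
          using weyl_chart.Ker_bounded[OF wc[OF jN] h, of k] by metis
        have "(\<lambda>Y. (\<lambda>(X, Y). weyl_chart.Ker (U j) (\<kappa> j) (\<rho> j) (\<theta> j) k \<eta> h X Y) (X, Y)) \<in> borel_measurable borel"
          by (rule measurable_compose[OF _ weyl_chart.meas_Ker[OF wc[OF jN]]]) measurable
        then have "(\<lambda>Y. weyl_chart.Ker (U j) (\<kappa> j) (\<rho> j) (\<theta> j) k \<eta> h X Y) \<in> borel_measurable borel" by simp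
        from L2_mult_bounded[OF v this B] show ?thesis by (rule L2_integrable)
      qed
      have "A h v X = (\<Sum>j<N. LINT Y|torus_measure. weyl_chart.Ker (U j) (\<kappa> j) (\<rho> j) (\<theta> j) k \<eta> h X Y * v Y)"
        unfolding A
      proof (intro sum.cong refl)
        fix j assume "j \<in> {..<N}"
        then have j: "j < N" by simp
        show "weyl_patch (U j) (\<kappa> j) (\<theta> j) (b j) h v X = (LINT Y|torus_measure. weyl_chart.Ker (U j) (\<kappa> j) (\<rho> j) (\<theta> j) k \<eta> h X Y * v Y)"
          unfolding b[OF j] by (rule weyl_chart.patch_kernel[OF wc[OF j] h v])
      qed
      also have "\<dots> = (LINT Y|torus_measure. K h X Y * v Y)"
        unfolding K_def sum_distrib_right by (intro Bochner_Integration.integral_sum[symmetric] i) auto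
      finally show ?thesis .
    qed
    ultimately show ?thesis by (intro exI[of _ K] conjI allI impI ballI)
  qed
qed

section \<open>Integrable majorants and boundedness of quadratic forms by Schur's test\<close>

section \<open>Schur's test on the torus\<close>

text \<open>Dyadic comparison: where 1 plus the norm is about 2^j, the function is at most
  2^(-j(d+1)), while the ball of radius 2^(j+1) has volume at most a constant times 2^(jd). The
  products form a geometric series.\<close>

lemma decay_integrable: "(\<integral>\<^sup>+(w::real^'n). ennreal (1 / (1 + norm w) ^ (CARD('n) + 1)) \<partial>lborel) < \<infinity>"
proof -
  let ?d = "CARD('n)"
  have ball: "emeasure lborel (cball (0::real^'n) r) \<le> ennreal ((2 * r) ^ ?d)" if r: "r > 0" for r
  proof -
    let ?b = "(\<chi> i. r) :: real^'n"
    have "cbox (- ?b) ?b \<noteq> {}" using r by (auto simp: interval_eq_empty_cart)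
    then have "measure lborel (cbox (- ?b) ?b) = (2 * r) ^ ?d"
      by (subst content_cbox_cart) auto
    then have b: "emeasure lborel (cbox (- ?b) ?b) = ennreal ((2 * r) ^ ?d)"
      using emeasure_lborel_cbox_finite[of "- ?b" ?b] by (subst emeasure_eq_ennreal_measure) auto
    have "cball (0::real^'n) r \<subseteq> cbox (- ?b) ?b"
    proof
      fix w :: "real^'n" assume w: "w \<in> cball 0 r"
      have "\<bar>w $ i\<bar> \<le> r" for i using component_le_norm_cart[of w i] w by simp
      then show "w \<in> cbox (- ?b) ?b" by (auto simp: mem_box_cart abs_le_iff minus_le_iff)
    qed
    then have "emeasure lborel (cball (0::real^'n) r) \<le> emeasure lborel (cbox (- ?b) ?b)"
      by (rule emeasure_mono) simp
    then show ?thesis unfolding b .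
  qed
  let ?a = "\<lambda>j::nat. (1 / 2 ^ j) ^ (?d + 1) :: real"
  let ?S = "\<lambda>j::nat. cball (0::real^'n) (2 ^ (j + 1))"
  have pw: "ennreal (1 / (1 + norm w) ^ (?d + 1)) \<le> (\<Sum>j. ennreal (?a j) * indicator (?S j) w)" for w :: "real^'n"
  proof -
    \<comment> \<open>The dyadic index of \<open>w\<close>: 1 plus the norm lies between 2^j and
      2^(j+1).\<close>
    define j where "j = nat \<lfloor>log 2 (1 + norm w)\<rfloor>"
    have l0: "0 \<le> log 2 (1 + norm w)" by (subst zero_le_log_cancel_iff) (auto simp: add_pos_nonneg)
    have "real j \<le> log 2 (1 + norm w)" "log 2 (1 + norm w) < real (j + 1)"
      using l0 unfolding j_def by linarith+
    then have "2 powr real j \<le> 1 + norm w" "1 + norm w < 2 powr real (j + 1)"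
      by (simp_all add: le_log_iff log_less_iff add_pos_nonneg)
    then have j: "2 ^ j \<le> 1 + norm w" "1 + norm w < 2 ^ (j + 1)"
      by (simp_all only: powr_realpow zero_less_numeral)
    have "1 / (1 + norm w) \<le> 1 / 2 ^ j"
      using j(1) by (intro divide_left_mono) (auto intro!: mult_pos_pos add_pos_nonneg)
    then have "(1 / (1 + norm w)) ^ (?d + 1) \<le> ?a j" by (intro power_mono) auto
    then have 1: "ennreal (1 / (1 + norm w) ^ (?d + 1)) \<le> ennreal (?a j) * indicator (?S j) w"
      using j(2) by (simp add: power_one_over indicator_def ennreal_leI)
    define T where "T i = ennreal (?a i) * indicator (?S i) w" for i
    have "T j = (\<Sum>i\<in>{j}. T i)" by simp
    also have "\<dots> \<le> (\<Sum>i. T i)" by (rule sum_le_suminf) auto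
    finally show ?thesis using 1 unfolding T_def by (rule order_trans[rotated])
  qed
  have "(\<integral>\<^sup>+(w::real^'n). ennreal (1 / (1 + norm w) ^ (?d + 1)) \<partial>lborel) \<le> (\<integral>\<^sup>+w. (\<Sum>j. ennreal (?a j) * indicator (?S j) w) \<partial>lborel)"
    by (rule nn_integral_mono) (rule pw)
  also have "\<dots> = (\<Sum>j. \<integral>\<^sup>+w. ennreal (?a j) * indicator (?S j) w \<partial>lborel)"
    by (intro nn_integral_suminf borel_measurable_times_ennreal borel_measurable_const borel_measurable_indicator) auto
  also have "\<dots> = (\<Sum>j. ennreal (?a j) * emeasure lborel (?S j))"
    by (simp add: nn_integral_cmult_indicator)
  also have "\<dots> \<le> (\<Sum>j. ennreal (4 ^ ?d * (1 / 2) ^ j))"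
  proof (rule suminf_le)
    fix j
    have "ennreal (?a j) * emeasure lborel (?S j) \<le> ennreal (?a j) * ennreal ((2 * 2 ^ (j + 1)) ^ ?d)"
      by (intro mult_left_mono ball) auto
    also have "\<dots> = ennreal (?a j * (2 * 2 ^ (j + 1)) ^ ?d)" by (rule ennreal_mult[symmetric]) auto
    also have "?a j * (2 * 2 ^ (j + 1)) ^ ?d = 4 ^ ?d * (1 / 2) ^ j"
    proof -
      have e1: "(1 / 2 ^ j) ^ ?d * (2 ^ j) ^ ?d = (1::real)"
        unfolding power_mult_distrib[symmetric] by simp
      have e2: "2 * 2 ^ (j + 1) = 4 * (2::real) ^ j" by simp
      have "?a j * (2 * 2 ^ (j + 1)) ^ ?d = ((1 / 2 ^ j) ^ ?d * (2 ^ j) ^ ?d) * (4 ^ ?d * (1 / 2 ^ j))"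
        by (subst e2) (simp only: power_mult_distrib[of 4] power_add power_one_right mult_ac)
      then show ?thesis unfolding e1 by (simp add: power_one_over)
    qed
    finally show "ennreal (?a j) * emeasure lborel (?S j) \<le> ennreal (4 ^ ?d * (1 / 2) ^ j)" .
  qed auto
  also have "\<dots> = ennreal (\<Sum>j. 4 ^ ?d * (1 / 2) ^ j)"
    by (intro suminf_ennreal2 summable_mult summable_geometric) auto
  also have "\<dots> < \<infinity>" by simp
  finally show ?thesis .
qed

lemma decay_tail:
  assumes "e > 0"
  shows "\<exists>R. (\<integral>\<^sup>+(w::real^'n). ennreal (1 / (1 + norm w) ^ (CARD('n) + 1)) * indicator {w. R < norm w} w \<partial>lborel) \<le> ennreal e"
proof -
  let ?f = "\<lambda>w::real^'n. 1 / (1 + norm w) ^ (CARD('n) + 1)"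
  have fpos: "?f w \<ge> 0" for w by simp
  have fi: "integrable lborel ?f"
    by (rule integrableI_bounded) (use decay_integrable in auto)
  have "(\<lambda>n. LINT w|lborel. ?f w * indicator {w. real n < norm w} w) \<longlonglongrightarrow> (LINT w|(lborel :: (real^'n) measure). 0)"
  proof (rule integral_dominated_convergence[OF _ _ fi])
    show "AE w in lborel. (\<lambda>n. ?f w * indicator {w. real n < norm w} w) \<longlonglongrightarrow> 0"
    proof (rule AE_I2)
      fix w :: "real^'n"
      obtain M :: nat where "norm w < M" using reals_Archimedean2 by blast
      then have "\<forall>n\<ge>M. ?f w * indicator {w. real n < norm w} w = 0" by (auto simp: indicator_def)
      then show "(\<lambda>n. ?f w * indicator {w. real n < norm w} w) \<longlonglongrightarrow> 0"
        by (intro tendsto_eventually) (auto simp: eventually_sequentially intro!: exI[of _ M])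
    qed
  qed (auto simp: indicator_def)
  then have "(\<lambda>n. LINT w|lborel. ?f w * indicator {w. real n < norm w} w) \<longlonglongrightarrow> 0" by simp
  from order_tendstoD(2)[OF this assms]
  obtain n where n: "(LINT w|lborel. ?f w * indicator {w. real n < norm w} w) < e"
    by (auto simp: eventually_sequentially)
  have gi: "integrable lborel (\<lambda>w. ?f w * indicator {w. real n < norm w} w)"
    by (rule Bochner_Integration.integrable_bound[OF fi]) (auto simp: indicator_def)
  have "(\<integral>\<^sup>+w. ennreal (?f w) * indicator {w. real n < norm w} w \<partial>lborel) = (\<integral>\<^sup>+w. ennreal (?f w * indicator {w. real n < norm w} w) \<partial>lborel)"
    by (intro nn_integral_cong) (simp add: indicator_def)
  also have "\<dots> = ennreal (LINT w|lborel. ?f w * indicator {w. real n < norm w} w)"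
    by (rule nn_integral_eq_integral[OF gi]) simp
  also have "\<dots> \<le> ennreal e" using n by (intro ennreal_leI) simp
  finally show ?thesis by blast
qed

lemma measurable_torus_diff [measurable]: "(\<lambda>(X, Y). X - Y) \<in> borel \<Otimes>\<^sub>M borel \<rightarrow>\<^sub>M (borel :: 'n::finite torus measure)"
proof -
  have "(\<lambda>p. proj (crep (fst p) - crep (snd p))) \<in> borel \<Otimes>\<^sub>M borel \<rightarrow>\<^sub>M (borel :: 'n torus measure)"
    by measurable
  then show ?thesis by (simp add: proj_diff case_prod_unfold)
qed

lemma norm_crep: "z \<in> pibox \<Longrightarrow> proj z = X \<Longrightarrow> norm (crep X) = norm z"
  using pibox_norm_le[of z "crep X"] pibox_norm_le[of "crep X" z] by simp

lemma norm_crep_minus: "norm (crep (- X)) = norm (crep X)"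
proof -
  have "- crep X \<in> pibox" using crep_pibox[of X] by (simp add: pibox_def)
  moreover have "proj (- crep X) = - X" using proj_diff[of 0 "crep X"] by (simp add: proj_0)
  ultimately show ?thesis using norm_crep by fastforce
qed

lemma nn_integral_scale_cart:
  fixes f :: "real^'n \<Rightarrow> ennreal"
  assumes h: "h > 0" and [measurable]: "f \<in> borel_measurable borel"
  shows "(\<integral>\<^sup>+x. f x \<partial>lborel) = ennreal (h ^ CARD('n)) * (\<integral>\<^sup>+w. f (p + h *\<^sub>R w) \<partial>lborel)"
proof -
  have "(\<integral>\<^sup>+x. f x \<partial>lborel) = (\<integral>\<^sup>+x. f x \<partial>density (distr lborel borel (\<lambda>w. p + h *\<^sub>R w)) (\<lambda>_. ennreal (\<bar>h\<bar> ^ DIM(real^'n))))"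
    using lborel_affine[of h p] h by simp
  also have "\<dots> = (\<integral>\<^sup>+x. ennreal (\<bar>h\<bar> ^ DIM(real^'n)) * f x \<partial>distr lborel borel (\<lambda>w. p + h *\<^sub>R w))"
    by (rule nn_integral_density) auto
  also have "\<dots> = (\<integral>\<^sup>+w. ennreal (\<bar>h\<bar> ^ DIM(real^'n)) * f (p + h *\<^sub>R w) \<partial>lborel)"
    by (rule nn_integral_distr) auto
  also have "\<dots> = ennreal (h ^ CARD('n)) * (\<integral>\<^sup>+w. f (p + h *\<^sub>R w) \<partial>lborel)"
    using h by (subst nn_integral_cmult) auto
  finally show ?thesis .
qed

text \<open>Translation by the centre \<open>p\<close> of the fundamental cube makes it the centred
  cube, on which the distance is the Euclidean norm. Enlarging the cube to the whole space and
  rescaling by \<open>h\<close> removes the factor \<open>h ^ CARD('n)\<close>.\<close>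

lemma nn_integral_crep:
  fixes \<gamma> :: "real \<Rightarrow> real"
  assumes h: "h > 0" and [measurable]: "\<gamma> \<in> borel_measurable borel" and \<gamma>: "\<And>s. 0 \<le> \<gamma> s"
  shows "(\<integral>\<^sup>+Z. ennreal (\<gamma> (norm (crep (Z :: 'n::finite torus)) / h) / h ^ CARD('n)) \<partial>torus_measure)
    \<le> (\<integral>\<^sup>+(w::real^'n). ennreal (\<gamma> (norm w)) \<partial>lborel)"
proof -
  let ?\<Psi> = "\<lambda>Z::'n torus. ennreal (\<gamma> (norm (crep Z) / h) / h ^ CARD('n))"
  define p :: "real^'n" where "p = (\<chi> i. pi)"
  have "(\<integral>\<^sup>+Z. ?\<Psi> Z \<partial>torus_measure) = (\<integral>\<^sup>+Z. ?\<Psi> (Z + proj (- p)) \<partial>torus_measure)"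
    by (rule nn_integral_torus_translate[symmetric]) measurable
  also have "\<dots> = (\<integral>\<^sup>+x. indicator qcube x * ?\<Psi> (proj x + proj (- p)) \<partial>lborel)"
    by (rule nn_integral_torus) measurable
  also have "\<dots> \<le> (\<integral>\<^sup>+x. ennreal (\<gamma> (norm (x - p) / h) / h ^ CARD('n)) \<partial>lborel)"
  proof (rule nn_integral_mono)
    fix x :: "real^'n"
    show "indicator qcube x * ?\<Psi> (proj x + proj (- p)) \<le> ennreal (\<gamma> (norm (x - p) / h) / h ^ CARD('n))"
    proof (cases "x \<in> qcube")
      case True
      have "\<bar>x $ i - pi\<bar> \<le> pi" for i
      proof -
        have "0 \<le> x $ i" "x $ i < 2 * pi" using True by (auto simp: qcube_def)
        then show ?thesis by linarith
      qed
      then have "x - p \<in> pibox" by (simp add: pibox_def p_def)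
      moreover have "proj (x - p) = proj x + proj (- p)" by (simp flip: proj_add)
      ultimately show ?thesis using True by (simp add: norm_crep)
    qed simp
  qed
  also have "\<dots> = ennreal (h ^ CARD('n)) * (\<integral>\<^sup>+w. ennreal (\<gamma> (norm ((p + h *\<^sub>R w) - p) / h) / h ^ CARD('n)) \<partial>(lborel :: (real^'n) measure))"
    by (rule nn_integral_scale_cart[OF h]) measurable
  also have "\<dots> = ennreal (h ^ CARD('n)) * (\<integral>\<^sup>+w. ennreal (\<gamma> (norm w) / h ^ CARD('n)) \<partial>(lborel :: (real^'n) measure))"
    using h by simp
  also have "\<dots> = (\<integral>\<^sup>+w. ennreal (h ^ CARD('n)) * ennreal (\<gamma> (norm w) / h ^ CARD('n)) \<partial>(lborel :: (real^'n) measure))"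
    by (rule nn_integral_cmult[symmetric]) measurable
  also have "\<dots> = (\<integral>\<^sup>+w. ennreal (\<gamma> (norm w)) \<partial>(lborel :: (real^'n) measure))"
    using h \<gamma> by (intro nn_integral_cong) (simp flip: ennreal_mult)
  finally show ?thesis .
qed

definition Kop :: "('n::finite torus \<Rightarrow> 'n torus \<Rightarrow> complex) \<Rightarrow> ('n torus \<Rightarrow> complex) \<Rightarrow> 'n torus \<Rightarrow> complex" where
  "Kop K v X = (LINT Y|torus_measure. K X Y * v Y)"

lemma measurable_section:
  assumes "(\<lambda>(X, Y). K X Y) \<in> borel_measurable (borel \<Otimes>\<^sub>M borel)"
  shows "K X \<in> borel_measurable borel"
proof -
  have "(\<lambda>Y. (\<lambda>(X, Y). K X Y) (X, Y)) \<in> borel_measurable borel"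
    by (rule measurable_compose[OF _ assms]) measurable
  then show ?thesis by simp
qed

lemma Kop_integrable:
  fixes K :: "'n::finite torus \<Rightarrow> 'n torus \<Rightarrow> complex"
  assumes K: "(\<lambda>(X, Y). K X Y) \<in> borel_measurable (borel \<Otimes>\<^sub>M borel)" "\<And>X Y. norm (K X Y) \<le> B" and v: "v \<in> L2_torus"
  shows "integrable torus_measure (\<lambda>Y. K X Y * v Y)"
  by (rule L2_integrable[OF L2_mult_bounded[OF v measurable_section[OF K(1)] K(2)]])

lemma Kop_norm:
  fixes K :: "'n::finite torus \<Rightarrow> 'n torus \<Rightarrow> complex"
  assumes K: "(\<lambda>(X, Y). K X Y) \<in> borel_measurable (borel \<Otimes>\<^sub>M borel)" "\<And>X Y. norm (K X Y) \<le> B" and v: "v \<in> L2_torus"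
  shows "norm (Kop K v X) \<le> B * (LINT Y|torus_measure. norm (v Y))"
proof -
  have "norm (Kop K v X) \<le> (LINT Y|torus_measure. norm (K X Y * v Y))"
    unfolding Kop_def by (rule integral_norm_bound)
  also have "\<dots> \<le> (LINT Y|torus_measure. B * norm (v Y))"
    by (intro integral_mono integrable_norm Kop_integrable[OF K v] Bochner_Integration.integrable_mult_right L2_integrable[OF v])
       (auto simp: norm_mult intro!: mult_right_mono K)
  finally show ?thesis by simp
qed

lemma Kop_L2:
  fixes K :: "'n::finite torus \<Rightarrow> 'n torus \<Rightarrow> complex"
  assumes K: "(\<lambda>(X, Y). K X Y) \<in> borel_measurable (borel \<Otimes>\<^sub>M borel)" "\<And>X Y. norm (K X Y) \<le> B" and v: "v \<in> L2_torus"
  shows "Kop K v \<in> L2_torus"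
proof (rule L2_bounded[OF _ Kop_norm[OF K v]])
  have [measurable]: "v \<in> borel_measurable borel" by (rule L2_torus_measurable[OF v])
  have [measurable]: "(\<lambda>p. K (fst p) (snd p)) \<in> borel_measurable (borel \<Otimes>\<^sub>M borel)"
    using K(1) by (simp add: case_prod_unfold)
  have "(\<lambda>(X, Y). K X Y * v Y) \<in> borel_measurable (borel \<Otimes>\<^sub>M torus_measure)"
    unfolding case_prod_unfold by measurable
  then show "Kop K v \<in> borel_measurable borel"
    unfolding Kop_def[abs_def] by (rule torus.borel_measurable_lebesgue_integral)
qed

lemma Kop_diff:
  fixes K K' :: "'n::finite torus \<Rightarrow> 'n torus \<Rightarrow> complex"
  assumes "(\<lambda>(X, Y). K X Y) \<in> borel_measurable (borel \<Otimes>\<^sub>M borel)" "\<And>X Y. norm (K X Y) \<le> B"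
    "(\<lambda>(X, Y). K' X Y) \<in> borel_measurable (borel \<Otimes>\<^sub>M borel)" "\<And>X Y. norm (K' X Y) \<le> B'" "v \<in> L2_torus"
  shows "Kop (\<lambda>X Y. K X Y - K' X Y) v = (\<lambda>X. Kop K v X - Kop K' v X)"
  unfolding Kop_def left_diff_distrib
  by (intro ext Bochner_Integration.integral_diff Kop_integrable[OF assms(1,2,5)] Kop_integrable[OF assms(3,4,5)])

text \<open>The kernel is dominated by a convolution kernel whose row integrals are at most
  \<open>G\<close>, and the column integrals are the same since the distance is even. Splitting the
  product of the two values of \<open>v\<close> by the arithmetic-geometric inequality leaves one
  row and one column integral.\<close>

lemma Schur:
  fixes E :: "'n::finite torus \<Rightarrow> 'n torus \<Rightarrow> complex" and \<gamma> :: "real \<Rightarrow> real"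
  assumes E: "(\<lambda>(X, Y). E X Y) \<in> borel_measurable (borel \<Otimes>\<^sub>M borel)" "\<And>X Y. norm (E X Y) \<le> B"
    and h: "h > 0" and [measurable]: "\<gamma> \<in> borel_measurable borel" and \<gamma>: "\<And>s. 0 \<le> \<gamma> s"
    and bound: "\<And>X Y. h ^ CARD('n) * norm (E X Y) \<le> \<gamma> (norm (crep (X - Y)) / h)"
    and G: "(\<integral>\<^sup>+(w::real^'n). ennreal (\<gamma> (norm w)) \<partial>lborel) \<le> ennreal G" "G \<ge> 0"
    and v: "v \<in> L2_torus"
  shows "norm (L2_inner (Kop E v) v) \<le> G * N2 v"
proof -
  note [measurable] = L2_torus_measurable[OF v]
  define \<Psi> :: "'n torus \<Rightarrow> ennreal" where "\<Psi> Z = ennreal (\<gamma> (norm (crep Z) / h) / h ^ CARD('n))" for Z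
  have [measurable]: "\<Psi> \<in> borel_measurable borel" unfolding \<Psi>_def by measurable
  have "(\<lambda>p. fst p - snd p) \<in> borel \<Otimes>\<^sub>M borel \<rightarrow>\<^sub>M (borel :: 'n torus measure)"
    using measurable_torus_diff by (simp add: case_prod_unfold)
  then have mpair [measurable]: "(\<lambda>p. \<Psi> (fst p - snd p)) \<in> borel_measurable (borel \<Otimes>\<^sub>M borel)"
    by (rule measurable_compose) measurable
  have msec [measurable]: "(\<lambda>Y. \<Psi> (X - Y)) \<in> borel_measurable borel" "(\<lambda>X. \<Psi> (X - Y)) \<in> borel_measurable borel" for X Y
    using measurable_compose[OF measurable_Pair1'[of X borel borel] mpair]
      measurable_compose[OF measurable_Pair2'[of Y borel borel] mpair] by simp_all
  have \<Psi>E: "ennreal (norm (E X Y)) \<le> \<Psi> (X - Y)" for X Y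
    unfolding \<Psi>_def using bound[of X Y] h by (intro ennreal_leI) (simp add: field_simps)
  have I: "(\<integral>\<^sup>+Z. \<Psi> Z \<partial>torus_measure) \<le> ennreal G"
    unfolding \<Psi>_def using nn_integral_crep[OF h _ \<gamma>] G(1) by (rule order_trans) measurable
  have I1: "(\<integral>\<^sup>+X. \<Psi> (X - Y) \<partial>torus_measure) \<le> ennreal G" for Y
    using nn_integral_torus_translate[of \<Psi> "- Y"] I by simp
  have sym: "\<Psi> (X - Y) = \<Psi> (Y - X)" for X Y
    using norm_crep_minus[of "X - Y"] by (simp add: \<Psi>_def)
  have I2: "(\<integral>\<^sup>+Y. \<Psi> (X - Y) \<partial>torus_measure) \<le> ennreal G" for X
    using I1[of X] by (subst sym)
  let ?n = "\<lambda>X. ennreal ((norm (v X))\<^sup>2)"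
  have nv: "(\<integral>\<^sup>+X. ?n X \<partial>torus_measure) = ennreal (N2 v)"
    unfolding N2_def by (rule nn_integral_eq_integral[OF L2_torus_square[OF v]]) simp
  have KL: "Kop E v \<in> L2_torus" by (rule Kop_L2[OF E v])
  have 1: "ennreal (norm (Kop E v X * cnj (v X))) \<le> (\<integral>\<^sup>+Y. \<Psi> (X - Y) * ennreal (norm (v Y)) * ennreal (norm (v X)) \<partial>torus_measure)" for X
  proof -
    have "ennreal (norm (Kop E v X)) \<le> (\<integral>\<^sup>+Y. ennreal (norm (E X Y * v Y)) \<partial>torus_measure)"
      unfolding Kop_def by (rule integral_norm_bound_ennreal[OF Kop_integrable[OF E v]])
    also have "\<dots> \<le> (\<integral>\<^sup>+Y. \<Psi> (X - Y) * ennreal (norm (v Y)) \<partial>torus_measure)"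
      by (intro nn_integral_mono) (simp add: norm_mult ennreal_mult mult_right_mono \<Psi>E)
    finally have "ennreal (norm (Kop E v X)) * ennreal (norm (v X)) \<le> (\<integral>\<^sup>+Y. \<Psi> (X - Y) * ennreal (norm (v Y)) \<partial>torus_measure) * ennreal (norm (v X))"
      by (rule mult_right_mono) simp
    also have "\<dots> = (\<integral>\<^sup>+Y. \<Psi> (X - Y) * ennreal (norm (v Y)) * ennreal (norm (v X)) \<partial>torus_measure)"
      by (rule nn_integral_multc[symmetric]) measurable
    finally show ?thesis by (simp add: norm_mult ennreal_mult)
  qed
  have am: "ennreal (norm (v Y)) * ennreal (norm (v X)) \<le> ennreal (1/2) * (?n X + ?n Y)" for X Y
  proof -
    have "norm (v Y) * norm (v X) \<le> (1/2) * ((norm (v X))\<^sup>2 + (norm (v Y))\<^sup>2)"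
      using prod_le_squares[of "norm (v Y)" "norm (v X)"] by simp
    from ennreal_leI[OF this] show ?thesis
      by (simp only: ennreal_mult[OF norm_ge_zero norm_ge_zero] ennreal_mult' ennreal_plus[OF zero_le_power2 zero_le_power2] zero_le_divide_1_iff zero_le_numeral)
  qed
  have "ennreal (norm (L2_inner (Kop E v) v)) \<le> (\<integral>\<^sup>+X. ennreal (norm (Kop E v X * cnj (v X))) \<partial>torus_measure)"
    unfolding L2_inner_def by (rule integral_norm_bound_ennreal[OF L2_inner_integrable[OF KL v]])
  also have "\<dots> \<le> (\<integral>\<^sup>+X. \<integral>\<^sup>+Y. \<Psi> (X - Y) * ennreal (norm (v Y)) * ennreal (norm (v X)) \<partial>torus_measure \<partial>torus_measure)"
    by (intro nn_integral_mono 1)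
  also have "\<dots> \<le> (\<integral>\<^sup>+X. \<integral>\<^sup>+Y. ennreal (1/2) * (\<Psi> (X - Y) * ?n X) + ennreal (1/2) * (\<Psi> (X - Y) * ?n Y) \<partial>torus_measure \<partial>torus_measure)"
  proof (intro nn_integral_mono)
    fix X Y
    have "\<Psi> (X - Y) * (ennreal (norm (v Y)) * ennreal (norm (v X))) \<le> \<Psi> (X - Y) * (ennreal (1/2) * (?n X + ?n Y))"
      by (intro mult_left_mono am) simp
    then show "\<Psi> (X - Y) * ennreal (norm (v Y)) * ennreal (norm (v X)) \<le> ennreal (1/2) * (\<Psi> (X - Y) * ?n X) + ennreal (1/2) * (\<Psi> (X - Y) * ?n Y)"
      by (simp add: distrib_left mult.assoc mult.left_commute)
  qed
  also have "\<dots> = (\<integral>\<^sup>+X. (ennreal (1/2) * (\<integral>\<^sup>+Y. \<Psi> (X - Y) * ?n X \<partial>torus_measure) + ennreal (1/2) * (\<integral>\<^sup>+Y. \<Psi> (X - Y) * ?n Y \<partial>torus_measure)) \<partial>torus_measure)"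
    by (subst nn_integral_add, simp_all add: nn_integral_cmult)
  also have "\<dots> = ennreal (1/2) * (\<integral>\<^sup>+X. \<integral>\<^sup>+Y. \<Psi> (X - Y) * ?n X \<partial>torus_measure \<partial>torus_measure) + ennreal (1/2) * (\<integral>\<^sup>+X. \<integral>\<^sup>+Y. \<Psi> (X - Y) * ?n Y \<partial>torus_measure \<partial>torus_measure)"
    by (subst nn_integral_add, simp_all add: nn_integral_cmult)
  also have "(\<integral>\<^sup>+X. \<integral>\<^sup>+Y. \<Psi> (X - Y) * ?n Y \<partial>torus_measure \<partial>torus_measure) = (\<integral>\<^sup>+Y. \<integral>\<^sup>+X. \<Psi> (X - Y) * ?n Y \<partial>torus_measure \<partial>torus_measure)"
  proof -
    interpret pair_sigma_finite torus_measure torus_measure ..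
    show ?thesis
      by (rule Fubini'[symmetric]) (simp add: case_prod_unfold)
  qed
  also have "(\<integral>\<^sup>+X. \<integral>\<^sup>+Y. \<Psi> (X - Y) * ?n X \<partial>torus_measure \<partial>torus_measure) \<le> (\<integral>\<^sup>+X. ennreal G * ?n X \<partial>torus_measure)"
    by (intro nn_integral_mono, subst nn_integral_multc) (auto intro!: mult_right_mono I2)
  also have "(\<integral>\<^sup>+Y. \<integral>\<^sup>+X. \<Psi> (X - Y) * ?n Y \<partial>torus_measure \<partial>torus_measure) \<le> (\<integral>\<^sup>+Y. ennreal G * ?n Y \<partial>torus_measure)"
    by (intro nn_integral_mono, subst nn_integral_multc) (auto intro!: mult_right_mono I1)
  also have "(\<integral>\<^sup>+Y. ennreal G * ?n Y \<partial>torus_measure) = ennreal (G * N2 v)"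
    using G(2) by (subst nn_integral_cmult) (simp_all add: nv ennreal_mult)
  finally have "ennreal (norm (L2_inner (Kop E v) v)) \<le> ennreal (1/2) * ennreal (G * N2 v) + ennreal (1/2) * ennreal (G * N2 v)"
    by (auto simp: add_mono mult_left_mono)
  also have "\<dots> = ennreal (G * N2 v)"
  proof -
    have n: "0 \<le> N2 v" by (simp add: N2_def)
    have "ennreal (1/2) * ennreal (G * N2 v) = ennreal (1/2 * (G * N2 v))"
      using n G(2) by (intro ennreal_mult[symmetric]) auto
    then show ?thesis using n G(2) by (simp only:) (subst ennreal_plus[symmetric], auto)
  qed
  finally show ?thesis using G(2) by (subst (asm) ennreal_le_iff) (auto simp: N2_def)
qed

section \<open>Reduction of every quantization to one quadratic form on Fourier coefficients\<close>

section \<open>Comparison of quantizations\<close>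

text \<open>Compactness: a sequence violating the bound has base points in \<open>pibox\<close> and
  rescaled displacements in a ball, so a subsequence of both converges. Along it the two rescaled
  kernels have the same limit, a contradiction.\<close>

lemma semiclassical_kernels_close:
  fixes K K' :: "real \<Rightarrow> 'n::finite torus \<Rightarrow> 'n torus \<Rightarrow> complex"
  assumes K: "semiclassical_kernel k \<eta> K" and K': "semiclassical_kernel k \<eta> K'" and e: "e > 0"
  shows "\<exists>h0>0. \<forall>h X Y. 0 < h \<longrightarrow> h < h0 \<longrightarrow> norm (crep (X - Y)) \<le> R * h \<longrightarrow> h ^ CARD('n) * norm (K h X Y - K' h X Y) \<le> e"
proof (rule ccontr)
  assume "\<not> ?thesis"
  then have neg: "\<exists>h X Y. 0 < h \<and> h < h0 \<and> norm (crep (X - Y)) \<le> R * h \<and> e < h ^ CARD('n) * norm (K h X Y - K' h X Y)" if "h0 > 0" for h0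
    using that by (meson not_le)
  have "\<exists>h X Y. 0 < h \<and> h < 1 / real (Suc n) \<and> norm (crep (X - Y)) \<le> R * h \<and> e < h ^ CARD('n) * norm (K h X Y - K' h X Y)" for n
    by (rule neg) simp
  then obtain h X Y where *: "\<And>n. 0 < h n \<and> h n < 1 / real (Suc n) \<and> norm (crep (X n - Y n)) \<le> R * h n \<and>
      e < h n ^ CARD('n) * norm (K (h n) (X n) (Y n) - K' (h n) (X n) (Y n))"
    by metis
  define z where "z n = crep (X n)" for n
  define w where "w n = (1 / h n) *\<^sub>R crep (X n - Y n)" for n
  have h0: "0 < h n" for n using * by blast
  have h1: "h n \<le> 1" for n
  proof -
    have "h n < 1 / real (Suc n)" using * by blast
    also have "\<dots> \<le> 1" by simp
    finally show ?thesis by simp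
  qed
  have hl: "h \<longlonglongrightarrow> 0"
  proof (rule tendsto_sandwich)
    show "\<forall>\<^sub>F n in sequentially. 0 \<le> h n" using h0 less_imp_le by (intro always_eventually) blast
    show "\<forall>\<^sub>F n in sequentially. h n \<le> 1 / real (Suc n)" using * less_imp_le by (intro always_eventually) blast
    show "(\<lambda>n. 1 / real (Suc n)) \<longlonglongrightarrow> 0" using LIMSEQ_inverse_real_of_nat by (simp add: inverse_eq_divide)
  qed simp
  have w: "norm (w n) \<le> R" for n
  proof -
    have "norm (crep (X n - Y n)) \<le> R * h n" using * by blast
    then show ?thesis using h0[of n] by (simp add: w_def field_simps)
  qed
  have "compact (pibox \<times> cball (0::real^'n) R)" by (intro compact_Times compact_pibox compact_cball)
  moreover have "\<forall>n. (z n, w n) \<in> pibox \<times> cball 0 R" using w by (simp add: z_def)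
  ultimately obtain p s where s: "strict_mono s" "((\<lambda>n. (z n, w n)) \<circ> s) \<longlonglongrightarrow> p"
    unfolding compact_eq_seq_compact_metric by (rule seq_compactE)
  obtain z' w' where p: "p = (z', w')" by (cases p)
  have zl: "(\<lambda>n. z (s n)) \<longlonglongrightarrow> z'" and wl: "(\<lambda>n. w (s n)) \<longlonglongrightarrow> w'"
    using tendsto_fst[OF s(2)] tendsto_snd[OF s(2)] by (simp_all add: p o_def)
  have hs: "(\<lambda>n. h (s n)) \<longlonglongrightarrow> 0"
    using LIMSEQ_subseq_LIMSEQ[OF hl s(1)] by (simp add: o_def)
  have Y: "proj (z n - h n *\<^sub>R w n) = Y n" for n
    using h0[of n] by (simp add: z_def w_def proj_diff)
  have lim: "(\<lambda>n. of_real (h (s n) ^ CARD('n)) * L (h (s n)) (X (s n)) (Y (s n))) \<longlonglongrightarrow> charc k (proj z') * chk \<eta> w'"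
    if L: "semiclassical_kernel k \<eta> L" for L
  proof -
    have "\<forall>h z z' w w'. (\<forall>n. 0 < h n \<and> h n \<le> 1) \<longrightarrow> h \<longlonglongrightarrow> 0 \<longrightarrow> z \<longlonglongrightarrow> z' \<longrightarrow> w \<longlonglongrightarrow> w' \<longrightarrow>
        (\<lambda>n. of_real (h n ^ CARD('n)) * L (h n) (proj (z n)) (proj (z n - h n *\<^sub>R w n)))
          \<longlonglongrightarrow> charc k (proj z') * chk \<eta> w'"
      using L unfolding semiclassical_kernel_def by (elim conjE)
    from this[rule_format, OF _ hs zl wl] h0 h1
    show ?thesis unfolding Y by (simp add: z_def)
  qed
  have "(\<lambda>n. norm (of_real (h (s n) ^ CARD('n)) * K (h (s n)) (X (s n)) (Y (s n)) - of_real (h (s n) ^ CARD('n)) * K' (h (s n)) (X (s n)) (Y (s n)))) \<longlonglongrightarrow> norm (0::complex)"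
    using tendsto_norm[OF tendsto_diff[OF lim[OF K] lim[OF K']]] by simp
  moreover have "norm (of_real (h n ^ CARD('n)) * K (h n) (X n) (Y n) - of_real (h n ^ CARD('n)) * K' (h n) (X n) (Y n)) = h n ^ CARD('n) * norm (K (h n) (X n) (Y n) - K' (h n) (X n) (Y n))" for n
    unfolding right_diff_distrib[symmetric] norm_mult norm_of_real using h0[of n] by simp
  ultimately have "(\<lambda>n. h (s n) ^ CARD('n) * norm (K (h (s n)) (X (s n)) (Y (s n)) - K' (h (s n)) (X (s n)) (Y (s n)))) \<longlonglongrightarrow> 0"
    by simp
  from LIMSEQ_le_const[OF this, of e] * have "e \<le> 0" by (meson less_imp_le)
  then show False using e by simp
qed

text \<open>At distances up to \<open>R * h\<close> the kernels are uniformly close; beyond, both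
  decay with an integrable rate whose tail is small. Together this is a majorant of integral at most
  \<open>e\<close>, to which Schur's test applies.\<close>

lemma semiclassical_forms_close:
  fixes K K' :: "real \<Rightarrow> 'n::finite torus \<Rightarrow> 'n torus \<Rightarrow> complex"
  assumes K: "semiclassical_kernel k \<eta> K" and K': "semiclassical_kernel k \<eta> K'" and e: "e > 0"
  shows "\<exists>h0>0. \<forall>h v. 0 < h \<longrightarrow> h < h0 \<longrightarrow> v \<in> L2_torus \<longrightarrow>
    norm (L2_inner (Kop (K h) v) v - L2_inner (Kop (K' h) v) v) \<le> e * N2 v"
proof -
  let ?d = "CARD('n)"
  have decay: "\<exists>C\<ge>0. \<forall>h X Y. 0 < h \<longrightarrow> h \<le> 1 \<longrightarrow> h ^ ?d * norm (L h X Y) * (1 + norm (crep (X - Y)) / h) ^ (?d + 1) \<le> C"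
    if L: "semiclassical_kernel k \<eta> L" for L
  proof -
    have "\<forall>N. \<exists>C\<ge>0. \<forall>h X Y z. 0 < h \<longrightarrow> h \<le> 1 \<longrightarrow> z \<in> pibox \<longrightarrow> X - Y = proj z \<longrightarrow>
        h ^ ?d * norm (L h X Y) * (1 + norm z / h) ^ N \<le> C"
      using L unfolding semiclassical_kernel_def by (elim conjE)
    from this[rule_format, of "?d + 1"] show ?thesis
      by (elim exE conjE) (rule exI, rule conjI, assumption, simp)
  qed
  from decay[OF K] obtain C1 where C1: "C1 \<ge> 0" "\<And>h X Y. 0 < h \<Longrightarrow> h \<le> 1 \<Longrightarrow> h ^ ?d * norm (K h X Y) * (1 + norm (crep (X - Y)) / h) ^ (?d + 1) \<le> C1" by blast
  from decay[OF K'] obtain C2 where C2: "C2 \<ge> 0" "\<And>h X Y. 0 < h \<Longrightarrow> h \<le> 1 \<Longrightarrow> h ^ ?d * norm (K' h X Y) * (1 + norm (crep (X - Y)) / h) ^ (?d + 1) \<le> C2" by blast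
  define C where "C = C1 + C2"
  have C: "C \<ge> 0" using C1 C2 by (simp add: C_def)
  \<comment> \<open>Half of \<open>e\<close> is allotted to the far region and half to the near one;
    adding 1 keeps the denominators positive.\<close>
  have "e / 2 / (C + 1) > 0" using e C by simp
  from decay_tail[OF this] obtain R where R: "(\<integral>\<^sup>+(w::real^'n). ennreal (1 / (1 + norm w) ^ (?d + 1)) * indicator {w. R < norm w} w \<partial>lborel) \<le> ennreal (e / 2 / (C + 1))"
    by blast
  define m where "m = measure lborel (cball (0::real^'n) R)"
  have m: "m \<ge> 0" by (simp add: m_def)
  define \<epsilon> where "\<epsilon> = e / 2 / (m + 1)"
  have \<epsilon>: "\<epsilon> > 0" using e m by (simp add: \<epsilon>_def)
  from semiclassical_kernels_close[OF K K' \<epsilon>, of R] obtain h0 where h0: "h0 > 0"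
    "\<And>h X Y. 0 < h \<Longrightarrow> h < h0 \<Longrightarrow> norm (crep (X - Y)) \<le> R * h \<Longrightarrow> h ^ ?d * norm (K h X Y - K' h X Y) \<le> \<epsilon>" by blast
  \<comment> \<open>The near and far majorants as one function of the rescaled distance; the
    absolute value keeps it nonnegative for every real argument.\<close>
  define \<gamma> where "\<gamma> s = (if s \<le> R then \<epsilon> else C * (1 / (1 + \<bar>s\<bar>) ^ (?d + 1)))" for s :: real
  have \<gamma>0: "0 \<le> \<gamma> s" for s using \<epsilon> C by (simp add: \<gamma>_def)
  have [measurable]: "\<gamma> \<in> borel_measurable borel" unfolding \<gamma>_def by measurable
  have "(\<integral>\<^sup>+(w::real^'n). ennreal (\<gamma> (norm w)) \<partial>lborel) \<le>
      (\<integral>\<^sup>+(w::real^'n). ennreal \<epsilon> * indicator (cball 0 R) w + ennreal C * (ennreal (1 / (1 + norm w) ^ (?d + 1)) * indicator {w. R < norm w} w) \<partial>lborel)"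
  proof (rule nn_integral_mono)
    fix w :: "real^'n"
    show "ennreal (\<gamma> (norm w)) \<le> ennreal \<epsilon> * indicator (cball 0 R) w + ennreal C * (ennreal (1 / (1 + norm w) ^ (?d + 1)) * indicator {w. R < norm w} w)"
      using C by (cases "norm w \<le> R") (simp_all add: \<gamma>_def ennreal_mult'[symmetric])
  qed
  also have "\<dots> = ennreal \<epsilon> * emeasure lborel (cball (0::real^'n) R) + ennreal C * (\<integral>\<^sup>+(w::real^'n). ennreal (1 / (1 + norm w) ^ (?d + 1)) * indicator {w. R < norm w} w \<partial>lborel)"
  proof -
    let ?t = "\<lambda>w::real^'n. ennreal (1 / (1 + norm w) ^ (?d + 1)) * indicator {w. R < norm w} w"
    have tm [measurable]: "?t \<in> borel_measurable borel" by measurable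
    have cm [measurable]: "cball (0::real^'n) R \<in> sets borel" by simp
    have "(\<integral>\<^sup>+w. ennreal \<epsilon> * indicator (cball 0 R) w + ennreal C * ?t w \<partial>lborel)
        = (\<integral>\<^sup>+(w::real^'n). ennreal \<epsilon> * indicator (cball 0 R) w \<partial>lborel) + (\<integral>\<^sup>+w. ennreal C * ?t w \<partial>lborel)"
      by (rule nn_integral_add) simp_all
    also have "(\<integral>\<^sup>+w. ennreal C * ?t w \<partial>lborel) = ennreal C * (\<integral>\<^sup>+w. ?t w \<partial>lborel)"
      by (rule nn_integral_cmult) simp
    also have "(\<integral>\<^sup>+(w::real^'n). ennreal \<epsilon> * indicator (cball 0 R) w \<partial>lborel) = ennreal \<epsilon> * emeasure lborel (cball (0::real^'n) R)"
      by (rule nn_integral_cmult_indicator) simp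
    finally show ?thesis .
  qed
  also have "\<dots> \<le> ennreal \<epsilon> * ennreal m + ennreal C * ennreal (e / 2 / (C + 1))"
  proof (intro add_mono mult_left_mono R)
    show "emeasure lborel (cball (0::real^'n) R) \<le> ennreal m"
      unfolding m_def using emeasure_lborel_cball_finite[of "0::real^'n" R]
      by (subst emeasure_eq_ennreal_measure) auto
  qed auto
  also have "\<dots> = ennreal (\<epsilon> * m + C * (e / 2 / (C + 1)))"
  proof -
    have "ennreal \<epsilon> * ennreal m = ennreal (\<epsilon> * m)" "ennreal C * ennreal (e / 2 / (C + 1)) = ennreal (C * (e / 2 / (C + 1)))"
      using \<epsilon> C by (simp_all only: ennreal_mult' less_imp_le)
    moreover have "0 \<le> \<epsilon> * m" "0 \<le> C * (e / 2 / (C + 1))" using \<epsilon> m C e by simp_all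
    ultimately show ?thesis by (simp only: ennreal_plus)
  qed
  also have "\<dots> \<le> ennreal e"
  proof (rule ennreal_leI)
    have 1: "e * m \<le> e * (m + 1)" "e * C \<le> e * (C + 1)" using e by simp_all
    have "\<epsilon> * m \<le> e / 2" "C * (e / 2 / (C + 1)) \<le> e / 2"
      unfolding \<epsilon>_def using 1 m C by (simp_all add: divide_le_eq le_divide_eq algebra_simps)
    then show "\<epsilon> * m + C * (e / 2 / (C + 1)) \<le> e" by linarith
  qed
  finally have G: "(\<integral>\<^sup>+(w::real^'n). ennreal (\<gamma> (norm w)) \<partial>lborel) \<le> ennreal e" .
  show ?thesis
  proof (intro exI conjI allI impI)
    show "min h0 1 > 0" using h0 by simp
    fix h :: real and v :: "'n torus \<Rightarrow> complex"
    assume h: "0 < h" "h < min h0 1" and v: "v \<in> L2_torus"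
    have mb: "(\<lambda>(X, Y). L h X Y) \<in> borel_measurable (borel \<Otimes>\<^sub>M borel)" "\<exists>B. \<forall>X Y. norm (L h X Y) \<le> B"
      if "semiclassical_kernel k \<eta> L" for L
      using that h(1) unfolding semiclassical_kernel_def by blast+
    obtain B where B: "\<And>X Y. norm (K h X Y) \<le> B" using mb(2)[OF K] by blast
    obtain B' where B': "\<And>X Y. norm (K' h X Y) \<le> B'" using mb(2)[OF K'] by blast
    define E where "E X Y = K h X Y - K' h X Y" for X Y
    have EM: "(\<lambda>(X, Y). E X Y) \<in> borel_measurable (borel \<Otimes>\<^sub>M borel)"
      using borel_measurable_diff[OF mb(1)[OF K] mb(1)[OF K']] by (simp add: E_def case_prod_unfold)
    have EB: "norm (E X Y) \<le> B + B'" for X Y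
      unfolding E_def by (rule order_trans[OF norm_triangle_ineq4 add_mono[OF B B']])
    have bound: "h ^ ?d * norm (E X Y) \<le> \<gamma> (norm (crep (X - Y)) / h)" for X Y
    proof (cases "norm (crep (X - Y)) / h \<le> R")
      case True
      then show ?thesis using h0(2)[OF h(1), of X Y] h by (simp add: \<gamma>_def E_def divide_le_eq)
    next
      case False
      define q where "q = (1 + norm (crep (X - Y)) / h) ^ (?d + 1)"
      have q: "q > 0" unfolding q_def using h(1) by (intro zero_less_power add_pos_nonneg) auto
      have "h ^ ?d * norm (E X Y) * q \<le> h ^ ?d * (norm (K h X Y) + norm (K' h X Y)) * q"
        unfolding E_def using h(1) q by (intro mult_right_mono mult_left_mono norm_triangle_ineq4) auto
      also have "\<dots> = h ^ ?d * norm (K h X Y) * q + h ^ ?d * norm (K' h X Y) * q" by (simp add: algebra_simps)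
      also have "\<dots> \<le> C" unfolding C_def q_def using h by (intro add_mono C1(2) C2(2)) auto
      finally have "h ^ ?d * norm (E X Y) \<le> C / q" using q by (simp add: le_divide_eq)
      moreover have "\<bar>norm (crep (X - Y)) / h\<bar> = norm (crep (X - Y)) / h" using h(1) by simp
      ultimately show ?thesis using False by (simp only: \<gamma>_def q_def if_False) simp
    qed
    have "L2_inner (Kop (K h) v) v - L2_inner (Kop (K' h) v) v = L2_inner (Kop E v) v"
      unfolding E_def Kop_diff[OF mb(1)[OF K] B mb(1)[OF K'] B' v]
      by (rule L2_inner_diff_left[symmetric, OF Kop_L2[OF mb(1)[OF K] B v] Kop_L2[OF mb(1)[OF K'] B' v] v])
    then show "norm (L2_inner (Kop (K h) v) v - L2_inner (Kop (K' h) v) v) \<le> e * N2 v"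
      using Schur[OF EM EB h(1) _ \<gamma>0 bound G _ v] e by simp
  qed
qed

text \<open>The kernel of a Fourier multiplier by \<open>\<eta>\<close> on the rescaled lattice,
  followed by multiplication with the character of \<open>k\<close>. It is the reference operator
  with which every quantization is compared.\<close>

definition TK :: "int^'n::finite \<Rightarrow> ((real^'n) \<Rightarrow> complex) \<Rightarrow> real \<Rightarrow> 'n torus \<Rightarrow> 'n torus \<Rightarrow> complex" where
  "TK k \<eta> h X Y = charc k X * (\<Sum>m\<in>{m. \<eta> (h *\<^sub>R ivec m) \<noteq> 0}. \<eta> (h *\<^sub>R ivec m) * charc m (X - Y)) / of_real (vol TYPE('n))"

text \<open>The quadratic form of \<open>TK\<close> expressed by Fourier coefficients
  (\<open>TK_form\<close>). Here the evolution is explicit, since it only changes the phases of the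
  coefficients.\<close>

definition qform :: "int^'n::finite \<Rightarrow> ((real^'n) \<Rightarrow> complex) \<Rightarrow> real \<Rightarrow> ('n torus \<Rightarrow> complex) \<Rightarrow> complex" where
  "qform k \<eta> h v = (\<Sum>m\<in>{m. \<eta> (h *\<^sub>R ivec m) \<noteq> 0}. \<eta> (h *\<^sub>R ivec m) * fc v m * cnj (fc v (m + k))) / of_real (vol TYPE('n))"

lemma TK_eq_gint:
  fixes \<eta> :: "(real^'n::finite) \<Rightarrow> complex"
  assumes \<eta>: "\<eta> \<in> testf" and h: "h > 0" and d: "X - Y = proj (h *\<^sub>R w)"
  shows "of_real (h ^ CARD('n)) * TK k \<eta> h X Y = charc k X * (gint \<eta> h w / of_real (vol TYPE('n)))"
  unfolding TK_def gint_eq_sum[OF \<eta> h] d charc_proj by (simp add: inner_scaleR_right)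

text \<open>Multiplied by \<open>h ^ CARD('n)\<close>, the kernel is a character times
  \<open>gint\<close>, so decay and limit are those of the Riemann sums; for displacements in
  \<open>pibox\<close> the restriction to one period is automatic.\<close>

lemma semiclassical_TK:
  fixes \<eta> :: "(real^'n::finite) \<Rightarrow> complex"
  assumes \<eta>: "\<eta> \<in> testf" shows "semiclassical_kernel k \<eta> (TK k \<eta>)"
  unfolding semiclassical_kernel_def
proof (intro conjI allI impI)
  fix h :: real assume h: "h > 0"
  show "(\<lambda>(X, Y). TK k \<eta> h X Y) \<in> borel_measurable (borel \<Otimes>\<^sub>M borel)"
    unfolding TK_def charc_diff case_prod_unfold by measurable
  let ?F = "{m. \<eta> (h *\<^sub>R ivec m) \<noteq> 0}"
  have "norm (TK k \<eta> h X Y) \<le> (\<Sum>m\<in>?F. norm (\<eta> (h *\<^sub>R ivec m))) / vol TYPE('n)" for X Y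
  proof -
    have "norm (\<Sum>m\<in>?F. \<eta> (h *\<^sub>R ivec m) * charc m (X - Y)) \<le> (\<Sum>m\<in>?F. norm (\<eta> (h *\<^sub>R ivec m)))"
      by (rule sum_norm_le) (simp add: norm_mult)
    then show ?thesis unfolding TK_def norm_divide norm_mult norm_charc norm_of_real
      by (simp add: divide_right_mono)
  qed
  then show "\<exists>B. \<forall>X Y. norm (TK k \<eta> h X Y) \<le> B" by blast
next
  fix N
  obtain C where C: "C \<ge> 0" "\<And>h w. 0 < h \<Longrightarrow> h \<le> 1 \<Longrightarrow> (\<forall>j. \<bar>h * w $ j\<bar> \<le> pi) \<Longrightarrow> norm (gint \<eta> h w) * (1 + norm w) ^ N \<le> C"
    using gint_decay[OF \<eta>, of N] by blast
  show "\<exists>C\<ge>0. \<forall>h X Y z. 0 < h \<longrightarrow> h \<le> 1 \<longrightarrow> z \<in> pibox \<longrightarrow> X - Y = proj z \<longrightarrow> h ^ CARD('n) * norm (TK k \<eta> h X Y) * (1 + norm z / h) ^ N \<le> C"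
  proof (intro exI conjI allI impI)
    show "C / vol TYPE('n) \<ge> 0" using C by (simp add: vol_def)
    fix h :: real and X Y :: "'n torus" and z :: "real^'n"
    assume h: "0 < h" "h \<le> 1" and z: "z \<in> pibox" and d: "X - Y = proj z"
    let ?w = "(1 / h) *\<^sub>R z"
    have d': "X - Y = proj (h *\<^sub>R ?w)" using d h by simp
    have "h ^ CARD('n) * norm (TK k \<eta> h X Y) = norm (of_real (h ^ CARD('n)) * TK k \<eta> h X Y)"
      using h by (simp add: norm_mult norm_power)
    also have "\<dots> = norm (gint \<eta> h ?w) / vol TYPE('n)"
      unfolding TK_eq_gint[OF \<eta> h(1) d'] norm_mult norm_divide norm_charc norm_of_real by simp
    finally have e: "h ^ CARD('n) * norm (TK k \<eta> h X Y) = norm (gint \<eta> h ?w) / vol TYPE('n)" .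
    have "norm (gint \<eta> h ?w) * (1 + norm ?w) ^ N \<le> C"
      using h z by (intro C(2)) (auto simp: pibox_def)
    moreover have "norm ?w = norm z / h" using h by simp
    ultimately have "norm (gint \<eta> h ?w) * (1 + norm z / h) ^ N \<le> C" by (simp only:)
    then show "h ^ CARD('n) * norm (TK k \<eta> h X Y) * (1 + norm z / h) ^ N \<le> C / vol TYPE('n)"
      unfolding e by (simp add: divide_right_mono)
  qed
next
  fix h :: "nat \<Rightarrow> real" and z w :: "nat \<Rightarrow> real^'n" and z' w' :: "real^'n"
  assume h: "\<forall>n. 0 < h n \<and> h n \<le> 1" "h \<longlonglongrightarrow> 0" and z: "z \<longlonglongrightarrow> z'" and w: "w \<longlonglongrightarrow> w'"
  have e: "of_real (h n ^ CARD('n)) * TK k \<eta> (h n) (proj (z n)) (proj (z n - h n *\<^sub>R w n))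
      = charc k (proj (z n)) * (gint \<eta> (h n) (w n) / of_real (vol TYPE('n)))" for n
    using h(1) by (intro TK_eq_gint \<eta>) (simp_all flip: proj_diff)
  have "(\<lambda>n. charc k (proj (z n))) \<longlonglongrightarrow> charc k (proj z')"
    by (rule continuous_on_tendsto_compose[OF continuous_charc continuous_on_tendsto_compose[OF continuous_proj z]]) simp_all
  then show "(\<lambda>n. of_real (h n ^ CARD('n)) * TK k \<eta> (h n) (proj (z n)) (proj (z n - h n *\<^sub>R w n))) \<longlonglongrightarrow> charc k (proj z') * chk \<eta> w'"
    unfolding e by (rule tendsto_mult) (use h w in \<open>auto intro!: gint_limit \<eta>\<close>)
qed

lemma TK_form:
  fixes \<eta> :: "(real^'n::finite) \<Rightarrow> complex"
  assumes \<eta>: "\<eta> \<in> testf" and h: "h > 0" and v: "v \<in> L2_torus"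
  shows "L2_inner (Kop (TK k \<eta> h) v) v = qform k \<eta> h v"
proof -
  let ?F = "{m. \<eta> (h *\<^sub>R ivec m) \<noteq> 0}"
  let ?V = "of_real (vol TYPE('n)) :: complex"
  have "Kop (TK k \<eta> h) v X = (\<Sum>m\<in>?F. (\<eta> (h *\<^sub>R ivec m) * fc v m / ?V) * charc (k + m) X)" for X
  proof -
    have "Kop (TK k \<eta> h) v X = (LINT Y|torus_measure. (\<Sum>m\<in>?F. (\<eta> (h *\<^sub>R ivec m) / ?V * charc (k + m) X) * (v Y * cnj (charc m Y))))"
      unfolding Kop_def TK_def
      by (intro Bochner_Integration.integral_cong refl)
         (simp add: charc_diff charc_add_left sum_distrib_left sum_distrib_right sum_divide_distrib mult_ac)
    also have "\<dots> = (\<Sum>m\<in>?F. (\<eta> (h *\<^sub>R ivec m) / ?V * charc (k + m) X) * fc v m)"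
      unfolding fc_def L2_inner_def
      by (subst Bochner_Integration.integral_sum) (auto intro!: Bochner_Integration.integrable_mult_right L2_inner_integrable v L2_charc)
    finally show ?thesis by (simp add: mult_ac)
  qed
  then have "L2_inner (Kop (TK k \<eta> h) v) v = L2_inner (\<lambda>X. \<Sum>m\<in>?F. (\<eta> (h *\<^sub>R ivec m) * fc v m / ?V) * charc (k + m) X) v"
    by presburger
  also have "\<dots> = (\<Sum>m\<in>?F. (\<eta> (h *\<^sub>R ivec m) * fc v m / ?V) * L2_inner (charc (k + m)) v)"
    by (subst L2_inner_sum_left) (simp_all only: L2_inner_scale_left L2_scale L2_charc v)
  also have "\<dots> = qform k \<eta> h v"
    unfolding qform_def sum_divide_distrib fc_def L2_inner_cnj
    by (intro sum.cong refl) (simp add: add.commute)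
  finally show ?thesis .
qed

text \<open>All dependence on patches and cut-offs ends here: the quantization and the lattice
  operator both have a \<open>semiclassical_kernel\<close> for the same \<open>k\<close> and
  \<open>\<eta>\<close>. Uniformity in \<open>v\<close> is what permits applying it to evolved
  states at all times.\<close>

lemma quantization_qform:
  fixes \<eta> :: "(real^'n::finite) \<Rightarrow> complex"
  assumes \<eta>: "\<eta> \<in> testf" and A: "weyl_quantization (tsym k \<eta>) A" and e: "e > 0"
  shows "\<exists>h0>0. \<forall>h v. 0 < h \<longrightarrow> h < h0 \<longrightarrow> v \<in> L2_torus \<longrightarrow> norm (L2_inner (A h v) v - qform k \<eta> h v) \<le> e * N2 v"
proof -
  obtain K where K: "semiclassical_kernel k \<eta> K"
    "\<And>h v X. h > 0 \<Longrightarrow> v \<in> L2_torus \<Longrightarrow> A h v X = (LINT Y|torus_measure. K h X Y * v Y)"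
    using quantization_kernel[OF \<eta> A] by blast
  have A': "A h v = Kop (K h) v" if "h > 0" "v \<in> L2_torus" for h v
    using K(2)[OF that] by (intro ext) (simp add: Kop_def)
  show ?thesis
    using semiclassical_forms_close[OF K(1) semiclassical_TK[OF \<eta>] e] by (simp add: A' TK_form[OF \<eta>])
qed

text \<open>A crude bound from a bounded kernel and finite volume. It is used for one kernel at a
  time, to obtain measurability and integrability in time.\<close>

lemma Kop_form_bound:
  fixes K :: "'n::finite torus \<Rightarrow> 'n torus \<Rightarrow> complex"
  assumes K: "(\<lambda>(X, Y). K X Y) \<in> borel_measurable (borel \<Otimes>\<^sub>M borel)" "\<And>X Y. norm (K X Y) \<le> B"
    and v: "v \<in> L2_torus" and w: "w \<in> L2_torus"
  shows "norm (L2_inner (Kop K v) w) \<le> B * vol TYPE('n) * (sqrt (N2 v) * sqrt (N2 w))"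
proof -
  have B: "B \<ge> 0" using K(2)[of 0 0] norm_ge_zero order_trans by blast
  have L1: "(LINT Y|torus_measure. norm (f Y)) \<le> sqrt (vol TYPE('n)) * sqrt (N2 f)" if f: "f \<in> L2_torus" for f :: "'n torus \<Rightarrow> complex"
  proof -
    have nf: "(\<lambda>Y. of_real (norm (f Y)) :: complex) \<in> L2_torus"
      using L2_torus_square[OF f] L2_torus_measurable[OF f] by (intro L2_torusI) auto
    have "L2_inner (\<lambda>Y. of_real (norm (f Y))) (\<lambda>_. 1) = of_real (LINT Y|torus_measure. norm (f Y))"
      by (simp add: L2_inner_def)
    then have "(LINT Y|torus_measure. norm (f Y)) \<le> norm (L2_inner (\<lambda>Y. of_real (norm (f Y))) (\<lambda>_::'n torus. 1))"
      by simp
    also have "\<dots> \<le> sqrt (N2 (\<lambda>Y. of_real (norm (f Y)))) * sqrt (N2 (\<lambda>_::'n torus. 1))"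
      by (rule L2_Cauchy_Schwarz[OF nf L2_one])
    also have "\<dots> = sqrt (N2 f) * sqrt (vol TYPE('n))" by (simp add: N2_def measure_torus_UNIV)
    finally show ?thesis by (simp add: mult.commute)
  qed
  let ?I = "LINT Y|torus_measure. norm (v Y)"
  have "norm (L2_inner (Kop K v) w) \<le> (LINT X|torus_measure. norm (Kop K v X * cnj (w X)))"
    unfolding L2_inner_def by (rule integral_norm_bound)
  also have "\<dots> \<le> (LINT X|torus_measure. B * ?I * norm (w X))"
    by (intro integral_mono integrable_norm L2_inner_integrable Kop_L2[OF K v] w Bochner_Integration.integrable_mult_right L2_integrable[OF w])
       (auto simp: norm_mult intro!: mult_right_mono Kop_norm[OF K v])
  also have "\<dots> = B * (?I * (LINT X|torus_measure. norm (w X)))" by simp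
  also have "\<dots> \<le> B * ((sqrt (vol TYPE('n)) * sqrt (N2 v)) * (sqrt (vol TYPE('n)) * sqrt (N2 w)))"
    by (intro mult_left_mono mult_mono L1 v w B) (auto simp: vol_def)
  also have "\<dots> = B * (sqrt (vol TYPE('n)) * sqrt (vol TYPE('n))) * (sqrt (N2 v) * sqrt (N2 w))" by (simp only: mult_ac)
  also have "sqrt (vol TYPE('n)) * sqrt (vol TYPE('n)) = vol TYPE('n)" by (simp add: vol_def)
  finally show ?thesis .
qed

text \<open>Partial Fourier sums of the evolved state are uniformly accurate in time and depend
  continuously on it.\<close>

lemma measurable_evolved_form:
  fixes K :: "'n::finite torus \<Rightarrow> 'n torus \<Rightarrow> complex"
  assumes K: "(\<lambda>(X, Y). K X Y) \<in> borel_measurable (borel \<Otimes>\<^sub>M borel)" "\<And>X Y. norm (K X Y) \<le> B"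
    and u: "u \<in> L2_torus"
  shows "(\<lambda>t. L2_inner (Kop K (schroedinger (c * t) u)) (schroedinger (c * t) u)) \<in> borel_measurable borel"
proof -
  have B: "B \<ge> 0" using K(2)[of 0 0] norm_ge_zero order_trans by blast
  let ?v = "\<lambda>t. schroedinger (c * t) u"
  have vL: "?v t \<in> L2_torus" for t by (rule schroedinger_L2[OF u])
  have "\<exists>F. finite F \<and> N2 (\<lambda>x. u x - psum (fc u) F x) < (1 / real (Suc j))\<^sup>2" for j
    by (rule psum_dense[OF u]) simp
  then obtain F where F: "\<And>j. finite (F j)" "\<And>j. N2 (\<lambda>x. u x - psum (fc u) (F j) x) < (1 / real (Suc j))\<^sup>2"
    by metis
  define p where "p j t = psum (fc (?v t)) (F j)" for j t
  have pL: "p j t \<in> L2_torus" for j t unfolding p_def by (rule psum_L2)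
  have fcn: "norm (fc (?v t) m) = norm (fc u m)" for t m by (simp add: fc_schroedinger[OF u] norm_mult)
  \<comment> \<open>The evolution preserves the moduli of the coefficients, so the truncation error
    equals that of the initial state at every time.\<close>
  have tail: "N2 (\<lambda>x. ?v t x - p j t x) = N2 (\<lambda>x. u x - psum (fc u) (F j) x)" for j t
    unfolding p_def N2_psum_diff[OF vL F(1)] N2_psum_diff[OF u F(1)] by (simp add: fcn N2_schroedinger[OF u])
  have tail': "sqrt (N2 (\<lambda>x. ?v t x - p j t x)) \<le> 1 / real (Suc j)" for j t
    unfolding tail using F(2)[of j] by (intro real_le_lsqrt) auto
  have pn: "N2 (p j t) \<le> N2 u" for j t
  proof -
    have "N2 (p j t) = (\<Sum>m\<in>F j. (norm (fc u m))\<^sup>2) / vol TYPE('n)"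
      unfolding p_def N2_psum[OF F(1)] by (simp add: fcn)
    also have "\<dots> \<le> N2 u" using Bessel[OF u F(1)] by (simp add: vol_def field_simps)
    finally show ?thesis .
  qed
  define f where "f t = L2_inner (Kop K (?v t)) (?v t)" for t
  define g where "g j t = L2_inner (Kop K (p j t)) (p j t)" for j t
  have KL: "Kop K a \<in> L2_torus" if "a \<in> L2_torus" for a by (rule Kop_L2[OF K that])
  have Kadd: "Kop K (\<lambda>x. a x - b x) = (\<lambda>X. Kop K a X - Kop K b X)" if "a \<in> L2_torus" "b \<in> L2_torus" for a b
    unfolding Kop_def right_diff_distrib
    by (intro ext Bochner_Integration.integral_diff Kop_integrable[OF K] that)
  have L2_inner_diff_right: "L2_inner a (\<lambda>x. b x - d x) = L2_inner a b - L2_inner a d"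
    if "a \<in> L2_torus" "b \<in> L2_torus" "d \<in> L2_torus" for a b d :: "'n torus \<Rightarrow> complex"
    using L2_inner_diff_left[OF that(2,3,1)] by (metis L2_inner_cnj complex_cnj_diff)
  define D where "D = B * vol TYPE('n) * (2 * sqrt (N2 u))"
  have close: "norm (f t - g j t) \<le> D * (1 / real (Suc j))" for j t
  proof -
    let ?e = "\<lambda>x. ?v t x - p j t x"
    have eL: "?e \<in> L2_torus" by (rule L2_diff[OF vL pL])
    have "f t - g j t = L2_inner (Kop K ?e) (?v t) + L2_inner (Kop K (p j t)) ?e"
      unfolding f_def g_def Kadd[OF vL pL]
      by (simp add: L2_inner_diff_left[OF KL[OF vL] KL[OF pL] vL] L2_inner_diff_right[OF KL[OF pL] vL pL])
    then have "norm (f t - g j t) \<le> norm (L2_inner (Kop K ?e) (?v t)) + norm (L2_inner (Kop K (p j t)) ?e)"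
      by (simp only: norm_triangle_ineq)
    also have "\<dots> \<le> B * vol TYPE('n) * (sqrt (N2 ?e) * sqrt (N2 (?v t))) + B * vol TYPE('n) * (sqrt (N2 (p j t)) * sqrt (N2 ?e))"
      by (rule add_mono[OF Kop_form_bound[OF K eL vL] Kop_form_bound[OF K pL eL]])
    also have "\<dots> \<le> B * vol TYPE('n) * ((1 / real (Suc j)) * sqrt (N2 u)) + B * vol TYPE('n) * (sqrt (N2 u) * (1 / real (Suc j)))"
    proof (rule add_mono; rule mult_left_mono)
      show "sqrt (N2 ?e) * sqrt (N2 (?v t)) \<le> (1 / real (Suc j)) * sqrt (N2 u)"
        unfolding N2_schroedinger[OF u] by (rule mult_right_mono[OF tail']) simp
      show "sqrt (N2 (p j t)) * sqrt (N2 ?e) \<le> sqrt (N2 u) * (1 / real (Suc j))"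
        using pn tail' by (intro mult_mono) auto
    qed (use B in simp_all)
    also have "\<dots> = D * (1 / real (Suc j))" by (simp add: D_def)
    finally show "norm (f t - g j t) \<le> D * (1 / real (Suc j))" .
  qed
  have "(\<lambda>j. g j t) \<longlonglongrightarrow> f t" for t
  proof (rule LIM_zero_cancel, rule Lim_null_comparison)
    show "\<forall>\<^sub>F j in sequentially. norm (g j t - f t) \<le> D * (1 / real (Suc j))"
      using close by (intro always_eventually) (simp add: norm_minus_commute)
    have "(\<lambda>j. 1 / real (Suc j)) \<longlonglongrightarrow> 0" using LIMSEQ_inverse_real_of_nat by (simp add: inverse_eq_divide)
    then show "(\<lambda>j. D * (1 / real (Suc j))) \<longlonglongrightarrow> 0" by (rule tendsto_mult_right_zero)
  qed
  \<comment> \<open>After truncation the form is a finite sum of products of exponentials in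
    \<open>t\<close>.\<close>
  moreover have "g j \<in> borel_measurable borel" for j
  proof -
    let ?V = "of_real (vol TYPE('n)) :: complex"
    have Kc: "Kop K (p j t) = (\<lambda>X. \<Sum>m\<in>F j. fc (?v t) m / ?V * Kop K (charc m) X)" for t
    proof
      fix X
      have "Kop K (p j t) X = (LINT Y|torus_measure. (\<Sum>m\<in>F j. fc (?v t) m / ?V * (K X Y * charc m Y)))"
        unfolding Kop_def p_def psum_def
        by (intro Bochner_Integration.integral_cong refl) (simp add: sum_distrib_left sum_divide_distrib mult_ac)
      also have "\<dots> = (\<Sum>m\<in>F j. fc (?v t) m / ?V * Kop K (charc m) X)"
        unfolding Kop_def
        by (subst Bochner_Integration.integral_sum) (auto intro!: Bochner_Integration.integrable_mult_right Kop_integrable[OF K] L2_charc)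
      finally show "Kop K (p j t) X = (\<Sum>m\<in>F j. fc (?v t) m / ?V * Kop K (charc m) X)" .
    qed
    have L: "L2_inner (charc m) (p j t) = (if m \<in> F j then cnj (fc (?v t) m) else 0)" for m t
      using fc_psum[OF F(1)[of j], of "fc (?v t)" m] unfolding p_def fc_def
      by (metis L2_inner_cnj complex_cnj_zero)
    have "g j t = (\<Sum>m\<in>F j. fc (?v t) m / ?V * L2_inner (Kop K (charc m)) (p j t))" for t
      unfolding g_def Kc
      by (subst L2_inner_sum_left) (simp_all only: L2_inner_scale_left L2_scale KL L2_charc pL)
    moreover have "L2_inner (Kop K (charc m)) (p j t) = (\<Sum>l\<in>F j. cnj (fc (?v t) l) / ?V * L2_inner (Kop K (charc m)) (charc l))" for m t
    proof -
      have "L2_inner (p j t) (Kop K (charc m)) = (\<Sum>l\<in>F j. fc (?v t) l * cnj (fc (Kop K (charc m)) l)) / ?V"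
        unfolding p_def by (rule L2_inner_psum_left[OF KL[OF L2_charc]])
      then have "cnj (L2_inner (p j t) (Kop K (charc m))) = cnj ((\<Sum>l\<in>F j. fc (?v t) l * cnj (fc (Kop K (charc m)) l)) / ?V)"
        by (rule arg_cong)
      then show ?thesis by (simp add: L2_inner_cnj sum_divide_distrib fc_def)
    qed
    ultimately have ge: "g j = (\<lambda>t. \<Sum>m\<in>F j. fc (?v t) m / ?V * (\<Sum>l\<in>F j. cnj (fc (?v t) l) / ?V * L2_inner (Kop K (charc m)) (charc l)))"
      by (intro ext) simp
    have [measurable]: "(\<lambda>t. cis (c * t * a / 2)) \<in> borel_measurable borel" for a
      by (rule measurable_compose[OF _ measurable_cis]) measurable
    show ?thesis unfolding ge fc_schroedinger[OF u] by measurable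
  qed
  ultimately show ?thesis
    unfolding f_def[symmetric] by (rule borel_measurable_LIMSEQ_metric[rotated])
qed

section \<open>Oscillation in time, non-resonance, and the limit for elementary symbols\<close>

section \<open>Averages in time\<close>

text \<open>The trivial bound serves nearly resonant modes; the bound by the primitive serves the
  rapidly oscillating ones.\<close>

lemma cis_integral_bounds:
  fixes s a b :: real
  assumes ab: "a \<le> b"
  shows "norm (LINT t|lborel. indicator {a..b} t * cis (s * t)) \<le> b - a"
    and "s \<noteq> 0 \<Longrightarrow> norm (LINT t|lborel. indicator {a..b} t * cis (s * t)) \<le> 2 / \<bar>s\<bar>"
proof -
  have "norm (LINT t|lborel. indicator {a..b} t * cis (s * t)) \<le> (LINT t|lborel. norm (indicator {a..b} t * cis (s * t)))"
    by (rule integral_norm_bound)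
  also have "\<dots> = (LINT t|lborel. indicator {a..b} t)"
    by (intro Bochner_Integration.integral_cong refl) (simp add: norm_mult indicator_def)
  also have "\<dots> = b - a" using ab by simp
  finally show "norm (LINT t|lborel. indicator {a..b} t * cis (s * t)) \<le> b - a" .
next
  assume s: "s \<noteq> 0"
  let ?G = "\<lambda>t. cis (s * t) / (\<i> * s)"
  have "has_bochner_integral lborel (\<lambda>t. indicator {a..b} t *\<^sub>R cis (s * t)) (?G b - ?G a)"
  proof (rule has_bochner_integral_FTC_Icc[OF ab])
    show "(?G has_vector_derivative cis (s * t)) (at t within {a..b})" for t
    proof -
      have "((\<lambda>z. exp (\<i> * of_real s * z) / (\<i> * s)) has_field_derivative exp (\<i> * of_real s * of_real t)) (at (of_real t))"
        using s by (auto intro!: derivative_eq_intros)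
      from has_vector_derivative_real_field[OF this]
      show ?thesis by (simp add: cis_conv_exp mult.assoc)
    qed
    show "continuous_on {a..b} (\<lambda>t. cis (s * t))" by (intro continuous_intros)
  qed
  then have "(LINT t|lborel. indicator {a..b} t *\<^sub>R cis (s * t)) = ?G b - ?G a"
    by (rule has_bochner_integral_integral_eq)
  moreover have "(LINT t|lborel. indicator {a..b} t *\<^sub>R cis (s * t)) = (LINT t|lborel. indicator {a..b} t * cis (s * t))"
    by (intro Bochner_Integration.integral_cong refl) (simp add: indicator_def)
  moreover have "norm (?G b - ?G a) \<le> norm (?G b) + norm (?G a)" by (rule norm_triangle_ineq4)
  moreover have "norm (?G t) = 1 / \<bar>s\<bar>" for t by (simp add: norm_divide norm_mult)
  ultimately show "norm (LINT t|lborel. indicator {a..b} t * cis (s * t)) \<le> 2 / \<bar>s\<bar>" by simp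
qed

text \<open>A smooth bump at least 1 where the frequency pairing is at most \<open>\<delta>\<close>
  and zero where it is at least \<open>2 * \<delta>\<close>. In the first region both
  \<open>expinv\<close> factors are at least \<open>exp (- 1)\<close>, which the factor
  \<open>exp 2\<close> compensates.\<close>

definition near_plane :: "int^'n::finite \<Rightarrow> real \<Rightarrow> real^'n \<Rightarrow> real" where
  "near_plane k \<delta> \<xi> = exp 2 * (expinv 0 (2 - ivec k \<bullet> \<xi> / \<delta>) * expinv 0 (2 + ivec k \<bullet> \<xi> / \<delta>))"

lemma near_plane_nonneg: "0 \<le> near_plane k \<delta> \<xi>"
  unfolding near_plane_def by (intro mult_nonneg_nonneg expinv_0_bounds) simp

lemma near_plane_le: "near_plane k \<delta> \<xi> \<le> exp 2"
proof -
  have "expinv 0 (2 - ivec k \<bullet> \<xi> / \<delta>) * expinv 0 (2 + ivec k \<bullet> \<xi> / \<delta>) \<le> 1"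
    by (intro mult_le_one expinv_0_bounds)
  then show ?thesis by (simp add: near_plane_def)
qed

lemma near_plane_ge_1:
  assumes "\<delta> > 0" "\<bar>ivec k \<bullet> \<xi>\<bar> \<le> \<delta>" shows "1 \<le> near_plane k \<delta> \<xi>"
proof -
  let ?x = "ivec k \<bullet> \<xi> / \<delta>"
  have x: "- 1 \<le> ?x" "?x \<le> 1" using assms by (simp_all add: le_divide_eq divide_le_eq abs_le_iff)
  have *: "exp (- 1) \<le> expinv 0 t" if "1 \<le> t" for t :: real
    using that by (simp add: expinv_def)
  have "exp (- 1) * exp (- 1) \<le> expinv 0 (2 - ?x) * expinv 0 (2 + ?x)"
    using x by (intro mult_mono * expinv_0_bounds) auto
  then have "exp 2 * (exp (- 1) * exp (- 1)) \<le> near_plane k \<delta> \<xi>"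
    unfolding near_plane_def by (intro mult_left_mono) auto
  moreover have "exp 2 * (exp (- 1) * exp (- 1)) = (1::real)" by (simp flip: exp_add)
  ultimately show ?thesis by simp
qed

lemma near_plane_zero:
  assumes "\<delta> > 0" "2 * \<delta> \<le> \<bar>ivec k \<bullet> \<xi>\<bar>" shows "near_plane k \<delta> \<xi> = 0"
proof -
  have "2 \<le> \<bar>ivec k \<bullet> \<xi> / \<delta>\<bar>" using assms by (simp add: le_divide_eq)
  then have "2 - ivec k \<bullet> \<xi> / \<delta> \<le> 0 \<or> 2 + ivec k \<bullet> \<xi> / \<delta> \<le> 0" by linarith
  then show ?thesis by (auto simp: near_plane_def expinv_def)
qed

lemma Ck_on_near_plane: "Ck_on n (\<lambda>\<xi>. of_real (near_plane k \<delta> \<xi>) :: complex) UNIV"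
proof -
  have *: "Ck_on n (\<lambda>\<xi>. expinv 0 ((c * (ivec k \<bullet> \<xi>)) + 2)) UNIV" for c
    by (intro Ck_on_affine[OF Ck_on_expinv] bounded_linear_const_mult bounded_linear_inner_right)
  have e: "near_plane k \<delta> = (\<lambda>\<xi>. exp 2 * (expinv 0 (((- 1 / \<delta>) * (ivec k \<bullet> \<xi>)) + 2) * expinv 0 (((1 / \<delta>) * (ivec k \<bullet> \<xi>)) + 2)))"
    by (simp add: near_plane_def fun_eq_iff add.commute)
  show ?thesis unfolding e by (intro Ck_on_of_real Ck_on_mult Ck_on_const *)
qed

text \<open>For real \<open>\<eta>\<close> this symbol is nonnegative, so its form of frequency 0 is
  a sum of nonnegative terms that controls the energy of the nearly resonant modes.\<close>

definition near_symbol :: "int^'n::finite \<Rightarrow> real \<Rightarrow> ((real^'n) \<Rightarrow> complex) \<Rightarrow> real^'n \<Rightarrow> complex" where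
  "near_symbol k \<delta> \<eta> \<xi> = \<eta> \<xi> * (\<eta> \<xi> * of_real (near_plane k \<delta> \<xi>))"

lemma near_symbol_testf: "\<eta> \<in> testf \<Longrightarrow> near_symbol k \<delta> \<eta> \<in> testf"
  unfolding near_symbol_def[abs_def] using Ck_on_near_plane
  by (intro testf_mult Ck_on_mult) (auto simp: testf_def)

lemma schroedinger_phase: "laplev m - laplev (m + k) = 2 * (ivec m \<bullet> ivec k + ivec k \<bullet> ivec k / 2)"
  by (simp add: laplev_def ivec_add inner_add inner_commute)

text \<open>In the difference of the eigenvalues at \<open>m\<close> and \<open>m + k\<close> the
  terms quadratic in \<open>m\<close> cancel, so the phase is affine in \<open>m\<close>.\<close>

lemma qform_schroedinger:
  fixes k :: "int^'n::finite"
  assumes u: "u \<in> L2_torus"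
  shows "qform k \<eta> h (schroedinger c u) =
    (\<Sum>m\<in>{m. \<eta> (h *\<^sub>R ivec m) \<noteq> 0}. \<eta> (h *\<^sub>R ivec m) * fc u m * cnj (fc u (m + k)) * cis (c * (ivec m \<bullet> ivec k + ivec k \<bullet> ivec k / 2)))
      / of_real (vol TYPE('n))"
proof -
  have "cis (c * laplev m / 2) * cnj (cis (c * laplev (m + k) / 2)) = cis (c * (ivec m \<bullet> ivec k + ivec k \<bullet> ivec k / 2))" for m
  proof -
    have "c * laplev m / 2 - c * laplev (m + k) / 2 = c * (laplev m - laplev (m + k)) / 2" by (simp add: algebra_simps)
    also have "\<dots> = c * (ivec m \<bullet> ivec k + ivec k \<bullet> ivec k / 2)" unfolding schroedinger_phase by simp
    finally show ?thesis by (simp add: cis_cnj cis_mult)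
  qed
  note phase = this
  have "\<eta> (h *\<^sub>R ivec m) * (cis (c * laplev m / 2) * fc u m) * cnj (cis (c * laplev (m + k) / 2) * fc u (m + k))
     = \<eta> (h *\<^sub>R ivec m) * fc u m * cnj (fc u (m + k)) * (cis (c * laplev m / 2) * cnj (cis (c * laplev (m + k) / 2)))" for m
    by (simp only: complex_cnj_mult mult_ac)
  note this[unfolded phase]
  then show ?thesis unfolding qform_def fc_schroedinger[OF u] by (simp only:)
qed

text \<open>Modes away from the plane orthogonal to \<open>k\<close> oscillate with frequency at
  least \<open>\<alpha> * \<delta> / 2\<close>, giving the first term. Nearly resonant ones gain
  nothing from time integration and are split, with weight \<open>\<tau>\<close>, into the form of
  \<open>near_symbol\<close> and the total energy.\<close>

lemma qform_time_bound:
  fixes \<eta> :: "(real^'n::finite) \<Rightarrow> complex" and k :: "int^'n"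
  assumes \<eta>: "\<eta> \<in> testf" and real: "\<And>\<xi>. cnj (\<eta> \<xi>) = \<eta> \<xi>" and B: "\<And>\<xi>. norm (\<eta> \<xi>) \<le> B"
    and h: "h > 0" "h * (ivec k \<bullet> ivec k) \<le> \<delta>" and \<delta>: "\<delta> > 0" and \<alpha>: "\<alpha> > 0" and \<tau>: "\<tau> > 0" and ab: "a \<le> b"
    and u: "u \<in> L2_torus"
  shows "norm (LINT t|lborel. indicator {a..b} t * qform k \<eta> h (schroedinger (\<alpha> * h * t) u))
    \<le> 4 / (\<alpha> * \<delta>) * B * N2 u + (b - a) * (norm (qform 0 (near_symbol k \<delta> \<eta>) h u) / (2 * \<tau>) + \<tau> / 2 * N2 u)"
proof -
  let ?V = "vol TYPE('n)"
  let ?F = "{m. \<eta> (h *\<^sub>R ivec m) \<noteq> 0}"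
  have fin: "finite ?F" by (rule finite_lattice_support[OF \<eta> h(1)])
  have B0: "B \<ge> 0" using B[of 0] norm_ge_zero order_trans by blast
  \<comment> \<open>The frequency in time of the pair of modes \<open>m\<close> and
    \<open>m + k\<close>.\<close>
  define s where "s m = \<alpha> * (h * (ivec m \<bullet> ivec k + ivec k \<bullet> ivec k / 2))" for m
  define I where "I m = (LINT t|lborel. indicator {a..b} t * cis (s m * t))" for m
  define c where "c m = norm (fc u m)" for m
  define e where "e m = norm (\<eta> (h *\<^sub>R ivec m))" for m
  define \<rho> where "\<rho> m = near_plane k \<delta> (h *\<^sub>R ivec m)" for m
  have int: "integrable lborel (\<lambda>t. indicator {a..b} t * cis (s m * t) :: complex)" for m
  proof -
    have "integrable lborel (\<lambda>t. indicator {a..b} t *\<^sub>R cis (s m * t))"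
      by (rule borel_integrable_compact) (auto intro: continuous_intros)
    moreover have "(\<lambda>t. indicator {a..b} t *\<^sub>R cis (s m * t)) = (\<lambda>t. indicator {a..b} t * cis (s m * t))"
      by (simp add: indicator_def fun_eq_iff)
    ultimately show ?thesis by simp
  qed
  have "(LINT t|lborel. indicator {a..b} t * qform k \<eta> h (schroedinger (\<alpha> * h * t) u))
      = (LINT t|lborel. (\<Sum>m\<in>?F. (\<eta> (h *\<^sub>R ivec m) * fc u m * cnj (fc u (m + k)) / of_real ?V) * (indicator {a..b} t * cis (s m * t))))"
    unfolding qform_schroedinger[OF u]
    by (intro Bochner_Integration.integral_cong refl)
       (simp add: sum_distrib_left sum_divide_distrib s_def mult_ac)
  also have "\<dots> = (\<Sum>m\<in>?F. (\<eta> (h *\<^sub>R ivec m) * fc u m * cnj (fc u (m + k)) / of_real ?V) * I m)"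
    unfolding I_def
    by (subst Bochner_Integration.integral_sum) (simp_all only: int Bochner_Integration.integrable_mult_right integral_mult_right_zero)
  finally have eq: "(LINT t|lborel. indicator {a..b} t * qform k \<eta> h (schroedinger (\<alpha> * h * t) u)) =
      (\<Sum>m\<in>?F. (\<eta> (h *\<^sub>R ivec m) * fc u m * cnj (fc u (m + k)) / of_real ?V) * I m)" .
  have I: "norm (I m) \<le> 4 / (\<alpha> * \<delta>) + (b - a) * (if \<bar>ivec k \<bullet> (h *\<^sub>R ivec m)\<bar> \<le> \<delta> then 1 else 0)" for m
  proof (cases "\<bar>ivec k \<bullet> (h *\<^sub>R ivec m)\<bar> \<le> \<delta>")
    case True
    have "0 \<le> 4 / (\<alpha> * \<delta>)" using \<alpha> \<delta> by simp
    moreover have "norm (I m) \<le> b - a" unfolding I_def by (rule cis_integral_bounds(1)[OF ab])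
    ultimately show ?thesis using True by (simp only: if_True mult_1_right)
  next
    case False
    define x where "x = h * (ivec m \<bullet> ivec k)"
    have x: "\<delta> < \<bar>x\<bar>" using False by (simp add: x_def inner_commute)
    have s: "s m = \<alpha> * (x + h * (ivec k \<bullet> ivec k) / 2)" by (simp add: s_def x_def algebra_simps)
    have "0 \<le> h * (ivec k \<bullet> ivec k)" using h by simp
    \<comment> \<open>The correction from the square of \<open>k\<close> is at most
      \<open>\<delta> / 2\<close> by the smallness assumption on \<open>h\<close>.\<close>
    then have "\<delta> / 2 \<le> \<bar>x + h * (ivec k \<bullet> ivec k) / 2\<bar>" using x h(2) by linarith
    then have le: "\<alpha> * (\<delta> / 2) \<le> \<bar>s m\<bar>" unfolding s abs_mult using \<alpha> by (simp add: mult_left_mono)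
    have p: "0 < \<alpha> * (\<delta> / 2)" using \<alpha> \<delta> by simp
    have "s m \<noteq> 0" using le p by auto
    moreover have "2 / \<bar>s m\<bar> \<le> 2 / (\<alpha> * (\<delta> / 2))"
    proof (rule divide_left_mono[OF le])
      have "0 < \<bar>s m\<bar>" using le p by linarith
      then show "0 < \<bar>s m\<bar> * (\<alpha> * (\<delta> / 2))" by (rule mult_pos_pos[OF _ p])
    qed simp
    ultimately show ?thesis using cis_integral_bounds(2)[OF ab, of "s m"] False unfolding I_def by simp
  qed
  have trm: "e m * c m * c (m + k) * norm (I m) \<le>
      (2 / (\<alpha> * \<delta>) * B) * ((c m)\<^sup>2 + (c (m + k))\<^sup>2) + (b - a) * (((e m)\<^sup>2 * \<rho> m * (c m)\<^sup>2) / (2 * \<tau>) + \<tau> / 2 * (c (m + k))\<^sup>2)" for m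
  proof -
    have n: "0 \<le> e m" "0 \<le> c m" "0 \<le> c (m + k)" "0 \<le> \<rho> m" by (simp_all add: e_def c_def \<rho>_def near_plane_nonneg)
    have eB: "e m \<le> B" by (simp add: e_def B)
    have 1: "e m * (c m * c (m + k)) \<le> B * (((c m)\<^sup>2 + (c (m + k))\<^sup>2) / 2)"
      using prod_le_squares[of "c m" "c (m + k)"] n B0 by (intro mult_mono eB) auto
    have 2: "e m * c m * c (m + k) * (if \<bar>ivec k \<bullet> (h *\<^sub>R ivec m)\<bar> \<le> \<delta> then 1 else 0) \<le> ((e m)\<^sup>2 * \<rho> m * (c m)\<^sup>2) / (2 * \<tau>) + \<tau> / 2 * (c (m + k))\<^sup>2"
    proof (cases "\<bar>ivec k \<bullet> (h *\<^sub>R ivec m)\<bar> \<le> \<delta>")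
      case True
      then have r: "1 \<le> \<rho> m" unfolding \<rho>_def by (rule near_plane_ge_1[OF \<delta>])
      \<comment> \<open>The weight \<open>\<tau>\<close> leaves a small factor on the unlocalised
        energy at \<open>m + k\<close>, while the bump localises the other factor near the
        plane.\<close>
      have "2 * ((e m * c m) * (\<tau> * c (m + k))) \<le> (e m * c m)\<^sup>2 + (\<tau> * c (m + k))\<^sup>2" by (rule prod_le_squares)
      also have "(e m * c m)\<^sup>2 \<le> (e m)\<^sup>2 * \<rho> m * (c m)\<^sup>2"
      proof -
        have "(e m * c m)\<^sup>2 * 1 \<le> (e m * c m)\<^sup>2 * \<rho> m" by (intro mult_left_mono r) simp
        then show ?thesis by (simp add: power_mult_distrib mult_ac)
      qed
      finally have "2 * \<tau> * (e m * c m * c (m + k)) \<le> (e m)\<^sup>2 * \<rho> m * (c m)\<^sup>2 + \<tau>\<^sup>2 * (c (m + k))\<^sup>2"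
        by (simp add: power_mult_distrib mult_ac)
      then have "e m * c m * c (m + k) \<le> ((e m)\<^sup>2 * \<rho> m * (c m)\<^sup>2 + \<tau>\<^sup>2 * (c (m + k))\<^sup>2) / (2 * \<tau>)"
        using \<tau> by (simp add: le_divide_eq mult_ac)
      also have "\<dots> = ((e m)\<^sup>2 * \<rho> m * (c m)\<^sup>2) / (2 * \<tau>) + \<tau> / 2 * (c (m + k))\<^sup>2"
        using \<tau> by (simp add: add_divide_distrib power2_eq_square)
      finally show ?thesis using True by simp
    qed (use n \<tau> in simp)
    have "e m * c m * c (m + k) * norm (I m) \<le> e m * c m * c (m + k) * (4 / (\<alpha> * \<delta>) + (b - a) * (if \<bar>ivec k \<bullet> (h *\<^sub>R ivec m)\<bar> \<le> \<delta> then 1 else 0))"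
      using n by (intro mult_left_mono I) simp
    also have "\<dots> = (4 / (\<alpha> * \<delta>)) * (e m * (c m * c (m + k))) + (b - a) * (e m * c m * c (m + k) * (if \<bar>ivec k \<bullet> (h *\<^sub>R ivec m)\<bar> \<le> \<delta> then 1 else 0))"
      by (simp only: distrib_left mult_ac)
    also have "\<dots> \<le> (4 / (\<alpha> * \<delta>)) * (B * (((c m)\<^sup>2 + (c (m + k))\<^sup>2) / 2)) + (b - a) * (((e m)\<^sup>2 * \<rho> m * (c m)\<^sup>2) / (2 * \<tau>) + \<tau> / 2 * (c (m + k))\<^sup>2)"
      using 1 2 \<alpha> \<delta> ab by (intro add_mono mult_left_mono) auto
    finally show ?thesis by simp
  qed
  have S1: "(\<Sum>m\<in>?F. (c m)\<^sup>2) \<le> ?V * N2 u"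
    unfolding c_def by (rule Bessel[OF u fin])
  have S2: "(\<Sum>m\<in>?F. (c (m + k))\<^sup>2) \<le> ?V * N2 u"
  proof -
    have "(\<Sum>m\<in>?F. (c (m + k))\<^sup>2) = (\<Sum>m\<in>(\<lambda>m. m + k) ` ?F. (c m)\<^sup>2)"
      by (subst sum.reindex) (auto simp: inj_on_def)
    also have "\<dots> \<le> ?V * N2 u" unfolding c_def by (rule Bessel[OF u]) (use fin in simp)
    finally show ?thesis .
  qed
  \<comment> \<open>With frequency 0 and real \<open>\<eta>\<close> every term of the form is
    nonnegative, so its norm is the sum itself.\<close>
  have S3: "(\<Sum>m\<in>?F. (e m)\<^sup>2 * \<rho> m * (c m)\<^sup>2) = ?V * norm (qform 0 (near_symbol k \<delta> \<eta>) h u)"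
  proof -
    let ?\<zeta> = "near_symbol k \<delta> \<eta>"
    have \<zeta>: "?\<zeta> (h *\<^sub>R ivec m) * fc u m * cnj (fc u m) = of_real ((e m)\<^sup>2 * \<rho> m * (c m)\<^sup>2)" for m
    proof -
      have "\<eta> (h *\<^sub>R ivec m) * \<eta> (h *\<^sub>R ivec m) = of_real ((e m)\<^sup>2)"
        using complex_norm_square[of "\<eta> (h *\<^sub>R ivec m)"] by (simp add: real e_def)
      moreover have "fc u m * cnj (fc u m) = of_real ((c m)\<^sup>2)"
        using complex_norm_square[of "fc u m"] by (simp add: c_def)
      moreover have "?\<zeta> (h *\<^sub>R ivec m) * fc u m * cnj (fc u m) = (\<eta> (h *\<^sub>R ivec m) * \<eta> (h *\<^sub>R ivec m)) * of_real (\<rho> m) * (fc u m * cnj (fc u m))"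
        by (simp add: near_symbol_def \<rho>_def mult_ac)
      ultimately show ?thesis by simp
    qed
    have "qform 0 ?\<zeta> h u = (\<Sum>m\<in>{m. ?\<zeta> (h *\<^sub>R ivec m) \<noteq> 0}. of_real ((e m)\<^sup>2 * \<rho> m * (c m)\<^sup>2)) / of_real ?V"
      unfolding qform_def by (simp add: \<zeta>)
    also have "(\<Sum>m\<in>{m. ?\<zeta> (h *\<^sub>R ivec m) \<noteq> 0}. of_real ((e m)\<^sup>2 * \<rho> m * (c m)\<^sup>2)) = (\<Sum>m\<in>?F. of_real ((e m)\<^sup>2 * \<rho> m * (c m)\<^sup>2) :: complex)"
    proof (rule sum.mono_neutral_left[OF fin])
      show "{m. ?\<zeta> (h *\<^sub>R ivec m) \<noteq> 0} \<subseteq> ?F" by (auto simp: near_symbol_def)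
      show "\<forall>m\<in>?F - {m. ?\<zeta> (h *\<^sub>R ivec m) \<noteq> 0}. of_real ((e m)\<^sup>2 * \<rho> m * (c m)\<^sup>2) = (0::complex)"
        using \<zeta> by (metis (mono_tags, lifting) DiffD2 mem_Collect_eq mult_zero_left)
    qed
    finally have "qform 0 ?\<zeta> h u = of_real ((\<Sum>m\<in>?F. (e m)\<^sup>2 * \<rho> m * (c m)\<^sup>2) / ?V)" by simp
    then have "norm (qform 0 ?\<zeta> h u) = \<bar>(\<Sum>m\<in>?F. (e m)\<^sup>2 * \<rho> m * (c m)\<^sup>2) / ?V\<bar>" by (simp only: norm_of_real)
    also have "\<dots> = (\<Sum>m\<in>?F. (e m)\<^sup>2 * \<rho> m * (c m)\<^sup>2) / ?V"
      by (intro abs_of_nonneg divide_nonneg_nonneg sum_nonneg mult_nonneg_nonneg) (simp_all add: \<rho>_def near_plane_nonneg)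
    finally show ?thesis by simp
  qed
  have "norm (\<Sum>m\<in>?F. (\<eta> (h *\<^sub>R ivec m) * fc u m * cnj (fc u (m + k)) / of_real ?V) * I m) \<le> (\<Sum>m\<in>?F. e m * c m * c (m + k) * norm (I m) / ?V)"
    by (rule sum_norm_le) (simp add: norm_mult norm_divide e_def c_def)
  also have "\<dots> = (\<Sum>m\<in>?F. e m * c m * c (m + k) * norm (I m)) / ?V" by (simp add: sum_divide_distrib)
  also have "\<dots> \<le> (\<Sum>m\<in>?F. (2 / (\<alpha> * \<delta>) * B) * ((c m)\<^sup>2 + (c (m + k))\<^sup>2) + (b - a) * (((e m)\<^sup>2 * \<rho> m * (c m)\<^sup>2) / (2 * \<tau>) + \<tau> / 2 * (c (m + k))\<^sup>2)) / ?V"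
    by (intro divide_right_mono sum_mono trm) simp
  also have "(\<Sum>m\<in>?F. (2 / (\<alpha> * \<delta>) * B) * ((c m)\<^sup>2 + (c (m + k))\<^sup>2) + (b - a) * (((e m)\<^sup>2 * \<rho> m * (c m)\<^sup>2) / (2 * \<tau>) + \<tau> / 2 * (c (m + k))\<^sup>2))
     = (2 / (\<alpha> * \<delta>) * B) * ((\<Sum>m\<in>?F. (c m)\<^sup>2) + (\<Sum>m\<in>?F. (c (m + k))\<^sup>2)) + (b - a) * ((\<Sum>m\<in>?F. (e m)\<^sup>2 * \<rho> m * (c m)\<^sup>2) / (2 * \<tau>) + \<tau> / 2 * (\<Sum>m\<in>?F. (c (m + k))\<^sup>2))"
    by (simp only: sum.distrib sum_distrib_left[symmetric] sum_divide_distrib[symmetric])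
  also have "\<dots> \<le> (2 / (\<alpha> * \<delta>) * B) * (?V * N2 u + ?V * N2 u) + (b - a) * (?V * norm (qform 0 (near_symbol k \<delta> \<eta>) h u) / (2 * \<tau>) + \<tau> / 2 * (?V * N2 u))"
    unfolding S3 using \<alpha> \<delta> B0 ab \<tau> S1 S2 by (intro add_mono mult_left_mono order_refl) auto
  finally have "norm (\<Sum>m\<in>?F. (\<eta> (h *\<^sub>R ivec m) * fc u m * cnj (fc u (m + k)) / of_real ?V) * I m) \<le>
     ((2 / (\<alpha> * \<delta>) * B) * (?V * N2 u + ?V * N2 u) + (b - a) * (?V * norm (qform 0 (near_symbol k \<delta> \<eta>) h u) / (2 * \<tau>) + \<tau> / 2 * (?V * N2 u))) / ?V"
    by (simp add: divide_right_mono)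
  also have "\<dots> = 4 / (\<alpha> * \<delta>) * B * N2 u + (b - a) * (norm (qform 0 (near_symbol k \<delta> \<eta>) h u) / (2 * \<tau>) + \<tau> / 2 * N2 u)"
  proof -
    have "(2 / (\<alpha> * \<delta>) * B) * (?V * N2 u + ?V * N2 u) + (b - a) * (?V * norm (qform 0 (near_symbol k \<delta> \<eta>) h u) / (2 * \<tau>) + \<tau> / 2 * (?V * N2 u))
      = ?V * (4 / (\<alpha> * \<delta>) * B * N2 u + (b - a) * (norm (qform 0 (near_symbol k \<delta> \<eta>) h u) / (2 * \<tau>) + \<tau> / 2 * N2 u))"
      by (simp add: algebra_simps)
    then show ?thesis by simp
  qed
  finally show ?thesis unfolding eq .
qed

lemma resonant_sets: "(UNIV :: 'n::finite torus set) \<times> (resonant :: (real^'n) set) \<in> sets borel"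
proof -
  have "UNIV \<times> resonant = (\<Union>k\<in>{k :: int^'n. k \<noteq> 0}. (\<lambda>z :: 'n cotangent. ivec k \<bullet> snd z) -` {0})"
    by (auto simp: resonant_def ivec_def)
  also have "\<dots> \<in> sets borel"
  proof (rule sets.countable_UN')
    show "(\<lambda>k :: int^'n. (\<lambda>z :: 'n cotangent. ivec k \<bullet> snd z) -` {0}) ` {k. k \<noteq> 0} \<subseteq> sets borel"
      by (auto intro!: borel_closed closed_vimage continuous_intros)
  qed (auto intro: countable_subset[of _ UNIV])
  finally show ?thesis .
qed

lemma radon_integrable:
  fixes f :: "'n::finite cotangent \<Rightarrow> complex"
  assumes M: "radon_measure M" and f: "f \<in> borel_measurable borel" and B: "\<And>z. norm (f z) \<le> B" and R: "\<And>z. R < norm (snd z) \<Longrightarrow> f z = 0"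
  shows "integrable M f"
proof -
  let ?K = "(UNIV :: 'n torus set) \<times> cball (0 :: real^'n) R"
  have K: "compact ?K" by (intro compact_Times compact_UNIV_torus compact_cball)
  have sM: "sets M = sets borel" using M by (simp add: radon_measure_def)
  have KM: "?K \<in> sets M" unfolding sM by (intro borel_closed compact_imp_closed K)
  have "emeasure M ?K < \<infinity>" using M K by (simp add: radon_measure_def)
  then have "integrable M (\<lambda>z. B * indicator ?K z :: real)"
    by (intro Bochner_Integration.integrable_mult_right integrable_real_indicator KM)
  then show ?thesis
  proof (rule Bochner_Integration.integrable_bound)
    show "f \<in> borel_measurable M" using f measurable_cong_sets[OF sM refl] by blast
    have B0: "0 \<le> B" using B norm_ge_zero order_trans by blast
    have "norm (f z) \<le> norm (B * indicator ?K z :: real)" for z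
      using B[of z] B0 R[of z] by (cases z) (auto simp: indicator_def not_le)
    then show "AE z in M. norm (f z) \<le> norm (B * indicator ?K z :: real)" by simp
  qed
qed

lemma tsym_measurable: "\<eta> \<in> testf \<Longrightarrow> tsym k \<eta> \<in> borel_measurable borel"
  unfolding tsym_def case_prod_unfold
  by (intro borel_measurable_continuous_onI continuous_intros continuous_on_compose2[OF testf_continuous]) auto

lemma tsym_integrable:
  assumes M: "radon_measure M" and \<eta>: "\<eta> \<in> testf" shows "integrable M (tsym k \<eta>)"
proof -
  obtain R B where "R > 0" "B \<ge> 0" "\<And>\<xi>. R < norm \<xi> \<Longrightarrow> \<eta> \<xi> = 0" "\<And>\<xi>. norm (\<eta> \<xi>) \<le> B"
    by (rule testf_bounded[OF \<eta>]) (rule that)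
  then show ?thesis
    by (intro radon_integrable[OF M tsym_measurable[OF \<eta>], where B = B and R = R]) (auto simp: tsym_def case_prod_unfold norm_mult)
qed

text \<open>Off the resonant set the bump eventually vanishes at each point because its width
  shrinks, and the resonant set is null. The square of \<open>\<eta>\<close>, times
  \<open>exp 2\<close>, dominates.\<close>

lemma near_symbol_limit:
  fixes k :: "int^'n::finite"
  assumes M: "radon_measure M" and nr: "emeasure M (UNIV \<times> resonant) = 0" and k: "k \<noteq> 0" and \<eta>: "\<eta> \<in> testf"
  shows "(\<lambda>j. LINT z|M. tsym 0 (near_symbol k (1 / real (Suc j)) \<eta>) z) \<longlonglongrightarrow> 0"
proof -
  obtain R B where RB: "R > 0" "B \<ge> 0" "\<And>\<xi>. R < norm \<xi> \<Longrightarrow> \<eta> \<xi> = 0" "\<And>\<xi>. norm (\<eta> \<xi>) \<le> B"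
    by (rule testf_bounded[OF \<eta>]) (rule that)
  have sM: "sets M = sets borel" using M by (simp add: radon_measure_def)
  have bm: "f \<in> borel_measurable M" if "f \<in> borel_measurable borel" for f :: "'n cotangent \<Rightarrow> complex"
    using that measurable_cong_sets[OF sM refl] by blast
  have null: "UNIV \<times> resonant \<in> null_sets M" using nr resonant_sets sM by (auto intro: null_setsI)
  define g where "g z = of_real (exp 2) * (tsym 0 \<eta> z * tsym 0 \<eta> z)" for z :: "'n cotangent"
  have gi: "integrable M g"
  proof (rule radon_integrable[OF M, where B = "exp 2 * (B * B)" and R = R])
    show "g \<in> borel_measurable borel" unfolding g_def[abs_def] using tsym_measurable[OF \<eta>, of 0] by measurable
    show "norm (g z) \<le> exp 2 * (B * B)" for z
      unfolding g_def norm_mult tsym_def case_prod_unfold norm_of_real norm_charc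
      using RB by (simp add: mult_mono)
  qed (simp add: g_def tsym_def case_prod_unfold RB)
  have "(\<lambda>j. LINT z|M. tsym 0 (near_symbol k (1 / real (Suc j)) \<eta>) z) \<longlonglongrightarrow> (LINT z|M. 0)"
  proof (rule integral_dominated_convergence[OF _ _ integrable_norm[OF gi]])
    show "tsym 0 (near_symbol k (1 / real (Suc j)) \<eta>) \<in> borel_measurable M" for j
      by (rule bm[OF tsym_measurable[OF near_symbol_testf[OF \<eta>]]])
    show "AE z in M. (\<lambda>j. tsym 0 (near_symbol k (1 / real (Suc j)) \<eta>) z) \<longlonglongrightarrow> 0"
    proof (rule AE_mp[OF AE_not_in[OF null]], rule AE_I2, rule impI)
      fix z :: "'n cotangent" assume "z \<notin> UNIV \<times> resonant"
      then have kz: "ivec k \<bullet> snd z \<noteq> 0" using k by (cases z) (auto simp: resonant_def ivec_def)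
      have "(\<lambda>j. 2 * (1 / real (Suc j))) \<longlonglongrightarrow> 2 * 0"
        using LIMSEQ_inverse_real_of_nat by (intro tendsto_mult tendsto_const) (simp add: inverse_eq_divide)
      then have "\<forall>\<^sub>F j in sequentially. 2 * (1 / real (Suc j)) < \<bar>ivec k \<bullet> snd z\<bar>"
        using kz by (intro order_tendstoD(2)) auto
      then have "\<forall>\<^sub>F j in sequentially. tsym 0 (near_symbol k (1 / real (Suc j)) \<eta>) z = 0"
      proof eventually_elim
        case (elim j)
        then have "near_plane k (1 / real (Suc j)) (snd z) = 0" by (intro near_plane_zero) auto
        then show ?case by (simp add: tsym_def near_symbol_def case_prod_unfold)
      qed
      then show "(\<lambda>j. tsym 0 (near_symbol k (1 / real (Suc j)) \<eta>) z) \<longlonglongrightarrow> 0" by (rule tendsto_eventually)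
    qed
    show "AE z in M. norm (tsym 0 (near_symbol k (1 / real (Suc j)) \<eta>) z) \<le> norm (g z)" for j
    proof (rule AE_I2)
      fix z :: "'n cotangent"
      define y where "y = norm (\<eta> (snd z)) * norm (\<eta> (snd z))"
      have "y * near_plane k (1 / real (Suc j)) (snd z) \<le> y * exp 2"
        by (intro mult_left_mono near_plane_le) (simp add: y_def)
      then show "norm (tsym 0 (near_symbol k (1 / real (Suc j)) \<eta>) z) \<le> norm (g z)"
        using near_plane_nonneg[of k "1 / real (Suc j)" "snd z"]
        by (simp add: y_def g_def tsym_def near_symbol_def case_prod_unfold norm_mult mult_ac)
    qed
  qed simp
  then show ?thesis by simp
qed

lemma integrable_interval_bounded:
  fixes f :: "real \<Rightarrow> complex"
  assumes [measurable]: "f \<in> borel_measurable borel" and B: "AE t in lborel. norm (f t) \<le> B"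
  shows "integrable lborel (\<lambda>t. indicator {a..b} t * f t)"
proof (rule Bochner_Integration.integrable_bound)
  show "integrable lborel (\<lambda>t. B * indicator {a..b} t :: real)"
    by (intro Bochner_Integration.integrable_mult_right integrable_real_indicator) (auto simp: emeasure_lborel_Icc_eq)
  show "AE t in lborel. norm (indicator {a..b} t * f t) \<le> norm (B * indicator {a..b} t :: real)"
    using B by eventually_elim (auto simp: indicator_def norm_mult)
qed measurable

text \<open>Bounded intervals are stable under intersection and generate the Borel sets, so
  subtracting \<open>c\<close> and applying \<open>AE_zero_of_set_integrals\<close> on each window
  from \<open>- N\<close> to \<open>N\<close> suffices. The windows provide integrability.\<close>

lemma AE_eq_of_interval_integrals:
  fixes f :: "real \<Rightarrow> complex"
  assumes f: "f \<in> borel_measurable lebesgue" and B: "AE t in lebesgue. norm (f t) \<le> B"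
    and avg: "\<And>a b. a \<le> b \<Longrightarrow> (LINT t|lebesgue. indicator {a..b} t * f t) = of_real (b - a) * c"
  shows "AE t in lebesgue. f t = c"
proof -
  have "(\<lambda>t. Re (f t)) \<in> borel_measurable lebesgue" "(\<lambda>t. Im (f t)) \<in> borel_measurable lebesgue"
    using f by measurable
  \<comment> \<open>A Borel representative is chosen, since generation by intervals concerns Borel
    sets.\<close>
  from this[THEN completion_ex_borel_measurable_real] obtain p q where
    [measurable]: "p \<in> borel_measurable lborel" "q \<in> borel_measurable lborel"
    and pq: "AE t in lborel. Re (f t) = p t" "AE t in lborel. Im (f t) = q t" by auto
  define g where "g t = of_real (p t) + \<i> * of_real (q t)" for t
  have gm [measurable]: "g \<in> borel_measurable borel" unfolding g_def[abs_def] by simp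
  have fg: "AE t in lborel. f t = g t"
    using pq by eventually_elim (simp add: g_def complex_eq_iff)
  have fg': "AE t in lebesgue. f t = g t" by (rule AE_completion[OF fg])
  have gB: "AE t in lborel. norm (g t) \<le> B"
    using fg B unfolding AE_completion_iff by eventually_elim simp
  have gi: "(LINT t|lborel. indicator {a..b} t * g t) = of_real (b - a) * c" if "a \<le> b" for a b
  proof -
    have "(LINT t|lborel. indicator {a..b} t * g t) = (LINT t|lebesgue. indicator {a..b} t * g t)"
      by (rule integral_completion[symmetric]) measurable
    also have "\<dots> = (LINT t|lebesgue. indicator {a..b} t * f t)"
    proof (rule integral_cong_AE)
      show "(\<lambda>t. indicator {a..b} t * g t) \<in> borel_measurable lebesgue"
        by (rule measurable_completion) measurable
      show "(\<lambda>t. indicator {a..b} t * f t) \<in> borel_measurable lebesgue"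
      proof (rule borel_measurable_times[OF _ f])
        show "(indicator {a..b} :: real \<Rightarrow> complex) \<in> borel_measurable lebesgue"
          by (rule measurable_completion) measurable
      qed
      show "AE t in lebesgue. indicator {a..b} t * g t = indicator {a..b} t * f t"
        using fg' by eventually_elim simp
    qed
    finally show ?thesis using avg[OF that] by simp
  qed
  define d where "d t = g t - c" for t
  have dm [measurable]: "d \<in> borel_measurable borel" unfolding d_def[abs_def] by measurable
  have dB: "AE t in lborel. norm (d t) \<le> B + norm c"
    using gB by eventually_elim (auto simp: d_def intro: order_trans[OF norm_triangle_ineq4])
  have di: "(LINT t|lborel. indicator {a..b} t * d t) = 0" for a b
  proof (cases "a \<le> b")
    case True
    have "(LINT t|lborel. indicator {a..b} t * d t) = (LINT t|lborel. indicator {a..b} t * g t - indicator {a..b} t * c)"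
      by (simp add: d_def right_diff_distrib)
    also have "\<dots> = (LINT t|lborel. indicator {a..b} t * g t) - (LINT t|lborel. indicator {a..b} t * c)"
      by (intro Bochner_Integration.integral_diff integrable_interval_bounded[OF gm gB] integrable_interval_bounded[where B = "norm c"]) auto
    also have "(LINT t|lborel. indicator {a..b} t * c) = of_real (b - a) * c"
    proof -
      have "(LINT t|lborel. indicator {a..b} t * c) = (LINT t|lborel. indicator {a..b} t *\<^sub>R c)"
        by (intro Bochner_Integration.integral_cong refl) (simp add: indicator_def)
      also have "\<dots> = (b - a) *\<^sub>R c" using True by simp
      finally show ?thesis by (simp add: scaleR_conv_of_real)
    qed
    finally show ?thesis using gi[OF True] by simp
  qed simp
  have "AE t in lborel. indicator {- real N..real N} t * d t = 0" for N
  proof (rule AE_zero_of_set_integrals[OF lborel.sigma_finite_measure_axioms, where G = "range (\<lambda>(a, b). {a..b})"])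
    show "integrable lborel (\<lambda>t. indicator {- real N..real N} t * d t)"
      by (rule integrable_interval_bounded[OF dm dB])
    show "Int_stable (range (\<lambda>(a, b). {a..b::real}))" by (auto simp: Int_stable_def)
    show "sets lborel = sigma_sets (space lborel) (range (\<lambda>(a, b). {a..b::real}))"
      by (simp add: borel_eq_atLeastAtMost)
    fix A :: "real set" assume "A \<in> range (\<lambda>(a, b). {a..b})"
    then obtain a b where A: "A = {a..b}" by auto
    have "(LINT t|lborel. indicator {- real N..real N} t * d t * indicator A t) = (LINT t|lborel. indicator {max a (- real N)..min b (real N)} t * d t)"
      unfolding A by (intro Bochner_Integration.integral_cong refl) (auto simp: indicator_def)
    then show "(LINT t|lborel. indicator {- real N..real N} t * d t * indicator A t) = 0" by (simp add: di)
  qed (simp_all add: di)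
  then have "AE t in lborel. \<forall>N. indicator {- real N..real N} t * d t = 0"
    unfolding AE_all_countable by blast
  then have "AE t in lborel. d t = 0"
  proof eventually_elim
    case (elim t)
    obtain N where "\<bar>t\<bar> \<le> real N" using real_arch_simple by blast
    then have "t \<in> {- real N..real N}" by (simp add: abs_le_iff)
    then show ?case using elim[rule_format, of N] by simp
  qed
  then have "AE t in lborel. f t = c"
    using fg by eventually_elim (simp add: d_def)
  then show ?thesis by (rule AE_completion)
qed

text \<open>The data of the evolved states, without the limiting family of measures: the limits of
  time averages below hold along the whole sequence.\<close>

locale evolved =
  fixes Op :: "('n::finite cotangent \<Rightarrow> complex) \<Rightarrow> real \<Rightarrow> ('n torus \<Rightarrow> complex) \<Rightarrow> 'n torus \<Rightarrow> complex"
    and h \<alpha> :: "nat \<Rightarrow> real" and u :: "nat \<Rightarrow> 'n torus \<Rightarrow> complex" and \<mu>0 :: "'n cotangent measure"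
  assumes Op: "\<And>a. a \<in> Cc_inf_cotangent \<Longrightarrow> weyl_quantization a (Op a)"
    and h: "\<And>n. h n > 0" "h \<longlonglongrightarrow> 0"
    and u: "\<And>n. u n \<in> L2_torus" "\<exists>C. \<forall>n. L2_norm (u n) \<le> C"
    and \<mu>0: "radon_measure \<mu>0"
      "\<And>a. a \<in> Cc_inf_cotangent \<Longrightarrow> (\<lambda>n. L2_inner (Op a (h n) (u n)) (u n)) \<longlonglongrightarrow> (LINT z|\<mu>0. a z)"
    and \<alpha>: "\<And>n. \<alpha> n > 0" "filterlim \<alpha> at_top sequentially"
    and nonresonant: "emeasure \<mu>0 (UNIV \<times> resonant) = 0"
begin

abbreviation evol :: "nat \<Rightarrow> real \<Rightarrow> 'n torus \<Rightarrow> complex" where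
  "evol n t \<equiv> schroedinger (\<alpha> n * h n * t) (u n)"

lemma energy_bound: "\<exists>D>0. \<forall>n. N2 (u n) \<le> D"
proof -
  obtain C where C: "\<And>n. sqrt (N2 (u n)) \<le> C" using u(2) unfolding L2_norm_eq by blast
  have "N2 (u n) \<le> C\<^sup>2 + 1" for n using sqrt_le_D[OF C[of n]] by simp
  then show ?thesis by (intro exI[of _ "C\<^sup>2 + 1"]) (auto intro: add_nonneg_pos)
qed

lemma eventually_qform_close:
  assumes \<eta>: "\<eta> \<in> testf" and e: "e > 0"
  shows "\<forall>\<^sub>F n in sequentially. \<forall>v\<in>L2_torus. norm (L2_inner (Op (tsym k \<eta>) (h n) v) v - qform k \<eta> (h n) v) \<le> e * N2 v"
proof -
  obtain h0 where h0: "h0 > 0" "\<And>h v. 0 < h \<Longrightarrow> h < h0 \<Longrightarrow> v \<in> L2_torus \<Longrightarrow>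
      norm (L2_inner (Op (tsym k \<eta>) h v) v - qform k \<eta> h v) \<le> e * N2 v"
    using quantization_qform[OF \<eta> Op[OF tsym_Cc_inf[OF \<eta>]] e] by blast
  from order_tendstoD(2)[OF h(2) h0(1)] show ?thesis
    by eventually_elim (use h0(2) h(1) in blast)
qed

text \<open>The initial limit passes to the lattice form by \<open>quantization_qform\<close> and
  bounded energy. It is used for the conserved form with \<open>k = 0\<close> and for the size of
  \<open>near_symbol\<close>.\<close>

lemma qform_limit:
  assumes \<eta>: "\<eta> \<in> testf"
  shows "(\<lambda>n. qform k \<eta> (h n) (u n)) \<longlonglongrightarrow> (LINT z|\<mu>0. tsym k \<eta> z)"
proof -
  obtain D where D: "D > 0" "\<And>n. N2 (u n) \<le> D" using energy_bound by blast
  have "(\<lambda>n. L2_inner (Op (tsym k \<eta>) (h n) (u n)) (u n) - qform k \<eta> (h n) (u n)) \<longlonglongrightarrow> 0"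
  proof (rule tendstoI)
    fix e :: real assume e: "e > 0"
    then have "e / 2 / D > 0" using D by simp
    from eventually_qform_close[OF \<eta> this, of k]
    show "\<forall>\<^sub>F n in sequentially. dist (L2_inner (Op (tsym k \<eta>) (h n) (u n)) (u n) - qform k \<eta> (h n) (u n)) 0 < e"
    proof eventually_elim
      case (elim n)
      have "norm (L2_inner (Op (tsym k \<eta>) (h n) (u n)) (u n) - qform k \<eta> (h n) (u n)) \<le> e / 2 / D * N2 (u n)"
        using elim u(1) by blast
      also have "\<dots> \<le> e / 2 / D * D" using D e by (intro mult_left_mono) auto
      also have "\<dots> < e" using D e by simp
      finally show ?case by simp
    qed
  qed
  from tendsto_diff[OF \<mu>0(2)[OF tsym_Cc_inf[OF \<eta>, of k]] this] show ?thesis by simp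
qed

text \<open>The order of choices matters: the weight \<open>\<tau>\<close> makes the energy term
  small, the width \<open>\<delta>\<close> then makes the limit of the near form small relative to
  \<open>\<tau>\<close>, and only afterwards does \<open>n\<close> grow, so that \<open>h\<close> is
  small and \<open>\<alpha>\<close> large.\<close>

lemma time_average_qform:
  assumes \<eta>: "\<eta> \<in> testf" and real: "\<And>\<xi>. cnj (\<eta> \<xi>) = \<eta> \<xi>" and k: "k \<noteq> 0" and ab: "a \<le> b"
  shows "(\<lambda>n. LINT t|lborel. indicator {a..b} t * qform k \<eta> (h n) (evol n t)) \<longlonglongrightarrow> 0"
proof (rule tendstoI)
  fix e :: real assume e: "e > 0"
  obtain D where D: "D > 0" "\<And>n. N2 (u n) \<le> D" using energy_bound by blast
  obtain R B where RB: "R > 0" "B \<ge> 0" "\<And>\<xi>. R < norm \<xi> \<Longrightarrow> \<eta> \<xi> = 0" "\<And>\<xi>. norm (\<eta> \<xi>) \<le> B"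
    by (rule testf_bounded[OF \<eta>]) (rule that)
  define L where "L = b - a + 1"
  have L: "L > 0" "b - a \<le> L" using ab by (simp_all add: L_def)
  \<comment> \<open>With this \<open>\<tau>\<close> the energy term is at most \<open>e / 8\<close>,
    and with \<open>\<epsilon>\<close> below the near form contributes at most \<open>e / 4\<close>;
    the oscillating part takes another \<open>e / 4\<close>.\<close>
  define \<tau> where "\<tau> = e / (4 * L * D)"
  have \<tau>: "\<tau> > 0" using e L D by (simp add: \<tau>_def)
  define \<epsilon> where "\<epsilon> = e * \<tau> / (2 * L)"
  have \<epsilon>: "\<epsilon> > 0" using e \<tau> L by (simp add: \<epsilon>_def)
  from tendstoD[OF near_symbol_limit[OF \<mu>0(1) nonresonant k \<eta>] \<epsilon>]
  obtain j where j: "norm (LINT z|\<mu>0. tsym 0 (near_symbol k (1 / real (Suc j)) \<eta>) z) < \<epsilon>"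
    by (auto simp: eventually_sequentially)
  define \<delta> where "\<delta> = 1 / real (Suc j)"
  have \<delta>: "\<delta> > 0" by (simp add: \<delta>_def)
  have E1: "\<forall>\<^sub>F n in sequentially. norm (qform 0 (near_symbol k \<delta> \<eta>) (h n) (u n)) < \<epsilon>"
    by (rule order_tendstoD(2)[OF tendsto_norm[OF qform_limit[OF near_symbol_testf[OF \<eta>]]]]) (use j in \<open>simp add: \<delta>_def\<close>)
  have "(\<lambda>n. h n * (ivec k \<bullet> ivec k)) \<longlonglongrightarrow> 0" using tendsto_mult_left_zero[OF h(2)] by simp
  then have E2: "\<forall>\<^sub>F n in sequentially. h n * (ivec k \<bullet> ivec k) < \<delta>" by (rule order_tendstoD(2)) (rule \<delta>)
  have E3: "\<forall>\<^sub>F n in sequentially. 16 * B * D / (\<delta> * e) \<le> \<alpha> n"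
    using \<alpha>(2) by (simp add: filterlim_at_top)
  show "\<forall>\<^sub>F n in sequentially. dist (LINT t|lborel. indicator {a..b} t * qform k \<eta> (h n) (evol n t)) 0 < e"
    using E1 E2 E3
  proof eventually_elim
    case (elim n)
    let ?q = "norm (qform 0 (near_symbol k \<delta> \<eta>) (h n) (u n))"
    have "norm (LINT t|lborel. indicator {a..b} t * qform k \<eta> (h n) (evol n t)) \<le>
       4 / (\<alpha> n * \<delta>) * B * N2 (u n) + (b - a) * (?q / (2 * \<tau>) + \<tau> / 2 * N2 (u n))"
      by (rule qform_time_bound[OF \<eta> real RB(4) h(1) less_imp_le[OF elim(2)] \<delta> \<alpha>(1) \<tau> ab u(1)])
    also have "\<dots> \<le> 4 / (\<alpha> n * \<delta>) * B * D + L * (\<epsilon> / (2 * \<tau>) + \<tau> / 2 * D)"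
      using elim(1) \<alpha>(1)[of n] \<delta> RB(2) D \<tau> L ab
      by (intro add_mono mult_mono mult_left_mono divide_right_mono) (auto intro!: add_nonneg_nonneg mult_nonneg_nonneg)
    also have "L * (\<epsilon> / (2 * \<tau>) + \<tau> / 2 * D) = e / 4 + e / 8"
      using L \<tau> D by (simp add: \<epsilon>_def distrib_left) (simp add: \<tau>_def)
    also have "4 / (\<alpha> n * \<delta>) * B * D \<le> e / 4"
    proof -
      have "16 * B * D \<le> \<alpha> n * (\<delta> * e)" using elim(3) \<delta> e by (simp add: divide_le_eq)
      then show ?thesis using \<alpha>(1)[of n] \<delta> by (simp add: divide_le_eq mult_ac)
    qed
    finally show ?case using e by simp
  qed
qed

lemma Op_kernel:
  assumes \<eta>: "\<eta> \<in> testf"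
  obtains K B where "(\<lambda>(X, Y). K X Y) \<in> borel_measurable (borel \<Otimes>\<^sub>M borel)" "\<And>X Y. norm (K X Y) \<le> B"
    "\<And>v. v \<in> L2_torus \<Longrightarrow> Op (tsym k \<eta>) (h n) v = Kop K v"
proof -
  obtain K where K: "semiclassical_kernel k \<eta> K"
    "\<And>h v X. h > 0 \<Longrightarrow> v \<in> L2_torus \<Longrightarrow> Op (tsym k \<eta>) h v X = (LINT Y|torus_measure. K h X Y * v Y)"
    using quantization_kernel[OF \<eta> Op[OF tsym_Cc_inf[OF \<eta>]]] by blast
  have "(\<lambda>(X, Y). K (h n) X Y) \<in> borel_measurable (borel \<Otimes>\<^sub>M borel)" "\<exists>B. \<forall>X Y. norm (K (h n) X Y) \<le> B"
    using K(1) h(1)[of n] unfolding semiclassical_kernel_def by simp_all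
  moreover have "Op (tsym k \<eta>) (h n) v = Kop (K (h n)) v" if "v \<in> L2_torus" for v
    using K(2)[OF h(1) that] by (intro ext) (simp add: Kop_def)
  ultimately show thesis using that[of "K (h n)"] by blast
qed

lemma evolved_form_regular:
  assumes K: "(\<lambda>(X, Y). K X Y) \<in> borel_measurable (borel \<Otimes>\<^sub>M borel)" "\<And>X Y. norm (K X Y) \<le> B"
  shows "(\<lambda>t. L2_inner (Kop K (evol n t)) (evol n t)) \<in> borel_measurable borel"
    and "integrable lborel (\<lambda>t. indicator {a..b} t * L2_inner (Kop K (evol n t)) (evol n t))"
proof -
  show m: "(\<lambda>t. L2_inner (Kop K (evol n t)) (evol n t)) \<in> borel_measurable borel"
    by (rule measurable_evolved_form[OF K u(1)])
  have "norm (L2_inner (Kop K (evol n t)) (evol n t)) \<le> B * vol TYPE('n) * (sqrt (N2 (u n)) * sqrt (N2 (u n)))" for t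
    using Kop_form_bound[OF K schroedinger_L2[OF u(1)] schroedinger_L2[OF u(1)]] by (simp only: N2_schroedinger[OF u(1)])
  then show "integrable lborel (\<lambda>t. indicator {a..b} t * L2_inner (Kop K (evol n t)) (evol n t))"
    by (intro integrable_interval_bounded[OF m] AE_I2)
qed

text \<open>The evolution preserves energy, so replacing the quantization by the lattice form costs
  the same small amount at every time. For \<open>k = 0\<close> the lattice form is constant in
  time, and for other \<open>k\<close> its averages vanish in the limit.\<close>

lemma time_average:
  assumes \<eta>: "\<eta> \<in> testf" and real: "\<And>\<xi>. cnj (\<eta> \<xi>) = \<eta> \<xi>" and ab: "a \<le> b"
  shows "(\<lambda>n. LINT t|lebesgue. indicator {a..b} t * L2_inner (Op (tsym k \<eta>) (h n) (evol n t)) (evol n t))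
     \<longlonglongrightarrow> of_real (b - a) * (if k = 0 then LINT z|\<mu>0. tsym 0 \<eta> z else 0)"
proof -
  obtain D where D: "D > 0" "\<And>n. N2 (u n) \<le> D" using energy_bound by blast
  define G where "G n t = L2_inner (Op (tsym k \<eta>) (h n) (evol n t)) (evol n t)" for n t
  define Q where "Q n t = qform k \<eta> (h n) (evol n t)" for n t
  have vL: "evol n t \<in> L2_torus" for n t by (rule schroedinger_L2[OF u(1)])
  have G: "G n \<in> borel_measurable borel" "integrable lborel (\<lambda>t. indicator {a..b} t * G n t)" for n
  proof -
    obtain K B where "(\<lambda>(X, Y). K X Y) \<in> borel_measurable (borel \<Otimes>\<^sub>M borel)" "\<And>X Y. norm (K X Y) \<le> B"
      "\<And>v. v \<in> L2_torus \<Longrightarrow> Op (tsym k \<eta>) (h n) v = Kop K v"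
      by (rule Op_kernel[OF \<eta>, of k n]) (rule that)
    note K = this
    have "G n = (\<lambda>t. L2_inner (Kop K (evol n t)) (evol n t))"
      unfolding G_def by (intro ext) (simp only: K(3)[OF vL])
    then show "G n \<in> borel_measurable borel" "integrable lborel (\<lambda>t. indicator {a..b} t * G n t)"
      using evolved_form_regular[OF K(1,2)] by simp_all
  qed
  have Q: "integrable lborel (\<lambda>t. indicator {a..b} t * Q n t)" for n
  proof -
    have "(\<lambda>(X, Y). TK k \<eta> (h n) X Y) \<in> borel_measurable (borel \<Otimes>\<^sub>M borel)" "\<exists>B. \<forall>X Y. norm (TK k \<eta> (h n) X Y) \<le> B"
      using semiclassical_TK[OF \<eta>, of k] h(1)[of n] unfolding semiclassical_kernel_def by simp_all
    then obtain B where K: "(\<lambda>(X, Y). TK k \<eta> (h n) X Y) \<in> borel_measurable (borel \<Otimes>\<^sub>M borel)" "\<And>X Y. norm (TK k \<eta> (h n) X Y) \<le> B"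
      by blast
    show ?thesis using evolved_form_regular(2)[OF K] by (simp add: TK_form[OF \<eta> h(1) vL] Q_def)
  qed
  have "(\<lambda>n. (LINT t|lborel. indicator {a..b} t * G n t) - (LINT t|lborel. indicator {a..b} t * Q n t)) \<longlonglongrightarrow> 0"
  proof (rule tendstoI)
    fix e :: real assume e: "e > 0"
    define \<epsilon> where "\<epsilon> = e / (2 * D * (b - a + 1))"
    have \<epsilon>: "\<epsilon> > 0" using e D ab by (simp add: \<epsilon>_def)
    from eventually_qform_close[OF \<eta> this, of k]
    show "\<forall>\<^sub>F n in sequentially. dist ((LINT t|lborel. indicator {a..b} t * G n t) - (LINT t|lborel. indicator {a..b} t * Q n t)) 0 < e"
    proof eventually_elim
      case (elim n)
      have close: "norm (G n t - Q n t) \<le> \<epsilon> * D" for t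
      proof -
        have "norm (G n t - Q n t) \<le> \<epsilon> * N2 (evol n t)" unfolding G_def Q_def using elim vL by blast
        also have "\<dots> \<le> \<epsilon> * D" unfolding N2_schroedinger[OF u(1)] using D \<epsilon> by (intro mult_left_mono) auto
        finally show ?thesis .
      qed
      have "(LINT t|lborel. indicator {a..b} t * G n t) - (LINT t|lborel. indicator {a..b} t * Q n t)
          = (LINT t|lborel. indicator {a..b} t * G n t - indicator {a..b} t * Q n t)"
        by (rule Bochner_Integration.integral_diff[symmetric, OF G(2) Q])
      also have "norm \<dots> \<le> (LINT t|lborel. norm (indicator {a..b} t * G n t - indicator {a..b} t * Q n t))"
        by (rule integral_norm_bound)
      also have "\<dots> \<le> (LINT t|lborel. \<epsilon> * D * indicator {a..b} t)"
      proof (rule integral_mono)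
        show "integrable lborel (\<lambda>t. norm (indicator {a..b} t * G n t - indicator {a..b} t * Q n t))"
          by (intro integrable_norm Bochner_Integration.integrable_diff G Q)
        show "integrable lborel (\<lambda>t. \<epsilon> * D * indicator {a..b} t :: real)"
          by (intro Bochner_Integration.integrable_mult_right integrable_real_indicator) (auto simp: emeasure_lborel_Icc_eq)
        show "norm (indicator {a..b} t * G n t - indicator {a..b} t * Q n t) \<le> \<epsilon> * D * indicator {a..b} t" for t
          using close by (simp add: indicator_def)
      qed
      also have "\<dots> = \<epsilon> * D * (b - a)" using ab by simp
      also have "\<dots> \<le> \<epsilon> * D * (b - a + 1)" using \<epsilon> D by (intro mult_left_mono) auto
      also have "\<dots> = e / 2"
      proof -
        have "e / (2 * D * S) * D * S = e / 2" if "S \<noteq> 0" for S using that D by simp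
        then show ?thesis using ab by (simp only: \<epsilon>_def)
      qed
      also have "\<dots> < e" using e by simp
      finally show ?case by simp
    qed
  qed
  moreover have "(\<lambda>n. LINT t|lborel. indicator {a..b} t * Q n t) \<longlonglongrightarrow> of_real (b - a) * (if k = 0 then LINT z|\<mu>0. tsym 0 \<eta> z else 0)"
  proof (cases "k = 0")
    case False
    then show ?thesis using time_average_qform[OF \<eta> real False ab] by (simp add: Q_def)
  next
    case True
    have "ivec (0::int^'n) = 0" by (simp add: ivec_def vec_eq_iff)
    then have "Q n t = qform 0 \<eta> (h n) (u n)" for n t
      unfolding Q_def True qform_schroedinger[OF u(1)] by (simp add: qform_def)
    then have "(LINT t|lborel. indicator {a..b} t * Q n t) = of_real (b - a) * qform 0 \<eta> (h n) (u n)" for n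
    proof -
      assume q: "\<And>n t. Q n t = qform 0 \<eta> (h n) (u n)"
      have "(LINT t|lborel. indicator {a..b} t * Q n t) = (LINT t|lborel. indicator {a..b} t *\<^sub>R qform 0 \<eta> (h n) (u n))"
        by (intro Bochner_Integration.integral_cong refl) (simp add: indicator_def q)
      also have "\<dots> = (b - a) *\<^sub>R qform 0 \<eta> (h n) (u n)" using ab by simp
      finally show ?thesis by (simp add: scaleR_conv_of_real)
    qed
    then show ?thesis using tendsto_mult_left[OF qform_limit[OF \<eta>, of 0], of "of_real (b - a)"] True by simp
  qed
  ultimately have "(\<lambda>n. LINT t|lborel. indicator {a..b} t * G n t) \<longlonglongrightarrow> of_real (b - a) * (if k = 0 then LINT z|\<mu>0. tsym 0 \<eta> z else 0)"
    using tendsto_add by fastforce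
  moreover have "(LINT t|lebesgue. indicator {a..b} t * G n t) = (LINT t|lborel. indicator {a..b} t * G n t)" for n
    using G(1)[of n] by (intro integral_completion) measurable
  ultimately show ?thesis by (simp add: G_def)
qed

end

section \<open>Passage from elementary symbols to all test symbols\<close>

section \<open>Symbols approximated by trigonometric polynomials\<close>

text \<open>The induction over \<open>tpoly\<close> must carry the average as an explicit function
  \<open>g\<close>, together with its integrability and support, so that sums and limits can be
  taken.\<close>

definition cut_transfer ::
  "'n::finite cotangent measure \<Rightarrow> 'n cotangent measure \<Rightarrow> nat \<Rightarrow> ('n cotangent \<Rightarrow> complex) \<Rightarrow> ('n cotangent \<Rightarrow> complex) \<Rightarrow> bool" where
  "cut_transfer \<mu>0 \<mu>t N p g \<longleftrightarrow>
     integrable \<mu>0 g \<and> integrable \<mu>t (\<lambda>z. p z * of_real (mcut N (snd z))) \<and>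
     (\<forall>z. has_avg (\<lambda>z. p z * of_real (mcut N (snd z))) z (g z)) \<and>
     (\<forall>z. real N * real CARD('n) < norm (snd z) \<longrightarrow> g z = 0) \<and>
     (LINT z|\<mu>t. p z * of_real (mcut N (snd z))) = (LINT z|\<mu>0. g z)"

text \<open>For a monomial the average is the symbol restricted to the plane orthogonal to
  \<open>k\<close>: everything if \<open>k = 0\<close>, and otherwise a part of the resonant set,
  hence null. Both cases match the assumed values; sums and multiples are formal.\<close>

lemma tpoly_cut_transfer:
  fixes \<mu>0 \<mu>t :: "'n::finite cotangent measure" and N :: nat
  assumes R0: "radon_measure \<mu>0" and nr: "emeasure \<mu>0 (UNIV \<times> resonant) = 0" and R: "radon_measure \<mu>t"
    and mono: "\<And>(k :: int^'n) l. (LINT z|\<mu>t. tsym k (\<lambda>\<xi>. of_real (\<Prod>i\<leftarrow>l. \<xi> $ i) * of_real (mcut N \<xi>)) z) =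
       (if k = 0 then LINT z|\<mu>0. tsym 0 (\<lambda>\<xi>. of_real (\<Prod>i\<leftarrow>l. \<xi> $ i) * of_real (mcut N \<xi>)) z else 0)"
    and p: "p \<in> tpoly"
  shows "\<exists>g. cut_transfer \<mu>0 \<mu>t N p g"
  using p
proof (induction rule: tpoly.induct)
  case (mon k l)
  let ?\<eta> = "\<lambda>\<xi>::real^'n. of_real (\<Prod>i\<leftarrow>l. \<xi> $ i) * of_real (mcut N \<xi>) :: complex"
  have \<eta>: "?\<eta> \<in> testf" by (rule mon_cut_testf)
  have sM: "sets \<mu>0 = sets borel" using R0 by (simp add: radon_measure_def)
  define g where "g z = (if ivec k \<bullet> snd z = 0 then tsym k ?\<eta> z else 0)" for z
  have gm: "g \<in> borel_measurable \<mu>0"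
  proof -
    have "g \<in> borel_measurable borel"
      unfolding g_def[abs_def]
    proof (rule measurable_If)
      show "tsym k ?\<eta> \<in> borel_measurable borel" by (rule tsym_measurable[OF \<eta>])
      show "{z :: 'n cotangent \<in> space borel. ivec k \<bullet> snd z = 0} \<in> sets borel"
      proof -
        have "closed {z :: 'n cotangent. ivec k \<bullet> snd z = 0}"
          by (intro closed_Collect_eq continuous_intros)
        then have "{z :: 'n cotangent. ivec k \<bullet> snd z = 0} \<in> sets borel" by (rule borel_closed)
        then show ?thesis by simp
      qed
    qed simp
    then show ?thesis using measurable_cong_sets[OF sM refl] by blast
  qed
  have gi: "integrable \<mu>0 g"
    by (rule Bochner_Integration.integrable_bound[OF tsym_integrable[OF R0 \<eta>, of k] gm]) (simp add: g_def)
  have "(LINT z|\<mu>0. g z) = (if k = 0 then LINT z|\<mu>0. tsym 0 ?\<eta> z else 0)"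
  proof (cases "k = 0")
    case True
    have "ivec (0::int^'n) = 0" by (simp add: ivec_def vec_eq_iff)
    then have "g = tsym k ?\<eta>" unfolding g_def[abs_def] True by simp
    then show ?thesis using True by simp
  next
    case False
    have "UNIV \<times> resonant \<in> null_sets \<mu>0" using nr resonant_sets sM by (auto intro: null_setsI)
    from AE_not_in[OF this] have "AE z in \<mu>0. g z = 0"
    proof eventually_elim
      case (elim z)
      then show ?case using False by (cases z) (auto simp: g_def resonant_def ivec_def)
    qed
    then have "(LINT z|\<mu>0. g z) = (LINT z|\<mu>0. 0)" by (intro integral_cong_AE gm) auto
    then show ?thesis using False by simp
  qed
  moreover have "has_avg (\<lambda>z. mon k l z * of_real (mcut N (snd z))) z (g z)" for z
    using has_avg_tsym[of k ?\<eta> z] unfolding g_def tsym_mon_cut .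
  moreover have "integrable \<mu>t (\<lambda>z. mon k l z * of_real (mcut N (snd z)))"
    using tsym_integrable[OF R \<eta>, of k] unfolding tsym_mon_cut .
  moreover have "g z = 0" if "real N * real CARD('n) < norm (snd z)" for z
    using mcut_zero[OF that] by (simp add: g_def tsym_def case_prod_unfold)
  ultimately have "cut_transfer \<mu>0 \<mu>t N (mon k l) g"
    using gi mono[of k l] unfolding tsym_mon_cut cut_transfer_def by simp
  then show ?case by (rule exI[of _ "g"])
next
  case (add f1 f2)
  let ?m = "\<lambda>z. of_real (mcut N (snd z)) :: complex"
  have cm: "continuous_on UNIV (?m :: 'n cotangent \<Rightarrow> complex)"
    by (rule continuous_on_compose2[OF testf_continuous[OF mcut_testf]]) (auto intro: continuous_intros)
  have c: "continuous_on UNIV (\<lambda>z. f z * ?m z)" if "f \<in> tpoly" for f :: "'n cotangent \<Rightarrow> complex"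
    by (intro continuous_on_mult tpoly_continuous[OF that] cm)
  obtain g1 where g1: "cut_transfer \<mu>0 \<mu>t N f1 g1" using add.IH(1) by (rule exE)
  obtain g2 where g2: "cut_transfer \<mu>0 \<mu>t N f2 g2" using add.IH(2) by (rule exE)
  have "has_avg (\<lambda>z. f1 z * ?m z + f2 z * ?m z) z (g1 z + g2 z)" for z
    using g1 g2 by (intro has_avg_add c add.hyps) (simp_all only: cut_transfer_def)
  then have "cut_transfer \<mu>0 \<mu>t N (\<lambda>z. f1 z + f2 z) (\<lambda>z. g1 z + g2 z)"
    using g1 g2 unfolding cut_transfer_def distrib_right by simp
  then show ?case by (rule exI[of _ "\<lambda>z. g1 z + g2 z"])
next
  case (scale f c)
  let ?m = "\<lambda>z. of_real (mcut N (snd z)) :: complex"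
  obtain g where g: "cut_transfer \<mu>0 \<mu>t N f g" using scale.IH by (rule exE)
  have "has_avg (\<lambda>z. c * (f z * ?m z)) z (c * g z)" for z
    using g by (intro has_avg_scale) (simp only: cut_transfer_def)
  then have "cut_transfer \<mu>0 \<mu>t N (\<lambda>z. c * f z) (\<lambda>z. c * g z)"
    using g unfolding cut_transfer_def mult.assoc by simp
  then show ?case by (rule exI[of _ "\<lambda>z. c * g z"])
qed

text \<open>Uniform approximants converge together with their averages at every point, so dominated
  convergence applies on both sides. The pointwise limit of the explicit averages also shows that
  \<open>flow_average a\<close> is measurable.\<close>

lemma transfer_Cc_inf:
  fixes \<mu>0 \<mu>t :: "'n::finite cotangent measure"
  assumes R0: "radon_measure \<mu>0" and nr: "emeasure \<mu>0 (UNIV \<times> resonant) = 0" and R: "radon_measure \<mu>t"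
    and mono: "\<And>(k :: int^'n) l N. (LINT z|\<mu>t. tsym k (\<lambda>\<xi>. of_real (\<Prod>i\<leftarrow>l. \<xi> $ i) * of_real (mcut N \<xi>)) z) =
       (if k = 0 then LINT z|\<mu>0. tsym 0 (\<lambda>\<xi>. of_real (\<Prod>i\<leftarrow>l. \<xi> $ i) * of_real (mcut N \<xi>)) z else 0)"
    and a: "a \<in> Cc_inf_cotangent"
  shows "(LINT z|\<mu>t. a z) = (LINT z|\<mu>0. flow_average a z)"
proof -
  have ac: "continuous_on UNIV a"
  proof -
    have "Ck_on 0 (\<lambda>(x, \<xi>). a (proj x, \<xi>)) UNIV" using a unfolding Cc_inf_cotangent_def smooth_on_def by blast
    then show ?thesis unfolding continuous_on_cotangent_iff by (rule Ck_on_continuous)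
  qed
  have "compact (snd ` supp a)"
    using a by (intro compact_continuous_image continuous_intros) (simp add: Cc_inf_cotangent_def)
  then obtain S where S: "\<And>\<xi>. \<xi> \<in> snd ` supp a \<Longrightarrow> norm \<xi> \<le> S"
    using compact_imp_bounded bounded_iff by metis
  have az: "a (X, \<xi>) = 0" if "S < norm \<xi>" for X \<xi>
  proof (rule ccontr)
    assume "a (X, \<xi>) \<noteq> 0"
    then have "(X, \<xi>) \<in> supp a" unfolding supp_def by (intro subsetD[OF closure_subset]) simp
    then have "\<xi> \<in> snd ` supp a" by force
    from S[OF this] show False using that by simp
  qed
  obtain N where N: "\<And>e. e > 0 \<Longrightarrow> \<exists>p\<in>tpoly. \<forall>z. norm (a z - p z * of_real (mcut N (snd z))) \<le> e * mcut N (snd z)"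
    using tpoly_cut_dense[OF ac az] by blast
  define e where "e j = 1 / real (Suc j)" for j
  have e: "0 < e j" "e j \<le> 1" for j by (simp_all add: e_def)
  have el: "e \<longlonglongrightarrow> 0" unfolding e_def[abs_def] using LIMSEQ_inverse_real_of_nat by (simp add: inverse_eq_divide)
  from N[OF e(1)] obtain p where p: "\<And>j. p j \<in> tpoly"
    "\<And>j z. norm (a z - p j z * of_real (mcut N (snd z))) \<le> e j * mcut N (snd z)" by metis
  define b where "b j z = p j z * of_real (mcut N (snd z))" for j and z :: "'n cotangent"
  have cm: "continuous_on UNIV (\<lambda>z::'n cotangent. of_real (mcut N (snd z)) :: complex)"
    by (rule continuous_on_compose2[OF testf_continuous[OF mcut_testf]]) (auto intro: continuous_intros)
  have bc: "continuous_on UNIV (b j)" for j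
    unfolding b_def[abs_def] by (intro continuous_on_mult tpoly_continuous p cm)
  have close: "norm (a z - b j z) \<le> e j * mcut N (snd z)" for j z unfolding b_def by (rule p(2))
  have close': "norm (a z - b j z) \<le> e j" for j z
  proof -
    have "e j * mcut N (snd z) \<le> e j * 1"
      by (rule mult_left_mono[OF mcut_le_1 less_imp_le[OF e(1)]])
    then show ?thesis using close[of z j] by simp
  qed
  have "\<exists>g. cut_transfer \<mu>0 \<mu>t N (p j) g" for j
    by (rule tpoly_cut_transfer[OF R0 nr R mono p(1)])
  then obtain g where ct: "\<And>j. cut_transfer \<mu>0 \<mu>t N (p j) (g j)" by metis
  note g = ct[unfolded cut_transfer_def, folded b_def, THEN conjunct1]
    ct[unfolded cut_transfer_def, folded b_def, THEN conjunct2, THEN conjunct1]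
    ct[unfolded cut_transfer_def, folded b_def, THEN conjunct2, THEN conjunct2, THEN conjunct1, rule_format]
    ct[unfolded cut_transfer_def, folded b_def, THEN conjunct2, THEN conjunct2, THEN conjunct2, THEN conjunct1, rule_format]
    ct[unfolded cut_transfer_def, folded b_def, THEN conjunct2, THEN conjunct2, THEN conjunct2, THEN conjunct2]
  have gl: "(\<lambda>j. g j z) \<longlonglongrightarrow> flow_average a z" for z
  proof -
    have "has_avg a z (lim (\<lambda>j. g j z))" "(\<lambda>j. g j z) \<longlonglongrightarrow> lim (\<lambda>j. g j z)"
      by (rule has_avg_limit[OF ac bc close' el g(3)])+
    then show ?thesis by (simp add: flow_average_eq)
  qed
  \<comment> \<open>Approximants are within 1 of \<open>a\<close>, hence within 2 of each other, and
    so are their averages; all vanish outside this ball. The initial member plus \<open>w\<close>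
    therefore dominates each sequence.\<close>
  define w where "w z = (if norm (snd z) \<le> real N * real CARD('n) then 2 else 0 :: complex)" for z :: "'n cotangent"
  have wi: "integrable M w" if "radon_measure M" for M
  proof (rule radon_integrable[OF that, where B = 2 and R = "real N * real CARD('n)"])
    show "w \<in> borel_measurable borel"
    proof -
      have "closed {z :: 'n cotangent. norm (snd z) \<le> real N * real CARD('n)}"
        by (intro closed_Collect_le continuous_intros)
      then have "{z \<in> space borel. norm (snd (z :: 'n cotangent)) \<le> real N * real CARD('n)} \<in> sets borel" by (simp add: borel_closed)
      then show ?thesis unfolding w_def[abs_def] by (intro measurable_If) auto
    qed
  qed (auto simp: w_def)
  have bb: "norm (b j z - b i z) \<le> 2" for i j z
  proof -
    have "norm (b j z - b i z) \<le> norm (a z - b j z) + norm (a z - b i z)"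
      using norm_triangle_ineq4[of "a z - b i z" "a z - b j z"] by (simp add: add.commute)
    also have "\<dots> \<le> 1 + 1" using close'[of z j] close'[of z i] e(2) by (intro add_mono) (meson order_trans)+
    finally show ?thesis by simp
  qed
  have gb: "norm (g j z) \<le> norm (g 0 z) + norm (w z)" for j z
  proof (cases "norm (snd z) \<le> real N * real CARD('n)")
    case True
    have "norm (g j z - g 0 z) \<le> 2" by (rule has_avg_close[OF bc bc bb g(3) g(3)])
    then show ?thesis using True norm_triangle_ineq2[of "g j z" "g 0 z"] by (simp add: w_def)
  qed (use g(4) in simp)
  have b0: "b j z = 0" if "\<not> norm (snd z) \<le> real N * real CARD('n)" for j z
    using that mcut_zero[of N "snd z"] by (simp add: b_def)
  have bb': "norm (b j z) \<le> norm (b 0 z) + norm (w z)" for j z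
    using bb[of j z 0] norm_triangle_ineq2[of "b j z" "b 0 z"] b0 by (simp add: w_def)
  have "(\<lambda>j. LINT z|\<mu>0. g j z) \<longlonglongrightarrow> (LINT z|\<mu>0. flow_average a z)"
  proof (rule integral_dominated_convergence)
    show gm: "g j \<in> borel_measurable \<mu>0" for j using g(1) by (rule borel_measurable_integrable)
    show "flow_average a \<in> borel_measurable \<mu>0" by (rule borel_measurable_LIMSEQ_metric[OF gm gl])
    show "integrable \<mu>0 (\<lambda>z. norm (g 0 z) + norm (w z))"
      by (intro Bochner_Integration.integrable_add integrable_norm g(1) wi R0)
  qed (simp_all add: gl gb)
  moreover have "(\<lambda>j. LINT z|\<mu>t. b j z) \<longlonglongrightarrow> (LINT z|\<mu>t. a z)"
  proof (rule integral_dominated_convergence)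
    have bl: "(\<lambda>j. b j z) \<longlonglongrightarrow> a z" for z
    proof (rule LIM_zero_cancel, rule Lim_null_comparison[OF _ el])
      show "\<forall>\<^sub>F j in sequentially. norm (b j z - a z) \<le> e j"
        using close' by (simp add: norm_minus_commute)
    qed
    then show "AE z in \<mu>t. (\<lambda>j. b j z) \<longlonglongrightarrow> a z" by simp
    show bm: "b j \<in> borel_measurable \<mu>t" for j using g(2) by (rule borel_measurable_integrable)
    show "a \<in> borel_measurable \<mu>t" by (rule borel_measurable_LIMSEQ_metric[OF bm bl])
    show "integrable \<mu>t (\<lambda>z. norm (b 0 z) + norm (w z))"
      by (intro Bochner_Integration.integrable_add integrable_norm g(2) wi R)
  qed (simp_all add: bb')
  ultimately show ?thesis unfolding g(5) by (rule LIMSEQ_unique[rotated])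
qed

theorem proposition10:
  fixes Op :: "('n::finite cotangent \<Rightarrow> complex) \<Rightarrow>
                 real \<Rightarrow> ('n torus \<Rightarrow> complex) \<Rightarrow> 'n torus \<Rightarrow> complex"
    and h \<alpha> :: "nat \<Rightarrow> real"
    and u :: "nat \<Rightarrow> 'n torus \<Rightarrow> complex"
    and \<mu>\<^sub>0 :: "'n cotangent measure"
    and \<mu> :: "real \<Rightarrow> 'n cotangent measure"
    and r :: "nat \<Rightarrow> nat"
  assumes Op: "\<And>a. a \<in> Cc_inf_cotangent \<Longrightarrow> weyl_quantization a (Op a)"
    and h: "\<And>n. h n > 0" "h \<longlonglongrightarrow> 0"
    and u: "\<And>n. u n \<in> L2_torus" "\<exists>C. \<forall>n. L2_norm (u n) \<le> C"
    and oscillating: "\<And>\<phi> :: 'n torus \<Rightarrow> complex. \<phi> \<in> Cc_inf_torus \<Longrightarrow>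
      ((\<lambda>R. limsup (\<lambda>n. ereal (L2_norm
          (fun_laplacian (\<lambda>l. indicator {..<R} ((h n)\<^sup>2 * l)) (\<lambda>x. \<phi> x * u n x)))))
        \<longlongrightarrow> 0) at_bot"
    and \<mu>\<^sub>0: "radon_measure \<mu>\<^sub>0"
      "\<And>a. a \<in> Cc_inf_cotangent \<Longrightarrow>
         (\<lambda>n. L2_inner (Op a (h n) (u n)) (u n)) \<longlonglongrightarrow> (LINT z|\<mu>\<^sub>0. a z)"
    and \<alpha>: "\<And>n. \<alpha> n > 0" "filterlim \<alpha> at_top sequentially"
    and \<mu>: "Linf_radon \<mu>"
    and r: "strict_mono r"
    and limit: "\<And>(\<phi> :: real \<Rightarrow> complex) a. integrable lebesgue \<phi> \<Longrightarrow> a \<in> Cc_inf_cotangent \<Longrightarrow>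
         (\<lambda>m. let n = r m in
            LINT t|lebesgue. \<phi> t *
              L2_inner (Op a (h n) (schroedinger (\<alpha> n * h n * t) (u n)))
                       (schroedinger (\<alpha> n * h n * t) (u n)))
         \<longlonglongrightarrow> (LINT t|lebesgue. \<phi> t * (LINT z|\<mu> t. a z))"
    and nonresonant: "emeasure \<mu>\<^sub>0 (UNIV \<times> resonant) = 0"
  shows "AE t in lebesgue. \<forall>a \<in> Cc_inf_cotangent.
           (LINT z|\<mu> t. a z) = (LINT z|\<mu>\<^sub>0. flow_average a z)"
proof -
  interpret evolved Op h \<alpha> u "\<mu>\<^sub>0"
    by unfold_locales (fact Op h u \<mu>\<^sub>0 \<alpha> nonresonant)+
  have rad: "radon_measure (\<mu> t)" for t using \<mu> by (simp add: Linf_radon_def)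
  \<comment> \<open>One elementary symbol at a time: local boundedness of the family of measures
    makes its integral a bounded measurable function of time, determined by its averages over
    intervals.\<close>
  have mono: "AE t in lebesgue. (LINT z|\<mu> t. tsym k \<eta> z) = (if k = 0 then LINT z|\<mu>\<^sub>0. tsym 0 \<eta> z else 0)"
    if \<eta>: "\<eta> \<in> testf" and real: "\<And>\<xi>. cnj (\<eta> \<xi>) = \<eta> \<xi>" for k :: "int^'n" and \<eta>
  proof -
    have Cc: "tsym k \<eta> \<in> Cc_inf_cotangent" by (rule tsym_Cc_inf[OF \<eta>])
    have "continuous_on UNIV (tsym k \<eta>)"
      unfolding tsym_def case_prod_unfold
      by (intro continuous_intros continuous_on_compose2[OF testf_continuous[OF \<eta>]]) auto
    then have meas: "(\<lambda>t. LINT z|\<mu> t. tsym k \<eta> z) \<in> borel_measurable lebesgue"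
      using \<mu> Cc unfolding Linf_radon_def Cc_inf_cotangent_def by simp
    obtain R B where RB: "R > 0" "B \<ge> 0" "\<And>\<xi>. R < norm \<xi> \<Longrightarrow> \<eta> \<xi> = 0" "\<And>\<xi>. norm (\<eta> \<xi>) \<le> B"
      by (rule testf_bounded[OF \<eta>]) (rule that)
    let ?K = "(UNIV :: 'n torus set) \<times> cball (0 :: real^'n) R"
    have K: "compact ?K" by (intro compact_Times compact_UNIV_torus compact_cball)
    then obtain C where C: "AE t in lebesgue. measure (\<mu> t) ?K \<le> C"
      using \<mu> unfolding Linf_radon_def by blast
    have KM: "?K \<in> sets (\<mu> t)" "emeasure (\<mu> t) ?K < \<infinity>" for t
      using rad[of t] K by (auto simp: radon_measure_def intro!: borel_closed compact_imp_closed)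
    have "norm (LINT z|\<mu> t. tsym k \<eta> z) \<le> B * measure (\<mu> t) ?K" for t
    proof -
      have "norm (LINT z|\<mu> t. tsym k \<eta> z) \<le> (LINT z|\<mu> t. norm (tsym k \<eta> z))" by (rule integral_norm_bound)
      also have "\<dots> \<le> (LINT z|\<mu> t. B * indicator ?K z)"
      proof (rule integral_mono)
        show "integrable (\<mu> t) (\<lambda>z. norm (tsym k \<eta> z))" by (intro integrable_norm tsym_integrable rad \<eta>)
        show "integrable (\<mu> t) (\<lambda>z. B * indicator ?K z :: real)"
          by (intro Bochner_Integration.integrable_mult_right integrable_real_indicator KM)
        show "norm (tsym k \<eta> z) \<le> B * indicator ?K z" for z
          using RB by (cases z) (auto simp: tsym_def norm_mult indicator_def not_le)
      qed
      also have "\<dots> = B * measure (\<mu> t) ?K" using KM by simp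
      finally show ?thesis .
    qed
    note bound = this
    have bdd: "AE t in lebesgue. norm (LINT z|\<mu> t. tsym k \<eta> z) \<le> B * C"
      using C
    proof eventually_elim
      case (elim t)
      show ?case by (rule order_trans[OF bound mult_left_mono[OF elim RB(2)]])
    qed
    \<comment> \<open>Indicators of intervals are admissible time weights in the defining limit, and
      along the subsequence \<open>r\<close> the limit from \<open>time_average\<close> is
      unchanged.\<close>
    have avg: "(LINT t|lebesgue. indicator {a..b} t * (LINT z|\<mu> t. tsym k \<eta> z)) = of_real (b - a) * (if k = 0 then LINT z|\<mu>\<^sub>0. tsym 0 \<eta> z else 0)"
      if ab: "a \<le> b" for a b :: real
    proof -
      have "integrable lebesgue (indicator {a..b} :: real \<Rightarrow> complex)"
      using integrable_interval_bounded[of "\<lambda>_. 1" 1 a b] by (subst integrable_completion) simp_all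
      from limit[OF this Cc] LIMSEQ_subseq_LIMSEQ[OF time_average[OF \<eta> real ab, of k] r]
      show ?thesis unfolding Let_def o_def by (rule LIMSEQ_unique)
    qed
    show ?thesis by (rule AE_eq_of_interval_integrals[OF meas bdd avg])
  qed
  let ?\<eta> = "\<lambda>(l :: 'n list) N \<xi>. of_real (\<Prod>i\<leftarrow>l. \<xi> $ i) * of_real (mcut N \<xi>) :: complex"
  have "AE t in lebesgue. (LINT z|\<mu> t. tsym k (?\<eta> l N) z) = (if k = 0 then LINT z|\<mu>\<^sub>0. tsym 0 (?\<eta> l N) z else 0)" for k l N
    by (rule mono[OF mon_cut_testf]) simp
  \<comment> \<open>Frequencies, monomials and cut-offs are countable, so a single null set of times
    is discarded before the passage to arbitrary symbols.\<close>
  then have "AE t in lebesgue. \<forall>k l N. (LINT z|\<mu> t. tsym k (?\<eta> l N) z) = (if k = 0 then LINT z|\<mu>\<^sub>0. tsym 0 (?\<eta> l N) z else 0)"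
    unfolding AE_all_countable by blast
  then show ?thesis
  proof eventually_elim
    case (elim t)
    show ?case
      by (intro ballI transfer_Cc_inf[OF \<mu>\<^sub>0(1) nonresonant rad]) (use elim in blast)
  qed
qed

end
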